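(* Let $\Lambda$ be a nonempty set, let $\{E_\lambda \mid \lambda\in\Lambda\}$ and $\{F_\lambda\mid\lambda\in\Lambda\}$ be families of Banach spaces, let $\{T_\lambda : E_\lambda\to F_\lambda \mid \lambda\in\Lambda\}$ be a family of Asplund operators with $\sup_{\lambda}\|T_\lambda\|<\infty$, let $\alpha>0$ be an ordinal, and let $p=0$ or $1<p<\infty$. The following are equivalent: (i) $\mathrm{Sz}\big((\bigoplus_{\lambda\in\Lambda}T_\lambda)_p\big)\leqslant\omega^\alpha$. (ii) $\sup\{\mathrm{Sz}_\varepsilon(T_\lambda)\mid\lambda\in\Lambda\}<\omega^\alpha$ for all $\varepsilon>0$. Moreover, if $(\bigoplus_{\lambda\in\Lambda}T_\lambda)_p$ is noncompact, then $$\mathrm{Sz}\big((\textstyle\bigoplus_{\lambda\in\Lambda}T_\lambda)_p\big)=\inf\{\omega^\alpha\mid \alpha \text{ an ordinal with } \sup\{\mathrm{Sz}_\varepsilon(T_\lambda)\mid\lambda\in\Lambda\}<\omega^\alpha\text{ for all }\varepsilon>0\}.$$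
   Context: Banach spaces are over $\mathbb R$ or $\mathbb C$; operators are bounded and linear; $B_X$ is the closed unit ball of $X$. Szlenk index. For a Banach space $E$, a $w^*$-compact set $K\subseteq E^*$ and $\varepsilon>0$, let $s_\varepsilon(K)=\{x\in K\mid \operatorname{diam}(K\cap V)>\varepsilon\text{ for every }w^*\text{-open }V\ni x\}$ (norm diameter). Set $s^0_\varepsilon(K)=K$, $s_\varepsilon^{\alpha+1}(K)=s_\varepsilon(s_\varepsilon^\alpha(K))$, and $s_\varepsilon^\alpha(K)=\bigcap_{\beta<\alpha}s_\varepsilon^\beta(K)$ for limit ordinals $\alpha$. $\mathrm{Sz}_\varepsilon(K)$ is the class of all ordinals $\alpha$ with $s^\alpha_\varepsilon(K)\neq\emptyset$ (i.e. the least ordinal $\alpha$ with $s^\alpha_\varepsilon(K)=\emptyset$ if one exists; otherwise it is the class of all ordinals and we write $\mathrm{Sz}_\varepsilon(K)=\infty$, larger than every ordinal). $\mathrm{Sz}(K)=\bigcup_{\varepsilon>0}\mathrm{Sz}_\varepsilon(K)=\sup_{\varepsilon>0}\mathrm{Sz}_\varepsilon(K)$. For an operator $T:E\to F$, $\mathrm{Sz}_\varepsilon(T)=\mathrm{Sz}_\varepsilon(T^*B_{F^*})$ and $\mathrm{Sz}(T)=\mathrm{Sz}(T^*B_{F^*})$. Direct sums. $(\bigoplus_\lambda E_\lambda)_p$ is the $\ell_p$-direct sum for $1<p<\infty$ and the $c_0$-direct sum for $p=0$. $(\bigoplus_\lambda T_\lambda)_p:(\bigoplus_\lambda E_\lambda)_p\to(\bigoplus_\lambda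 F_\lambda)_p$ is the operator $(x_\lambda)_\lambda\mapsto(T_\lambda x_\lambda)_\lambda$. Asplund operators. $T:E\to F$ is Asplund if for every finite positive measure space $(\Omega,\Sigma,\mu)$, every operator $S:F\to L_\infty(\Omega,\Sigma,\mu)$ and every $\varepsilon>0$ there is $B\in\Sigma$ with $\mu(B)>\mu(\Omega)-\varepsilon$ such that $\{f\chi_B\mid f\in ST(B_E)\}$ is relatively compact in $L_\infty(\Omega,\Sigma,\mu)$. It is known that $T$ is Asplund if and only if $\mathrm{Sz}(T)<\infty$. *)

theory Defs
  imports "HOL-Algebra.Module" "HOL-Analysis.Analysis"
begin

section \<open>Ordinals\<close>

text \<open>
  \<open>'u ordinal\<close> is the set of ordinals below the successor cardinal of the cardinality of
  \<open>'u\<close>. For infinite \<open>'u\<close> this initial segment of the ordinals is closed under the operations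
  below and under suprema of families of size at most that of \<open>'u\<close>. Every ordinal occurs in
  \<open>'u ordinal\<close> for a suitable \<open>'u\<close>.
\<close>

typedef 'u ordinal = "Field (cardSuc (card_of (UNIV :: 'u set)))"
proof -
  have "(card_of (UNIV :: 'u set), cardSuc (card_of (UNIV :: 'u set))) \<in> ordLess"
    by (simp add: cardSuc_greater card_of_Card_order)
  then show ?thesis
    by (subst (asm) internalize_ordLess) auto
qed

lemma cardSuc_UNIV_Well_order: "Well_order (cardSuc (card_of (UNIV :: 'u set)))"
  using cardSuc_Card_order[OF card_of_Card_order] card_order_on_well_order_on by blast

instantiation ordinal :: (type) wellorder
begin

definition less_eq_ordinal :: "'a ordinal \<Rightarrow> 'a ordinal \<Rightarrow> bool" where
  "less_eq_ordinal \<alpha> \<beta> \<longleftrightarrow> (Rep_ordinal \<alpha>, Rep_ordinal \<beta>) \<in> cardSuc (card_of (UNIV :: 'a set))"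

definition less_ordinal :: "'a ordinal \<Rightarrow> 'a ordinal \<Rightarrow> bool" where
  "less_ordinal \<alpha> \<beta> \<longleftrightarrow> \<alpha> \<le> \<beta> \<and> \<not> \<beta> \<le> \<alpha>"

instance
proof
  let ?r = "cardSuc (card_of (UNIV :: 'a set))"
  note wo = cardSuc_UNIV_Well_order[where ?'u = 'a]
  have refl: "refl_on (Field ?r) ?r" and trans: "trans ?r" and antisym: "antisym ?r"
    and total: "total_on (Field ?r) ?r" and wf: "wf (?r - Id)"
    using wo by (auto simp: well_order_on_def linear_order_on_def partial_order_on_def
        preorder_on_def)
  fix x y z :: "'a ordinal"
  show "(x < y) = (x \<le> y \<and> \<not> y \<le> x)" by (fact less_ordinal_def)
  show "x \<le> x" unfolding less_eq_ordinal_def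
    using refl Rep_ordinal[of x] by (rule refl_onD)
  show "x \<le> y \<Longrightarrow> y \<le> z \<Longrightarrow> x \<le> z" unfolding less_eq_ordinal_def
    using trans by (rule transD)
  show "x \<le> y \<Longrightarrow> y \<le> x \<Longrightarrow> x = y" unfolding less_eq_ordinal_def
    using antisym by (metis Rep_ordinal_inject antisymD)
  show "x \<le> y \<or> y \<le> x" unfolding less_eq_ordinal_def
    using total refl Rep_ordinal[of x] Rep_ordinal[of y]
    by (metis refl_onD total_on_def)
next
  let ?r = "cardSuc (card_of (UNIV :: 'a set))"
  fix P :: "'a ordinal \<Rightarrow> bool" and a
  assume step: "\<And>x. (\<And>y. y < x \<Longrightarrow> P y) \<Longrightarrow> P x"
  have "wf (?r - Id)"
    using cardSuc_UNIV_Well_order[where ?'u = 'a] by (simp add: well_order_on_def)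
  then have "wf (inv_image (?r - Id) Rep_ordinal)" by (rule wf_inv_image)
  moreover have "(y, x) \<in> inv_image (?r - Id) Rep_ordinal" if "y < x" for x y :: "'a ordinal"
    using that by (auto simp: less_ordinal_def less_eq_ordinal_def)
  ultimately show "P a" by (metis step wf_induct_rule)
qed

end

instantiation ordinal :: (type) zero
begin

definition zero_ordinal :: "'a ordinal" where
  "zero_ordinal = (LEAST \<alpha>. True)"

instance ..

end

definition osucc :: "'u ordinal \<Rightarrow> 'u ordinal" where
  "osucc \<alpha> = (LEAST \<beta>. \<alpha> < \<beta>)"

definition osup :: "'u ordinal set \<Rightarrow> 'u ordinal" where
  "osup A = (LEAST \<beta>. \<forall>\<alpha>\<in>A. \<alpha> \<le> \<beta>)"

definition is_succ :: "'u ordinal \<Rightarrow> bool" where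
  "is_succ \<alpha> \<longleftrightarrow> (\<exists>\<beta><\<alpha>. \<alpha> = osucc \<beta>)"

definition opred :: "'u ordinal \<Rightarrow> 'u ordinal" where
  "opred \<alpha> = (THE \<beta>. \<beta> < \<alpha> \<and> \<alpha> = osucc \<beta>)"

lemma opred_less:
  assumes "is_succ \<alpha>"
  shows "opred \<alpha> < \<alpha>" and "osucc (opred \<alpha>) = \<alpha>"
proof -
  have "\<exists>!\<beta>. \<beta> < \<alpha> \<and> \<alpha> = osucc \<beta>"
  proof (rule ex_ex1I)
    show "\<exists>\<beta>. \<beta> < \<alpha> \<and> \<alpha> = osucc \<beta>" using assms by (auto simp: is_succ_def)
  next
    fix \<beta> \<gamma> assume "\<beta> < \<alpha> \<and> \<alpha> = osucc \<beta>" "\<gamma> < \<alpha> \<and> \<alpha> = osucc \<gamma>"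
    then show "\<beta> = \<gamma>"
      unfolding osucc_def by (metis not_less_Least linorder_neqE)
  qed
  then have "opred \<alpha> < \<alpha> \<and> \<alpha> = osucc (opred \<alpha>)"
    unfolding opred_def by (rule theI')
  then show "opred \<alpha> < \<alpha>" and "osucc (opred \<alpha>) = \<alpha>" by auto
qed

text \<open>Transfinite recursion: value at 0, successor step, and limit step (applied to the set of
  all earlier values).\<close>

function transrec :: "'b \<Rightarrow> ('b \<Rightarrow> 'b) \<Rightarrow> ('b set \<Rightarrow> 'b) \<Rightarrow> 'u ordinal \<Rightarrow> 'b" where
  "transrec z s l \<alpha> =
    (if \<alpha> = 0 then z
     else if is_succ \<alpha> then s (transrec z s l (opred \<alpha>))
     else l (transrec z s l ` {..<\<alpha>}))"
  by pat_completeness auto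
termination
  by (relation "inv_image {(x, y). x < y} (\<lambda>(z, s, l, \<alpha>). \<alpha>)")
    (auto simp: opred_less wf)

declare transrec.simps [simp del]

definition oadd :: "'u ordinal \<Rightarrow> 'u ordinal \<Rightarrow> 'u ordinal" where
  "oadd \<alpha> = transrec \<alpha> osucc osup"

definition omult :: "'u ordinal \<Rightarrow> 'u ordinal \<Rightarrow> 'u ordinal" where
  "omult \<alpha> = transrec 0 (\<lambda>\<gamma>. oadd \<gamma> \<alpha>) osup"

definition omega :: "'u ordinal" where
  "omega = (LEAST \<alpha>. \<alpha> \<noteq> 0 \<and> \<not> is_succ \<alpha>)"

definition omega_pow :: "'u ordinal \<Rightarrow> 'u ordinal" where
  "omega_pow = transrec (osucc 0) (\<lambda>\<gamma>. omult \<gamma> omega) osup"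


section \<open>Banach spaces with explicit carrier\<close>

text \<open>
  A normed space is a module over the scalar field together with a norm; the fields \<open>mult\<close> and
  \<open>one\<close> inherited from the record \<open>module\<close> play no role, except in \<open>scalar_space\<close>, which is
  also used as the ring of scalars. The scalar field is a type of class
  \<open>real_normed_field\<close> and \<open>euclidean_space\<close>; up to isometric isomorphism these are
  exactly the reals and the complex numbers.
\<close>

record ('k, 'a) nspace = "('k, 'a) module" +
  nrm :: "'a \<Rightarrow> real"

definition scalar_space :: "('k::{real_normed_field, euclidean_space}, 'k) nspace" where
  "scalar_space = \<lparr>carrier = UNIV, monoid.mult = (*), one = 1, zero = 0, add = (+), module.smult = (*),
     nrm = norm\<rparr>"

text \<open>The locale \<open>Metric_space\<close> requires the distance to be nonnegative and symmetric on the
  whole type, hence the value 0 off the carrier.\<close>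

definition ndist :: "('k, 'a) nspace \<Rightarrow> 'a \<Rightarrow> 'a \<Rightarrow> real" where
  "ndist N x y =
     (if x \<in> carrier N \<and> y \<in> carrier N then nrm N (x \<ominus>\<^bsub>N\<^esub> y) else 0)"

definition normed_space :: "('k::{real_normed_field, euclidean_space}, 'a) nspace \<Rightarrow> bool" where
  "normed_space N \<longleftrightarrow>
     Module.module scalar_space N \<and>
     (\<forall>x\<in>carrier N. 0 \<le> nrm N x \<and> (nrm N x = 0 \<longleftrightarrow> x = \<zero>\<^bsub>N\<^esub>)) \<and>
     (\<forall>c. \<forall>x\<in>carrier N. nrm N (c \<odot>\<^bsub>N\<^esub> x) = norm c * nrm N x) \<and>
     (\<forall>x\<in>carrier N. \<forall>y\<in>carrier N. nrm N (x \<oplus>\<^bsub>N\<^esub> y) \<le> nrm N x + nrm N y)"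

definition banach_space :: "('k::{real_normed_field, euclidean_space}, 'a) nspace \<Rightarrow> bool" where
  "banach_space N \<longleftrightarrow> normed_space N \<and> Metric_space.mcomplete (carrier N) (ndist N)"

definition unit_ball :: "('k, 'a) nspace \<Rightarrow> 'a set" where
  "unit_ball N = {x \<in> carrier N. nrm N x \<le> 1}"

definition ndiam :: "('k, 'a) nspace \<Rightarrow> 'a set \<Rightarrow> ereal" where
  "ndiam N A = (SUP (x, y) \<in> A \<times> A. ereal (ndist N x y))"

definition relatively_compact :: "('k, 'a) nspace \<Rightarrow> 'a set \<Rightarrow> bool" where
  "relatively_compact N A \<longleftrightarrow>
     (let \<tau> = Metric_space.mtopology (carrier N) (ndist N) in compactin \<tau> (\<tau> closure_of A))"

definition bounded_operator ::
  "('k::{real_normed_field, euclidean_space}, 'a) nspace \<Rightarrow> ('k, 'b) nspace \<Rightarrow> ('a \<Rightarrow> 'b) \<Rightarrow> bool"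
  where
  "bounded_operator N Y T \<longleftrightarrow>
     (\<forall>x\<in>carrier N. T x \<in> carrier Y) \<and>
     (\<forall>x\<in>carrier N. \<forall>y\<in>carrier N. T (x \<oplus>\<^bsub>N\<^esub> y) = T x \<oplus>\<^bsub>Y\<^esub> T y) \<and>
     (\<forall>c. \<forall>x\<in>carrier N. T (c \<odot>\<^bsub>N\<^esub> x) = c \<odot>\<^bsub>Y\<^esub> T x) \<and>
     (\<exists>C. \<forall>x\<in>carrier N. nrm Y (T x) \<le> C * nrm N x)"

definition op_norm :: "('k, 'a) nspace \<Rightarrow> ('k, 'b) nspace \<Rightarrow> ('a \<Rightarrow> 'b) \<Rightarrow> real" where
  "op_norm N Y T = (SUP x\<in>unit_ball N. nrm Y (T x))"

definition compact_operator :: "('k, 'a) nspace \<Rightarrow> ('k, 'b) nspace \<Rightarrow> ('a \<Rightarrow> 'b) \<Rightarrow> bool" where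
  "compact_operator N Y T \<longleftrightarrow> relatively_compact Y (T ` unit_ball N)"

text \<open>Functionals are taken to be undefined off the carrier, so that equality of functionals is
  equality of functions, and so that the weak-star topology is a subspace of the product
  topology of the library.\<close>

definition dual :: "('k::{real_normed_field, euclidean_space}, 'a) nspace \<Rightarrow> ('k, 'a \<Rightarrow> 'k) nspace"
  where
  "dual N = \<lparr>carrier = {f \<in> extensional (carrier N). bounded_operator N scalar_space f},
     monoid.mult = undefined, one = undefined,
     zero = (\<lambda>x\<in>carrier N. 0),
     add = (\<lambda>f g. \<lambda>x\<in>carrier N. f x + g x),
     module.smult = (\<lambda>c f. \<lambda>x\<in>carrier N. c * f x),
     nrm = op_norm N scalar_space\<rparr>"

definition weak_star :: "('k::{real_normed_field, euclidean_space}, 'a) nspace \<Rightarrow> ('a \<Rightarrow> 'k) topology"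
  where
  "weak_star N = subtopology (product_topology (\<lambda>_. euclidean) (carrier N)) (carrier (dual N))"

definition adjoint :: "('k, 'a) nspace \<Rightarrow> ('a \<Rightarrow> 'b) \<Rightarrow> ('b \<Rightarrow> 'k) \<Rightarrow> ('a \<Rightarrow> 'k)" where
  "adjoint N T f = (\<lambda>x\<in>carrier N. f (T x))"


section \<open>The Szlenk index\<close>

text \<open>
  As in the convention that an ordinal is the set of smaller ordinals, and that \<open>\<infinity>\<close> is the
  class of all ordinals, Szlenk indices are initial segments of \<open>'u ordinal\<close>: the ordinal
  \<open>\<alpha>\<close> is \<open>{..<\<alpha>}\<close>, and \<open>\<infinity>\<close> is \<open>UNIV\<close>. The order is inclusion, and suprema and infima are
  unions and intersections. Iterating the derivation of subsets of \<open>E\<^sup>*\<close> can only strictly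
  decrease at as many ordinals as \<open>E\<^sup>*\<close> has elements, so if \<open>E\<^sup>*\<close> embeds into the (infinite) type
  \<open>'u\<close> then the index in \<open>'u ordinal\<close> is \<open>UNIV\<close> only if the derivation never reaches the empty
  set.
\<close>

definition szlenk_deriv ::
  "('k::{real_normed_field, euclidean_space}, 'a) nspace \<Rightarrow> real \<Rightarrow> ('a \<Rightarrow> 'k) set \<Rightarrow> ('a \<Rightarrow> 'k) set"
  where
  "szlenk_deriv E \<epsilon> K =
     {x \<in> K. \<forall>V. openin (weak_star E) V \<and> x \<in> V \<longrightarrow> ndiam (dual E) (K \<inter> V) > ereal \<epsilon>}"

definition Sz_eps ::
  "('k::{real_normed_field, euclidean_space}, 'a) nspace \<Rightarrow> real \<Rightarrow> ('a \<Rightarrow> 'k) set \<Rightarrow> 'u ordinal set"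
  where
  "Sz_eps E \<epsilon> K = {\<alpha>. transrec K (szlenk_deriv E \<epsilon>) Inter \<alpha> \<noteq> {}}"

definition Sz ::
  "('k::{real_normed_field, euclidean_space}, 'a) nspace \<Rightarrow> ('a \<Rightarrow> 'k) set \<Rightarrow> 'u ordinal set"
  where
  "Sz E K = (SUP \<epsilon>\<in>{0<..}. Sz_eps E \<epsilon> K)"

definition Sz_eps_op ::
  "('k::{real_normed_field, euclidean_space}, 'a) nspace \<Rightarrow> ('k, 'b) nspace \<Rightarrow> real \<Rightarrow> ('a \<Rightarrow> 'b)
     \<Rightarrow> 'u ordinal set"
  where
  "Sz_eps_op E F \<epsilon> T = Sz_eps E \<epsilon> (adjoint E T ` unit_ball (dual F))"

definition Sz_op ::
  "('k::{real_normed_field, euclidean_space}, 'a) nspace \<Rightarrow> ('k, 'b) nspace \<Rightarrow> ('a \<Rightarrow> 'b)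
     \<Rightarrow> 'u ordinal set"
  where
  "Sz_op E F T = Sz E (adjoint E T ` unit_ball (dual F))"


section \<open>Direct sums\<close>

text \<open>The \<open>c\<^sub>0\<close>-sum for \<open>p = 0\<close>, the \<open>\<ell>\<^sub>p\<close>-sum otherwise.\<close>

definition direct_sum :: "real \<Rightarrow> 'i set \<Rightarrow> ('i \<Rightarrow> ('k, 'a) nspace) \<Rightarrow> ('k, 'i \<Rightarrow> 'a) nspace" where
  "direct_sum p \<Lambda> E =
    \<lparr>carrier = {x \<in> (\<Pi>\<^sub>E l\<in>\<Lambda>. carrier (E l)).
        if p = 0 then \<forall>\<epsilon>>0. finite {l \<in> \<Lambda>. nrm (E l) (x l) \<ge> \<epsilon>}
        else (\<lambda>l. nrm (E l) (x l) powr p) summable_on \<Lambda>},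
     monoid.mult = undefined, one = undefined,
     zero = (\<lambda>l\<in>\<Lambda>. \<zero>\<^bsub>E l\<^esub>),
     add = (\<lambda>x y. \<lambda>l\<in>\<Lambda>. x l \<oplus>\<^bsub>E l\<^esub> y l),
     module.smult = (\<lambda>c x. \<lambda>l\<in>\<Lambda>. c \<odot>\<^bsub>E l\<^esub> x l),
     nrm = (\<lambda>x. if p = 0 then (SUP l\<in>\<Lambda>. nrm (E l) (x l))
                else (\<Sum>\<^sub>\<infinity>l\<in>\<Lambda>. nrm (E l) (x l) powr p) powr (1 / p))\<rparr>"

definition direct_sum_op :: "'i set \<Rightarrow> ('i \<Rightarrow> 'a \<Rightarrow> 'b) \<Rightarrow> ('i \<Rightarrow> 'a) \<Rightarrow> ('i \<Rightarrow> 'b)" where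
  "direct_sum_op \<Lambda> T x = (\<lambda>l\<in>\<Lambda>. T l (x l))"


section \<open>Asplund operators\<close>

definition ae_class :: "'m measure \<Rightarrow> ('m \<Rightarrow> 'k::{real_normed_field, euclidean_space}) \<Rightarrow> ('m \<Rightarrow> 'k) set"
  where
  "ae_class M f = {g \<in> borel_measurable M. AE x in M. g x = f x}"

definition L_infinity :: "'m measure \<Rightarrow> ('k::{real_normed_field, euclidean_space}, ('m \<Rightarrow> 'k) set) nspace"
  where
  "L_infinity M =
    \<lparr>carrier = ae_class M ` {f \<in> borel_measurable M. \<exists>C. AE x in M. norm (f x) \<le> C},
     monoid.mult = undefined, one = undefined,
     zero = ae_class M (\<lambda>_. 0),
     add = (\<lambda>A B. \<Union>f\<in>A. \<Union>g\<in>B. ae_class M (\<lambda>x. f x + g x)),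
     module.smult = (\<lambda>c A. \<Union>f\<in>A. ae_class M (\<lambda>x. c * f x)),
     nrm = (\<lambda>A. Inf {C. 0 \<le> C \<and> (\<exists>f\<in>A. AE x in M. norm (f x) \<le> C)})\<rparr>"

definition restrict_class ::
  "'m measure \<Rightarrow> 'm set \<Rightarrow> ('m \<Rightarrow> 'k::{real_normed_field, euclidean_space}) set \<Rightarrow> ('m \<Rightarrow> 'k) set"
  where
  "restrict_class M B A = (\<Union>f\<in>A. ae_class M (\<lambda>x. f x * indicator B x))"

text \<open>The type argument bounds the underlying sets of the measure spaces that are considered. Any
  type into which the reals embed gives the full notion: if \<open>T\<close> is not an Asplund operator, this
  is already witnessed by Haar measure on the Cantor group.\<close>

definition asplund_operator ::
  "'m itself \<Rightarrow> ('k::{real_normed_field, euclidean_space}, 'a) nspace \<Rightarrow> ('k, 'b) nspace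
     \<Rightarrow> ('a \<Rightarrow> 'b) \<Rightarrow> bool"
  where
  "asplund_operator _ E F T \<longleftrightarrow>
     bounded_operator E F T \<and>
     (\<forall>(M :: 'm measure) S \<epsilon>. finite_measure M \<and> bounded_operator F (L_infinity M) S \<and> 0 < \<epsilon> \<longrightarrow>
        (\<exists>B\<in>sets M. measure M B > measure M (space M) - \<epsilon> \<and>
           relatively_compact (L_infinity M) ((\<lambda>x. restrict_class M B (S (T x))) ` unit_ball E)))"

end

theory Submission
  imports Defs
begin

text \<open>
  Only \<open>Sz ((\<Oplus> T\<^sub>\<lambda>)\<^sub>p) \<le> \<omega>\<^sup>\<alpha>\<close> is hard. It is proved on the dual ball of \<open>(\<Oplus> F\<^sub>\<lambda>)\<^sub>p\<close>, with the
  distance of the images under the adjoint. Near a functional of norm close to \<open>1\<close> the norms of its coordinates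
  are almost constant on a finite set \<open>G\<close> that carries almost all of the norm. Each coordinate, rescaled, has
  a rank in the derivation of \<open>T\<^sub>\<lambda>\<^sup>* B\<close>, below \<open>\<omega>\<^sup>\<beta> \<cdot> m < \<omega>\<^sup>\<alpha>\<close> uniformly in \<open>\<lambda>\<close>; nearby functionals at
  distance \<open>> \<epsilon>\<close> have smaller ranks on a part of \<open>G\<close> whose weight is at least a constant depending on \<open>\<epsilon>\<close> only. Hence the
  number of derivations of length \<open>\<omega>\<^sup>\<beta>\<close> needed to leave a neighbourhood of the sphere is bounded independently
  of \<open>G\<close>, and finitely many such rounds shrink the ball to diameter \<open>\<le> \<epsilon>\<close>. For the last claim, convexity and
  symmetry make the Szlenk index of an operator additively indecomposable, hence a power of \<open>\<omega>\<close>; it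
  is not \<open>\<omega>\<^sup>0\<close> because an operator of index \<open>1\<close> is compact.
\<close>

section \<open>Ordinal arithmetic\<close>

text \<open>Uniformity is the obstacle. The finite set depends on the functional, and a tuple of
  ranks indexed by it would seem to allow a number of derivations that grows with its size. Two
  devices remove this dependence. Ranks are split into quotient and remainder modulo
  \<open>omega_pow \<beta>\<close>: the remainders of any finite tuple are exhausted within a single
  stage of length \<open>omega_pow \<beta>\<close>, so only quotients have to be counted. Quotients
  are counted with weights, essentially the \<open>q\<close>-th powers of the norms of the
  coordinates for the conjugate exponent \<open>q\<close>; their sum is at most 1 because the dual
  of the direct sum is an ell_q-sum with finite \<open>q\<close>. The argument runs on the dual ball
  of the range space since there the norm of a coordinate is weak-star lower semicontinuous: a
  neighbourhood keeps the coordinate norms above the weights, while the radius of the ball limits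
  them from above. Passing to the image under the adjoint then costs a factor 2 in the
  distance.\<close>

locale ordinals =
  fixes cardinality :: "'u itself"
  assumes infinite_cardinality: "infinite (UNIV :: 'u set)"
begin

section \<open>Size of initial segments and bounds for small sets of ordinals\<close>

lemma card_of_lessThan_ordinal: "ordLeq3 (card_of {..<\<alpha> :: 'u ordinal}) (card_of (UNIV :: 'u set))"
proof -
  let ?r = "cardSuc (card_of (UNIV :: 'u set))"
  have r: "Card_order ?r" by (simp add: cardSuc_Card_order card_of_Card_order)
  have "Rep_ordinal ` {..<\<alpha>} \<subseteq> underS ?r (Rep_ordinal \<alpha>)"
    by (auto simp: underS_def less_ordinal_def less_eq_ordinal_def)
  then have "ordLeq3 (card_of {..<\<alpha>}) (card_of (underS ?r (Rep_ordinal \<alpha>)))"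
    by (metis Rep_ordinal_inject card_of_ordLeq inj_onI)
  moreover have "ordLess2 (card_of (underS ?r (Rep_ordinal \<alpha>))) ?r"
    using card_of_underS[OF r] Rep_ordinal by blast
  ultimately have "ordLess2 (card_of {..<\<alpha>}) ?r" by (rule ordLeq_ordLess_trans)
  then show ?thesis by (simp add: cardSuc_ordLeq_ordLess card_of_Card_order)
qed

lemma card_of_ordinal_not_ordLeq:
  "\<not> ordLeq3 (card_of (UNIV :: 'u ordinal set)) (card_of (UNIV :: 'u set))"
proof
  let ?r = "cardSuc (card_of (UNIV :: 'u set))"
  assume le: "ordLeq3 (card_of (UNIV :: 'u ordinal set)) (card_of (UNIV :: 'u set))"
  have "bij_betw Rep_ordinal (UNIV :: 'u ordinal set) (Field ?r)"
    by (metis Rep_ordinal_inject bij_betw_def inj_def type_definition.Rep_range type_definition_ordinal)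
  then have "ordIso2 (card_of (Field ?r)) (card_of (UNIV :: 'u ordinal set))"
    using card_of_ordIsoI ordIso_symmetric by blast
  then have "ordLeq3 ?r (card_of (UNIV :: 'u set))"
    by (meson le card_of_Card_order cardSuc_Card_order card_of_Field_ordIso ordIso_ordLeq_trans
        ordIso_symmetric)
  then show False using cardSuc_greater card_of_Card_order not_ordLess_ordLeq by blast
qed

text \<open>Regularity of the successor cardinal. A cofinal set with at most as many members as
  \<open>'u\<close> would exhaust the type by that many initial segments, each of at most that size.
  Infinite \<open>'u\<close> keeps such a union small; it also excludes a last ordinal, at which
  \<open>osucc\<close> would be meaningless.\<close>

lemma small_imp_bounded:
  assumes "ordLeq3 (card_of A) (card_of (UNIV :: 'u set))"
  shows "\<exists>\<beta>. \<forall>\<alpha>\<in>A. \<alpha> < (\<beta> :: 'u ordinal)"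
proof (rule ccontr)
  assume "\<nexists>\<beta>. \<forall>\<alpha>\<in>A. \<alpha> < \<beta>"
  then have "\<exists>\<alpha>\<in>A. \<beta> \<le> \<alpha>" for \<beta> by (meson not_less)
  then have "UNIV = (\<Union>\<alpha>\<in>A. {..<\<alpha>}) \<union> A" by (auto simp: order_le_less)
  moreover have "ordLeq3 (card_of (\<Union>\<alpha>\<in>A. {..<\<alpha>})) (card_of (UNIV :: 'u set))"
    using card_of_UNION_ordLeq_infinite[OF infinite_cardinality assms, of "\<lambda>\<alpha>. {..<\<alpha>}"]
    card_of_lessThan_ordinal by blast
  then have "ordLeq3 (card_of ((\<Union>\<alpha>\<in>A. {..<\<alpha>}) \<union> A)) (card_of (UNIV :: 'u set))"
    using card_of_Un_ordLeq_infinite_Field[OF _ _ assms card_of_Card_order] infinite_cardinality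
    by (simp add: Field_card_of)
  ultimately show False using card_of_ordinal_not_ordLeq by simp
qed

lemma small_image_lessThan:
  "ordLeq3 (card_of (f ` {..<\<alpha> :: 'u ordinal})) (card_of (UNIV :: 'u set))"
  using card_of_image card_of_lessThan_ordinal ordLeq_transitive by blast

lemma gt_ex_ordinal: "\<exists>\<beta>. (\<alpha> :: 'u ordinal) < \<beta>"
proof -
  have "ordLeq3 (card_of {\<alpha>}) (card_of (UNIV :: 'u set))"
    by (rule card_of_singl_ordLeq) simp
  then show ?thesis using small_imp_bounded by fastforce
qed

lemma less_osucc: "(\<alpha> :: 'u ordinal) < osucc \<alpha>"
  unfolding osucc_def by (metis LeastI gt_ex_ordinal)

lemma less_osucc_iff [simp]: "\<beta> < osucc \<alpha> \<longleftrightarrow> \<beta> \<le> (\<alpha> :: 'u ordinal)"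
  by (metis less_osucc not_less osucc_def order_le_less_trans not_less_Least)

lemma osucc_le_iff [simp]: "osucc \<alpha> \<le> \<beta> \<longleftrightarrow> (\<alpha> :: 'u ordinal) < \<beta>"
  by (metis less_osucc_iff not_less)

lemma osucc_inject [simp]: "osucc \<alpha> = osucc \<beta> \<longleftrightarrow> (\<alpha> :: 'u ordinal) = \<beta>"
  by (metis antisym less_osucc less_osucc_iff)

lemma zero_le_ordinal [simp]: "0 \<le> (\<alpha> :: 'u ordinal)"
  by (simp add: zero_ordinal_def Least_le)

lemma not_less_zero_ordinal [simp]: "\<not> (\<alpha> :: 'u ordinal) < 0"
  by (simp add: not_less)

lemma le_zero_ordinal [simp]: "(\<alpha> :: 'u ordinal) \<le> 0 \<longleftrightarrow> \<alpha> = 0"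
  by (simp add: antisym)

lemma zero_less_ordinal_iff: "0 < (\<alpha> :: 'u ordinal) \<longleftrightarrow> \<alpha> \<noteq> 0"
  by (metis le_zero_ordinal not_less)

lemma osucc_neq_zero [simp]: "osucc \<alpha> \<noteq> (0 :: 'u ordinal)"
  by (metis less_osucc not_less_zero_ordinal)

lemma is_succ_osucc [simp]: "is_succ (osucc (\<alpha> :: 'u ordinal))"
  unfolding is_succ_def using less_osucc by blast

lemma opred_osucc [simp]: "opred (osucc \<alpha>) = (\<alpha> :: 'u ordinal)"
  by (metis opred_less(2) is_succ_osucc osucc_inject)

definition limit_ordinal :: "'u ordinal \<Rightarrow> bool" where
  "limit_ordinal \<alpha> \<longleftrightarrow> \<alpha> \<noteq> 0 \<and> \<not> is_succ \<alpha>"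

lemma limit_ordinal_osucc_less: "limit_ordinal \<beta> \<Longrightarrow> \<alpha> < \<beta> \<Longrightarrow> osucc \<alpha> < \<beta>"
  by (metis is_succ_osucc limit_ordinal_def order_le_less osucc_le_iff)

lemma limit_ordinalI: "0 < \<beta> \<Longrightarrow> (\<And>\<alpha>. \<alpha> < \<beta> \<Longrightarrow> osucc \<alpha> < \<beta>) \<Longrightarrow> limit_ordinal \<beta>"
  by (metis is_succ_def less_irrefl limit_ordinal_def)

lemma ordinal_cases [case_names zero succ limit]:
  obtains "\<alpha> = 0" | \<beta> where "\<alpha> = osucc \<beta>" | "limit_ordinal (\<alpha> :: 'u ordinal)"
  by (metis is_succ_def limit_ordinal_def)

lemma ordinal_induct [case_names zero succ limit]:
  assumes "P 0" and "\<And>\<alpha>. P \<alpha> \<Longrightarrow> P (osucc \<alpha>)"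
    and "\<And>\<alpha>. limit_ordinal \<alpha> \<Longrightarrow> (\<And>\<beta>. \<beta> < \<alpha> \<Longrightarrow> P \<beta>) \<Longrightarrow> P \<alpha>"
  shows "P (\<alpha> :: 'u ordinal)"
proof (induction \<alpha> rule: less_induct)
  case (less \<alpha>)
  then show ?case using assms less_osucc by (cases \<alpha> rule: ordinal_cases) auto
qed

lemma transrec_zero [simp]: "transrec z s l (0 :: 'u ordinal) = z"
  by (simp add: transrec.simps)

lemma transrec_osucc [simp]: "transrec z s l (osucc \<alpha> :: 'u ordinal) = s (transrec z s l \<alpha>)"
  by (simp add: transrec.simps[of _ _ _ "osucc \<alpha>"])

lemma transrec_limit: "limit_ordinal \<alpha> \<Longrightarrow> transrec z s l \<alpha> = l (transrec z s l ` {..<\<alpha>})"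
  by (simp add: transrec.simps[of _ _ _ "\<alpha>"] limit_ordinal_def)

text \<open>\<open>osup\<close> is a \<open>LEAST\<close>, hence meaningful only once some upper
  bound exists; the image of an initial segment is small, which provides one.\<close>

lemma osup_image_le_iff:
  "osup (f ` {..<\<alpha> :: 'u ordinal}) \<le> (\<gamma> :: 'u ordinal) \<longleftrightarrow> (\<forall>\<beta><\<alpha>. f \<beta> \<le> \<gamma>)"
proof -
  let ?P = "\<lambda>\<gamma>. \<forall>\<delta>\<in>f ` {..<\<alpha>}. \<delta> \<le> \<gamma>"
  have "\<exists>\<gamma>. ?P \<gamma>"
    by (meson small_imp_bounded[OF small_image_lessThan] order.strict_implies_order)
  then have "?P (osup (f ` {..<\<alpha>}))" unfolding osup_def by (rule LeastI_ex)
  moreover have "?P \<gamma> \<Longrightarrow> osup (f ` {..<\<alpha>}) \<le> \<gamma>" unfolding osup_def by (rule Least_le)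
  ultimately show ?thesis by (auto intro: order_trans)
qed

lemma less_osup_image_iff:
  "(\<gamma> :: 'u ordinal) < osup (f ` {..<\<alpha> :: 'u ordinal}) \<longleftrightarrow> (\<exists>\<beta><\<alpha>. \<gamma> < f \<beta>)"
  by (metis osup_image_le_iff not_less)

section \<open>Addition of ordinals\<close>

lemma oadd_zero [simp]: "oadd \<alpha> 0 = (\<alpha> :: 'u ordinal)"
  by (simp add: oadd_def)

lemma oadd_osucc [simp]: "oadd \<alpha> (osucc \<beta>) = osucc (oadd \<alpha> \<beta> :: 'u ordinal)"
  by (simp add: oadd_def)

lemma oadd_limit_le_iff:
  "limit_ordinal \<beta> \<Longrightarrow> oadd \<alpha> \<beta> \<le> \<gamma> \<longleftrightarrow> (\<forall>\<delta><\<beta>. oadd \<alpha> \<delta> \<le> \<gamma>)"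
  by (simp add: oadd_def transrec_limit osup_image_le_iff)

lemma less_oadd_limit_iff:
  "limit_ordinal \<beta> \<Longrightarrow> \<gamma> < oadd \<alpha> \<beta> \<longleftrightarrow> (\<exists>\<delta><\<beta>. \<gamma> < oadd \<alpha> \<delta>)"
  by (simp add: oadd_def transrec_limit less_osup_image_iff)

lemma oadd_strict_mono: "\<beta> < \<gamma> \<Longrightarrow> oadd \<alpha> \<beta> < oadd \<alpha> (\<gamma> :: 'u ordinal)"
proof (induction \<gamma> rule: ordinal_induct)
  case (succ \<gamma>)
  then show ?case by (cases "\<beta> = \<gamma>") (auto intro: less_imp_le)
next
  case (limit \<gamma>)
  then show ?case
    by (metis less_oadd_limit_iff less_osucc limit_ordinal_osucc_less oadd_osucc)
qed auto

lemma oadd_less_cancel [simp]: "oadd \<alpha> \<beta> < oadd \<alpha> \<gamma> \<longleftrightarrow> \<beta> < (\<gamma> :: 'u ordinal)"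
  by (metis less_asym linorder_neqE oadd_strict_mono)

lemma oadd_le_cancel [simp]: "oadd \<alpha> \<beta> \<le> oadd \<alpha> \<gamma> \<longleftrightarrow> \<beta> \<le> (\<gamma> :: 'u ordinal)"
  by (metis oadd_less_cancel not_less)

lemma le_oadd1 [simp]: "\<alpha> \<le> oadd \<alpha> (\<beta> :: 'u ordinal)"
  by (metis oadd_le_cancel oadd_zero zero_le_ordinal)

lemma oadd_mono1: "\<alpha> \<le> \<alpha>' \<Longrightarrow> oadd \<alpha> \<beta> \<le> oadd \<alpha>' (\<beta> :: 'u ordinal)"
proof (induction \<beta> rule: ordinal_induct)
  case (limit \<beta>)
  have "oadd \<alpha> \<delta> \<le> oadd \<alpha>' \<beta>" if "\<delta> < \<beta>" for \<delta>
  proof -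
    have "oadd \<alpha> \<delta> \<le> oadd \<alpha>' \<delta>" using limit that by blast
    also have "\<dots> \<le> oadd \<alpha>' \<beta>" using that by simp
    finally show ?thesis .
  qed
  then show ?case using oadd_limit_le_iff[OF limit(1)] by blast
qed auto

lemma le_oadd2: "\<beta> \<le> oadd \<alpha> (\<beta> :: 'u ordinal)"
proof (induction \<beta> rule: ordinal_induct)
  case (limit \<beta>)
  show ?case
  proof (rule ccontr)
    assume "\<not> \<beta> \<le> oadd \<alpha> \<beta>"
    then have less: "oadd \<alpha> \<beta> < \<beta>" by simp
    \<comment> \<open>The induction hypothesis at the smaller ordinal
      \<open>oadd \<alpha> \<beta>\<close>; strict monotonicity gives the opposite
      inequality.\<close>
    then have "oadd \<alpha> \<beta> \<le> oadd \<alpha> (oadd \<alpha> \<beta>)" by (rule limit(2))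
    then show False using less by simp
  qed
qed auto

lemma limit_ordinal_oadd: "limit_ordinal \<beta> \<Longrightarrow> limit_ordinal (oadd \<alpha> \<beta>)"
proof (rule limit_ordinalI)
  assume \<beta>: "limit_ordinal \<beta>"
  then show "0 < oadd \<alpha> \<beta>"
    by (metis le_oadd2 limit_ordinal_def zero_less_ordinal_iff le_zero_ordinal)
  fix \<gamma> assume "\<gamma> < oadd \<alpha> \<beta>"
  with \<beta> show "osucc \<gamma> < oadd \<alpha> \<beta>"
    by (metis less_oadd_limit_iff oadd_less_cancel osucc_le_iff order_le_less_trans)
qed

lemma oadd_assoc: "oadd (oadd \<alpha> \<beta>) \<gamma> = oadd \<alpha> (oadd \<beta> (\<gamma> :: 'u ordinal))"
proof (induction \<gamma> rule: ordinal_induct)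
  case (limit \<gamma>)
  \<comment> \<open>Sums with a limit on the right are known through their upper bounds, so the two
    sides are compared by these.\<close>
  have "oadd (oadd \<alpha> \<beta>) \<gamma> \<le> \<delta> \<longleftrightarrow> oadd \<alpha> (oadd \<beta> \<gamma>) \<le> \<delta>" for \<delta>
  proof
    assume *: "oadd \<alpha> (oadd \<beta> \<gamma>) \<le> \<delta>"
    show "oadd (oadd \<alpha> \<beta>) \<gamma> \<le> \<delta>"
      unfolding oadd_limit_le_iff[OF limit(1)]
    proof (intro allI impI)
      fix \<eta> assume \<eta>: "\<eta> < \<gamma>"
      then have "oadd (oadd \<alpha> \<beta>) \<eta> = oadd \<alpha> (oadd \<beta> \<eta>)" by (rule limit(2))
      also have "\<dots> \<le> \<delta>" using * \<eta> by (meson less_imp_le oadd_le_cancel order_trans)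
      finally show "oadd (oadd \<alpha> \<beta>) \<eta> \<le> \<delta>" .
    qed
  next
    assume *: "oadd (oadd \<alpha> \<beta>) \<gamma> \<le> \<delta>"
    show "oadd \<alpha> (oadd \<beta> \<gamma>) \<le> \<delta>"
      unfolding oadd_limit_le_iff[OF limit_ordinal_oadd[OF limit(1)]]
    proof (intro allI impI)
      fix \<eta> assume "\<eta> < oadd \<beta> \<gamma>"
      then obtain \<xi> where \<xi>: "\<xi> < \<gamma>" "\<eta> < oadd \<beta> \<xi>"
        using less_oadd_limit_iff[OF limit(1)] by auto
      then have "oadd \<alpha> \<eta> \<le> oadd \<alpha> (oadd \<beta> \<xi>)" by simp
      also have "\<dots> = oadd (oadd \<alpha> \<beta>) \<xi>" using limit(2)[OF \<xi>(1)] by simp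
      also have "\<dots> \<le> \<delta>" using * \<xi>(1) by (meson less_imp_le oadd_le_cancel order_trans)
      finally show "oadd \<alpha> \<eta> \<le> \<delta>" .
    qed
  qed
  then show ?case by (metis antisym order_refl)
qed auto

text \<open>Subtraction on the left. At a limit, the least \<open>\<gamma>\<close> with
  \<open>\<alpha> \<le> oadd \<beta> \<gamma>\<close> cannot overshoot, since addition advances by
  one at successors and is continuous in its right argument.\<close>

lemma le_imp_ex_oadd:
  assumes "\<beta> \<le> \<alpha>"
  shows "\<exists>\<gamma>. \<alpha> = oadd \<beta> (\<gamma> :: 'u ordinal)"
  using assms
proof (induction \<alpha> rule: ordinal_induct)
  case zero
  then show ?case by (metis oadd_zero le_zero_ordinal)
next
  case (succ \<alpha>)
  then show ?case
    by (metis less_osucc_iff oadd_osucc oadd_zero order_le_less)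
next
  case (limit \<alpha>)
  let ?\<gamma> = "LEAST \<gamma>. \<alpha> \<le> oadd \<beta> \<gamma>"
  have le: "\<alpha> \<le> oadd \<beta> ?\<gamma>" by (rule LeastI) (rule le_oadd2)
  have least: "oadd \<beta> \<gamma> < \<alpha>" if "\<gamma> < ?\<gamma>" for \<gamma> using not_less_Least[OF that] by simp
  have "oadd \<beta> ?\<gamma> \<le> \<alpha>"
  proof (cases ?\<gamma> rule: ordinal_cases)
    case zero
    then show ?thesis using limit(3) by simp
  next
    case (succ \<delta>)
    then have "oadd \<beta> \<delta> < \<alpha>" using least less_osucc by metis
    then show ?thesis unfolding succ by simp
  next
    case limit
    then show ?thesis using least by (metis oadd_limit_le_iff less_imp_le)
  qed
  with le show ?case by (metis antisym)
qed

section \<open>Finite multiples, omega and its powers\<close>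

fun nat_mult :: "'u ordinal \<Rightarrow> nat \<Rightarrow> 'u ordinal" where
  "nat_mult \<alpha> 0 = 0"
| "nat_mult \<alpha> (Suc n) = oadd (nat_mult \<alpha> n) \<alpha>"

lemma nat_mult_strict_mono: "0 < \<alpha> \<Longrightarrow> m < n \<Longrightarrow> nat_mult \<alpha> m < nat_mult \<alpha> n"
proof (rule lift_Suc_mono_less[of "nat_mult \<alpha>"])
  fix n assume "0 < \<alpha>"
  then have "oadd (nat_mult \<alpha> n) 0 < oadd (nat_mult \<alpha> n) \<alpha>" by (rule oadd_strict_mono)
  then show "nat_mult \<alpha> n < nat_mult \<alpha> (Suc n)" by simp
qed

lemma nat_mult_mono: "m \<le> n \<Longrightarrow> nat_mult \<alpha> m \<le> nat_mult \<alpha> n"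
  by (rule lift_Suc_mono_le[of "nat_mult \<alpha>"]) auto

lemma oadd_zero_left [simp]: "oadd 0 \<beta> = (\<beta> :: 'u ordinal)"
proof (induction \<beta> rule: ordinal_induct)
  case (limit \<beta>)
  have "oadd 0 \<beta> \<le> \<beta>" unfolding oadd_limit_le_iff[OF limit(1)] using limit(2) by (simp add: less_imp_le)
  then show ?case using le_oadd2 by (rule antisym)
qed auto

lemma nat_mult_add: "nat_mult \<alpha> (m + n) = oadd (nat_mult \<alpha> m) (nat_mult \<alpha> n)"
  by (induction n) (auto simp: oadd_assoc)

lemma ex_limit_ordinal: "\<exists>\<beta>. limit_ordinal \<beta>"
proof -
  let ?f = "\<lambda>n. (osucc ^^ n) (0 :: 'u ordinal)"
  have "ordLeq3 (card_of (range ?f)) (card_of (UNIV :: 'u set))"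
    using infinite_cardinality card_of_image infinite_iff_card_of_nat ordLeq_transitive by blast
  then obtain \<beta> where "\<forall>n. ?f n < \<beta>" using small_imp_bounded by blast
  let ?\<beta> = "LEAST \<beta>. \<forall>n. ?f n < \<beta>"
  have 1: "\<forall>n. ?f n < ?\<beta>" by (rule LeastI) fact
  have "limit_ordinal ?\<beta>"
  proof (rule limit_ordinalI)
    show "0 < ?\<beta>" using 1 by (metis funpow_0)
    fix \<alpha> assume "\<alpha> < ?\<beta>"
    then obtain n where "\<not> ?f n < \<alpha>" using not_less_Least by blast
    then have "\<alpha> \<le> ?f n" by simp
    also have "?f n < ?f (Suc n)" by (simp add: less_osucc)
    finally have "osucc \<alpha> \<le> ?f (Suc n)" by simp
    also have "\<dots> < ?\<beta>" using 1 by blast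
    finally show "osucc \<alpha> < ?\<beta>" .
  qed
  then show ?thesis by blast
qed

lemma limit_ordinal_omega: "limit_ordinal omega"
  unfolding omega_def limit_ordinal_def by (rule LeastI_ex) (use ex_limit_ordinal limit_ordinal_def in auto)

lemma less_omega_iff: "\<alpha> < omega \<longleftrightarrow> (\<exists>n. \<alpha> = (osucc ^^ n) (0 :: 'u ordinal))"
proof
  assume "\<alpha> < omega"
  then show "\<exists>n. \<alpha> = (osucc ^^ n) 0"
  proof (induction \<alpha> rule: ordinal_induct)
    case zero
    show ?case by (metis funpow_0)
  next
    case (succ \<alpha>)
    then obtain n where "\<alpha> = (osucc ^^ n) 0" using less_osucc less_trans by blast
    then have "osucc \<alpha> = (osucc ^^ Suc n) 0" by simp
    then show ?case by blast
  next
    case (limit \<alpha>)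
    then show ?case unfolding omega_def limit_ordinal_def using not_less_Least by blast
  qed
next
  assume "\<exists>n. \<alpha> = (osucc ^^ n) 0"
  then obtain n where "\<alpha> = (osucc ^^ n) 0" ..
  moreover have "(osucc ^^ n) 0 < (omega :: 'u ordinal)" for n
    using limit_ordinal_omega
    by (induction n) (auto simp: limit_ordinal_osucc_less limit_ordinal_def zero_less_ordinal_iff)
  ultimately show "\<alpha> < omega" by simp
qed

text \<open>The factor \<open>omega\<close> is the only one that occurs on the right, so all further
  work with products can be done with finite multiples.\<close>

lemma less_omult_omega_iff: "\<gamma> < omult \<alpha> omega \<longleftrightarrow> (\<exists>n. \<gamma> < nat_mult \<alpha> n)"
proof -
  have "omult \<alpha> ((osucc ^^ n) 0) = nat_mult \<alpha> n" for n
    by (induction n) (auto simp: omult_def)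
  moreover have "\<gamma> < omult \<alpha> omega \<longleftrightarrow> (\<exists>\<beta><omega. \<gamma> < omult \<alpha> \<beta>)"
    by (simp add: omult_def transrec_limit[OF limit_ordinal_omega] less_osup_image_iff)
  ultimately show ?thesis by (auto simp: less_omega_iff)
qed

lemma omega_pow_zero [simp]: "omega_pow 0 = osucc (0 :: 'u ordinal)"
  by (simp add: omega_pow_def)

lemma less_omega_pow_osucc_iff:
  "\<gamma> < omega_pow (osucc \<alpha>) \<longleftrightarrow> (\<exists>n. \<gamma> < nat_mult (omega_pow \<alpha>) n)"
  by (simp add: omega_pow_def less_omult_omega_iff)

lemma less_omega_pow_limit_iff:
  "limit_ordinal \<alpha> \<Longrightarrow> \<gamma> < omega_pow \<alpha> \<longleftrightarrow> (\<exists>\<beta><\<alpha>. \<gamma> < omega_pow \<beta>)"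
  by (simp add: omega_pow_def transrec_limit less_osup_image_iff)

lemma omega_pow_pos: "0 < omega_pow (\<alpha> :: 'u ordinal)"
proof (induction \<alpha> rule: ordinal_induct)
  case (succ \<alpha>)
  then have "0 < nat_mult (omega_pow \<alpha>) 1" by simp
  then show ?case by (metis less_omega_pow_osucc_iff)
next
  case (limit \<alpha>)
  then show ?case
    by (metis less_omega_pow_limit_iff limit_ordinal_def zero_less_ordinal_iff)
qed (simp add: less_osucc)

lemma nat_mult_omega_pow_less: "nat_mult (omega_pow \<alpha>) n < omega_pow (osucc \<alpha>)"
  using nat_mult_strict_mono[OF omega_pow_pos, of n "Suc n"] less_omega_pow_osucc_iff by blast

lemma omega_pow_less_osucc: "omega_pow \<alpha> < omega_pow (osucc \<alpha> :: 'u ordinal)"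
  using nat_mult_omega_pow_less[of \<alpha> 1] by simp

lemma omega_pow_strict_mono: "\<alpha> < \<beta> \<Longrightarrow> omega_pow \<alpha> < omega_pow (\<beta> :: 'u ordinal)"
proof (induction \<beta> rule: ordinal_induct)
  case (succ \<beta>)
  then show ?case by (metis less_osucc_iff less_trans omega_pow_less_osucc order_le_less)
next
  case (limit \<beta>)
  then show ?case
    by (meson less_omega_pow_limit_iff limit_ordinal_osucc_less omega_pow_less_osucc)
qed auto

lemma le_omega_pow: "\<alpha> \<le> omega_pow (\<alpha> :: 'u ordinal)"
proof (induction \<alpha> rule: less_induct)
  case (less \<alpha>)
  then show ?case using omega_pow_strict_mono by (metis leI le_less_trans less_irrefl)
qed

text \<open>Additive indecomposability: finitely many rounds of derivation, each shorter than a
  power of omega, together remain shorter than it.\<close>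

lemma oadd_less_omega_pow:
  "\<alpha> < omega_pow \<gamma> \<Longrightarrow> \<beta> < omega_pow \<gamma> \<Longrightarrow> oadd \<alpha> \<beta> < omega_pow (\<gamma> :: 'u ordinal)"
proof (induction \<gamma> arbitrary: \<alpha> \<beta> rule: ordinal_induct)
  case (succ \<gamma>)
  then obtain m n where "\<alpha> < nat_mult (omega_pow \<gamma>) m" "\<beta> < nat_mult (omega_pow \<gamma>) n"
    by (metis less_omega_pow_osucc_iff)
  then have "oadd \<alpha> \<beta> < nat_mult (omega_pow \<gamma>) (m + n)"
    by (metis less_imp_le nat_mult_add oadd_mono1 oadd_strict_mono order_less_le_trans)
  then show ?case by (metis less_omega_pow_osucc_iff)
next
  case (limit \<gamma>)
  obtain \<delta> \<eta> where "\<delta> < \<gamma>" "\<alpha> < omega_pow \<delta>" "\<eta> < \<gamma>" "\<beta> < omega_pow \<eta>"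
    using limit by (metis less_omega_pow_limit_iff)
  moreover then have "omega_pow \<delta> \<le> omega_pow (max \<delta> \<eta>)" "omega_pow \<eta> \<le> omega_pow (max \<delta> \<eta>)"
    by (metis max.cobounded1 max.cobounded2 omega_pow_strict_mono order_le_less)+
  ultimately have "oadd \<alpha> \<beta> < omega_pow (max \<delta> \<eta>)" "max \<delta> \<eta> < \<gamma>"
    using limit(2)[of "max \<delta> \<eta>"] by auto
  then show ?case using less_omega_pow_limit_iff[OF limit(1)] by blast
qed simp

lemma limit_ordinal_omega_pow: "0 < \<alpha> \<Longrightarrow> limit_ordinal (omega_pow \<alpha>)"
proof (rule limit_ordinalI)
  assume "0 < \<alpha>"
  then have "osucc 0 < omega_pow \<alpha>" using omega_pow_strict_mono[of 0 \<alpha>] by simp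
  moreover fix \<beta> assume "\<beta> < omega_pow \<alpha>"
  ultimately have "oadd \<beta> (osucc 0) < omega_pow \<alpha>" by (intro oadd_less_omega_pow)
  then show "osucc \<beta> < omega_pow \<alpha>" by simp
qed (rule omega_pow_pos)

text \<open>The least power of omega above \<open>\<mu>\<close> must have a successor exponent. Were
  the preceding power below \<open>\<mu>\<close>, closure would keep all its finite multiples below
  \<open>\<mu>\<close>, although they are cofinal in a larger ordinal.\<close>

lemma oadd_closed_imp_omega_pow:
  assumes "0 < \<mu>" and closed: "\<And>\<alpha> \<beta>. \<alpha> < \<mu> \<Longrightarrow> \<beta> < \<mu> \<Longrightarrow> oadd \<alpha> \<beta> < \<mu>"
  shows "\<exists>\<beta>. \<mu> = omega_pow (\<beta> :: 'u ordinal)"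
proof -
  let ?\<gamma> = "LEAST \<gamma>. \<mu> < omega_pow \<gamma>"
  have \<gamma>: "\<mu> < omega_pow ?\<gamma>"
    by (rule LeastI[of _ "osucc \<mu>"]) (metis le_omega_pow osucc_le_iff)
  have le: "omega_pow \<beta> \<le> \<mu>" if "\<beta> < ?\<gamma>" for \<beta> using not_less_Least[OF that] by simp
  show ?thesis
  proof (cases ?\<gamma> rule: ordinal_cases)
    case zero
    then show ?thesis using \<gamma> assms(1) by auto
  next
    case (succ \<beta>)
    have "omega_pow \<beta> \<le> \<mu>" using le succ less_osucc by metis
    moreover have "\<not> omega_pow \<beta> < \<mu>"
    proof
      assume *: "omega_pow \<beta> < \<mu>"
      have "nat_mult (omega_pow \<beta>) n < \<mu>" for n
        by (induction n) (auto simp: assms *)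
      moreover obtain n where "\<mu> < nat_mult (omega_pow \<beta>) n"
        using \<gamma> unfolding succ less_omega_pow_osucc_iff by blast
      ultimately show False by (metis less_asym)
    qed
    ultimately show ?thesis by (metis order_le_less)
  next
    case limit
    then show ?thesis using \<gamma> le by (meson less_omega_pow_limit_iff not_less)
  qed
qed

text \<open>Successor and limit exponents are treated at once from here on: a bound below
  \<open>omega_pow \<alpha>\<close> is replaced by a finite multiple of an earlier power, by 1 if
  \<open>\<alpha>\<close> is a limit.\<close>

lemma less_omega_pow_imp:
  assumes "\<gamma> < omega_pow \<alpha>" "0 < \<alpha>"
  shows "\<exists>\<beta><\<alpha>. \<exists>n>0. \<gamma> < nat_mult (omega_pow \<beta>) n"
proof (cases \<alpha> rule: ordinal_cases)
  case (succ \<beta>)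
  then obtain n where n: "\<gamma> < nat_mult (omega_pow \<beta>) n" using assms less_omega_pow_osucc_iff by blast
  then have "n > 0" by (cases n) auto
  then show ?thesis using n succ less_osucc by blast
next
  case limit
  then obtain \<beta> where "\<beta> < \<alpha>" "\<gamma> < nat_mult (omega_pow \<beta>) 1"
    using assms less_omega_pow_limit_iff by auto
  then show ?thesis using zero_less_one by blast
qed (use assms in simp)

text \<open>\<open>\<alpha> = \<omega>\<^sup>\<beta> \<cdot> oquot \<beta> \<alpha> + orem \<beta> \<alpha>\<close> for \<open>\<alpha> < \<omega>\<^bsup>\<beta> + 1\<^esup>\<close>\<close>

definition oquot :: "'u ordinal \<Rightarrow> 'u ordinal \<Rightarrow> nat" where
  "oquot \<beta> \<alpha> = (LEAST n. \<alpha> < nat_mult (omega_pow \<beta>) (Suc n))"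

definition orem :: "'u ordinal \<Rightarrow> 'u ordinal \<Rightarrow> 'u ordinal" where
  "orem \<beta> \<alpha> = (SOME \<gamma>. \<alpha> = oadd (nat_mult (omega_pow \<beta>) (oquot \<beta> \<alpha>)) \<gamma>)"

lemma oquot_less:
  assumes "\<alpha> < nat_mult (omega_pow \<beta>) n"
  shows "oquot \<beta> \<alpha> < n"
proof (cases n)
  case (Suc m)
  then show ?thesis using assms Least_le[of "\<lambda>n. \<alpha> < nat_mult (omega_pow \<beta>) (Suc n)" m]
    unfolding oquot_def by simp
qed (use assms in simp)

lemma less_nat_mult_oquot:
  assumes "\<alpha> < nat_mult (omega_pow \<beta>) n"
  shows "\<alpha> < nat_mult (omega_pow \<beta>) (Suc (oquot \<beta> \<alpha>))"
proof -
  have "\<alpha> < nat_mult (omega_pow \<beta>) (Suc n)"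
    using assms nat_mult_mono[of n "Suc n"] by (meson le_SucI order_refl order_less_le_trans)
  then show ?thesis unfolding oquot_def by (rule LeastI)
qed

lemma nat_mult_oquot_le: "nat_mult (omega_pow \<beta>) (oquot \<beta> \<alpha>) \<le> \<alpha>"
proof (cases "oquot \<beta> \<alpha>")
  case (Suc n)
  then have "n < oquot \<beta> \<alpha>" by simp
  then show ?thesis using not_less_Least[of n "\<lambda>n. \<alpha> < nat_mult (omega_pow \<beta>) (Suc n)"] Suc
    unfolding oquot_def by simp
qed simp

lemma oquot_orem: "\<alpha> = oadd (nat_mult (omega_pow \<beta>) (oquot \<beta> \<alpha>)) (orem \<beta> \<alpha>)"
  unfolding orem_def by (rule someI_ex) (rule le_imp_ex_oadd[OF nat_mult_oquot_le])

lemma orem_less: "\<alpha> < nat_mult (omega_pow \<beta>) n \<Longrightarrow> orem \<beta> \<alpha> < omega_pow \<beta>"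
  by (metis less_nat_mult_oquot nat_mult.simps(2) oadd_less_cancel oquot_orem)

lemma orem_le: "\<alpha> \<le> \<alpha>' \<Longrightarrow> oquot \<beta> \<alpha> = oquot \<beta> \<alpha>' \<Longrightarrow> orem \<beta> \<alpha> \<le> orem \<beta> \<alpha>'"
  by (metis oadd_le_cancel oquot_orem)

lemma orem_mono: "\<alpha> < \<alpha>' \<Longrightarrow> oquot \<beta> \<alpha> = oquot \<beta> \<alpha>' \<Longrightarrow> orem \<beta> \<alpha> < orem \<beta> \<alpha>'"
  by (metis oadd_less_cancel oquot_orem)

lemma oquot_mono:
  assumes "\<alpha> \<le> \<alpha>'" "\<alpha>' < nat_mult (omega_pow \<beta>) n"
  shows "oquot \<beta> \<alpha> \<le> oquot \<beta> \<alpha>'"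
  using assms less_nat_mult_oquot oquot_less by (meson less_Suc_eq_le order_le_less_trans)

end

section \<open>Derivations of sets in a topological space with a distance function\<close>

text \<open>Stated for an arbitrary function \<open>d\<close>, since it is applied both to the norm
  distance of a dual and to its pullback along an adjoint, where different points may have distance
  0. The pair \<open>y\<close>, \<open>z\<close> expresses a diameter above
  \<open>e\<close>.\<close>

definition sder :: "'x topology \<Rightarrow> ('x \<Rightarrow> 'x \<Rightarrow> real) \<Rightarrow> real \<Rightarrow> 'x set \<Rightarrow> 'x set" where
  "sder X d e A = {x \<in> A. \<forall>V. openin X V \<and> x \<in> V \<longrightarrow> (\<exists>y\<in>A \<inter> V. \<exists>z\<in>A \<inter> V. e < d y z)}"

definition derived ::
  "'x topology \<Rightarrow> ('x \<Rightarrow> 'x \<Rightarrow> real) \<Rightarrow> real \<Rightarrow> 'x set \<Rightarrow> 'u ordinal \<Rightarrow> 'x set" where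
  "derived X d e A = transrec A (sder X d e) Inter"

lemma sder_subset: "sder X d e A \<subseteq> A"
  by (auto simp: sder_def)

lemma sder_mono:
  assumes "A \<subseteq> B" "e' \<le> e"
  shows "sder X d e A \<subseteq> sder X d e' B"
proof
  fix x assume x: "x \<in> sder X d e A"
  have "\<exists>y\<in>B \<inter> V. \<exists>z\<in>B \<inter> V. e' < d y z" if "openin X V \<and> x \<in> V" for V
  proof -
    obtain y z where "y \<in> A \<inter> V" "z \<in> A \<inter> V" "e < d y z"
      using x \<open>openin X V \<and> x \<in> V\<close> by (auto simp: sder_def)
    then show ?thesis using assms by (intro bexI[of _ y] bexI[of _ z]) auto
  qed
  then show "x \<in> sder X d e' B" using x assms by (auto simp: sder_def)
qed

text \<open>The finite intersection property: the indices are linearly ordered, so a finite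
  subfamily has a smallest member, the one with the largest index.\<close>

lemma compactin_nested_nonempty:
  fixes C :: "'l::linorder \<Rightarrow> 'x set"
  assumes "compactin X K" "I \<noteq> {}"
    and "\<And>i. i \<in> I \<Longrightarrow> closedin X (C i)" "\<And>i. i \<in> I \<Longrightarrow> C i \<subseteq> K" "\<And>i. i \<in> I \<Longrightarrow> C i \<noteq> {}"
    and anti: "\<And>i j. i \<in> I \<Longrightarrow> j \<in> I \<Longrightarrow> i \<le> j \<Longrightarrow> C j \<subseteq> C i"
  shows "(\<Inter>i\<in>I. C i) \<noteq> {}"
proof -
  have "K \<inter> \<Inter>(C ` I) \<noteq> {}"
  proof (rule ccontr)
    assume "\<not> K \<inter> \<Inter>(C ` I) \<noteq> {}"
    with assms(1,3) obtain F where F: "finite F" "F \<subseteq> C ` I" "K \<inter> \<Inter>F = {}"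
      unfolding compactin_fip by (metis (no_types, lifting) imageE)
    obtain J where J: "J \<subseteq> I" "finite J" "F = C ` J"
      using F by (meson finite_subset_image)
    show False
    proof (cases "J = {}")
      case True
      then have "K = {}" using F J by simp
      then show ?thesis using assms(2,4,5) by blast
    next
      case False
      then have M: "Max J \<in> J" "\<And>j. j \<in> J \<Longrightarrow> j \<le> Max J" using J by auto
      then have "C (Max J) \<subseteq> C j" if "j \<in> J" for j using that J(1) anti by blast
      then have "C (Max J) \<subseteq> \<Inter>F" using J(3) by blast
      moreover have MI: "Max J \<in> I" using M(1) J(1) by (rule rev_subsetD)
      ultimately have "C (Max J) = {}" using F(3) assms(4)[OF MI] by (metis Int_greatest subset_empty)
      then show ?thesis using assms(5)[OF MI] by simp
    qed
  qed
  then show ?thesis by auto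
qed

context ordinals
begin

section \<open>Iterated derivations: stages, monotonicity, closedness\<close>

lemma derived_zero [simp]: "derived X d e A (0 :: 'u ordinal) = A"
  by (simp add: derived_def)

lemma derived_osucc [simp]: "derived X d e A (osucc \<alpha>) = sder X d e (derived X d e A (\<alpha> :: 'u ordinal))"
  by (simp add: derived_def)

lemma derived_limit:
  "limit_ordinal \<alpha> \<Longrightarrow> derived X d e A \<alpha> = (\<Inter>\<beta>\<in>{..<\<alpha>}. derived X d e A (\<beta> :: 'u ordinal))"
  by (simp add: derived_def transrec_limit)

lemma limit_ordinal_pos: "limit_ordinal \<alpha> \<Longrightarrow> 0 < \<alpha>"
  by (simp add: limit_ordinal_def zero_less_ordinal_iff)

lemma derived_antimono: "\<alpha> \<le> \<beta> \<Longrightarrow> derived X d e A (\<beta> :: 'u ordinal) \<subseteq> derived X d e A \<alpha>"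
proof (induction \<beta> rule: ordinal_induct)
  case (succ \<beta>)
  show ?case
  proof (cases "\<alpha> = osucc \<beta>")
    case False
    then have "derived X d e A \<beta> \<subseteq> derived X d e A \<alpha>" using succ by (metis less_osucc_iff order_le_less)
    then show ?thesis using sder_subset[of X d e "derived X d e A \<beta>"] by simp
  qed simp
next
  case (limit \<beta>)
  show ?case
  proof (cases "\<alpha> = \<beta>")
    case False
    then have "\<alpha> < \<beta>" using limit(3) by simp
    then show ?thesis unfolding derived_limit[OF limit(1)] by blast
  qed simp
qed auto

lemma derived_subset: "derived X d e A (\<alpha> :: 'u ordinal) \<subseteq> A"
  using derived_antimono[of 0 \<alpha>] by simp

lemma derived_mono:
  assumes "A \<subseteq> B" "e' \<le> e"
  shows "derived X d e A (\<alpha> :: 'u ordinal) \<subseteq> derived X d e' B \<alpha>"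
proof (induction \<alpha> rule: ordinal_induct)
  case (succ \<alpha>)
  then show ?case using sder_mono assms(2) by simp
qed (use assms in \<open>auto simp: derived_limit\<close>)

text \<open>Derivation may be restarted from a derived set, with lengths adding up; all later counts
  of stages rest on this.\<close>

lemma derived_oadd:
  "derived X d e A (oadd \<alpha> \<beta> :: 'u ordinal) = derived X d e (derived X d e A \<alpha>) \<beta>"
proof (induction \<beta> rule: ordinal_induct)
  case (limit \<beta>)
  have "derived X d e A (oadd \<alpha> \<beta>) = (\<Inter>\<gamma>\<in>{..<oadd \<alpha> \<beta>}. derived X d e A \<gamma>)"
    by (rule derived_limit[OF limit_ordinal_oadd[OF limit(1)]])
  also have "\<dots> = (\<Inter>\<delta>\<in>{..<\<beta>}. derived X d e A (oadd \<alpha> \<delta>))"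
  proof (rule antisym)
    show "(\<Inter>\<gamma>\<in>{..<oadd \<alpha> \<beta>}. derived X d e A \<gamma>) \<subseteq> (\<Inter>\<delta>\<in>{..<\<beta>}. derived X d e A (oadd \<alpha> \<delta>))"
      by auto
    show "(\<Inter>\<delta>\<in>{..<\<beta>}. derived X d e A (oadd \<alpha> \<delta>)) \<subseteq> (\<Inter>\<gamma>\<in>{..<oadd \<alpha> \<beta>}. derived X d e A \<gamma>)"
    proof (rule INT_greatest)
      fix \<gamma> assume "\<gamma> \<in> {..<oadd \<alpha> \<beta>}"
      then obtain \<delta> where \<delta>: "\<delta> < \<beta>" "\<gamma> < oadd \<alpha> \<delta>" using less_oadd_limit_iff[OF limit(1)] by auto
      then have "derived X d e A (oadd \<alpha> \<delta>) \<subseteq> derived X d e A \<gamma>"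
        by (intro derived_antimono less_imp_le)
      then show "(\<Inter>\<delta>\<in>{..<\<beta>}. derived X d e A (oadd \<alpha> \<delta>)) \<subseteq> derived X d e A \<gamma>"
        using \<delta>(1) by blast
    qed
  qed
  also have "\<dots> = (\<Inter>\<delta>\<in>{..<\<beta>}. derived X d e (derived X d e A \<alpha>) \<delta>)" using limit(2) by simp
  also have "\<dots> = derived X d e (derived X d e A \<alpha>) \<beta>" by (rule derived_limit[OF limit(1), symmetric])
  finally show ?case .
qed auto

text \<open>A neighbourhood that removes \<open>x\<close> at a successor stage, by its small
  diameter, removes all of its points at the same time.\<close>

lemma not_in_derived_nbhd:
  assumes "x \<notin> derived X d e A (\<alpha> :: 'u ordinal)" "x \<in> A" "x \<in> topspace X"
  shows "\<exists>V. openin X V \<and> x \<in> V \<and> V \<inter> derived X d e A \<alpha> = {}"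
  using assms(1)
proof (induction \<alpha> rule: ordinal_induct)
  case (succ \<alpha>)
  show ?case
  proof (cases "x \<in> derived X d e A \<alpha>")
    case False
    then show ?thesis using succ.IH sder_subset[of X d e "derived X d e A \<alpha>"] by fastforce
  next
    case True
    then obtain V where "openin X V" "x \<in> V"
      and "\<not> (\<exists>y\<in>derived X d e A \<alpha> \<inter> V. \<exists>z\<in>derived X d e A \<alpha> \<inter> V. e < d y z)"
      using succ.prems by (auto simp: sder_def)
    moreover then have "V \<inter> sder X d e (derived X d e A \<alpha>) = {}" unfolding sder_def by blast
    ultimately show ?thesis unfolding derived_osucc by blast
  qed
next
  case (limit \<alpha>)
  then obtain \<beta> where "\<beta> < \<alpha>" "x \<notin> derived X d e A \<beta>" by (auto simp: derived_limit)
  then show ?case using limit(2) derived_antimono[OF less_imp_le, of \<beta> \<alpha>] by fastforce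
qed (use assms in simp)

lemma closedin_derived:
  assumes "closedin X A"
  shows "closedin X (derived X d e A (\<alpha> :: 'u ordinal))"
proof -
  have A: "A \<subseteq> topspace X" using assms by (rule closedin_subset)
  have "openin X (topspace X - derived X d e A \<alpha>)"
  proof (subst openin_subopen, intro ballI)
    fix x assume x: "x \<in> topspace X - derived X d e A \<alpha>"
    show "\<exists>V. openin X V \<and> x \<in> V \<and> V \<subseteq> topspace X - derived X d e A \<alpha>"
    proof (cases "x \<in> A")
      case True
      then obtain V where V: "openin X V" "x \<in> V" "V \<inter> derived X d e A \<alpha> = {}"
        using x not_in_derived_nbhd[of x X d e A \<alpha>] by auto
      then have "V \<subseteq> topspace X - derived X d e A \<alpha>" using openin_subset[OF V(1)] by auto
      then show ?thesis using V by auto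
    next
      case False
      then show ?thesis
        using x assms derived_subset[of X d e A \<alpha>]
        by (intro exI[of _ "topspace X - A"]) auto
    qed
  qed
  moreover have "derived X d e A \<alpha> \<subseteq> topspace X" using A derived_subset by (rule subset_trans[rotated])
  ultimately show ?thesis unfolding closedin_def by simp
qed

lemma compactin_derived:
  assumes "compactin X A" "Hausdorff_space X"
  shows "compactin X (derived X d e A (\<alpha> :: 'u ordinal))"
  using closed_compactin[OF assms(1) derived_subset closedin_derived] compactin_imp_closedin assms
  by blast

lemma derived_limit_nonempty:
  assumes "compactin X A" "Hausdorff_space X" "limit_ordinal (\<alpha> :: 'u ordinal)"
    and "\<And>\<beta>. \<beta> < \<alpha> \<Longrightarrow> derived X d e A \<beta> \<noteq> {}"
  shows "derived X d e A \<alpha> \<noteq> {}"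
  unfolding derived_limit[OF assms(3)]
proof (rule compactin_nested_nonempty[OF assms(1)])
  show "{..<\<alpha>} \<noteq> {}" using limit_ordinal_pos[OF assms(3)] by blast
  show "closedin X (derived X d e A \<beta>)" for \<beta> :: "'u ordinal"
    by (rule closedin_derived[OF compactin_imp_closedin[OF assms(2,1)]])
qed (use assms(4) in \<open>simp_all add: derived_antimono derived_subset\<close>)

text \<open>Compactness forbids the derived sets to vanish for the first time at a limit. So the
  index for fixed \<open>e\<close>, if bounded, is a successor; the strict inequality in (ii) comes
  from here.\<close>

lemma derived_index_eq_atMost:
  assumes "compactin X A" "Hausdorff_space X" "A \<noteq> {}"
    and "derived X d e A (\<alpha> :: 'u ordinal) = {}"
  obtains \<gamma> where "{\<beta> :: 'u ordinal. derived X d e A \<beta> \<noteq> {}} = {..\<gamma>}"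
proof -
  let ?\<mu> = "LEAST \<beta> :: 'u ordinal. derived X d e A \<beta> = {}"
  have \<mu>: "derived X d e A ?\<mu> = {}" using assms(4) by (rule LeastI)
  have less: "derived X d e A \<beta> \<noteq> {}" if "\<beta> < ?\<mu>" for \<beta> :: "'u ordinal" using not_less_Least[OF that] .
  obtain \<gamma> where \<gamma>: "?\<mu> = osucc \<gamma>"
    using \<mu> derived_limit_nonempty[OF assms(1,2) _ less] assms(3)
    by (cases ?\<mu> rule: ordinal_cases) auto
  have "derived X d e A \<beta> \<noteq> {} \<longleftrightarrow> \<beta> \<le> \<gamma>" for \<beta>
  proof
    assume "derived X d e A \<beta> \<noteq> {}"
    then have "\<beta> < ?\<mu>" using \<mu> derived_antimono[of ?\<mu> \<beta>] by (metis leI subset_empty)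
    then show "\<beta> \<le> \<gamma>" unfolding \<gamma> by simp
  next
    assume "\<beta> \<le> \<gamma>"
    then have "\<beta> < ?\<mu>" unfolding \<gamma> by simp
    then show "derived X d e A \<beta> \<noteq> {}" by (rule less)
  qed
  then show ?thesis using that by blast
qed

text \<open>Neighbourhoods of an image point are pulled back by continuity, and distant pairs found
  in them are pushed forward. It serves the embedding of a summand and the affine maps of the
  convexity argument.\<close>

lemma image_derived_subset:
  assumes "continuous_map (subtopology X A) Y \<phi>" "A \<subseteq> topspace X" "\<phi> ` A \<subseteq> B"
    and "\<And>y z. y \<in> A \<Longrightarrow> z \<in> A \<Longrightarrow> e < d y z \<Longrightarrow> e' < d' (\<phi> y) (\<phi> z)"
  shows "\<phi> ` derived X d e A (\<alpha> :: 'u ordinal) \<subseteq> derived Y d' e' B \<alpha>"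
proof (induction \<alpha> rule: ordinal_induct)
  case (succ \<alpha>)
  show ?case unfolding derived_osucc
  proof (rule image_subsetI)
    fix x assume x: "x \<in> sder X d e (derived X d e A \<alpha>)"
    then have xA: "x \<in> derived X d e A \<alpha>" by (simp add: sder_def)
    have "\<exists>y\<in>derived Y d' e' B \<alpha> \<inter> V. \<exists>z\<in>derived Y d' e' B \<alpha> \<inter> V. e' < d' y z"
      if V: "openin Y V" "\<phi> x \<in> V" for V
    proof -
      have "openin (subtopology X A) {y \<in> topspace (subtopology X A). \<phi> y \<in> V}"
        using assms(1) V(1) by (rule openin_continuous_map_preimage)
      then obtain W where W: "openin X W" "{y \<in> topspace (subtopology X A). \<phi> y \<in> V} = W \<inter> A"
        by (auto simp: openin_subtopology)
      have "x \<in> {y \<in> topspace (subtopology X A). \<phi> y \<in> V}"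
        using xA V(2) derived_subset[of X d e A \<alpha>] assms(2) by auto
      then have "x \<in> W" using W(2) by blast
      then obtain y z where yz: "y \<in> derived X d e A \<alpha> \<inter> W" "z \<in> derived X d e A \<alpha> \<inter> W" "e < d y z"
        using x W(1) by (auto simp: sder_def)
      then have A: "y \<in> A" "z \<in> A" using derived_subset[of X d e A \<alpha>] by auto
      then have "\<phi> y \<in> V" "\<phi> z \<in> V" using W(2) yz by blast+
      moreover have "e' < d' (\<phi> y) (\<phi> z)" using assms(4) A yz(3) by blast
      moreover have "\<phi> y \<in> derived Y d' e' B \<alpha>" "\<phi> z \<in> derived Y d' e' B \<alpha>"
        using yz succ.IH by auto
      ultimately show ?thesis by blast
    qed
    then show "\<phi> x \<in> sder Y d' e' (derived Y d' e' B \<alpha>)"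
      using xA succ.IH by (auto simp: sder_def)
  qed
next
  case (limit \<alpha>)
  then show ?case unfolding derived_limit[OF limit(1)] by fastforce
qed (use assms in simp)

text \<open>The opposite direction rests on compact fibres. If no preimage of \<open>x\<close>
  survives, finitely many open sets on which the distance is at most \<open>e\<close> cover the
  fibre, and image points close to \<open>x\<close> have their preimages in this cover. They are
  within \<open>e\<close> of \<open>x\<close>, hence within \<open>2 * e\<close> of each
  other.\<close>

lemma derived_image_subset:
  assumes cont: "continuous_map (subtopology X A) Y \<phi>" and A: "compactin X A"
    and X: "Hausdorff_space X" and Y: "Hausdorff_space Y"
    and tri: "\<And>x y z. x \<in> \<phi> ` A \<Longrightarrow> y \<in> \<phi> ` A \<Longrightarrow> z \<in> \<phi> ` A \<Longrightarrow> d y z \<le> d x y + d x z"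
  shows "derived Y d (2 * e) (\<phi> ` A) (\<alpha> :: 'u ordinal)
    \<subseteq> \<phi> ` derived X (\<lambda>f g. d (\<phi> f) (\<phi> g)) e A \<alpha>"
proof (induction \<alpha> rule: ordinal_induct)
  case (succ \<alpha>)
  let ?D = "derived X (\<lambda>f g. d (\<phi> f) (\<phi> g)) e A \<alpha>"
  let ?B = "derived Y d (2 * e) (\<phi> ` A) \<alpha>"
  have topA: "A \<subseteq> topspace X" using A by (rule compactin_subset_topspace)
  have D: "compactin X ?D" "?D \<subseteq> A" using compactin_derived[OF A X] derived_subset by simp_all
  have contD: "continuous_map (subtopology X ?D) Y \<phi>"
    using continuous_map_from_subtopology_mono[OF cont] D(2) by blast
  show ?case unfolding derived_osucc
  proof
    fix x assume x: "x \<in> sder Y d (2 * e) ?B"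
    then have xB: "x \<in> ?B" by (simp add: sder_def)
    then have xA: "x \<in> \<phi> ` A" by (rule subsetD[OF derived_subset])
    show "x \<in> \<phi> ` sder X (\<lambda>f g. d (\<phi> f) (\<phi> g)) e ?D"
    proof (rule ccontr)
      assume neg: "x \<notin> \<phi> ` sder X (\<lambda>f g. d (\<phi> f) (\<phi> g)) e ?D"
      let ?C = "{f \<in> ?D. \<phi> f = x}"
      have "\<exists>V. openin X V \<and> f \<in> V \<and> (\<forall>g\<in>?D \<inter> V. \<forall>h\<in>?D \<inter> V. d (\<phi> g) (\<phi> h) \<le> e)"
        if f: "f \<in> ?C" for f
      proof -
        have "f \<notin> sder X (\<lambda>f g. d (\<phi> f) (\<phi> g)) e ?D" using neg f by auto
        then obtain V where "openin X V" "f \<in> V"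
          "\<not> (\<exists>g\<in>?D \<inter> V. \<exists>h\<in>?D \<inter> V. e < d (\<phi> g) (\<phi> h))"
          using f unfolding sder_def by auto
        then show ?thesis by (meson not_less)
      qed
      then have "\<forall>f\<in>?C. \<exists>V. openin X V \<and> f \<in> V \<and>
          (\<forall>g\<in>?D \<inter> V. \<forall>h\<in>?D \<inter> V. d (\<phi> g) (\<phi> h) \<le> e)" ..
      from bchoice[OF this] obtain V where
        "\<forall>f\<in>?C. openin X (V f) \<and> f \<in> V f \<and>
          (\<forall>g\<in>?D \<inter> V f. \<forall>h\<in>?D \<inter> V f. d (\<phi> g) (\<phi> h) \<le> e)" ..
      then have V: "\<And>f. f \<in> ?C \<Longrightarrow> openin X (V f)" "\<And>f. f \<in> ?C \<Longrightarrow> f \<in> V f"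
        and small: "\<And>f g h. f \<in> ?C \<Longrightarrow> g \<in> ?D \<inter> V f \<Longrightarrow> h \<in> ?D \<inter> V f \<Longrightarrow> d (\<phi> g) (\<phi> h) \<le> e"
        by simp_all
      have "x \<in> topspace Y" using xA cont topA by (auto simp: continuous_map_def)
      then have "closedin Y {x}" using Y by (simp add: closedin_Hausdorff_singleton)
      then have "closedin (subtopology X ?D) {f \<in> topspace (subtopology X ?D). \<phi> f \<in> {x}}"
        by (rule closedin_continuous_map_preimage[OF contD])
      moreover have "{f \<in> topspace (subtopology X ?D). \<phi> f \<in> {x}} = ?C" using D topA by auto
      ultimately have "compactin (subtopology X ?D) ?C"
        using closedin_compact_space[OF compact_space_subtopology[OF D(1)]] by simp
      then have C: "compactin X ?C" by (simp add: compactin_subtopology)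
      obtain F where F: "finite F" "F \<subseteq> ?C" "?C \<subseteq> \<Union>(V ` F)"
      proof -
        have "(\<forall>U\<in>V ` ?C. openin X U) \<and> ?C \<subseteq> \<Union>(V ` ?C)" using V by auto
        then have "\<exists>\<F>. finite \<F> \<and> \<F> \<subseteq> V ` ?C \<and> ?C \<subseteq> \<Union>\<F>"
          using conjunct2[OF C[unfolded compactin_def], rule_format, of "V ` ?C"] by simp
        then obtain \<F> where \<F>: "finite \<F>" "\<F> \<subseteq> V ` ?C" "?C \<subseteq> \<Union>\<F>" by (elim exE conjE)
        obtain F where "F \<subseteq> ?C" "finite F" "\<F> = V ` F"
          using finite_subset_image[OF \<F>(1,2)] by (elim exE conjE)
        then show ?thesis using that \<F>(3) by simp
      qed
      let ?O = "\<Union>(V ` F)"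
      have "openin X ?O" using subsetD[OF F(2)] V(1) by (intro openin_Union) auto
      then have "compactin X (?D \<inter> (topspace X - ?O))"
        using D(1) by (intro compact_Int_closedin) auto
      moreover have "?D \<inter> (topspace X - ?O) = ?D - ?O" using D(2) topA by auto
      ultimately have "compactin (subtopology X ?D) (?D - ?O)" by (simp add: compactin_subtopology)
      then have "compactin Y (\<phi> ` (?D - ?O))" using contD by (rule image_compactin)
      then have cl: "closedin Y (\<phi> ` (?D - ?O))" by (rule compactin_imp_closedin[OF Y])
      \<comment> \<open>Removing the compact image of the part outside the cover leaves a
        neighbourhood of \<open>x\<close> whose points come from the cover only.\<close>
      let ?W = "topspace Y - \<phi> ` (?D - ?O)"
      have "openin Y ?W" using cl by (simp add: closedin_def)
      moreover have "x \<in> ?W" using F(3) \<open>x \<in> topspace Y\<close> by auto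
      ultimately have "\<exists>y\<in>?B \<inter> ?W. \<exists>z\<in>?B \<inter> ?W. 2 * e < d y z"
        using x unfolding sder_def by simp
      then obtain y z where yz: "y \<in> ?B \<inter> ?W" "z \<in> ?B \<inter> ?W" "2 * e < d y z" by (elim bexE)
      have near: "d x u \<le> e" if u: "u \<in> ?B \<inter> ?W" for u
      proof -
        obtain g where g: "g \<in> ?D" "u = \<phi> g" using u succ.IH by auto
        then have "g \<in> ?O" using u by auto
        then obtain f where f: "f \<in> F" "g \<in> V f" by auto
        then have "f \<in> ?C" using F(2) by auto
        then have "d (\<phi> f) (\<phi> g) \<le> e" using small[of f f g] V(2)[of f] f g by simp
        then show ?thesis using \<open>f \<in> ?C\<close> g by simp
      qed
      have "y \<in> \<phi> ` A" "z \<in> \<phi> ` A"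
        using yz derived_subset[of Y d "2 * e" "\<phi> ` A" \<alpha>] by auto
      then have "d y z \<le> d x y + d x z" using tri[OF xA] by simp
      then show False using near[OF yz(1)] near[OF yz(2)] yz(3) by linarith
    qed
  qed
next
  case (limit \<alpha>)
  let ?D = "derived X (\<lambda>f g. d (\<phi> f) (\<phi> g)) e A :: 'u ordinal \<Rightarrow> _"
  have topA: "A \<subseteq> topspace X" using A by (rule compactin_subset_topspace)
  have clA: "closedin X A" using X A by (rule compactin_imp_closedin)
  show ?case
  proof
    fix x assume x: "x \<in> derived Y d (2 * e) (\<phi> ` A) \<alpha>"
    then have xA: "x \<in> \<phi> ` A" by (rule subsetD[OF derived_subset])
    have "x \<in> topspace Y" using xA cont topA by (auto simp: continuous_map_def)
    then have "closedin Y {x}" using Y by (simp add: closedin_Hausdorff_singleton)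
    then have "closedin (subtopology X A) {f \<in> topspace (subtopology X A). \<phi> f \<in> {x}}"
      by (rule closedin_continuous_map_preimage[OF cont])
    moreover have "{f \<in> topspace (subtopology X A). \<phi> f \<in> {x}} = {f \<in> A. \<phi> f = x}" using topA by auto
    ultimately have cl: "closedin X {f \<in> A. \<phi> f = x}" using closedin_trans_full[OF _ clA] by simp
    \<comment> \<open>At each earlier stage the surviving preimage of \<open>x\<close> may be a
      different one; the nested traces of the fibre provide one that survives all stages.\<close>
    have "(\<Inter>\<beta>\<in>{..<\<alpha>}. ?D \<beta> \<inter> {f \<in> A. \<phi> f = x}) \<noteq> {}"
    proof (rule compactin_nested_nonempty[OF A])
      show "{..<\<alpha>} \<noteq> {}" using limit_ordinal_pos[OF limit(1)] by auto
      fix \<beta> assume \<beta>: "\<beta> \<in> {..<\<alpha>}"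
      show "closedin X (?D \<beta> \<inter> {f \<in> A. \<phi> f = x})"
        using cl closedin_derived[OF clA] by (rule closedin_Int[rotated])
      show "?D \<beta> \<inter> {f \<in> A. \<phi> f = x} \<subseteq> A" by blast
      have "x \<in> derived Y d (2 * e) (\<phi> ` A) \<beta>" using x \<beta> by (auto simp: derived_limit[OF limit(1)])
      then have "x \<in> \<phi> ` ?D \<beta>" using limit(2)[of \<beta>] \<beta> by auto
      moreover have "?D \<beta> \<subseteq> A" by (rule derived_subset)
      ultimately show "?D \<beta> \<inter> {f \<in> A. \<phi> f = x} \<noteq> {}" by auto
    next
      fix \<beta> \<gamma> :: "'u ordinal" assume "\<beta> \<le> \<gamma>"
      from derived_antimono[OF this, of X "\<lambda>f g. d (\<phi> f) (\<phi> g)" e A] show "?D \<gamma> \<inter> {f \<in> A. \<phi> f = x} \<subseteq> ?D \<beta> \<inter> {f \<in> A. \<phi> f = x}"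
        by blast
    qed
    then obtain f where f: "f \<in> (\<Inter>\<beta>\<in>{..<\<alpha>}. ?D \<beta> \<inter> {f \<in> A. \<phi> f = x})"
      unfolding ex_in_conv[symmetric] ..
    have "f \<in> ?D \<beta>" if "\<beta> < \<alpha>" for \<beta> using INT_D[OF f, of \<beta>] that by simp
    moreover have "\<phi> f = x" using INT_D[OF f, of 0] limit_ordinal_pos[OF limit(1)] by simp
    ultimately have "f \<in> ?D \<alpha>" "\<phi> f = x" unfolding derived_limit[OF limit(1)] by simp_all
    then show "x \<in> \<phi> ` ?D \<alpha>" by auto
  qed
qed simp

text \<open>The rank of \<open>x\<close> is the last stage that \<open>x\<close> survives; it exists
  because limit stages are intersections. Nearby points avoid the next derived set, so they have no
  larger rank, and those of equal rank lie in a set of diameter at most \<open>e\<close> around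
  \<open>x\<close>.\<close>

lemma derived_empty_imp_rank:
  assumes "derived X d e A (\<gamma> :: 'u ordinal) = {}" "A \<subseteq> topspace X"
  obtains r :: "'x \<Rightarrow> 'u ordinal" where "\<And>x. x \<in> A \<Longrightarrow> r x < \<gamma>"
    and "\<And>x. x \<in> A \<Longrightarrow> \<exists>V. openin X V \<and> x \<in> V \<and>
      (\<forall>y\<in>A \<inter> V. r y \<le> r x \<and> (e < d x y \<longrightarrow> r y < r x))"
proof -
  let ?D = "derived X d e A :: 'u ordinal \<Rightarrow> 'x set"
  have "\<exists>\<rho><\<gamma>. x \<in> ?D \<rho> \<and> x \<notin> ?D (osucc \<rho>)" if x: "x \<in> A" for x
  proof -
    let ?\<mu> = "LEAST \<beta>. x \<notin> ?D \<beta>"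
    have "x \<notin> ?D \<gamma>" using assms(1) by simp
    then have \<mu>: "x \<notin> ?D ?\<mu>" "?\<mu> \<le> \<gamma>" by (rule LeastI, rule Least_le)
    have less: "x \<in> ?D \<beta>" if "\<beta> < ?\<mu>" for \<beta> using not_less_Least[OF that] by simp
    show ?thesis
    proof (cases ?\<mu> rule: ordinal_cases)
      case zero
      then show ?thesis using \<mu> x by simp
    next
      case (succ \<rho>)
      then have "x \<in> ?D \<rho>" using less less_osucc by metis
      then show ?thesis using succ \<mu> by auto
    next
      case limit
      have "x \<in> ?D ?\<mu>" unfolding derived_limit[OF limit] using less by auto
      then show ?thesis using \<mu>(1) by simp
    qed
  qed
  then have "\<forall>x\<in>A. \<exists>\<rho><\<gamma>. x \<in> ?D \<rho> \<and> x \<notin> ?D (osucc \<rho>)" by simp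
  from bchoice[OF this] obtain r where "\<forall>x\<in>A. r x < \<gamma> \<and> x \<in> ?D (r x) \<and> x \<notin> ?D (osucc (r x))" ..
  then have r: "\<And>x. x \<in> A \<Longrightarrow> r x < \<gamma>" "\<And>x. x \<in> A \<Longrightarrow> x \<in> ?D (r x)"
    "\<And>x. x \<in> A \<Longrightarrow> x \<notin> ?D (osucc (r x))" by simp_all
  have "\<exists>V. openin X V \<and> x \<in> V \<and> (\<forall>y\<in>A \<inter> V. r y \<le> r x \<and> (e < d x y \<longrightarrow> r y < r x))"
    if x: "x \<in> A" for x
  proof -
    have "\<exists>V. openin X V \<and> x \<in> V \<and> \<not> (\<exists>y\<in>?D (r x) \<inter> V. \<exists>z\<in>?D (r x) \<inter> V. e < d y z)"
      using r(2,3)[OF x] unfolding derived_osucc sder_def by simp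
    then obtain V where V: "openin X V" "x \<in> V"
      and V': "\<not> (\<exists>y\<in>?D (r x) \<inter> V. \<exists>z\<in>?D (r x) \<inter> V. e < d y z)" by (elim exE conjE)
    obtain W where W: "openin X W" "x \<in> W" "W \<inter> ?D (osucc (r x)) = {}"
      using not_in_derived_nbhd[OF r(3)[OF x] x] subsetD[OF assms(2) x] by auto
    have "r y \<le> r x \<and> (e < d x y \<longrightarrow> r y < r x)" if y: "y \<in> A \<inter> (V \<inter> W)" for y
    proof -
      have "y \<notin> ?D (osucc (r x))" using W y by auto
      then have "\<not> osucc (r x) \<le> r y"
        using r(2)[of y] y derived_antimono[of "osucc (r x)" "r y" X d e A] by auto
      then have le: "r y \<le> r x" by simp
      moreover have "r y \<noteq> r x" if "e < d x y"
      proof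
        assume "r y = r x"
        then have "y \<in> ?D (r x) \<inter> V" using r(2)[of y] y by auto
        then show False using V' r(2)[OF x] V(2) that by auto
      qed
      ultimately show ?thesis by auto
    qed
    then show ?thesis using V W by (intro exI[of _ "V \<inter> W"]) auto
  qed
  with r(1) show ?thesis by (rule that)
qed

text \<open>What a finite product of derivations retains once the factors are forgotten: near each
  point no rank rises, and a move by more than \<open>e\<close> lowers ranks on coordinates of total
  weight at least \<open>\<theta>\<close>. For \<open>w\<close> and \<open>\<theta>\<close> equal to
  1 this says that at least one rank drops.\<close>

definition rank_tuple ::
  "'x topology \<Rightarrow> ('x \<Rightarrow> 'x \<Rightarrow> real) \<Rightarrow> real \<Rightarrow> 'i set \<Rightarrow> ('i \<Rightarrow> real) \<Rightarrow> real \<Rightarrow> 'x set \<Rightarrow>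
    ('i \<Rightarrow> 'x \<Rightarrow> 'u ordinal) \<Rightarrow> bool" where
  "rank_tuple X d e G w \<theta> A \<rho> \<longleftrightarrow>
    (\<forall>x\<in>A. \<exists>V. openin X V \<and> x \<in> V \<and> (\<forall>y\<in>A \<inter> V. (\<forall>i\<in>G. \<rho> i y \<le> \<rho> i x) \<and>
      (e < d x y \<longrightarrow> \<theta> \<le> (\<Sum>i\<in>{i \<in> G. \<rho> i y < \<rho> i x}. w i))))"

lemma rank_tupleE:
  assumes "rank_tuple X d e G w \<theta> A \<rho>" "x \<in> A"
  obtains V where "openin X V" "x \<in> V" "\<And>y i. y \<in> A \<Longrightarrow> y \<in> V \<Longrightarrow> i \<in> G \<Longrightarrow> \<rho> i y \<le> \<rho> i x"
    "\<And>y. y \<in> A \<Longrightarrow> y \<in> V \<Longrightarrow> e < d x y \<Longrightarrow> \<theta> \<le> (\<Sum>i\<in>{i \<in> G. \<rho> i y < \<rho> i x}. w i)"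
  using assms unfolding rank_tuple_def by (elim ballE[of _ _ x] exE) auto

lemma rank_tuple_subset:
  assumes "rank_tuple X d e G w \<theta> A \<rho>" "B \<subseteq> A"
  shows "rank_tuple X d e G w \<theta> B \<rho>"
  unfolding rank_tuple_def
proof
  fix x assume "x \<in> B"
  with assms(2) have "x \<in> A" ..
  with assms(1) obtain V where "openin X V" "x \<in> V"
    "\<And>y i. y \<in> A \<Longrightarrow> y \<in> V \<Longrightarrow> i \<in> G \<Longrightarrow> \<rho> i y \<le> \<rho> i x"
    "\<And>y. y \<in> A \<Longrightarrow> y \<in> V \<Longrightarrow> e < d x y \<Longrightarrow> \<theta> \<le> (\<Sum>i\<in>{i \<in> G. \<rho> i y < \<rho> i x}. w i)"
    by (rule rank_tupleE) simp
  then show "\<exists>V. openin X V \<and> x \<in> V \<and> (\<forall>y\<in>B \<inter> V. (\<forall>i\<in>G. \<rho> i y \<le> \<rho> i x) \<and>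
      (e < d x y \<longrightarrow> \<theta> \<le> (\<Sum>i\<in>{i \<in> G. \<rho> i y < \<rho> i x}. w i)))"
    using assms(2) by (intro exI[of _ V]) auto
qed

text \<open>The weighted count of quotients by \<open>\<omega>\<^sup>\<beta>\<close> bounds the number of derivations of length
  \<open>\<omega>\<^sup>\<beta>\<close>: near a point \<open>x\<close> of the \<open>j\<close>-th such derivative, the quotients differ from those at \<open>x\<close>
  only on a set of weight below \<open>\<theta>\<close>, so every drop of weight \<open>\<theta>\<close> makes some remainder drop
  whose quotient is still that of \<open>x\<close>.\<close>

lemma rank_tuple_stage:
  fixes w :: "'i \<Rightarrow> real" and \<rho> :: "'i \<Rightarrow> 'x \<Rightarrow> 'u ordinal"
  assumes IH: "\<And>A U \<rho> :: 'i \<Rightarrow> 'x \<Rightarrow> 'u ordinal. A \<subseteq> S \<Longrightarrow> openin X U \<Longrightarrow> rank_tuple X d e G (\<lambda>_. 1) 1 (A \<inter> U) \<rho> \<Longrightarrow>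
      (\<And>x i. x \<in> A \<inter> U \<Longrightarrow> i \<in> G \<Longrightarrow> \<rho> i x < omega_pow \<beta>) \<Longrightarrow>
      derived X d e' A (omega_pow \<beta>) \<inter> U = {}"
    and G: "finite G" and "A \<subseteq> S" "openin X U"
    and w: "\<And>i. i \<in> G \<Longrightarrow> 0 \<le> w i" and \<theta>: "0 < \<theta>"
    and rt: "rank_tuple X d e G w \<theta> (A \<inter> U) \<rho>"
    and less: "\<And>x i. x \<in> A \<inter> U \<Longrightarrow> i \<in> G \<Longrightarrow> \<rho> i x < nat_mult (omega_pow \<beta>) m"
    and x: "x \<in> A \<inter> U" "(\<Sum>i\<in>G. w i * real (oquot \<beta> (\<rho> i x))) < real j * \<theta>"
  shows "x \<notin> derived X d e' A (nat_mult (omega_pow \<beta>) j)"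
  using x
proof (induction j arbitrary: x)
  case 0
  moreover have "0 \<le> (\<Sum>i\<in>G. w i * real (oquot \<beta> (\<rho> i x)))" using w by (intro sum_nonneg) auto
  ultimately show ?case by simp
next
  case (Suc j)
  obtain V where V: "openin X V" "x \<in> V"
    and Vle: "\<And>y i. y \<in> A \<inter> U \<Longrightarrow> y \<in> V \<Longrightarrow> i \<in> G \<Longrightarrow> \<rho> i y \<le> \<rho> i x"
    using rank_tupleE[OF rt Suc.prems(1)] by metis
  define A' where "A' = derived X d e' A (nat_mult (omega_pow \<beta>) j)"
  have A': "A' \<subseteq> A" unfolding A'_def by (rule derived_subset)
  define k where "k i = oquot \<beta> (\<rho> i x)" for i
  \<comment> \<open>The value 0 after a quotient has dropped keeps \<open>\<sigma>\<close> from
    rising, and such a coordinate cannot drop any more.\<close>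
  define \<sigma> where "\<sigma> i y = (if oquot \<beta> (\<rho> i y) = k i then orem \<beta> (\<rho> i y) else 0)" for i y
  have qmono: "oquot \<beta> (\<rho> i z) \<le> oquot \<beta> (\<rho> i y)"
    if "\<rho> i z \<le> \<rho> i y" "y \<in> A \<inter> U" "i \<in> G" for i y z
    using that(1) less[OF that(2,3)] by (rule oquot_mono)
  have "derived X d e' A' (omega_pow \<beta>) \<inter> (U \<inter> V) = {}"
  proof (rule IH)
    show "A' \<subseteq> S" using A' \<open>A \<subseteq> S\<close> by (rule subset_trans)
    show "openin X (U \<inter> V)" using \<open>openin X U\<close> V(1) by (rule openin_Int)
    show "\<sigma> i y < omega_pow \<beta>" if "y \<in> A' \<inter> (U \<inter> V)" "i \<in> G" for i y
      using orem_less[OF less[of y i]] that A' omega_pow_pos unfolding \<sigma>_def by auto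
    show "rank_tuple X d e G (\<lambda>_. 1) 1 (A' \<inter> (U \<inter> V)) \<sigma>"
      unfolding rank_tuple_def
    proof
      fix y assume y: "y \<in> A' \<inter> (U \<inter> V)"
      then have yA: "y \<in> A \<inter> U" using A' by blast
      obtain W where W: "openin X W" "y \<in> W"
        and Wle: "\<And>z i. z \<in> A \<inter> U \<Longrightarrow> z \<in> W \<Longrightarrow> i \<in> G \<Longrightarrow> \<rho> i z \<le> \<rho> i y"
        and Wless: "\<And>z. z \<in> A \<inter> U \<Longrightarrow> z \<in> W \<Longrightarrow> e < d y z \<Longrightarrow>
          \<theta> \<le> (\<Sum>i\<in>{i \<in> G. \<rho> i z < \<rho> i y}. w i)"
        by (rule rank_tupleE[OF rt yA]) (rule that)
      have "(\<forall>i\<in>G. \<sigma> i z \<le> \<sigma> i y) \<and> (e < d y z \<longrightarrow> 1 \<le> (\<Sum>i\<in>{i \<in> G. \<sigma> i z < \<sigma> i y}. 1 :: real))"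
        if z: "z \<in> A' \<inter> (U \<inter> V) \<inter> W" for z
      proof (intro conjI ballI impI)
        have zA: "z \<in> A \<inter> U" "z \<in> W" using z A' by auto
        have q: "oquot \<beta> (\<rho> i z) \<le> oquot \<beta> (\<rho> i y)" "oquot \<beta> (\<rho> i y) \<le> k i" if "i \<in> G" for i
          using qmono[OF Wle[OF zA that] yA that] qmono[OF Vle[of y i] Suc.prems(1) that] y yA that
          unfolding k_def by auto
        fix i assume i: "i \<in> G"
        show "\<sigma> i z \<le> \<sigma> i y"
          using q[OF i] Wle[OF zA i] orem_le[of "\<rho> i z" "\<rho> i y" \<beta>] unfolding \<sigma>_def by auto
      next
        have zA: "z \<in> A \<inter> U" "z \<in> W" using z A' by auto
        have q: "oquot \<beta> (\<rho> i z) \<le> oquot \<beta> (\<rho> i y)" "oquot \<beta> (\<rho> i y) \<le> k i" if "i \<in> G" for i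
          using qmono[OF Wle[OF zA that] yA that] qmono[OF Vle[of y i] Suc.prems(1) that] y yA that
          unfolding k_def by auto
        assume dyz: "e < d y z"
        let ?B = "{i \<in> G. \<rho> i z < \<rho> i y}"
        \<comment> \<open>Otherwise each rank that drops from \<open>y\<close> to \<open>z\<close>
          has a quotient at \<open>z\<close> below the one at \<open>x\<close>. These coordinates
          weigh at least \<open>\<theta>\<close>, so the weighted count at \<open>z\<close> lies
          lower by \<open>\<theta>\<close> and the induction hypothesis expels \<open>z\<close> from
          \<open>A'\<close>.\<close>
        have "{i \<in> G. \<sigma> i z < \<sigma> i y} \<noteq> {}"
        proof
          assume empty: "{i \<in> G. \<sigma> i z < \<sigma> i y} = {}"
          have B: "oquot \<beta> (\<rho> i z) < k i" if i: "i \<in> ?B" for i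
          proof (rule ccontr)
            assume "\<not> oquot \<beta> (\<rho> i z) < k i"
            then have "oquot \<beta> (\<rho> i z) = k i" "oquot \<beta> (\<rho> i y) = k i" using q[of i] i by auto
            then have "\<sigma> i z < \<sigma> i y" using i orem_mono unfolding \<sigma>_def by auto
            then show False using empty i by auto
          qed
          have "\<theta> \<le> (\<Sum>i\<in>?B. w i)" using Wless zA dyz by simp
          also have "\<dots> \<le> (\<Sum>i\<in>?B. w i * (real (k i) - real (oquot \<beta> (\<rho> i z))))"
          proof (rule sum_mono)
            fix i assume i: "i \<in> ?B"
            then have "real (oquot \<beta> (\<rho> i z)) + 1 \<le> real (k i)" using B[OF i] by linarith
            then have "w i * 1 \<le> w i * (real (k i) - real (oquot \<beta> (\<rho> i z)))"
              using w i by (intro mult_left_mono) auto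
            then show "w i \<le> w i * (real (k i) - real (oquot \<beta> (\<rho> i z)))" by simp
          qed
          also have "\<dots> \<le> (\<Sum>i\<in>G. w i * (real (k i) - real (oquot \<beta> (\<rho> i z))))"
          proof (rule sum_mono2[OF G])
            fix i assume i: "i \<in> G - ?B"
            then show "0 \<le> w i * (real (k i) - real (oquot \<beta> (\<rho> i z)))"
              using w[of i] q[of i] by auto
          qed auto
          also have "\<dots> = (\<Sum>i\<in>G. w i * real (k i)) - (\<Sum>i\<in>G. w i * real (oquot \<beta> (\<rho> i z)))"
            by (simp add: right_diff_distrib sum_subtractf)
          also have "(\<Sum>i\<in>G. w i * real (k i)) < real (Suc j) * \<theta>"
            using Suc.prems(2) unfolding k_def .
          finally have "(\<Sum>i\<in>G. w i * real (oquot \<beta> (\<rho> i z))) < real j * \<theta>"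
            by (simp add: algebra_simps)
          then have "z \<notin> A'" unfolding A'_def by (rule Suc.IH[OF zA(1)])
          then show False using z by simp
        qed
        then have "1 \<le> card {i \<in> G. \<sigma> i z < \<sigma> i y}" using G by (simp add: Suc_le_eq card_gt_0_iff)
        then show "1 \<le> (\<Sum>i\<in>{i \<in> G. \<sigma> i z < \<sigma> i y}. 1 :: real)" by simp
      qed
      then show "\<exists>W. openin X W \<and> y \<in> W \<and> (\<forall>z\<in>A' \<inter> (U \<inter> V) \<inter> W. (\<forall>i\<in>G. \<sigma> i z \<le> \<sigma> i y) \<and>
        (e < d y z \<longrightarrow> 1 \<le> (\<Sum>i\<in>{i \<in> G. \<sigma> i z < \<sigma> i y}. 1 :: real)))" using W by (intro exI[of _ W]) simp
    qed
  qed
  then show ?case using Suc.prems(1) V(2) by (auto simp: derived_oadd A'_def)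
qed

text \<open>Ranks near a point are bounded by their values at it. So for a successor exponent a
  finite multiple of the smaller power removes the point, and for a limit exponent one smaller power
  does; that both depend on the point and on \<open>G\<close> is harmless below
  \<open>omega_pow \<beta>\<close>.\<close>

lemma rank_tuple_omega_pow:
  fixes \<rho> :: "'i \<Rightarrow> 'x \<Rightarrow> 'u ordinal"
  assumes G: "finite G"
    and tri: "\<And>x y z. x \<in> S \<Longrightarrow> y \<in> S \<Longrightarrow> z \<in> S \<Longrightarrow> d y z \<le> d x y + d x z"
    and "A \<subseteq> S" "openin X U" "rank_tuple X d e G (\<lambda>_. 1) 1 (A \<inter> U) \<rho>"
    and "\<And>x i. x \<in> A \<inter> U \<Longrightarrow> i \<in> G \<Longrightarrow> \<rho> i x < omega_pow \<beta>"
  shows "derived X d (2 * e) A (omega_pow \<beta>) \<inter> U = {}"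
  using assms(3-6)
proof (induction \<beta> arbitrary: A U \<rho> rule: ordinal_induct)
  case zero
  show ?case
  proof (rule ccontr)
    assume "derived X d (2 * e) A (omega_pow (0 :: 'u ordinal)) \<inter> U \<noteq> {}"
    then obtain x where x: "x \<in> sder X d (2 * e) A" "x \<in> U" by auto
    then have xA: "x \<in> A" by (simp add: sder_def)
    obtain V where V: "openin X V" "x \<in> V"
      and Vless: "\<And>y. y \<in> A \<inter> U \<Longrightarrow> y \<in> V \<Longrightarrow> e < d x y \<Longrightarrow>
        1 \<le> (\<Sum>i\<in>{i \<in> G. \<rho> i y < \<rho> i x}. 1 :: real)"
      using xA x(2) by (auto intro: rank_tupleE[OF zero(3), of x])
    \<comment> \<open>Of two points more than \<open>2 * e\<close> apart, one is more than
      \<open>e\<close> away from \<open>x\<close>; some rank would have to drop below 0. The factor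
      2 arises here and is inherited by all exponents.\<close>
    obtain y z where yz: "y \<in> A \<inter> (U \<inter> V)" "z \<in> A \<inter> (U \<inter> V)" "2 * e < d y z"
      using x V(2) openin_Int[OF zero(2) V(1)] unfolding sder_def by auto
    then have "d y z \<le> d x y + d x z" using tri[of x y z] xA zero(1) by auto
    then obtain u where u: "u \<in> A \<inter> U" "u \<in> V" "e < d x u" using yz by (cases "e < d x y") auto
    have "{i \<in> G. \<rho> i u < \<rho> i x} = {}"
      using zero(4)[of x] xA x(2) by auto
    then show False using Vless[OF u] by (simp only: sum.empty)
  qed
next
  case (succ \<beta>)
  show ?case
  proof (rule ccontr)
    assume "derived X d (2 * e) A (omega_pow (osucc \<beta>)) \<inter> U \<noteq> {}"
    then obtain x where x: "x \<in> derived X d (2 * e) A (omega_pow (osucc \<beta>))" "x \<in> U" by auto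
    then have xA: "x \<in> A \<inter> U" using derived_subset[THEN subsetD] by fast
    obtain V where V: "openin X V" "x \<in> V" and Vle: "\<And>y i. y \<in> A \<inter> U \<Longrightarrow> y \<in> V \<Longrightarrow> i \<in> G \<Longrightarrow> \<rho> i y \<le> \<rho> i x"
      using rank_tupleE[OF succ(4) xA] by metis
    have "\<forall>i\<in>G. \<exists>n. \<rho> i x < nat_mult (omega_pow \<beta>) n"
      using succ(5)[OF xA] by (simp add: less_omega_pow_osucc_iff)
    from bchoice[OF this] obtain n where
      n: "\<And>i. i \<in> G \<Longrightarrow> \<rho> i x < nat_mult (omega_pow \<beta>) (n i)" by auto
    define m where "m = Max (insert 0 (n ` G))"
    have m: "\<rho> i x < nat_mult (omega_pow \<beta>) m" if "i \<in> G" for i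
    proof -
      have "n i \<le> m" unfolding m_def using G that by (intro Max_ge) auto
      then show ?thesis using n[OF that] nat_mult_mono by (meson order_less_le_trans)
    qed
    \<comment> \<open>With all weights 1 the count may be as large as \<open>card G\<close> times
      \<open>m\<close>, still finite.\<close>
    obtain j :: nat where j: "(\<Sum>i\<in>G. 1 * real (oquot \<beta> (\<rho> i x))) < real j"
      using reals_Archimedean2 by blast
    have "x \<notin> derived X d (2 * e) A (nat_mult (omega_pow \<beta>) j)"
    proof (rule rank_tuple_stage[where S = S and U = "U \<inter> V" and G = G and w = "\<lambda>_. 1" and \<theta> = 1
          and e = e and \<rho> = \<rho> and m = m])
      show "rank_tuple X d e G (\<lambda>_. 1) 1 (A \<inter> (U \<inter> V)) \<rho>"
        by (rule rank_tuple_subset[OF succ(4)]) blast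
      show "\<rho> i y < nat_mult (omega_pow \<beta>) m" if "y \<in> A \<inter> (U \<inter> V)" "i \<in> G" for i y
      proof -
        have "\<rho> i y \<le> \<rho> i x" using Vle[of y i] that by simp
        then show ?thesis using m[OF that(2)] by (rule order_le_less_trans)
      qed
      show "(\<Sum>i\<in>G. 1 * real (oquot \<beta> (\<rho> i x))) < real j * 1" using j by simp
    qed (use succ G V xA in auto)
    moreover have "derived X d (2 * e) A (omega_pow (osucc \<beta>))
        \<subseteq> derived X d (2 * e) A (nat_mult (omega_pow \<beta>) j)"
      by (intro derived_antimono less_imp_le nat_mult_omega_pow_less)
    ultimately show False using x(1) by auto
  qed
next
  case (limit \<beta>)
  show ?case
  proof (rule ccontr)
    assume "derived X d (2 * e) A (omega_pow \<beta>) \<inter> U \<noteq> {}"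
    then obtain x where x: "x \<in> derived X d (2 * e) A (omega_pow \<beta>)" "x \<in> U" by auto
    then have xA: "x \<in> A \<inter> U" using derived_subset[THEN subsetD] by fast
    obtain V where V: "openin X V" "x \<in> V" and Vle: "\<And>y i. y \<in> A \<inter> U \<Longrightarrow> y \<in> V \<Longrightarrow> i \<in> G \<Longrightarrow> \<rho> i y \<le> \<rho> i x"
      using rank_tupleE[OF limit(5) xA] by metis
    have "\<forall>i\<in>G. \<exists>\<gamma><\<beta>. \<rho> i x < omega_pow \<gamma>"
      using limit(6)[OF xA] by (simp add: less_omega_pow_limit_iff[OF limit(1)])
    from bchoice[OF this] obtain c where
      c: "\<And>i. i \<in> G \<Longrightarrow> c i < \<beta> \<and> \<rho> i x < omega_pow (c i)" by auto
    define \<gamma> where "\<gamma> = Max (insert 0 (c ` G))"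
    have \<gamma>: "\<gamma> < \<beta>" unfolding \<gamma>_def using G c limit_ordinal_pos[OF limit(1)] by auto
    have less: "\<rho> i x < omega_pow \<gamma>" if "i \<in> G" for i
    proof -
      have "c i \<le> \<gamma>" unfolding \<gamma>_def using G that by (intro Max_ge) auto
      then have "omega_pow (c i) \<le> omega_pow \<gamma>" by (metis omega_pow_strict_mono order_le_less)
      then show ?thesis using c[OF that] by (meson order_less_le_trans)
    qed
    have "derived X d (2 * e) A (omega_pow \<gamma>) \<inter> (U \<inter> V) = {}"
    proof (rule limit(2)[OF \<gamma> limit(3)])
      show "openin X (U \<inter> V)" using limit(4) V(1) by (rule openin_Int)
      show "rank_tuple X d e G (\<lambda>_. 1) 1 (A \<inter> (U \<inter> V)) \<rho>"
        by (rule rank_tuple_subset[OF limit(5)]) blast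
      show "\<rho> i y < omega_pow \<gamma>" if "y \<in> A \<inter> (U \<inter> V)" "i \<in> G" for i y
      proof -
        have "\<rho> i y \<le> \<rho> i x" using Vle[of y i] that by simp
        then show ?thesis using less[OF that(2)] by (rule order_le_less_trans)
      qed
    qed
    moreover have "derived X d (2 * e) A (omega_pow \<beta>) \<subseteq> derived X d (2 * e) A (omega_pow \<gamma>)"
      by (intro derived_antimono less_imp_le omega_pow_strict_mono \<gamma>)
    ultimately show False using x V(2) by auto
  qed
qed

text \<open>Here the number of stages is uniform: \<open>j\<close> depends on \<open>m\<close>,
  \<open>\<theta>\<close> and the total weight, but not on the number of coordinates.\<close>

proposition rank_tuple_derived_empty:
  fixes \<rho> :: "'i \<Rightarrow> 'x \<Rightarrow> 'u ordinal" and w :: "'i \<Rightarrow> real"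
  assumes G: "finite G"
    and tri: "\<And>x y z. x \<in> A \<Longrightarrow> y \<in> A \<Longrightarrow> z \<in> A \<Longrightarrow> d y z \<le> d x y + d x z"
    and U: "openin X U" and w: "\<And>i. i \<in> G \<Longrightarrow> 0 \<le> w i" and \<theta>: "0 < \<theta>"
    and rt: "rank_tuple X d e G w \<theta> (A \<inter> U) \<rho>"
    and less: "\<And>x i. x \<in> A \<inter> U \<Longrightarrow> i \<in> G \<Longrightarrow> \<rho> i x < nat_mult (omega_pow \<beta>) m"
    and j: "real m * (\<Sum>i\<in>G. w i) < real j * \<theta>"
  shows "derived X d (2 * e) A (nat_mult (omega_pow \<beta>) j) \<inter> U = {}"
proof (rule ccontr)
  assume "derived X d (2 * e) A (nat_mult (omega_pow \<beta>) j) \<inter> U \<noteq> {}"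
  then obtain x where x: "x \<in> derived X d (2 * e) A (nat_mult (omega_pow \<beta>) j)" "x \<in> U" by blast
  then have xA: "x \<in> A \<inter> U" using derived_subset[THEN subsetD] by fast
  have "(\<Sum>i\<in>G. w i * real (oquot \<beta> (\<rho> i x))) \<le> (\<Sum>i\<in>G. w i * real m)"
  proof (intro sum_mono mult_left_mono w)
    fix i assume "i \<in> G"
    then show "real (oquot \<beta> (\<rho> i x)) \<le> real m"
      using oquot_less[OF less[OF xA]] by (simp add: less_imp_le)
  qed
  also have "\<dots> < real j * \<theta>" using j by (simp add: sum_distrib_left[symmetric] mult.commute)
  finally have sum: "(\<Sum>i\<in>G. w i * real (oquot \<beta> (\<rho> i x))) < real j * \<theta>" .
  have "x \<notin> derived X d (2 * e) A (nat_mult (omega_pow \<beta>) j)"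
  proof (rule rank_tuple_stage[OF _ G subset_refl U w \<theta> rt less xA sum])
    fix B U and \<sigma> :: "'i \<Rightarrow> 'x \<Rightarrow> 'u ordinal"
    assume "B \<subseteq> A" "openin X U" "rank_tuple X d e G (\<lambda>_. 1) 1 (B \<inter> U) \<sigma>"
      "\<And>x i. x \<in> B \<inter> U \<Longrightarrow> i \<in> G \<Longrightarrow> \<sigma> i x < omega_pow \<beta>"
    then show "derived X d (2 * e) B (omega_pow \<beta>) \<inter> U = {}"
      by (intro rank_tuple_omega_pow[OF G tri]) auto
  qed
  then show False using x by blast
qed

end

section \<open>Normed spaces, functionals and the weak-star topology\<close>

lemma scalar_space_simps [simp]:
  "carrier scalar_space = UNIV" "zero scalar_space = 0" "one scalar_space = 1"
  "x \<oplus>\<^bsub>scalar_space\<^esub> y = x + y" "x \<otimes>\<^bsub>scalar_space\<^esub> y = x * y"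
  "x \<odot>\<^bsub>scalar_space\<^esub> y = x * y" "nrm scalar_space = norm"
  by (simp_all add: scalar_space_def)

lemma
  assumes "normed_space N"
  shows normed_space_module: "Module.module scalar_space N"
    and normed_space_abelian_group: "abelian_group N"
    and add_closed: "x \<in> carrier N \<Longrightarrow> y \<in> carrier N \<Longrightarrow> x \<oplus>\<^bsub>N\<^esub> y \<in> carrier N"
    and zero_closed: "\<zero>\<^bsub>N\<^esub> \<in> carrier N"
    and smult_closed: "x \<in> carrier N \<Longrightarrow> c \<odot>\<^bsub>N\<^esub> x \<in> carrier N"
    and nrm_nonneg: "x \<in> carrier N \<Longrightarrow> 0 \<le> nrm N x"
    and nrm_eq_0_iff: "x \<in> carrier N \<Longrightarrow> nrm N x = 0 \<longleftrightarrow> x = \<zero>\<^bsub>N\<^esub>"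
    and nrm_smult: "x \<in> carrier N \<Longrightarrow> nrm N (c \<odot>\<^bsub>N\<^esub> x) = norm c * nrm N x"
    and nrm_triangle: "x \<in> carrier N \<Longrightarrow> y \<in> carrier N \<Longrightarrow> nrm N (x \<oplus>\<^bsub>N\<^esub> y) \<le> nrm N x + nrm N y"
proof -
  show *: "Module.module scalar_space N" using assms by (simp add: normed_space_def)
  interpret Module.module scalar_space N by (rule *)
  show "abelian_group N" by (rule M.abelian_group_axioms)
  show "x \<in> carrier N \<Longrightarrow> y \<in> carrier N \<Longrightarrow> x \<oplus>\<^bsub>N\<^esub> y \<in> carrier N" by simp
  show "\<zero>\<^bsub>N\<^esub> \<in> carrier N" by simp
  show "x \<in> carrier N \<Longrightarrow> c \<odot>\<^bsub>N\<^esub> x \<in> carrier N" by simp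
qed (use assms in \<open>simp_all add: normed_space_def\<close>)

lemma nrm_zero: "normed_space N \<Longrightarrow> nrm N \<zero>\<^bsub>N\<^esub> = 0"
  by (simp add: nrm_eq_0_iff zero_closed)

lemma smult_minus_one:
  assumes "normed_space N" "x \<in> carrier N"
  shows "\<ominus>\<^bsub>N\<^esub> x = (-1) \<odot>\<^bsub>N\<^esub> x"
proof -
  interpret Module.module scalar_space N by (rule normed_space_module[OF assms(1)])
  have "(-1) \<odot>\<^bsub>N\<^esub> x \<oplus>\<^bsub>N\<^esub> x = (-1) \<odot>\<^bsub>N\<^esub> x \<oplus>\<^bsub>N\<^esub> 1 \<odot>\<^bsub>N\<^esub> x"
    using smult_one assms(2) by simp
  also have "\<dots> = ((-1) + 1) \<odot>\<^bsub>N\<^esub> x"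
    using smult_l_distr[of "-1" 1 x] assms(2) by simp
  also have "\<dots> = \<zero>\<^bsub>N\<^esub>" using smult_l_null[OF assms(2)] by simp
  finally show ?thesis using assms(2) by (intro M.minus_equality) auto
qed

lemma minus_eq:
  assumes "normed_space N" "x \<in> carrier N" "y \<in> carrier N"
  shows "x \<ominus>\<^bsub>N\<^esub> y = x \<oplus>\<^bsub>N\<^esub> (-1) \<odot>\<^bsub>N\<^esub> y"
  using assms by (simp add: a_minus_def smult_minus_one)

lemma zero_in_unit_ball: "normed_space N \<Longrightarrow> \<zero>\<^bsub>N\<^esub> \<in> unit_ball N"
  by (simp add: unit_ball_def zero_closed nrm_zero)

lemma smult_in_unit_ball:
  assumes "normed_space N" "x \<in> carrier N" "nrm N x \<le> r" "0 < r"
  shows "of_real (1 / r) \<odot>\<^bsub>N\<^esub> x \<in> unit_ball N"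
  using assms by (simp add: unit_ball_def smult_closed nrm_smult norm_divide divide_le_eq)

text \<open>That the scalars form a commutative ring is read off from the module structure of
  \<open>N\<close>, hence the reference to a space in the hypothesis.\<close>

lemma normed_space_scalar_space:
  assumes "normed_space (N :: ('k::{real_normed_field, euclidean_space}, 'a) nspace)"
  shows "normed_space (scalar_space :: ('k, 'k) nspace)"
proof -
  interpret N: Module.module "scalar_space :: ('k, 'k) nspace" N by (rule normed_space_module[OF assms])
  have "Module.module (scalar_space :: ('k, 'k) nspace) (scalar_space :: ('k, 'k) nspace)"
    by (rule Module.moduleI[OF Module.module.axioms(1)[OF normed_space_module[OF assms]] N.R.abelian_group_axioms]) (simp_all add: algebra_simps)
  then show ?thesis by (simp add: normed_space_def norm_mult norm_triangle_ineq)
qed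

section \<open>Bounded operators and the operator norm\<close>

lemma bounded_operatorD:
  assumes "bounded_operator N Y T"
  shows "x \<in> carrier N \<Longrightarrow> T x \<in> carrier Y"
    and "x \<in> carrier N \<Longrightarrow> y \<in> carrier N \<Longrightarrow> T (x \<oplus>\<^bsub>N\<^esub> y) = T x \<oplus>\<^bsub>Y\<^esub> T y"
    and "x \<in> carrier N \<Longrightarrow> T (c \<odot>\<^bsub>N\<^esub> x) = c \<odot>\<^bsub>Y\<^esub> T x"
  using assms by (auto simp: bounded_operator_def)

lemma bounded_operator_bound:
  assumes "normed_space N" "bounded_operator N Y T"
  obtains C where "0 \<le> C" "\<And>x. x \<in> carrier N \<Longrightarrow> nrm Y (T x) \<le> C * nrm N x"
proof -
  obtain C where "\<forall>x\<in>carrier N. nrm Y (T x) \<le> C * nrm N x"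
    using assms(2) by (auto simp: bounded_operator_def)
  then have C: "\<And>x. x \<in> carrier N \<Longrightarrow> nrm Y (T x) \<le> C * nrm N x" by simp
  have "nrm Y (T x) \<le> max 0 C * nrm N x" if "x \<in> carrier N" for x
    using C[OF that] nrm_nonneg[OF assms(1) that] by (meson max.cobounded2 mult_right_mono order_trans)
  then show ?thesis using that[of "max 0 C"] by simp
qed

lemma op_norm_upper:
  assumes "normed_space N" "bounded_operator N Y T" "x \<in> unit_ball N"
  shows "nrm Y (T x) \<le> op_norm N Y T"
proof -
  obtain C where C: "0 \<le> C" "\<And>x. x \<in> carrier N \<Longrightarrow> nrm Y (T x) \<le> C * nrm N x"
    by (rule bounded_operator_bound[OF assms(1,2)]) (rule that)
  have "nrm Y (T x) \<le> C" if "x \<in> unit_ball N" for x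
    using C(1) C(2)[of x] that mult_left_mono[of "nrm N x" 1 C] by (auto simp: unit_ball_def)
  then have "bdd_above ((\<lambda>x. nrm Y (T x)) ` unit_ball N)" by (auto intro!: bdd_aboveI[of _ C])
  then show ?thesis unfolding op_norm_def using assms(3) by (rule cSUP_upper2) simp
qed

lemma op_norm_le:
  assumes "normed_space N" "\<And>x. x \<in> unit_ball N \<Longrightarrow> nrm Y (T x) \<le> M"
  shows "op_norm N Y T \<le> M"
  unfolding op_norm_def using zero_in_unit_ball[OF assms(1)] assms(2) by (intro cSUP_least) auto

lemma nrm_le_op_norm:
  assumes "normed_space N" "normed_space Y" "bounded_operator N Y T" "x \<in> carrier N"
  shows "nrm Y (T x) \<le> op_norm N Y T * nrm N x"
proof (cases "nrm N x = 0")
  case True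
  obtain C where "nrm Y (T x) \<le> C * nrm N x" using bounded_operator_bound[OF assms(1,3)] assms(4) by metis
  then show ?thesis using True by simp
next
  case False
  then have pos: "0 < nrm N x" using nrm_nonneg[OF assms(1,4)] by simp
  have "nrm Y (T (of_real (1 / nrm N x) \<odot>\<^bsub>N\<^esub> x)) \<le> op_norm N Y T"
    by (intro op_norm_upper assms smult_in_unit_ball pos order_refl)
  also have "T (of_real (1 / nrm N x) \<odot>\<^bsub>N\<^esub> x) = of_real (1 / nrm N x) \<odot>\<^bsub>Y\<^esub> T x"
    by (rule bounded_operatorD[OF assms(3,4)])
  finally show ?thesis
    using pos bounded_operatorD(1)[OF assms(3,4)] by (simp add: nrm_smult[OF assms(2)] norm_divide divide_le_eq mult.commute)
qed

lemma op_norm_nonneg: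
  assumes "normed_space N" "normed_space Y" "bounded_operator N Y T"
  shows "0 \<le> op_norm N Y T"
  using op_norm_upper[OF assms(1,3) zero_in_unit_ball[OF assms(1)]]
    nrm_nonneg[OF assms(2) bounded_operatorD(1)[OF assms(3) zero_closed[OF assms(1)]]] by linarith

section \<open>Functionals and the dual norm\<close>

lemma in_carrier_dual_iff:
  "f \<in> carrier (dual N) \<longleftrightarrow> f \<in> extensional (carrier N) \<and>
    (\<forall>x\<in>carrier N. \<forall>y\<in>carrier N. f (x \<oplus>\<^bsub>N\<^esub> y) = f x + f y) \<and>
    (\<forall>c. \<forall>x\<in>carrier N. f (c \<odot>\<^bsub>N\<^esub> x) = c * f x) \<and>
    (\<exists>C. \<forall>x\<in>carrier N. norm (f x) \<le> C * nrm N x)"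
  by (auto simp: dual_def bounded_operator_def)

lemma dual_simps [simp]:
  "nrm (dual N) = op_norm N scalar_space"
  "\<zero>\<^bsub>dual N\<^esub> = (\<lambda>x\<in>carrier N. 0)"
  "f \<oplus>\<^bsub>dual N\<^esub> g = (\<lambda>x\<in>carrier N. f x + g x)"
  "c \<odot>\<^bsub>dual N\<^esub> f = (\<lambda>x\<in>carrier N. c * f x)"
  by (simp_all add: dual_def)

context
  fixes N :: "('k::{real_normed_field, euclidean_space}, 'a) nspace"
  assumes N: "normed_space N"
begin

lemma
  assumes "f \<in> carrier (dual N)"
  shows functional_add: "x \<in> carrier N \<Longrightarrow> y \<in> carrier N \<Longrightarrow> f (x \<oplus>\<^bsub>N\<^esub> y) = f x + f y"
    and functional_smult: "x \<in> carrier N \<Longrightarrow> f (c \<odot>\<^bsub>N\<^esub> x) = c * f x"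
    and functional_extensional: "f \<in> extensional (carrier N)"
    and functional_bounded_operator: "bounded_operator N scalar_space f"
  using assms by (auto simp: in_carrier_dual_iff bounded_operator_def)

lemma functional_zero: "f \<in> carrier (dual N) \<Longrightarrow> f \<zero>\<^bsub>N\<^esub> = 0"
  using functional_add[of f "\<zero>\<^bsub>N\<^esub>" "\<zero>\<^bsub>N\<^esub>"] zero_closed[OF N]
    abelian_group.r_neg abelian_monoid.l_zero[OF abelian_group.axioms(1)[OF normed_space_abelian_group[OF N]]]
  by simp

lemma norm_functional_le:
  "f \<in> carrier (dual N) \<Longrightarrow> x \<in> carrier N \<Longrightarrow> norm (f x) \<le> op_norm N scalar_space f * nrm N x"
  using nrm_le_op_norm[OF N normed_space_scalar_space[OF N] functional_bounded_operator] by simp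

lemma dual_norm_nonneg: "f \<in> carrier (dual N) \<Longrightarrow> 0 \<le> op_norm N scalar_space f"
  using op_norm_nonneg[OF N normed_space_scalar_space[OF N] functional_bounded_operator] .

lemma dual_norm_le_iff:
  assumes "f \<in> carrier (dual N)"
  shows "op_norm N scalar_space f \<le> M \<longleftrightarrow> (\<forall>x\<in>unit_ball N. norm (f x) \<le> M)"
proof
  assume *: "op_norm N scalar_space f \<le> M"
  show "\<forall>x\<in>unit_ball N. norm (f x) \<le> M"
    using op_norm_upper[OF N functional_bounded_operator[OF assms]] * by (auto intro: order_trans)
qed (simp add: op_norm_le[OF N])

lemma dual_norm_leI:
  assumes "0 \<le> M" "\<And>x. x \<in> carrier N \<Longrightarrow> norm (f x) \<le> M * nrm N x"
  shows "op_norm N scalar_space f \<le> M"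
proof (rule op_norm_le[OF N])
  fix x assume "x \<in> unit_ball N"
  then have "norm (f x) \<le> M * nrm N x" "M * nrm N x \<le> M * 1"
    using assms mult_left_mono[of "nrm N x" 1 M] by (auto simp: unit_ball_def)
  then show "nrm scalar_space (f x) \<le> M" by simp
qed

lemma dual_lincomb_closed:
  assumes f: "f \<in> carrier (dual N)" and g: "g \<in> carrier (dual N)"
  shows "(\<lambda>x\<in>carrier N. a * f x + b * g x) \<in> carrier (dual N)"
proof -
  have "norm (a * f x + b * g x)
      \<le> (norm a * op_norm N scalar_space f + norm b * op_norm N scalar_space g) * nrm N x"
    if x: "x \<in> carrier N" for x
  proof -
    have "norm (a * f x + b * g x) \<le> norm a * norm (f x) + norm b * norm (g x)"
      by (metis norm_mult norm_triangle_ineq)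
    also have "\<dots> \<le> norm a * (op_norm N scalar_space f * nrm N x) + norm b * (op_norm N scalar_space g * nrm N x)"
      by (intro add_mono mult_left_mono norm_functional_le f g x) auto
    finally show ?thesis by (simp add: algebra_simps)
  qed
  then have "\<exists>C. \<forall>x\<in>carrier N. norm (a * f x + b * g x) \<le> C * nrm N x" by blast
  then show ?thesis unfolding in_carrier_dual_iff
    using functional_add[OF f] functional_add[OF g] functional_smult[OF f] functional_smult[OF g]
    by (simp add: add_closed[OF N] smult_closed[OF N] algebra_simps)
qed

lemma dual_add_closed: "f \<in> carrier (dual N) \<Longrightarrow> g \<in> carrier (dual N) \<Longrightarrow> (\<lambda>x\<in>carrier N. f x + g x) \<in> carrier (dual N)"
  using dual_lincomb_closed[of f g 1 1] by simp

lemma dual_zero_closed: "(\<lambda>x\<in>carrier N. 0) \<in> carrier (dual N)"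
proof -
  have "\<forall>x\<in>carrier N. norm (0 :: 'k) \<le> 0 * nrm N x" by simp
  then have "\<exists>C. \<forall>x\<in>carrier N. norm (0 :: 'k) \<le> C * nrm N x" ..
  then show ?thesis unfolding in_carrier_dual_iff by (simp add: add_closed[OF N] smult_closed[OF N])
qed

lemma dual_smult_closed: "f \<in> carrier (dual N) \<Longrightarrow> (\<lambda>x\<in>carrier N. c * f x) \<in> carrier (dual N)"
  using dual_lincomb_closed[of f f c 0] by simp

lemma dual_diff_closed: "f \<in> carrier (dual N) \<Longrightarrow> g \<in> carrier (dual N) \<Longrightarrow> (\<lambda>x\<in>carrier N. f x - g x) \<in> carrier (dual N)"
  using dual_lincomb_closed[of f g 1 "-1"] by simp

lemma abelian_group_dual: "abelian_group (dual N)"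
proof (rule abelian_groupI)
  fix f assume f: "f \<in> carrier (dual N)"
  show "\<exists>g\<in>carrier (dual N). g \<oplus>\<^bsub>dual N\<^esub> f = \<zero>\<^bsub>dual N\<^esub>"
    using dual_smult_closed[OF f, of "-1"] by (intro bexI) (auto simp: fun_eq_iff)
  show "\<zero>\<^bsub>dual N\<^esub> \<oplus>\<^bsub>dual N\<^esub> f = f"
    using functional_extensional[OF f] by (auto simp: fun_eq_iff extensional_def)
qed (auto simp: dual_add_closed dual_zero_closed fun_eq_iff)

lemma dual_minus:
  assumes "f \<in> carrier (dual N)" "g \<in> carrier (dual N)"
  shows "f \<ominus>\<^bsub>dual N\<^esub> g = (\<lambda>x\<in>carrier N. f x - g x)"
proof -
  interpret abelian_group "dual N" by (rule abelian_group_dual)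
  have "\<ominus>\<^bsub>dual N\<^esub> g = (\<lambda>x\<in>carrier N. (-1) * g x)"
    by (rule minus_equality) (use assms dual_smult_closed[of g "-1"] in \<open>auto simp: fun_eq_iff\<close>)
  then show ?thesis by (auto simp: a_minus_def fun_eq_iff)
qed

lemma ndist_dual:
  assumes "f \<in> carrier (dual N)" "g \<in> carrier (dual N)"
  shows "ndist (dual N) f g = op_norm N scalar_space (\<lambda>x\<in>carrier N. f x - g x)"
  using assms by (simp add: ndist_def dual_minus)

lemma ndist_dual_le_iff:
  assumes "f \<in> carrier (dual N)" "g \<in> carrier (dual N)"
  shows "ndist (dual N) f g \<le> M \<longleftrightarrow> (\<forall>x\<in>unit_ball N. norm (f x - g x) \<le> M)"
  using dual_norm_le_iff[OF dual_diff_closed[OF assms]] assms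
  by (simp add: ndist_dual unit_ball_def)

lemma less_ndist_dual_iff:
  assumes "f \<in> carrier (dual N)" "g \<in> carrier (dual N)"
  shows "M < ndist (dual N) f g \<longleftrightarrow> (\<exists>x\<in>unit_ball N. M < norm (f x - g x))"
  using ndist_dual_le_iff[OF assms, of M] by (meson not_le)

lemma norm_diff_le_ndist_dual:
  assumes "f \<in> carrier (dual N)" "g \<in> carrier (dual N)" "x \<in> unit_ball N"
  shows "norm (f x - g x) \<le> ndist (dual N) f g"
  using ndist_dual_le_iff[OF assms(1,2)] assms(3) by blast

text \<open>The form with a common base point \<open>f\<close> is the one that the derivation lemmas
  assume; it makes no appeal to symmetry.\<close>

lemma ndist_dual_triangle:
  assumes "f \<in> carrier (dual N)" "g \<in> carrier (dual N)" "h \<in> carrier (dual N)"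
  shows "ndist (dual N) g h \<le> ndist (dual N) f g + ndist (dual N) f h"
  unfolding ndist_dual_le_iff[OF assms(2,3)]
proof
  fix x assume x: "x \<in> unit_ball N"
  have "norm (g x - h x) \<le> norm (f x - g x) + norm (f x - h x)"
    using norm_triangle_ineq4[of "f x - h x" "f x - g x"] by simp
  then show "norm (g x - h x) \<le> ndist (dual N) f g + ndist (dual N) f h"
    using norm_diff_le_ndist_dual[OF assms(1,2) x] norm_diff_le_ndist_dual[OF assms(1,3) x] by linarith
qed

section \<open>The weak-star topology\<close>

lemma topspace_weak_star [simp]: "topspace (weak_star N) = carrier (dual N)"
  using functional_extensional by (auto simp: weak_star_def PiE_def)

lemma continuous_map_weak_star_eval:
  assumes "x \<in> carrier N"
  shows "continuous_map (weak_star N) euclidean (\<lambda>f. f x)"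
  unfolding weak_star_def
  by (intro continuous_map_from_subtopology continuous_map_product_projection assms)

lemma continuous_map_into_weak_star:
  assumes "\<And>z. z \<in> topspace Z \<Longrightarrow> \<phi> z \<in> carrier (dual N)"
    and "\<And>x. x \<in> carrier N \<Longrightarrow> continuous_map Z euclidean (\<lambda>z. \<phi> z x)"
  shows "continuous_map Z (weak_star N) \<phi>"
  unfolding weak_star_def continuous_map_in_subtopology continuous_map_componentwise
  using assms functional_extensional by auto

lemma Hausdorff_space_weak_star: "Hausdorff_space (weak_star N)"
  unfolding weak_star_def
  by (intro Hausdorff_space_subtopology) (simp add: Hausdorff_space_product_topology)

text \<open>Lower semicontinuity, the dual norm being a supremum of weak-star continuous functions.
  It supplies the neighbourhoods on which coordinate norms stay above given weights.\<close>

lemma openin_weak_star_dual_norm: "openin (weak_star N) {f \<in> carrier (dual N). s < op_norm N scalar_space f}"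
proof -
  have "{f \<in> carrier (dual N). s < op_norm N scalar_space f}
      = (\<Union>x\<in>unit_ball N. {f \<in> topspace (weak_star N). f x \<in> {c. s < norm c}})"
    using dual_norm_le_iff by (auto simp: not_le[symmetric])
  moreover have "openin (weak_star N) {f \<in> topspace (weak_star N). f x \<in> {c. s < norm c}}"
    if "x \<in> unit_ball N" for x
  proof (rule openin_continuous_map_preimage[OF continuous_map_weak_star_eval])
    show "x \<in> carrier N" using that by (simp add: unit_ball_def)
    show "openin euclidean {c :: 'k. s < norm c}"
      by (simp add: open_Collect_less continuous_on_norm)
  qed
  ultimately show ?thesis by auto
qed

text \<open>The ball is the intersection of a product of compact balls with the closed conditions of
  additivity and homogeneity. Functionals being undefined off the carrier, this is an equality of
  sets of functions.\<close>

theorem Banach_Alaoglu: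
  assumes "0 \<le> r"
  shows "compactin (weak_star N) {f \<in> carrier (dual N). op_norm N scalar_space f \<le> r}"
proof -
  let ?P = "product_topology (\<lambda>_. euclidean :: 'k topology) (carrier N)"
  let ?K = "PiE (carrier N) (\<lambda>x. cball (0 :: 'k) (r * nrm N x))"
  have cont: "continuous_map ?P euclidean (\<lambda>f. f x)" if "x \<in> carrier N" for x
    using that by (rule continuous_map_product_projection)
  have add: "closedin ?P {f \<in> topspace ?P. f (x \<oplus>\<^bsub>N\<^esub> y) - (f x + f y) \<in> {0}}"
    if "x \<in> carrier N" "y \<in> carrier N" for x y
    by (rule closedin_continuous_map_preimage[where Y = euclidean])
      (use that in \<open>auto intro!: continuous_map_diff continuous_map_add cont add_closed[OF N]\<close>)
  have smult: "closedin ?P {f \<in> topspace ?P. f (c \<odot>\<^bsub>N\<^esub> x) - c * f x \<in> {0}}"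
    if "x \<in> carrier N" for x c
    by (rule closedin_continuous_map_preimage[where Y = euclidean])
      (use that in \<open>auto intro!: continuous_map_diff continuous_map_compose[OF cont, unfolded o_def, where g = "\<lambda>z. c * z"]
        continuous_intros cont smult_closed[OF N]\<close>)
  let ?L = "(\<Inter>x\<in>carrier N. \<Inter>y\<in>carrier N. {f \<in> topspace ?P. f (x \<oplus>\<^bsub>N\<^esub> y) - (f x + f y) \<in> {0}}) \<inter>
    (\<Inter>c. \<Inter>x\<in>carrier N. {f \<in> topspace ?P. f (c \<odot>\<^bsub>N\<^esub> x) - c * f x \<in> {0}})"
  have ne: "carrier N \<noteq> {}" using zero_closed[OF N] by auto
  have "closedin ?P ?L"
    using ne by (intro closedin_Int closedin_INT add smult) auto
  moreover have "compactin ?P ?K" by (simp add: compactin_PiE)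
  ultimately have KL: "compactin ?P (?K \<inter> ?L)" by (rule compact_Int_closedin[rotated])
  have eq: "{f \<in> carrier (dual N). op_norm N scalar_space f \<le> r} = ?K \<inter> ?L"
  proof (intro subset_antisym subsetI)
    fix f assume "f \<in> {f \<in> carrier (dual N). op_norm N scalar_space f \<le> r}"
    then have f: "f \<in> carrier (dual N)" "op_norm N scalar_space f \<le> r" by auto
    have "norm (f x) \<le> r * nrm N x" if "x \<in> carrier N" for x
      using norm_functional_le[OF f(1) that] mult_right_mono[OF f(2) nrm_nonneg[OF N that]] by linarith
    then show "f \<in> ?K \<inter> ?L"
      using functional_add[OF f(1)] functional_smult[OF f(1)] functional_extensional[OF f(1)]
      by (auto simp: PiE_iff)
  next
    fix f assume f: "f \<in> ?K \<inter> ?L"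
    then have K: "f \<in> extensional (carrier N)" "\<And>x. x \<in> carrier N \<Longrightarrow> norm (f x) \<le> r * nrm N x"
      by (auto simp: PiE_iff)
    have "f (x \<oplus>\<^bsub>N\<^esub> y) - (f x + f y) = 0" if "x \<in> carrier N" "y \<in> carrier N" for x y
      using f that by auto
    moreover have "f (c \<odot>\<^bsub>N\<^esub> x) - c * f x = 0" if "x \<in> carrier N" for c x
      using f that by auto
    moreover have "\<exists>C. \<forall>x\<in>carrier N. norm (f x) \<le> C * nrm N x" using K(2) by auto
    ultimately have fd: "f \<in> carrier (dual N)" using K(1) unfolding in_carrier_dual_iff by simp
    have "op_norm N scalar_space f \<le> r" using \<open>0 \<le> r\<close> K(2) by (rule dual_norm_leI)
    then show "f \<in> {f \<in> carrier (dual N). op_norm N scalar_space f \<le> r}" using fd by simp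
  qed
  have "?K \<inter> ?L \<subseteq> carrier (dual N)" unfolding eq[symmetric] by auto
  with KL show ?thesis unfolding eq weak_star_def by (simp add: compactin_subtopology)
qed

end

section \<open>Families of nonnegative reals\<close>

text \<open>The value 1 for \<open>p = 0\<close> reflects that the dual of a c_0-sum is an
  ell_1-sum.\<close>

definition conj_exp :: "real \<Rightarrow> real" where
  "conj_exp p = (if p = 0 then 1 else p / (p - 1))"

text \<open>A norm bound through finite partial sums, which makes sense before membership of the
  family in the space is known. For \<open>1 < p\<close> it implies membership; for
  \<open>p = 0\<close> it is a bound on the supremum only.\<close>

definition lp_le :: "real \<Rightarrow> 'i set \<Rightarrow> ('i \<Rightarrow> real) \<Rightarrow> real \<Rightarrow> bool" where
  "lp_le p I a M \<longleftrightarrow> (if p = 0 then \<forall>i\<in>I. a i \<le> M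
     else \<forall>G. finite G \<and> G \<subseteq> I \<longrightarrow> (\<Sum>i\<in>G. a i powr p) \<le> M powr p)"

definition lp_family :: "real \<Rightarrow> 'i set \<Rightarrow> ('i \<Rightarrow> real) \<Rightarrow> bool" where
  "lp_family p I a \<longleftrightarrow> (if p = 0 then \<forall>e>0. finite {i \<in> I. a i \<ge> e}
     else (\<lambda>i. a i powr p) summable_on I)"

definition lp_norm :: "real \<Rightarrow> 'i set \<Rightarrow> ('i \<Rightarrow> real) \<Rightarrow> real" where
  "lp_norm p I a = (if p = 0 then (SUP i\<in>I. a i) else (\<Sum>\<^sub>\<infinity>i\<in>I. a i powr p) powr (1 / p))"

lemma powr_convex_nonneg:
  fixes x y t p :: real
  assumes "1 < p" "0 \<le> t" "t \<le> 1" "0 \<le> x" "0 \<le> y"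
  shows "(t * x + (1 - t) * y) powr p \<le> t * x powr p + (1 - t) * y powr p"
proof -
  \<comment> \<open>Convexity is applied on the open half-line; when \<open>x\<close> or
    \<open>y\<close> is 0, the claim reduces to this estimate.\<close>
  have le: "(s * z) powr p \<le> s * z powr p" if "0 \<le> s" "s \<le> 1" "0 \<le> z" for s z :: real
  proof -
    have "s powr p \<le> s"
    proof (cases "s = 0")
      case False
      then have "s powr p \<le> s powr 1" using that assms(1) by (intro powr_mono') auto
      then show ?thesis using False that by simp
    qed simp
    then show ?thesis using that by (simp add: powr_mult mult_right_mono)
  qed
  show ?thesis
  proof (cases "x = 0 \<or> y = 0")
    case True
    then show ?thesis using le[of t x] le[of "1 - t" y] assms by auto
  next
    case False
    then have xy: "0 < x" "0 < y" using assms by auto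
    have "convex_on {0<..} (\<lambda>x. x powr p)" using assms(1) by (intro powr_convex) simp
    from convex_onD[OF this, of "1 - t" x y] show ?thesis using xy assms by simp
  qed
qed

lemma lp_le_zero_imp:
  assumes "lp_le p I a 0" "p = 0 \<or> 1 < p" "i \<in> I" "0 \<le> a i"
  shows "a i = 0"
proof (cases "p = 0")
  case True
  then show ?thesis using assms by (auto simp: lp_le_def)
next
  case False
  then have "(\<Sum>i\<in>{i}. a i powr p) \<le> 0 powr p"
    using assms(1,3) unfolding lp_le_def by (metis empty_subsetI finite.emptyI finite.insertI insert_subset)
  then have "a i powr p \<le> 0" using False by simp
  then show ?thesis by (simp add: not_less[symmetric])
qed

lemma lp_le_mono:
  assumes "lp_le p I a M" "J \<subseteq> I" "M \<le> N" "0 \<le> M" "p = 0 \<or> 1 < p"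
    and "\<And>i. i \<in> J \<Longrightarrow> 0 \<le> b i" "\<And>i. i \<in> J \<Longrightarrow> b i \<le> a i"
  shows "lp_le p J b N"
proof (cases "p = 0")
  case True
  have "b i \<le> N" if "i \<in> J" for i
  proof -
    have "a i \<le> M" using assms(1,2) that True by (auto simp: lp_le_def)
    then show ?thesis using assms(7)[OF that] assms(3) by linarith
  qed
  then show ?thesis using True by (simp add: lp_le_def)
next
  case False
  have "(\<Sum>i\<in>G. b i powr p) \<le> N powr p" if G: "finite G" "G \<subseteq> J" for G
  proof -
    have "(\<Sum>i\<in>G. b i powr p) \<le> (\<Sum>i\<in>G. a i powr p)"
      using assms(5-7) G(2) False by (intro sum_mono powr_mono2) auto
    also have "\<dots> \<le> M powr p" using assms(1,2) G False by (simp add: lp_le_def)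
    also have "\<dots> \<le> N powr p" using assms(3-5) False by (intro powr_mono2) auto
    finally show ?thesis .
  qed
  then show ?thesis using False by (simp add: lp_le_def)
qed

lemma lp_le_cmult:
  assumes "lp_le p I a M" "0 \<le> c" "0 \<le> M" "p = 0 \<or> 1 < p" "\<And>i. i \<in> I \<Longrightarrow> 0 \<le> a i"
  shows "lp_le p I (\<lambda>i. c * a i) (c * M)"
proof (cases "p = 0")
  case True
  then show ?thesis using assms by (auto simp: lp_le_def intro: mult_left_mono)
next
  case False
  have "(\<Sum>i\<in>G. (c * a i) powr p) \<le> (c * M) powr p" if G: "finite G" "G \<subseteq> I" for G
  proof -
    have "(\<Sum>i\<in>G. (c * a i) powr p) = (\<Sum>i\<in>G. c powr p * a i powr p)"
      using G(2) assms by (intro sum.cong) (auto simp: powr_mult)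
    also have "\<dots> = c powr p * (\<Sum>i\<in>G. a i powr p)" by (simp add: sum_distrib_left)
    also have "\<dots> \<le> c powr p * M powr p"
      using assms(1) G False by (intro mult_left_mono) (auto simp: lp_le_def)
    also have "\<dots> = (c * M) powr p" using assms by (simp add: powr_mult)
    finally show ?thesis .
  qed
  then show ?thesis using False by (simp add: lp_le_def)
qed

text \<open>Minkowski's inequality from convexity: \<open>(a i + b i) / (M + N)\<close> is the
  convex combination of \<open>a i / M\<close> and \<open>b i / N\<close> with weight
  \<open>M / (M + N)\<close> on the former.\<close>

lemma lp_le_add:
  assumes a: "lp_le p I a M" and b: "lp_le p I b N" and p: "p = 0 \<or> 1 < p" and MN: "0 \<le> M" "0 \<le> N"
    and nonneg: "\<And>i. i \<in> I \<Longrightarrow> 0 \<le> a i" "\<And>i. i \<in> I \<Longrightarrow> 0 \<le> b i"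
  shows "lp_le p I (\<lambda>i. a i + b i) (M + N)"
proof (cases "p = 0")
  case True
  then show ?thesis using a b by (auto simp: lp_le_def intro: add_mono)
next
  case False
  then have p: "1 < p" using p by simp
  consider "M = 0" | "N = 0" | "0 < M" "0 < N" using MN by linarith
  then show ?thesis
  proof cases
    case 1
    then have "a i = 0" if "i \<in> I" for i using lp_le_zero_imp[of p I a i] a p that nonneg by simp
    then show ?thesis using 1 MN by (intro lp_le_mono[OF b]) (use p nonneg in auto)
  next
    case 2
    then have "b i = 0" if "i \<in> I" for i using lp_le_zero_imp[of p I b i] b p that nonneg by simp
    then show ?thesis using 2 MN by (intro lp_le_mono[OF a]) (use p nonneg in auto)
  next
    case 3
    let ?t = "M / (M + N)"
    have t: "0 \<le> ?t" "?t \<le> 1" "1 - ?t = N / (M + N)" using 3 by (auto simp: field_simps)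
    have "(\<Sum>i\<in>G. (a i + b i) powr p) \<le> (M + N) powr p" if G: "finite G" "G \<subseteq> I" for G
    proof -
      have "(\<Sum>i\<in>G. (a i + b i) powr p)
        = (\<Sum>i\<in>G. (M + N) powr p * (?t * (a i / M) + (1 - ?t) * (b i / N)) powr p)"
      proof (rule sum.cong[OF refl])
        fix i assume "i \<in> G"
        then have "0 \<le> a i" "0 \<le> b i" using G nonneg by auto
        then have "0 \<le> ?t * (a i / M) + (1 - ?t) * (b i / N)" using t 3 by (intro add_nonneg_nonneg mult_nonneg_nonneg) auto
        moreover have "(M + N) * (?t * (a i / M) + (1 - ?t) * (b i / N)) = a i + b i"
          unfolding t(3) using 3 by (simp add: distrib_left)
        ultimately show "(a i + b i) powr p = (M + N) powr p * (?t * (a i / M) + (1 - ?t) * (b i / N)) powr p"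
          using 3 by (metis add_nonneg_nonneg less_imp_le powr_mult)
      qed
      also have "\<dots> = (M + N) powr p * (\<Sum>i\<in>G. (?t * (a i / M) + (1 - ?t) * (b i / N)) powr p)"
        by (simp add: sum_distrib_left)
      also have "\<dots> \<le> (M + N) powr p * (\<Sum>i\<in>G. ?t * (a i / M) powr p + (1 - ?t) * (b i / N) powr p)"
        using p t 3 nonneg G(2) by (intro mult_left_mono sum_mono powr_convex_nonneg) auto
      also have "(\<Sum>i\<in>G. ?t * (a i / M) powr p + (1 - ?t) * (b i / N) powr p)
        = ?t * ((\<Sum>i\<in>G. a i powr p) / M powr p) + (1 - ?t) * ((\<Sum>i\<in>G. b i powr p) / N powr p)"
        unfolding sum.distrib sum_distrib_left[symmetric] sum_divide_distrib
        using G(2) nonneg 3 by (intro arg_cong2[where f = "(+)"] arg_cong2[where f = "(*)"] refl sum.cong)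
          (auto simp: powr_divide)
      also have "\<dots> \<le> ?t * 1 + (1 - ?t) * 1"
        using a b G p 3 t by (intro add_mono mult_left_mono) (auto simp: lp_le_def)
      finally show ?thesis by (simp add: mult_left_mono)
    qed
    then show ?thesis using p by (simp add: lp_le_def)
  qed
qed

lemma conj_exp:
  assumes "p = 0 \<or> 1 < p"
  shows "1 \<le> conj_exp p" "1 < p \<Longrightarrow> 1 < conj_exp p" "1 < p \<Longrightarrow> 1 / p + 1 / conj_exp p = 1"
    "1 < p \<Longrightarrow> (conj_exp p - 1) * p = conj_exp p"
  using assms by (auto simp: conj_exp_def field_simps)

text \<open>Young's inequality for the normalised terms \<open>a i / M\<close> and
  \<open>b i / N\<close>, summed over \<open>G\<close>; for \<open>p = 0\<close> a supremum meets a
  sum directly.\<close>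

lemma Holder_finite:
  assumes p: "p = 0 \<or> 1 < p" and G: "finite G" and a: "lp_le p G a M"
    and b: "(\<Sum>i\<in>G. b i powr conj_exp p) \<le> N powr conj_exp p"
    and MN: "0 \<le> M" "0 \<le> N" and nonneg: "\<And>i. i \<in> G \<Longrightarrow> 0 \<le> a i" "\<And>i. i \<in> G \<Longrightarrow> 0 \<le> b i"
  shows "(\<Sum>i\<in>G. a i * b i) \<le> M * N"
proof (cases "p = 0")
  case True
  then have "(\<Sum>i\<in>G. b i powr 1) \<le> N powr 1" using b by (simp add: conj_exp_def)
  moreover have "(\<Sum>i\<in>G. b i powr 1) = (\<Sum>i\<in>G. b i)" using nonneg by (intro sum.cong) auto
  ultimately have bN: "(\<Sum>i\<in>G. b i) \<le> N" using MN by simp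
  have "(\<Sum>i\<in>G. a i * b i) \<le> (\<Sum>i\<in>G. M * b i)"
    using a True nonneg by (intro sum_mono mult_right_mono) (auto simp: lp_le_def)
  also have "\<dots> = M * (\<Sum>i\<in>G. b i)" by (simp add: sum_distrib_left)
  also have "\<dots> \<le> M * N" using bN MN by (intro mult_left_mono)
  finally show ?thesis .
next
  case False
  then have p: "1 < p" using p by simp
  let ?q = "conj_exp p"
  note q = conj_exp[of p]
  show ?thesis
  proof (cases "M = 0 \<or> N = 0")
    case True
    have "a i * b i = 0" if "i \<in> G" for i
    proof (cases "M = 0")
      case True
      then show ?thesis using lp_le_zero_imp[of p G a i] a p that nonneg by simp
    next
      case False
      then have "N = 0" using True by simp
      then have "(\<Sum>i\<in>G. b i powr ?q) \<le> 0" using b by simp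
      moreover have "b i powr ?q \<le> (\<Sum>i\<in>G. b i powr ?q)" using G that by (intro member_le_sum) auto
      ultimately have "b i powr ?q \<le> 0" by linarith
      then show ?thesis by (simp add: not_less[symmetric])
    qed
    then have "(\<Sum>i\<in>G. a i * b i) = 0" by (intro sum.neutral) simp
    then show ?thesis using MN by simp
  next
    case False
    then have MN: "0 < M" "0 < N" using MN by auto
    have aM: "(\<Sum>i\<in>G. a i powr p) / M powr p \<le> 1" using a G p MN by (simp add: lp_le_def)
    have bN: "(\<Sum>i\<in>G. b i powr ?q) / N powr ?q \<le> 1" using b MN by simp
    have "(\<Sum>i\<in>G. (a i / M) * (b i / N)) \<le> (\<Sum>i\<in>G. (a i / M) powr p / p + (b i / N) powr ?q / ?q)"
      using p q nonneg MN by (intro sum_mono Youngs_inequality) auto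
    also have "\<dots> = (\<Sum>i\<in>G. a i powr p) / M powr p / p + (\<Sum>i\<in>G. b i powr ?q) / N powr ?q / ?q"
      unfolding sum.distrib sum_divide_distrib
      using nonneg MN by (intro arg_cong2[where f = "(+)"] sum.cong refl) (auto simp: powr_divide)
    also have "\<dots> \<le> 1 / p + 1 / ?q"
      using aM bN p q by (intro add_mono divide_right_mono) auto
    also have "\<dots> = 1" using q p by simp
    finally have "(\<Sum>i\<in>G. a i * b i) / (M * N) \<le> 1"
      by (simp add: sum_divide_distrib)
    then show ?thesis using MN by simp
  qed
qed

lemma lp_family_bounded:
  assumes "lp_family p I a" "p = 0 \<or> 1 < p" "\<And>i. i \<in> I \<Longrightarrow> 0 \<le> a i"
  obtains M where "0 \<le> M" "lp_le p I a M"
proof (cases "p = 0")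
  case True
  let ?F = "{i \<in> I. a i \<ge> 1}"
  have "finite ?F" using assms(1) True by (simp add: lp_family_def)
  then have fin: "finite (insert 1 (a ` ?F))" by simp
  have one: "1 \<le> Max (insert 1 (a ` ?F))" by (rule Max_ge[OF fin]) simp
  have "a i \<le> Max (insert 1 (a ` ?F))" if "i \<in> I" for i
  proof (cases "a i \<ge> 1")
    case True
    then show ?thesis using that by (intro Max_ge[OF fin]) simp
  next
    case False
    then show ?thesis using one by linarith
  qed
  then show ?thesis using one True by (intro that[of "Max (insert 1 (a ` ?F))"]) (auto simp: lp_le_def)
next
  case False
  then have p: "1 < p" using assms by simp
  have s: "(\<lambda>i. a i powr p) summable_on I" using assms(1) False by (simp add: lp_family_def)
  let ?S = "(\<Sum>\<^sub>\<infinity>i\<in>I. a i powr p)"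
  have "0 \<le> ?S" by (rule infsum_nonneg) simp
  then have "(?S powr (1 / p)) powr p = ?S" using p by (simp add: powr_powr)
  then have "lp_le p I a (?S powr (1 / p))"
    using finite_sum_le_infsum[OF s] p by (simp add: lp_le_def)
  then show ?thesis by (rule that[rotated]) simp
qed

lemma lp_le_imp_lp_family:
  assumes "lp_le p I a M" "1 < p"
  shows "lp_family p I a"
proof -
  have "(\<lambda>i. a i powr p) summable_on I"
    by (rule nonneg_bdd_above_summable_on)
      (use assms in \<open>auto intro!: bdd_aboveI[of _ "M powr p"] simp: lp_le_def\<close>)
  then show ?thesis using assms(2) by (simp add: lp_family_def)
qed

text \<open>Through this equivalence, norm inequalities in direct sums are proved on finite partial
  sums.\<close>

lemma lp_norm_le_iff:
  assumes "lp_family p I a" "p = 0 \<or> 1 < p" "\<And>i. i \<in> I \<Longrightarrow> 0 \<le> a i" "I \<noteq> {}" "0 \<le> M"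
  shows "lp_norm p I a \<le> M \<longleftrightarrow> lp_le p I a M"
proof (cases "p = 0")
  case True
  obtain B where "0 \<le> B" "lp_le p I a B" by (rule lp_family_bounded[OF assms(1-3)])
  then have "bdd_above (a ` I)" using True by (auto simp: lp_le_def intro!: bdd_aboveI[of _ B])
  then show ?thesis using True assms(4) by (simp add: lp_norm_def lp_le_def cSUP_le_iff)
next
  case False
  then have p: "1 < p" using assms by simp
  have s: "(\<lambda>i. a i powr p) summable_on I" using assms(1) False by (simp add: lp_family_def)
  let ?S = "(\<Sum>\<^sub>\<infinity>i\<in>I. a i powr p)"
  have S: "0 \<le> ?S" by (rule infsum_nonneg) simp
  have "?S powr (1 / p) \<le> M \<longleftrightarrow> ?S \<le> M powr p"
  proof
    assume "?S powr (1 / p) \<le> M"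
    then have "(?S powr (1 / p)) powr p \<le> M powr p" using p by (intro powr_mono2) auto
    then show "?S \<le> M powr p" using S p by (simp add: powr_powr)
  next
    assume "?S \<le> M powr p"
    then have "?S powr (1 / p) \<le> (M powr p) powr (1 / p)" using p S by (intro powr_mono2) auto
    then show "?S powr (1 / p) \<le> M" using assms(5) p by (simp add: powr_powr)
  qed
  also have "?S \<le> M powr p \<longleftrightarrow> (\<forall>G. finite G \<and> G \<subseteq> I \<longrightarrow> (\<Sum>i\<in>G. a i powr p) \<le> M powr p)"
    using infsum_le_finite_sums[OF s, of "M powr p"] finite_sum_le_infsum[OF s]
    by (auto intro: order_trans)
  finally show ?thesis using p by (simp add: lp_norm_def lp_le_def)
qed

lemma lp_norm_nonneg:
  assumes "lp_family p I a" "p = 0 \<or> 1 < p" "\<And>i. i \<in> I \<Longrightarrow> 0 \<le> a i" "I \<noteq> {}"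
  shows "0 \<le> lp_norm p I a"
proof (cases "p = 0")
  case True
  obtain B where "0 \<le> B" "lp_le p I a B" by (rule lp_family_bounded[OF assms(1-3)])
  then have bdd: "bdd_above (a ` I)" using True by (auto simp: lp_le_def intro!: bdd_aboveI[of _ B])
  obtain i where "i \<in> I" using assms(4) by auto
  then have "0 \<le> (SUP i\<in>I. a i)" using assms(3) by (intro cSUP_upper2[OF bdd])
  then show ?thesis using True by (simp add: lp_norm_def)
qed (simp add: lp_norm_def)

text \<open>Takes the place of density of finitely supported vectors when a functional is recovered
  from its components.\<close>

lemma lp_family_tail:
  assumes "lp_family p I a" "p = 0 \<or> 1 < p" "\<And>i. i \<in> I \<Longrightarrow> 0 \<le> a i" "0 < (e :: real)"
  obtains G where "finite G" "G \<subseteq> I" "lp_le p (I - G) a e"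
proof (cases "p = 0")
  case True
  have "finite {i \<in> I. a i \<ge> e}" using assms True by (simp add: lp_family_def)
  moreover have "lp_le p (I - {i \<in> I. a i \<ge> e}) a e" using True by (auto simp: lp_le_def)
  ultimately show ?thesis using that[of "{i \<in> I. a i \<ge> e}"] by auto
next
  case False
  then have p: "1 < p" using assms by simp
  have s: "(\<lambda>i. a i powr p) summable_on I" using assms(1) False by (simp add: lp_family_def)
  let ?S = "(\<Sum>\<^sub>\<infinity>i\<in>I. a i powr p)"
  have "\<exists>F. finite F \<and> F \<subseteq> I \<and> ?S - e powr p < (\<Sum>i\<in>F. a i powr p)"
  proof (rule ccontr)
    assume "\<not> ?thesis"
    then have "?S \<le> ?S - e powr p" by (intro infsum_le_finite_sums s) (auto simp: not_less)
    then show False using assms(4) by simp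
  qed
  then obtain F where F: "finite F" "F \<subseteq> I" "?S - e powr p < (\<Sum>i\<in>F. a i powr p)" by auto
  have "(\<Sum>i\<in>G. a i powr p) \<le> e powr p" if G: "finite G" "G \<subseteq> I - F" for G
  proof -
    have "(\<Sum>i\<in>F. a i powr p) + (\<Sum>i\<in>G. a i powr p) = (\<Sum>i\<in>F \<union> G. a i powr p)"
      using F G by (intro sum.union_disjoint[symmetric]) auto
    also have "\<dots> \<le> ?S" using F G by (intro finite_sum_le_infsum s) auto
    finally show ?thesis using F(3) by linarith
  qed
  then show ?thesis using that[OF F(1,2)] p by (simp add: lp_le_def)
qed

lemma lp_family_mono:
  assumes "lp_family p I a" "p = 0 \<or> 1 < p"
    and "\<And>i. i \<in> I \<Longrightarrow> 0 \<le> b i" "\<And>i. i \<in> I \<Longrightarrow> b i \<le> a i"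
  shows "lp_family p I b"
proof (cases "p = 0")
  case True
  have "finite {i \<in> I. b i \<ge> e}" if "0 < e" for e :: real
  proof (rule finite_subset)
    show "{i \<in> I. b i \<ge> e} \<subseteq> {i \<in> I. a i \<ge> e}" using assms(4) by force
    show "finite {i \<in> I. a i \<ge> e}" using assms(1) True that by (simp add: lp_family_def)
  qed
  then show ?thesis using True by (simp add: lp_family_def)
next
  case False
  then have p: "1 < p" using assms by simp
  have nonneg: "0 \<le> a i" if "i \<in> I" for i using assms(3,4)[OF that] by linarith
  obtain M where M: "0 \<le> M" "lp_le p I a M" by (rule lp_family_bounded[OF assms(1,2) nonneg])
  have "lp_le p I b M" by (rule lp_le_mono[OF M(2) subset_refl order_refl M(1) assms(2-4)])
  then show ?thesis using p by (rule lp_le_imp_lp_family)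
qed

lemma lp_family_add:
  assumes "lp_family p I a" "lp_family p I b" "p = 0 \<or> 1 < p"
    and "\<And>i. i \<in> I \<Longrightarrow> 0 \<le> a i" "\<And>i. i \<in> I \<Longrightarrow> 0 \<le> b i"
  shows "lp_family p I (\<lambda>i. a i + b i)"
proof (cases "p = 0")
  case True
  have "finite {i \<in> I. a i + b i \<ge> e}" if "0 < e" for e :: real
  proof (rule finite_subset)
    show "{i \<in> I. a i + b i \<ge> e} \<subseteq> {i \<in> I. a i \<ge> e / 2} \<union> {i \<in> I. b i \<ge> e / 2}" by auto
    have "finite {i \<in> I. a i \<ge> e / 2}" "finite {i \<in> I. b i \<ge> e / 2}"
      using assms(1,2) True half_gt_zero[OF that] unfolding lp_family_def by metis+
    then show "finite ({i \<in> I. a i \<ge> e / 2} \<union> {i \<in> I. b i \<ge> e / 2})" by (rule finite_UnI)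
  qed
  then show ?thesis using True by (simp add: lp_family_def)
next
  case False
  then have p: "1 < p" using assms by simp
  obtain M where M: "0 \<le> M" "lp_le p I a M" by (rule lp_family_bounded[OF assms(1,3,4)])
  obtain N where N: "0 \<le> N" "lp_le p I b N" by (rule lp_family_bounded[OF assms(2,3,5)])
  have "lp_le p I (\<lambda>i. a i + b i) (M + N)" by (rule lp_le_add[OF M(2) N(2) assms(3) M(1) N(1) assms(4,5)])
  then show ?thesis using p by (rule lp_le_imp_lp_family)
qed

lemma lp_family_cmult:
  assumes "lp_family p I a" "0 \<le> c" "p = 0 \<or> 1 < p" "\<And>i. i \<in> I \<Longrightarrow> 0 \<le> a i"
  shows "lp_family p I (\<lambda>i. c * a i)"
proof (cases "p = 0")
  case True
  have "finite {i \<in> I. c * a i \<ge> e}" if e: "0 < e" for e :: real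
  proof (rule finite_subset)
    \<comment> \<open>Dividing by \<open>c + 1\<close> instead of \<open>c\<close> covers
      \<open>c = 0\<close>.\<close>
    show "{i \<in> I. c * a i \<ge> e} \<subseteq> {i \<in> I. a i \<ge> e / (c + 1)}"
    proof safe
      fix i assume i: "i \<in> I" "c * a i \<ge> e"
      have "c * a i \<le> (c + 1) * a i" using assms(4)[OF i(1)] by (simp add: distrib_right)
      then show "a i \<ge> e / (c + 1)" using i(2) assms(2) by (simp add: divide_le_eq mult.commute)
    qed
    show "finite {i \<in> I. a i \<ge> e / (c + 1)}" using assms(1,2) True e by (simp add: lp_family_def)
  qed
  then show ?thesis using True by (simp add: lp_family_def)
next
  case False
  then have p: "1 < p" using assms by simp
  obtain M where M: "0 \<le> M" "lp_le p I a M" by (rule lp_family_bounded[OF assms(1,3,4)])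
  have "lp_le p I (\<lambda>i. c * a i) (c * M)" by (rule lp_le_cmult[OF M(2) assms(2) M(1) assms(3,4)])
  then show ?thesis using p by (rule lp_le_imp_lp_family)
qed

lemma lp_family_finite_support:
  assumes "finite G" "\<And>i. i \<in> I - G \<Longrightarrow> a i = 0" "p = 0 \<or> 1 < p"
  shows "lp_family p I a"
proof (cases "p = 0")
  case True
  have "finite {i \<in> I. a i \<ge> e}" if e: "0 < e" for e :: real
    by (rule finite_subset[OF _ assms(1)]) (use assms(2) e in force)
  then show ?thesis using True by (simp add: lp_family_def)
next
  case False
  then have p: "1 < p" using assms by simp
  have "(\<lambda>i. a i powr p) summable_on (I \<inter> G)" using assms(1) by simp
  also have "?this \<longleftrightarrow> (\<lambda>i. a i powr p) summable_on I"
    by (rule summable_on_cong_neutral) (use assms(2) in auto)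
  finally show ?thesis using p by (simp add: lp_family_def)
qed

section \<open>Direct sums and their functionals\<close>

lemma lp_le_restrict:
  assumes "lp_le p (I \<inter> G) a M" "0 \<le> M" "p = 0 \<or> 1 < p"
  shows "lp_le p I (\<lambda>i. if i \<in> G then a i else 0) M"
proof (cases "p = 0")
  case True
  then show ?thesis using assms by (simp add: lp_le_def)
next
  case False
  have "(\<Sum>i\<in>H. (if i \<in> G then a i else 0) powr p) \<le> M powr p" if H: "finite H" "H \<subseteq> I" for H
  proof -
    have "(\<Sum>i\<in>H. (if i \<in> G then a i else 0) powr p) = (\<Sum>i\<in>H. if i \<in> G then a i powr p else 0)"
      by (intro sum.cong) auto
    also have "\<dots> = (\<Sum>i\<in>H \<inter> G. a i powr p)" using H by (simp add: sum.inter_restrict)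
    also have "\<dots> \<le> M powr p"
    proof -
      have "finite (H \<inter> G)" "H \<inter> G \<subseteq> I \<inter> G" using H by auto
      then show ?thesis using assms(1) False by (simp add: lp_le_def)
    qed
    finally show ?thesis .
  qed
  then show ?thesis using False by (simp add: lp_le_def)
qed

locale normed_family =
  fixes p :: real and \<Lambda> :: "'i set" and E :: "'i \<Rightarrow> ('k::{real_normed_field, euclidean_space}, 'a) nspace"
  assumes nonempty: "\<Lambda> \<noteq> {}" and p: "p = 0 \<or> 1 < p"
    and normed: "\<And>l. l \<in> \<Lambda> \<Longrightarrow> normed_space (E l)"
begin

abbreviation S :: "('k, 'i \<Rightarrow> 'a) nspace" where
  "S \<equiv> direct_sum p \<Lambda> E"

section \<open>The direct sum as a normed space\<close>

lemma in_S_iff: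
  "x \<in> carrier S \<longleftrightarrow> x \<in> extensional \<Lambda> \<and> (\<forall>l\<in>\<Lambda>. x l \<in> carrier (E l)) \<and>
    lp_family p \<Lambda> (\<lambda>l. nrm (E l) (x l))"
  by (auto simp: direct_sum_def lp_family_def PiE_iff)

lemma S_simps [simp]:
  "\<zero>\<^bsub>S\<^esub> = (\<lambda>l\<in>\<Lambda>. \<zero>\<^bsub>E l\<^esub>)"
  "x \<oplus>\<^bsub>S\<^esub> y = (\<lambda>l\<in>\<Lambda>. x l \<oplus>\<^bsub>E l\<^esub> y l)"
  "c \<odot>\<^bsub>S\<^esub> x = (\<lambda>l\<in>\<Lambda>. c \<odot>\<^bsub>E l\<^esub> x l)"
  by (simp_all add: direct_sum_def)

lemma nrm_S: "nrm S x = lp_norm p \<Lambda> (\<lambda>l. nrm (E l) (x l))"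
  by (simp add: direct_sum_def lp_norm_def)

lemma
  assumes "x \<in> carrier S"
  shows S_extensional: "x \<in> extensional \<Lambda>"
    and S_coord: "l \<in> \<Lambda> \<Longrightarrow> x l \<in> carrier (E l)"
    and S_lp_family: "lp_family p \<Lambda> (\<lambda>l. nrm (E l) (x l))"
    and S_coord_nonneg: "l \<in> \<Lambda> \<Longrightarrow> 0 \<le> nrm (E l) (x l)"
  using assms nrm_nonneg[OF normed] by (auto simp: in_S_iff)

lemma nrm_S_le_iff:
  "x \<in> carrier S \<Longrightarrow> 0 \<le> M \<Longrightarrow> nrm S x \<le> M \<longleftrightarrow> lp_le p \<Lambda> (\<lambda>l. nrm (E l) (x l)) M"
  unfolding nrm_S by (intro lp_norm_le_iff S_lp_family S_coord_nonneg p nonempty)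

lemma nrm_S_nonneg: "x \<in> carrier S \<Longrightarrow> 0 \<le> nrm S x"
  unfolding nrm_S by (intro lp_norm_nonneg S_lp_family S_coord_nonneg p nonempty)

lemma lp_le_nrm_S: "x \<in> carrier S \<Longrightarrow> lp_le p \<Lambda> (\<lambda>l. nrm (E l) (x l)) (nrm S x)"
  using nrm_S_le_iff[of x "nrm S x"] nrm_S_nonneg by simp

lemma coord_le_nrm_S:
  assumes "x \<in> carrier S" "l \<in> \<Lambda>"
  shows "nrm (E l) (x l) \<le> nrm S x"
proof (cases "p = 0")
  case True
  then show ?thesis using lp_le_nrm_S[OF assms(1)] assms(2) by (simp add: lp_le_def)
next
  case False
  then have p1: "1 < p" using p by simp
  have "finite {l}" "{l} \<subseteq> \<Lambda>" using assms(2) by auto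
  then have "(\<Sum>l\<in>{l}. nrm (E l) (x l) powr p) \<le> nrm S x powr p"
    using lp_le_nrm_S[OF assms(1)] False unfolding lp_le_def by metis
  then have "nrm (E l) (x l) powr p \<le> nrm S x powr p" by simp
  then have "(nrm (E l) (x l) powr p) powr (1 / p) \<le> (nrm S x powr p) powr (1 / p)"
    by (rule powr_mono2[rotated 2]) (use p1 in auto)
  then show ?thesis
    using p1 S_coord_nonneg[OF assms] nrm_S_nonneg[OF assms(1)] by (simp add: powr_powr)
qed

lemma S_add_closed:
  assumes "x \<in> carrier S" "y \<in> carrier S"
  shows "(\<lambda>l\<in>\<Lambda>. x l \<oplus>\<^bsub>E l\<^esub> y l) \<in> carrier S"
proof -
  have "lp_family p \<Lambda> (\<lambda>l. nrm (E l) (x l) + nrm (E l) (y l))"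
    using assms by (intro lp_family_add S_lp_family S_coord_nonneg p)
  then have "lp_family p \<Lambda> (\<lambda>l. nrm (E l) ((\<lambda>l\<in>\<Lambda>. x l \<oplus>\<^bsub>E l\<^esub> y l) l))"
    by (rule lp_family_mono[OF _ p])
      (simp_all add: S_coord assms nrm_triangle[OF normed] nrm_nonneg[OF normed] add_closed[OF normed])
  then show ?thesis unfolding in_S_iff by (simp add: S_coord assms add_closed[OF normed])
qed

lemma S_smult_closed:
  assumes "x \<in> carrier S"
  shows "(\<lambda>l\<in>\<Lambda>. c \<odot>\<^bsub>E l\<^esub> x l) \<in> carrier S"
proof -
  have "lp_family p \<Lambda> (\<lambda>l. norm c * nrm (E l) (x l))"
    using assms by (intro lp_family_cmult S_lp_family S_coord_nonneg p) auto
  then have "lp_family p \<Lambda> (\<lambda>l. nrm (E l) ((\<lambda>l\<in>\<Lambda>. c \<odot>\<^bsub>E l\<^esub> x l) l))"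
    by (rule lp_family_mono[OF _ p])
      (simp_all add: S_coord assms nrm_smult[OF normed] nrm_nonneg[OF normed] smult_closed[OF normed])
  then show ?thesis unfolding in_S_iff by (simp add: S_coord assms smult_closed[OF normed])
qed

lemma S_finite_support:
  assumes "finite G" "\<And>l. l \<in> \<Lambda> \<Longrightarrow> v l \<in> carrier (E l)"
  shows "(\<lambda>l\<in>\<Lambda>. if l \<in> G then v l else \<zero>\<^bsub>E l\<^esub>) \<in> carrier S"
proof -
  have "lp_family p \<Lambda> (\<lambda>l. nrm (E l) ((\<lambda>l\<in>\<Lambda>. if l \<in> G then v l else \<zero>\<^bsub>E l\<^esub>) l))"
    by (rule lp_family_finite_support[OF assms(1) _ p]) (simp add: nrm_zero[OF normed])
  then show ?thesis unfolding in_S_iff by (simp add: zero_closed[OF normed] assms(2))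
qed

lemma S_zero_closed: "(\<lambda>l\<in>\<Lambda>. \<zero>\<^bsub>E l\<^esub>) \<in> carrier S"
  using S_finite_support[of "{}" "\<lambda>l. \<zero>\<^bsub>E l\<^esub>"] zero_closed[OF normed] by simp

lemma S_eqI:
  assumes "x \<in> extensional \<Lambda>" "y \<in> extensional \<Lambda>" "\<And>l. l \<in> \<Lambda> \<Longrightarrow> x l = y l"
  shows "x = y"
  using assms by (rule extensionalityI)

lemma module_coord: "l \<in> \<Lambda> \<Longrightarrow> Module.module scalar_space (E l)"
  by (rule normed_space_module[OF normed])

lemma
  assumes "l \<in> \<Lambda>"
  shows coord_assoc: "x \<in> carrier (E l) \<Longrightarrow> y \<in> carrier (E l) \<Longrightarrow> z \<in> carrier (E l) \<Longrightarrow>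
      (x \<oplus>\<^bsub>E l\<^esub> y) \<oplus>\<^bsub>E l\<^esub> z = x \<oplus>\<^bsub>E l\<^esub> (y \<oplus>\<^bsub>E l\<^esub> z)"
    and coord_comm: "x \<in> carrier (E l) \<Longrightarrow> y \<in> carrier (E l) \<Longrightarrow> x \<oplus>\<^bsub>E l\<^esub> y = y \<oplus>\<^bsub>E l\<^esub> x"
    and coord_l_zero: "x \<in> carrier (E l) \<Longrightarrow> \<zero>\<^bsub>E l\<^esub> \<oplus>\<^bsub>E l\<^esub> x = x"
    and coord_r_zero: "x \<in> carrier (E l) \<Longrightarrow> x \<oplus>\<^bsub>E l\<^esub> \<zero>\<^bsub>E l\<^esub> = x"
    and coord_l_neg: "x \<in> carrier (E l) \<Longrightarrow> (-1) \<odot>\<^bsub>E l\<^esub> x \<oplus>\<^bsub>E l\<^esub> x = \<zero>\<^bsub>E l\<^esub>"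
    and coord_smult_l_distr: "x \<in> carrier (E l) \<Longrightarrow> (a + b) \<odot>\<^bsub>E l\<^esub> x = a \<odot>\<^bsub>E l\<^esub> x \<oplus>\<^bsub>E l\<^esub> b \<odot>\<^bsub>E l\<^esub> x"
    and coord_smult_r_distr: "x \<in> carrier (E l) \<Longrightarrow> y \<in> carrier (E l) \<Longrightarrow>
      a \<odot>\<^bsub>E l\<^esub> (x \<oplus>\<^bsub>E l\<^esub> y) = a \<odot>\<^bsub>E l\<^esub> x \<oplus>\<^bsub>E l\<^esub> a \<odot>\<^bsub>E l\<^esub> y"
    and coord_smult_assoc: "x \<in> carrier (E l) \<Longrightarrow> (a * b) \<odot>\<^bsub>E l\<^esub> x = a \<odot>\<^bsub>E l\<^esub> (b \<odot>\<^bsub>E l\<^esub> x)"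
    and coord_smult_one: "x \<in> carrier (E l) \<Longrightarrow> 1 \<odot>\<^bsub>E l\<^esub> x = x"
    and coord_smult_zero: "c \<odot>\<^bsub>E l\<^esub> \<zero>\<^bsub>E l\<^esub> = \<zero>\<^bsub>E l\<^esub>"
proof -
  interpret Module.module scalar_space "E l" by (rule module_coord[OF assms])
  show "x \<in> carrier (E l) \<Longrightarrow> y \<in> carrier (E l) \<Longrightarrow> z \<in> carrier (E l) \<Longrightarrow>
      (x \<oplus>\<^bsub>E l\<^esub> y) \<oplus>\<^bsub>E l\<^esub> z = x \<oplus>\<^bsub>E l\<^esub> (y \<oplus>\<^bsub>E l\<^esub> z)" by (rule M.a_assoc)
  show "x \<in> carrier (E l) \<Longrightarrow> y \<in> carrier (E l) \<Longrightarrow> x \<oplus>\<^bsub>E l\<^esub> y = y \<oplus>\<^bsub>E l\<^esub> x" by (rule M.a_comm)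
  show "x \<in> carrier (E l) \<Longrightarrow> \<zero>\<^bsub>E l\<^esub> \<oplus>\<^bsub>E l\<^esub> x = x" by simp
  show "x \<in> carrier (E l) \<Longrightarrow> x \<oplus>\<^bsub>E l\<^esub> \<zero>\<^bsub>E l\<^esub> = x" by simp
  show "x \<in> carrier (E l) \<Longrightarrow> (-1) \<odot>\<^bsub>E l\<^esub> x \<oplus>\<^bsub>E l\<^esub> x = \<zero>\<^bsub>E l\<^esub>"
    using smult_minus_one[OF normed[OF assms], symmetric] M.l_neg by simp
  show "x \<in> carrier (E l) \<Longrightarrow> (a + b) \<odot>\<^bsub>E l\<^esub> x = a \<odot>\<^bsub>E l\<^esub> x \<oplus>\<^bsub>E l\<^esub> b \<odot>\<^bsub>E l\<^esub> x"
    using smult_l_distr[of a b x] by simp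
  show "x \<in> carrier (E l) \<Longrightarrow> y \<in> carrier (E l) \<Longrightarrow>
      a \<odot>\<^bsub>E l\<^esub> (x \<oplus>\<^bsub>E l\<^esub> y) = a \<odot>\<^bsub>E l\<^esub> x \<oplus>\<^bsub>E l\<^esub> a \<odot>\<^bsub>E l\<^esub> y" using smult_r_distr[of a x y] by simp
  show "x \<in> carrier (E l) \<Longrightarrow> (a * b) \<odot>\<^bsub>E l\<^esub> x = a \<odot>\<^bsub>E l\<^esub> (b \<odot>\<^bsub>E l\<^esub> x)"
    using smult_assoc1[of a b x] by simp
  show "x \<in> carrier (E l) \<Longrightarrow> 1 \<odot>\<^bsub>E l\<^esub> x = x" using smult_one by simp
  show "c \<odot>\<^bsub>E l\<^esub> \<zero>\<^bsub>E l\<^esub> = \<zero>\<^bsub>E l\<^esub>" using smult_r_null[of c] by simp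
qed

text \<open>Half of homogeneity; applied to \<open>1 / c\<close> it also yields the reverse
  inequality in \<open>normed_space_S\<close>.\<close>

lemma nrm_S_smult_le:
  assumes "x \<in> carrier S"
  shows "nrm S (\<lambda>l\<in>\<Lambda>. c \<odot>\<^bsub>E l\<^esub> x l) \<le> norm c * nrm S x"
proof (subst nrm_S_le_iff)
  show "(\<lambda>l\<in>\<Lambda>. c \<odot>\<^bsub>E l\<^esub> x l) \<in> carrier S" by (rule S_smult_closed[OF assms])
  show nn: "0 \<le> norm c * nrm S x" using nrm_S_nonneg[OF assms] by simp
  have "lp_le p \<Lambda> (\<lambda>l. norm c * nrm (E l) (x l)) (norm c * nrm S x)"
    using assms by (intro lp_le_cmult lp_le_nrm_S nrm_S_nonneg p S_coord_nonneg) auto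
  then show "lp_le p \<Lambda> (\<lambda>l. nrm (E l) ((\<lambda>l\<in>\<Lambda>. c \<odot>\<^bsub>E l\<^esub> x l) l)) (norm c * nrm S x)"
    by (rule lp_le_mono[OF _ subset_refl order_refl nn p])
      (simp_all add: S_coord assms nrm_smult[OF normed] nrm_nonneg[OF normed])
qed

lemma normed_space_S: "normed_space S"
proof -
  have scalar: "cring (scalar_space :: ('k, 'k) nspace)"
  proof -
    obtain l where "l \<in> \<Lambda>" using nonempty by auto
    then show ?thesis using Module.module.axioms(1)[OF module_coord] by auto
  qed
  have grp: "abelian_group S"
  proof (rule abelian_groupI)
    fix x y z assume xyz: "x \<in> carrier S" "y \<in> carrier S" "z \<in> carrier S"
    show "x \<oplus>\<^bsub>S\<^esub> y \<oplus>\<^bsub>S\<^esub> z = x \<oplus>\<^bsub>S\<^esub> (y \<oplus>\<^bsub>S\<^esub> z)"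
      by (rule S_eqI) (simp_all add: coord_assoc S_coord xyz)
  next
    fix x y assume xy: "x \<in> carrier S" "y \<in> carrier S"
    show "x \<oplus>\<^bsub>S\<^esub> y = y \<oplus>\<^bsub>S\<^esub> x" by (rule S_eqI) (simp_all add: coord_comm S_coord xy)
    show "x \<oplus>\<^bsub>S\<^esub> y \<in> carrier S" using S_add_closed[OF xy] by simp
  next
    fix x assume x: "x \<in> carrier S"
    show "\<zero>\<^bsub>S\<^esub> \<oplus>\<^bsub>S\<^esub> x = x"
      by (rule S_eqI) (simp_all add: coord_l_zero S_coord S_extensional x)
    show "\<exists>y\<in>carrier S. y \<oplus>\<^bsub>S\<^esub> x = \<zero>\<^bsub>S\<^esub>"
    proof
      show "(\<lambda>l\<in>\<Lambda>. (-1) \<odot>\<^bsub>E l\<^esub> x l) \<in> carrier S" by (rule S_smult_closed[OF x])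
      show "(\<lambda>l\<in>\<Lambda>. (-1) \<odot>\<^bsub>E l\<^esub> x l) \<oplus>\<^bsub>S\<^esub> x = \<zero>\<^bsub>S\<^esub>"
        by (rule S_eqI) (simp_all add: coord_l_neg S_coord x)
    qed
  qed (simp add: S_zero_closed)
  have mod: "Module.module scalar_space S"
  proof (rule Module.moduleI[OF scalar grp])
    fix a b :: 'k and x y assume "x \<in> carrier S" "y \<in> carrier S"
    then show "a \<odot>\<^bsub>S\<^esub> (x \<oplus>\<^bsub>S\<^esub> y) = a \<odot>\<^bsub>S\<^esub> x \<oplus>\<^bsub>S\<^esub> a \<odot>\<^bsub>S\<^esub> y"
      by (intro S_eqI) (simp_all add: coord_smult_r_distr S_coord)
  next
    fix a b :: 'k and x assume x: "x \<in> carrier S"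
    show "a \<odot>\<^bsub>S\<^esub> x \<in> carrier S" using S_smult_closed[OF x] by simp
    show "(a \<oplus>\<^bsub>scalar_space\<^esub> b) \<odot>\<^bsub>S\<^esub> x = a \<odot>\<^bsub>S\<^esub> x \<oplus>\<^bsub>S\<^esub> b \<odot>\<^bsub>S\<^esub> x"
      by (rule S_eqI) (simp_all add: coord_smult_l_distr S_coord x)
    show "(a \<otimes>\<^bsub>scalar_space\<^esub> b) \<odot>\<^bsub>S\<^esub> x = a \<odot>\<^bsub>S\<^esub> (b \<odot>\<^bsub>S\<^esub> x)"
      by (rule S_eqI) (simp_all add: coord_smult_assoc S_coord x)
  next
    fix x assume x: "x \<in> carrier S"
    show "\<one>\<^bsub>scalar_space\<^esub> \<odot>\<^bsub>S\<^esub> x = x"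
      by (rule S_eqI) (simp_all add: coord_smult_one S_coord S_extensional x)
  qed
  have zero: "nrm S x = 0 \<longleftrightarrow> x = \<zero>\<^bsub>S\<^esub>" if x: "x \<in> carrier S" for x
  proof
    assume "nrm S x = 0"
    then have "nrm (E l) (x l) = 0" if "l \<in> \<Lambda>" for l
      using coord_le_nrm_S[OF x that] S_coord_nonneg[OF x that] by simp
    then show "x = \<zero>\<^bsub>S\<^esub>"
      by (intro S_eqI) (simp_all add: S_extensional x nrm_eq_0_iff[OF normed] S_coord)
  next
    assume x0: "x = \<zero>\<^bsub>S\<^esub>"
    have "nrm (E l) (x l) = 0" if "l \<in> \<Lambda>" for l
      unfolding x0 using that by (simp add: nrm_zero[OF normed])
    then have "lp_le p \<Lambda> (\<lambda>l. nrm (E l) (x l)) 0" unfolding lp_le_def by (simp add: subset_iff)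
    then have "nrm S x \<le> 0" using nrm_S_le_iff[OF x, of 0] by simp
    then show "nrm S x = 0" using nrm_S_nonneg[OF x] by simp
  qed
  have smult: "nrm S (c \<odot>\<^bsub>S\<^esub> x) = norm c * nrm S x" if x: "x \<in> carrier S" for c x
  proof (rule antisym)
    show "nrm S (c \<odot>\<^bsub>S\<^esub> x) \<le> norm c * nrm S x" using nrm_S_smult_le[OF x] by simp
    show "norm c * nrm S x \<le> nrm S (c \<odot>\<^bsub>S\<^esub> x)"
    proof (cases "c = 0")
      case True
      then show ?thesis using nrm_S_nonneg[OF S_smult_closed[OF x, of c]] by simp
    next
      case False
      have "x = (\<lambda>l\<in>\<Lambda>. (1 / c) \<odot>\<^bsub>E l\<^esub> (\<lambda>l\<in>\<Lambda>. c \<odot>\<^bsub>E l\<^esub> x l) l)"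
        by (rule S_eqI)
          (use False in \<open>simp_all add: S_extensional x S_coord coord_smult_one coord_smult_assoc[symmetric]\<close>)
      then have "nrm S x \<le> norm (1 / c) * nrm S (\<lambda>l\<in>\<Lambda>. c \<odot>\<^bsub>E l\<^esub> x l)"
        using nrm_S_smult_le[OF S_smult_closed[OF x, of c], of "1 / c"] by simp
      then show ?thesis using False by (simp add: norm_divide field_simps)
    qed
  qed
  have triangle: "nrm S (x \<oplus>\<^bsub>S\<^esub> y) \<le> nrm S x + nrm S y" if x: "x \<in> carrier S" and y: "y \<in> carrier S" for x y
  proof -
    have nn: "0 \<le> nrm S x + nrm S y" using nrm_S_nonneg x y by simp
    have "lp_le p \<Lambda> (\<lambda>l. nrm (E l) (x l) + nrm (E l) (y l)) (nrm S x + nrm S y)"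
      using x y by (intro lp_le_add lp_le_nrm_S nrm_S_nonneg p S_coord_nonneg)
    then have "lp_le p \<Lambda> (\<lambda>l. nrm (E l) ((\<lambda>l\<in>\<Lambda>. x l \<oplus>\<^bsub>E l\<^esub> y l) l)) (nrm S x + nrm S y)"
      by (rule lp_le_mono[OF _ subset_refl order_refl nn p])
        (simp_all add: S_coord x y nrm_triangle[OF normed] nrm_nonneg[OF normed] add_closed[OF normed])
    then show ?thesis using nrm_S_le_iff[OF S_add_closed[OF x y] nn] by simp
  qed
  show ?thesis unfolding normed_space_def using mod zero smult triangle nrm_S_nonneg by blast
qed

section \<open>Injections, restrictions and components of functionals\<close>

definition inj :: "'i \<Rightarrow> 'a \<Rightarrow> 'i \<Rightarrow> 'a" where
  "inj l v = (\<lambda>m\<in>\<Lambda>. if m = l then v else \<zero>\<^bsub>E m\<^esub>)"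

definition res :: "'i set \<Rightarrow> ('i \<Rightarrow> 'a) \<Rightarrow> 'i \<Rightarrow> 'a" where
  "res G x = (\<lambda>m\<in>\<Lambda>. if m \<in> G then x m else \<zero>\<^bsub>E m\<^esub>)"

text \<open>The component of a functional in the dual of the summand \<open>E l\<close>. The lemmas
  below show that the norm of \<open>f\<close> is the ell_q-norm of the norms of its components,
  \<open>q\<close> being the conjugate exponent.\<close>

definition comp :: "'i \<Rightarrow> (('i \<Rightarrow> 'a) \<Rightarrow> 'k) \<Rightarrow> 'a \<Rightarrow> 'k" where
  "comp l f = (\<lambda>v\<in>carrier (E l). f (inj l v))"

lemma res_closed:
  assumes "x \<in> carrier S"
  shows "res G x \<in> carrier S"
proof -
  have "lp_family p \<Lambda> (\<lambda>l. nrm (E l) (res G x l))"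
    by (rule lp_family_mono[OF S_lp_family[OF assms] p])
      (simp_all add: res_def S_coord_nonneg[OF assms] nrm_zero[OF normed])
  then show ?thesis unfolding in_S_iff by (simp add: res_def S_coord[OF assms] zero_closed[OF normed])
qed

lemma nrm_res_le:
  assumes "x \<in> carrier S" "lp_le p (\<Lambda> \<inter> G) (\<lambda>l. nrm (E l) (x l)) M" "0 \<le> M"
  shows "nrm S (res G x) \<le> M"
  unfolding nrm_S_le_iff[OF res_closed[OF assms(1)] assms(3)]
  by (rule lp_le_mono[OF lp_le_restrict[OF assms(2,3) p] subset_refl order_refl assms(3) p])
    (simp_all add: res_def S_coord_nonneg[OF assms(1)] nrm_zero[OF normed])

lemma inj_closed:
  assumes "l \<in> \<Lambda>" "v \<in> carrier (E l)"
  shows "inj l v \<in> carrier S"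
proof -
  have "inj l v = (\<lambda>m\<in>\<Lambda>. if m \<in> {l} then (if m = l then v else \<zero>\<^bsub>E m\<^esub>) else \<zero>\<^bsub>E m\<^esub>)"
    by (auto simp: inj_def fun_eq_iff)
  then show ?thesis
    using S_finite_support[of "{l}" "\<lambda>m. if m = l then v else \<zero>\<^bsub>E m\<^esub>"] assms(2) zero_closed[OF normed] by simp
qed

lemma nrm_inj_le:
  assumes "l \<in> \<Lambda>" "v \<in> carrier (E l)"
  shows "nrm S (inj l v) \<le> nrm (E l) v"
proof -
  have nn: "0 \<le> nrm (E l) v" by (rule nrm_nonneg[OF normed[OF assms(1)] assms(2)])
  have "lp_le p (\<Lambda> \<inter> {l}) (\<lambda>m. nrm (E m) (inj l v m)) (nrm (E l) v)"
  proof (cases "p = 0")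
    case True
    then show ?thesis using assms(1) by (simp add: lp_le_def inj_def)
  next
    case False
    have "(\<Sum>m\<in>G. nrm (E m) (inj l v m) powr p) \<le> nrm (E l) v powr p" if G: "G \<subseteq> \<Lambda> \<inter> {l}" for G
    proof -
      have "G = {} \<or> G = {l}" using G by auto
      then show ?thesis using assms(1) by (elim disjE) (simp_all add: inj_def)
    qed
    then show ?thesis using False by (simp add: lp_le_def)
  qed
  then have "nrm S (res {l} (inj l v)) \<le> nrm (E l) v" by (rule nrm_res_le[OF inj_closed[OF assms] _ nn])
  moreover have "res {l} (inj l v) = inj l v" by (auto simp: res_def inj_def fun_eq_iff)
  ultimately show ?thesis by simp
qed

lemma inj_add:
  "l \<in> \<Lambda> \<Longrightarrow> inj l (v \<oplus>\<^bsub>E l\<^esub> w) = inj l v \<oplus>\<^bsub>S\<^esub> inj l w"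
  by (rule S_eqI) (simp_all add: inj_def coord_l_zero zero_closed[OF normed])

lemma inj_smult:
  "l \<in> \<Lambda> \<Longrightarrow> inj l (c \<odot>\<^bsub>E l\<^esub> v) = c \<odot>\<^bsub>S\<^esub> inj l v"
  by (rule S_eqI) (simp_all add: inj_def coord_smult_zero)

lemma comp_closed:
  assumes "f \<in> carrier (dual S)" "l \<in> \<Lambda>"
  shows "comp l f \<in> carrier (dual (E l))"
proof -
  have "norm (comp l f v) \<le> op_norm S scalar_space f * nrm (E l) v" if v: "v \<in> carrier (E l)" for v
  proof -
    have "norm (f (inj l v)) \<le> op_norm S scalar_space f * nrm S (inj l v)"
      by (rule norm_functional_le[OF normed_space_S assms(1) inj_closed[OF assms(2) v]])
    also have "\<dots> \<le> op_norm S scalar_space f * nrm (E l) v"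
      by (intro mult_left_mono nrm_inj_le assms v dual_norm_nonneg[OF normed_space_S])
    finally show ?thesis using v by (simp add: comp_def)
  qed
  then have "\<exists>C. \<forall>v\<in>carrier (E l). norm (comp l f v) \<le> C * nrm (E l) v" by blast
  moreover have "comp l f (v \<oplus>\<^bsub>E l\<^esub> w) = comp l f v + comp l f w"
    if "v \<in> carrier (E l)" "w \<in> carrier (E l)" for v w
    using that functional_add[OF normed_space_S assms(1) inj_closed[OF assms(2)] inj_closed[OF assms(2)]]
      inj_add[OF assms(2), of v w] add_closed[OF normed[OF assms(2)]]
    unfolding comp_def by simp
  moreover have "comp l f (c \<odot>\<^bsub>E l\<^esub> v) = c * comp l f v" if "v \<in> carrier (E l)" for c v
    using that functional_smult[OF normed_space_S assms(1) inj_closed[OF assms(2)]]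
      inj_smult[OF assms(2), of c v] smult_closed[OF normed[OF assms(2)]]
    unfolding comp_def by simp
  ultimately show ?thesis unfolding in_carrier_dual_iff by (simp add: comp_def)
qed

lemma res_insert:
  assumes "x \<in> carrier S" "l \<in> \<Lambda>" "l \<notin> G"
  shows "res (insert l G) x = res G x \<oplus>\<^bsub>S\<^esub> inj l (x l)"
  using assms(2,3)
  by (intro S_eqI)
    (auto simp: res_def inj_def coord_l_zero coord_r_zero S_coord[OF assms(1)] zero_closed[OF normed])

lemma functional_res:
  assumes f: "f \<in> carrier (dual S)" and x: "x \<in> carrier S" and G: "finite G" "G \<subseteq> \<Lambda>"
  shows "f (res G x) = (\<Sum>l\<in>G. comp l f (x l))"
  using G
proof (induction G)
  case empty
  have "res {} x = \<zero>\<^bsub>S\<^esub>" by (simp add: res_def)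
  then show ?case using functional_zero[OF normed_space_S f] by (simp only: sum.empty)
next
  case (insert l G)
  then have l: "l \<in> \<Lambda>" "G \<subseteq> \<Lambda>" by auto
  have "f (res (insert l G) x) = f (res G x) + f (inj l (x l))"
    unfolding res_insert[OF x l(1) insert.hyps(2)]
    by (intro functional_add[OF normed_space_S f] res_closed inj_closed S_coord x l)
  then show ?case using insert l by (simp add: comp_def S_coord[OF x])
qed

lemma functional_split:
  assumes f: "f \<in> carrier (dual S)" and x: "x \<in> carrier S"
  shows "f x = f (res G x) + f (res (- G) x)"
proof -
  have "x = res G x \<oplus>\<^bsub>S\<^esub> res (- G) x"
    by (rule S_eqI) (auto simp: res_def coord_l_zero coord_r_zero S_coord x S_extensional)
  then show ?thesis using functional_add[OF normed_space_S f res_closed[OF x] res_closed[OF x]] by metis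
qed

text \<open>Hoelder's inequality on a finite set of coordinates; the rest of \<open>x\<close> is so
  small that mere boundedness of \<open>f\<close> controls it.\<close>

lemma dual_norm_S_le:
  assumes f: "f \<in> carrier (dual S)" and M: "0 \<le> M"
    and le: "\<And>G. finite G \<Longrightarrow> G \<subseteq> \<Lambda> \<Longrightarrow>
      (\<Sum>l\<in>G. op_norm (E l) scalar_space (comp l f) powr conj_exp p) \<le> M powr conj_exp p"
  shows "op_norm S scalar_space f \<le> M"
proof (rule dual_norm_leI[OF normed_space_S M])
  fix x assume x: "x \<in> carrier S"
  let ?C = "op_norm S scalar_space f"
  have C: "0 \<le> ?C" by (rule dual_norm_nonneg[OF normed_space_S f])
  show "norm (f x) \<le> M * nrm S x"
  proof (rule field_le_epsilon)
    fix e :: real assume e: "0 < e"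
    then have e': "0 < e / (?C + 1)" using C by simp
    \<comment> \<open>The tail has norm at most \<open>e / (?C + 1)\<close>, so that
      \<open>f\<close> contributes at most \<open>e\<close> there; adding 1 covers the zero
      functional.\<close>
    obtain G where G: "finite G" "G \<subseteq> \<Lambda>" "lp_le p (\<Lambda> - G) (\<lambda>l. nrm (E l) (x l)) (e / (?C + 1))"
      by (rule lp_family_tail[OF S_lp_family[OF x] p S_coord_nonneg[OF x] e'])
    have "norm (f (res (- G) x)) \<le> ?C * nrm S (res (- G) x)"
      by (rule norm_functional_le[OF normed_space_S f res_closed[OF x]])
    also have "\<dots> \<le> ?C * (e / (?C + 1))"
      using G(3) e' by (intro mult_left_mono nrm_res_le x C) (auto simp: Diff_eq)
    also have "\<dots> \<le> e" using C e by (simp add: field_simps)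
    finally have 1: "norm (f (res (- G) x)) \<le> e" .
    have "norm (f (res G x)) \<le> (\<Sum>l\<in>G. norm (comp l f (x l)))"
      unfolding functional_res[OF f x G(1,2)] by (rule norm_sum)
    also have "\<dots> \<le> (\<Sum>l\<in>G. nrm (E l) (x l) * op_norm (E l) scalar_space (comp l f))"
    proof (rule sum_mono)
      fix l assume "l \<in> G"
      then have l: "l \<in> \<Lambda>" using G by auto
      show "norm (comp l f (x l)) \<le> nrm (E l) (x l) * op_norm (E l) scalar_space (comp l f)"
        using norm_functional_le[OF normed[OF l] comp_closed[OF f l] S_coord[OF x l]]
        by (simp add: mult.commute)
    qed
    also have "\<dots> \<le> nrm S x * M"
    proof (rule Holder_finite[OF p G(1) _ le[OF G(1,2)] nrm_S_nonneg[OF x] M])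
      show "lp_le p G (\<lambda>l. nrm (E l) (x l)) (nrm S x)"
        using G(2) by (intro lp_le_mono[OF lp_le_nrm_S[OF x] G(2) order_refl nrm_S_nonneg[OF x] p])
          (auto simp: S_coord_nonneg[OF x] subset_iff)
      fix l assume "l \<in> G"
      then have l: "l \<in> \<Lambda>" using G by auto
      show "0 \<le> nrm (E l) (x l)" by (rule S_coord_nonneg[OF x l])
      show "0 \<le> op_norm (E l) scalar_space (comp l f)"
        by (rule dual_norm_nonneg[OF normed[OF l] comp_closed[OF f l]])
    qed
    finally have 2: "norm (f (res G x)) \<le> M * nrm S x" by (simp add: mult.commute)
    have "norm (f x) \<le> norm (f (res G x)) + norm (f (res (- G) x))"
      unfolding functional_split[OF f x, of G] by (rule norm_triangle_ineq)
    then show "norm (f x) \<le> M * nrm S x + e" using 1 2 by linarith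
  qed
qed

lemma sum_norm_comp_le:
  assumes f: "f \<in> carrier (dual S)" and G: "finite G" "G \<subseteq> \<Lambda>"
    and v: "\<And>l. l \<in> G \<Longrightarrow> v l \<in> carrier (E l)"
    and M: "lp_le p G (\<lambda>l. nrm (E l) (v l)) M" "0 \<le> M"
  shows "(\<Sum>l\<in>G. norm (comp l f (v l))) \<le> op_norm S scalar_space f * M"
proof -
  \<comment> \<open>Factors of modulus 1 that turn the values into nonnegative reals, so that these
    add up without cancellation in one value of \<open>f\<close>; the factor is 1 where the value is
    0.\<close>
  define c where "c l = (if comp l f (v l) = 0 then 1 else of_real (norm (comp l f (v l))) / comp l f (v l))" for l
  have c: "norm (c l) = 1" "c l * comp l f (v l) = of_real (norm (comp l f (v l)))" for l
    by (auto simp: c_def norm_divide)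
  define x where "x = (\<lambda>l\<in>\<Lambda>. if l \<in> G then c l \<odot>\<^bsub>E l\<^esub> (if l \<in> G then v l else \<zero>\<^bsub>E l\<^esub>) else \<zero>\<^bsub>E l\<^esub>)"
  have x: "x \<in> carrier S"
    unfolding x_def using v G(2)
    by (intro S_finite_support G(1) smult_closed[OF normed]) (auto simp: zero_closed[OF normed])
  have nrm_x: "nrm (E l) (x l) = nrm (E l) (v l)" if "l \<in> G" for l
    using that G(2) v[OF that] by (auto simp: x_def nrm_smult[OF normed] c subset_iff)
  have res_x: "res G x = x" by (auto simp: res_def x_def fun_eq_iff)
  have "lp_le p G (\<lambda>l. nrm (E l) (x l)) M"
    using nrm_x v G(2) nrm_nonneg[OF normed]
    by (intro lp_le_mono[OF M(1) subset_refl order_refl M(2) p]) (auto simp: subset_iff)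
  moreover have "\<Lambda> \<inter> G = G" using G(2) by auto
  ultimately have "nrm S x \<le> M" using nrm_res_le[OF x, of G M] M(2) res_x by simp
  have "comp l f (x l) = of_real (norm (comp l f (v l)))" if l: "l \<in> G" for l
  proof -
    have "l \<in> \<Lambda>" using l G(2) by auto
    have "comp l f (c l \<odot>\<^bsub>E l\<^esub> v l) = c l * comp l f (v l)"
      by (rule functional_smult[OF normed[OF \<open>l \<in> \<Lambda>\<close>] comp_closed[OF f \<open>l \<in> \<Lambda>\<close>] v[OF l]])
    then show ?thesis using l \<open>l \<in> \<Lambda>\<close> c(2) by (simp add: x_def)
  qed
  then have "f x = (\<Sum>l\<in>G. of_real (norm (comp l f (v l))))"
    using functional_res[OF f x G] res_x by simp
  then have "(\<Sum>l\<in>G. norm (comp l f (v l))) = norm (f x)"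
    by (simp add: of_real_sum[symmetric] sum_nonneg del: of_real_sum)
  also have "\<dots> \<le> op_norm S scalar_space f * nrm S x"
    by (rule norm_functional_le[OF normed_space_S f x])
  also have "\<dots> \<le> op_norm S scalar_space f * M"
    using \<open>nrm S x \<le> M\<close> by (intro mult_left_mono dual_norm_nonneg[OF normed_space_S f])
  finally show ?thesis .
qed

text \<open>The component norms may not be attained. Vectors attaining them up to
  \<open>e / ?B\<close> are scaled by \<open>b\<close>; since \<open>?B\<close> exceeds the sum of
  \<open>b\<close>, the total error is at most \<open>e\<close>.\<close>

lemma sum_dual_norm_comp_le:
  assumes f: "f \<in> carrier (dual S)" and G: "finite G" "G \<subseteq> \<Lambda>"
    and b: "\<And>l. l \<in> G \<Longrightarrow> 0 \<le> b l" and M: "lp_le p G b M" "0 \<le> M"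
  shows "(\<Sum>l\<in>G. b l * op_norm (E l) scalar_space (comp l f)) \<le> op_norm S scalar_space f * M"
proof (rule field_le_epsilon)
  fix e :: real assume e: "0 < e"
  let ?B = "(\<Sum>l\<in>G. b l) + 1"
  have B: "0 < ?B" using sum_nonneg[of G b] b by simp
  have "\<exists>v\<in>unit_ball (E l). op_norm (E l) scalar_space (comp l f) - e / ?B < norm (comp l f v)"
    if l: "l \<in> G" for l
  proof -
    have l': "l \<in> \<Lambda>" using l G by auto
    have "0 < e / ?B" using e B by (rule divide_pos_pos)
    then have "\<not> op_norm (E l) scalar_space (comp l f) \<le> op_norm (E l) scalar_space (comp l f) - e / ?B"
      by linarith
    then show ?thesis
      unfolding dual_norm_le_iff[OF normed[OF l'] comp_closed[OF f l'],
        of "op_norm (E l) scalar_space (comp l f) - e / ?B"] by (simp add: not_le)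
  qed
  then have "\<forall>l\<in>G. \<exists>v. v \<in> unit_ball (E l) \<and> op_norm (E l) scalar_space (comp l f) - e / ?B < norm (comp l f v)"
    by auto
  from bchoice[OF this] obtain v where v: "\<And>l. l \<in> G \<Longrightarrow> v l \<in> unit_ball (E l)"
    "\<And>l. l \<in> G \<Longrightarrow> op_norm (E l) scalar_space (comp l f) - e / ?B < norm (comp l f (v l))" by auto
  define u where "u l = of_real (b l) \<odot>\<^bsub>E l\<^esub> v l" for l
  have vc: "v l \<in> carrier (E l)" "nrm (E l) (v l) \<le> 1" if "l \<in> G" for l
    using v(1)[OF that] by (auto simp: unit_ball_def)
  have L: "l \<in> \<Lambda>" if "l \<in> G" for l using that G by auto
  have u: "u l \<in> carrier (E l)" "nrm (E l) (u l) \<le> b l" if "l \<in> G" for l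
    using vc[OF that] b[OF that] mult_left_mono[of "nrm (E l) (v l)" 1 "b l"]
    by (simp_all add: u_def smult_closed[OF normed[OF L[OF that]]] nrm_smult[OF normed[OF L[OF that]]])
  have "lp_le p G (\<lambda>l. nrm (E l) (u l)) M"
    by (rule lp_le_mono[OF M(1) subset_refl order_refl M(2) p])
      (use u L nrm_nonneg[OF normed] in auto)
  then have le: "(\<Sum>l\<in>G. norm (comp l f (u l))) \<le> op_norm S scalar_space f * M"
    using sum_norm_comp_le[OF f G u(1) _ M(2)] by simp
  have "(\<Sum>l\<in>G. b l * op_norm (E l) scalar_space (comp l f)) \<le> (\<Sum>l\<in>G. norm (comp l f (u l)) + b l * (e / ?B))"
  proof (rule sum_mono)
    fix l assume l: "l \<in> G"
    have "comp l f (u l) = of_real (b l) * comp l f (v l)"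
      unfolding u_def by (rule functional_smult[OF normed[OF L[OF l]] comp_closed[OF f L[OF l]] vc(1)[OF l]])
    then have "norm (comp l f (u l)) = b l * norm (comp l f (v l))" using b[OF l] by (simp add: norm_mult)
    moreover have "b l * op_norm (E l) scalar_space (comp l f) \<le> b l * (norm (comp l f (v l)) + e / ?B)"
      using v(2)[OF l] b[OF l] by (intro mult_left_mono) auto
    ultimately show "b l * op_norm (E l) scalar_space (comp l f) \<le> norm (comp l f (u l)) + b l * (e / ?B)"
      by (simp add: distrib_left)
  qed
  also have "\<dots> = (\<Sum>l\<in>G. norm (comp l f (u l))) + (\<Sum>l\<in>G. b l) * (e / ?B)"
    by (simp only: sum.distrib sum_distrib_right)
  also have "(\<Sum>l\<in>G. b l) * (e / ?B) \<le> ?B * (e / ?B)"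
    using e B by (intro mult_right_mono) auto
  also have "?B * (e / ?B) = e" using B by simp
  finally show "(\<Sum>l\<in>G. b l * op_norm (E l) scalar_space (comp l f)) \<le> op_norm S scalar_space f * M + e"
    using le by linarith
qed

text \<open>The converse of Hoelder's inequality. Testing with the \<open>(q - 1)\<close>-th powers
  of the component norms, of ell_p-norm \<open>?Q powr (1 / p)\<close> because
  \<open>(q - 1) * p = q\<close>, bounds \<open>?Q\<close> by the norm of \<open>f\<close> times
  \<open>?Q powr (1 / p)\<close>; divide by the last factor.\<close>

lemma sum_powr_dual_norm_comp_le:
  assumes f: "f \<in> carrier (dual S)" and G: "finite G" "G \<subseteq> \<Lambda>"
  shows "(\<Sum>l\<in>G. op_norm (E l) scalar_space (comp l f) powr conj_exp p)
    \<le> op_norm S scalar_space f powr conj_exp p"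
proof -
  let ?n = "\<lambda>l. op_norm (E l) scalar_space (comp l f)" and ?q = "conj_exp p"
  have n: "0 \<le> ?n l" if "l \<in> G" for l
    using that G dual_norm_nonneg[OF normed comp_closed[OF f]] by auto
  have C: "0 \<le> op_norm S scalar_space f" by (rule dual_norm_nonneg[OF normed_space_S f])
  show ?thesis
  proof (cases "p = 0")
    case True
    then have "lp_le p G (\<lambda>_. 1) 1" by (simp add: lp_le_def)
    from sum_dual_norm_comp_le[OF f G _ this] have "(\<Sum>l\<in>G. ?n l) \<le> op_norm S scalar_space f" by simp
    moreover have "(\<Sum>l\<in>G. ?n l powr ?q) = (\<Sum>l\<in>G. ?n l)"
      using True n by (intro sum.cong) (auto simp: conj_exp_def)
    ultimately show ?thesis using True C by (simp add: conj_exp_def)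
  next
    case False
    then have p1: "1 < p" using p by simp
    note q = conj_exp[OF p]
    let ?Q = "\<Sum>l\<in>G. ?n l powr ?q"
    have Q: "0 \<le> ?Q" by (intro sum_nonneg) auto
    have le: "lp_le p G (\<lambda>l. ?n l powr (?q - 1)) (?Q powr (1 / p))"
    proof -
      have "(\<Sum>l\<in>H. (?n l powr (?q - 1)) powr p) \<le> (?Q powr (1 / p)) powr p" if H: "finite H" "H \<subseteq> G" for H
      proof -
        have "(\<Sum>l\<in>H. (?n l powr (?q - 1)) powr p) = (\<Sum>l\<in>H. ?n l powr ?q)"
          using q(4)[OF p1] by (simp add: powr_powr)
        also have "\<dots> \<le> ?Q" using H G by (intro sum_mono2) auto
        finally show ?thesis using Q p1 by (simp add: powr_powr)
      qed
      then show ?thesis using False by (simp add: lp_le_def)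
    qed
    have "(\<Sum>l\<in>G. ?n l powr (?q - 1) * ?n l) \<le> op_norm S scalar_space f * ?Q powr (1 / p)"
      by (rule sum_dual_norm_comp_le[OF f G _ le]) auto
    moreover have "(\<Sum>l\<in>G. ?n l powr (?q - 1) * ?n l) = ?Q"
    proof (rule sum.cong[OF refl])
      fix l assume l: "l \<in> G"
      have "?n l powr (?q - 1) * ?n l = ?n l powr (?q - 1) * ?n l powr 1" using n[OF l] by (simp only: powr_one)
      also have "\<dots> = ?n l powr ?q" by (simp only: powr_add[symmetric]) simp
      finally show "?n l powr (?q - 1) * ?n l = ?n l powr ?q" .
    qed
    ultimately have main: "?Q \<le> op_norm S scalar_space f * ?Q powr (1 / p)" by simp
    show ?thesis
    proof (cases "?Q = 0")
      case False
      then have pos: "0 < ?Q" using Q by simp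
      have "?Q powr (1 / ?q) * ?Q powr (1 / p) = ?Q powr (1 / p + 1 / ?q)"
        by (simp only: powr_add mult.commute)
      also have "\<dots> = ?Q" using q(3)[OF p1] Q by (simp only: powr_one)
      finally have "?Q powr (1 / ?q) * ?Q powr (1 / p) \<le> op_norm S scalar_space f * ?Q powr (1 / p)"
        using main by (simp only:)
      moreover have "0 < ?Q powr (1 / p)" using False by (simp only: powr_gt_zero) simp
      ultimately have "?Q powr (1 / ?q) \<le> op_norm S scalar_space f" by (rule mult_right_le_imp_le)
      then have "(?Q powr (1 / ?q)) powr ?q \<le> op_norm S scalar_space f powr ?q"
        by (rule powr_mono2[rotated 2]) (use q(1) in auto)
      moreover have "(?Q powr (1 / ?q)) powr ?q = ?Q" using Q q(1) by (simp only: powr_powr) simp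
      ultimately show ?thesis by (simp only:)
    qed simp
  qed
qed

end

section \<open>Adjoints and the Szlenk index\<close>

lemma szlenk_deriv_eq_sder: "szlenk_deriv E \<epsilon> = sder (weak_star E) (ndist (dual E)) \<epsilon>"
proof -
  have "ereal \<epsilon> < ndiam (dual E) A \<longleftrightarrow> (\<exists>y\<in>A. \<exists>z\<in>A. \<epsilon> < ndist (dual E) y z)" for A
    by (auto simp: ndiam_def less_SUP_iff)
  then show ?thesis by (auto simp: szlenk_deriv_def sder_def fun_eq_iff)
qed

lemma Sz_eps_eq_derived:
  "Sz_eps E \<epsilon> K = {\<alpha>. derived (weak_star E) (ndist (dual E)) \<epsilon> K \<alpha> \<noteq> {}}"
  by (simp add: Sz_eps_def szlenk_deriv_eq_sder derived_def)

lemma unit_ball_dual: "unit_ball (dual N) = {f \<in> carrier (dual N). op_norm N scalar_space f \<le> 1}"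
  by (simp add: unit_ball_def)

context
  fixes N :: "('k::{real_normed_field, euclidean_space}, 'a) nspace" and Y :: "('k, 'b) nspace"
    and T :: "'a \<Rightarrow> 'b"
  assumes N: "normed_space N" and Y: "normed_space Y" and T: "bounded_operator N Y T"
begin

section \<open>Adjoint operators on dual balls\<close>

lemma norm_adjoint_le:
  assumes "f \<in> carrier (dual Y)" "x \<in> carrier N"
  shows "norm (f (T x)) \<le> op_norm Y scalar_space f * op_norm N Y T * nrm N x"
proof -
  have "norm (f (T x)) \<le> op_norm Y scalar_space f * nrm Y (T x)"
    by (rule norm_functional_le[OF Y assms(1) bounded_operatorD(1)[OF T assms(2)]])
  also have "\<dots> \<le> op_norm Y scalar_space f * (op_norm N Y T * nrm N x)"
    by (rule mult_left_mono[OF nrm_le_op_norm[OF N Y T assms(2)] dual_norm_nonneg[OF Y assms(1)]])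
  finally show ?thesis by (simp add: mult.assoc)
qed

lemma adjoint_closed:
  assumes f: "f \<in> carrier (dual Y)"
  shows "adjoint N T f \<in> carrier (dual N)"
proof -
  have "\<forall>x\<in>carrier N. norm (adjoint N T f x) \<le> (op_norm Y scalar_space f * op_norm N Y T) * nrm N x"
    using norm_adjoint_le[OF f] by (simp add: adjoint_def)
  then have "\<exists>C. \<forall>x\<in>carrier N. norm (adjoint N T f x) \<le> C * nrm N x" ..
  then show ?thesis unfolding in_carrier_dual_iff
    by (simp add: adjoint_def add_closed[OF N] smult_closed[OF N] bounded_operatorD[OF T]
        functional_add[OF Y f] functional_smult[OF Y f])
qed

lemma continuous_map_adjoint: "continuous_map (weak_star Y) (weak_star N) (adjoint N T)"
proof (rule continuous_map_into_weak_star[OF N])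
  show "adjoint N T f \<in> carrier (dual N)" if "f \<in> topspace (weak_star Y)" for f
    using that by (simp add: topspace_weak_star[OF Y] adjoint_closed)
  show "continuous_map (weak_star Y) euclidean (\<lambda>f. adjoint N T f x)" if "x \<in> carrier N" for x
    using continuous_map_weak_star_eval[OF Y bounded_operatorD(1)[OF T that]] that
    by (simp add: adjoint_def)
qed

lemma compactin_unit_ball_dual: "compactin (weak_star Y) (unit_ball (dual Y))"
  using Banach_Alaoglu[OF Y, of 1] by (simp add: unit_ball_dual)

lemma compactin_adjoint_unit_ball: "compactin (weak_star N) (adjoint N T ` unit_ball (dual Y))"
  by (rule image_compactin[OF compactin_unit_ball_dual continuous_map_adjoint])

lemma adjoint_unit_ball_subset: "adjoint N T ` unit_ball (dual Y) \<subseteq> carrier (dual N)"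
  using adjoint_closed by (auto simp: unit_ball_dual)

lemma zero_in_adjoint_unit_ball: "(\<lambda>x\<in>carrier N. 0) \<in> adjoint N T ` unit_ball (dual Y)"
proof
  show "(\<lambda>x\<in>carrier N. 0) = adjoint N T (\<lambda>y\<in>carrier Y. 0)"
    by (auto simp: adjoint_def fun_eq_iff bounded_operatorD(1)[OF T])
  have "op_norm Y scalar_space (\<lambda>y\<in>carrier Y. 0) \<le> 1"
    by (rule op_norm_le[OF Y]) (simp add: unit_ball_def)
  then show "(\<lambda>y\<in>carrier Y. 0) \<in> unit_ball (dual Y)" by (simp add: unit_ball_dual dual_zero_closed[OF Y])
qed

lemma ndist_adjoint_le:
  assumes "f \<in> carrier (dual Y)" "g \<in> carrier (dual Y)" "op_norm N Y T \<le> C"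
  shows "ndist (dual N) (adjoint N T f) (adjoint N T g)
    \<le> C * (op_norm Y scalar_space f + op_norm Y scalar_space g)"
  unfolding ndist_dual_le_iff[OF N adjoint_closed[OF assms(1)] adjoint_closed[OF assms(2)]]
proof
  fix x assume x: "x \<in> unit_ball N"
  then have xN: "x \<in> carrier N" "nrm N x \<le> 1" by (auto simp: unit_ball_def)
  have C: "op_norm N Y T * nrm N x \<le> C" "0 \<le> op_norm N Y T * nrm N x"
    using assms(3) xN op_norm_nonneg[OF N Y T] nrm_nonneg[OF N xN(1)]
      mult_left_mono[of "nrm N x" 1 "op_norm N Y T"] by auto
  have le: "norm (h (T x)) \<le> op_norm Y scalar_space h * C" if h: "h \<in> carrier (dual Y)" for h
  proof -
    have "norm (h (T x)) \<le> op_norm Y scalar_space h * (op_norm N Y T * nrm N x)"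
      using norm_adjoint_le[OF h xN(1)] by (simp add: mult.assoc)
    also have "\<dots> \<le> op_norm Y scalar_space h * C"
      using C by (intro mult_left_mono dual_norm_nonneg[OF Y h])
    finally show ?thesis .
  qed
  have "norm (f (T x) - g (T x)) \<le> norm (f (T x)) + norm (g (T x))" by (rule norm_triangle_ineq4)
  also have "\<dots> \<le> op_norm Y scalar_space f * C + op_norm Y scalar_space g * C"
    by (intro add_mono le assms)
  finally show "norm (adjoint N T f x - adjoint N T g x)
      \<le> C * (op_norm Y scalar_space f + op_norm Y scalar_space g)"
    using xN by (simp add: adjoint_def algebra_simps)
qed

end

text \<open>\<open>C\<close> is any common bound rather than the supremum of the norms, so that it
  may be chosen positive.\<close>

locale operator_family =
  E: normed_family p \<Lambda> E + F: normed_family p \<Lambda> F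
  for p :: real and \<Lambda> :: "'i set"
    and E :: "'i \<Rightarrow> ('k::{real_normed_field, euclidean_space}, 'a) nspace"
    and F :: "'i \<Rightarrow> ('k, 'b) nspace" +
  fixes T :: "'i \<Rightarrow> 'a \<Rightarrow> 'b" and C :: real
  assumes bounded: "\<And>l. l \<in> \<Lambda> \<Longrightarrow> bounded_operator (E l) (F l) (T l)"
    and op_norm_le_C: "\<And>l. l \<in> \<Lambda> \<Longrightarrow> op_norm (E l) (F l) (T l) \<le> C"
begin

abbreviation TS :: "('i \<Rightarrow> 'a) \<Rightarrow> 'i \<Rightarrow> 'b" where
  "TS \<equiv> direct_sum_op \<Lambda> T"

section \<open>The direct sum of a family of operators\<close>

lemma C_nonneg: "0 \<le> C"
proof -
  obtain l where l: "l \<in> \<Lambda>" using E.nonempty by auto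
  have "0 \<le> op_norm (E l) (F l) (T l)"
    by (rule op_norm_nonneg[OF E.normed[OF l] F.normed[OF l] bounded[OF l]])
  then show ?thesis using op_norm_le_C[OF l] by linarith
qed

lemma nrm_T_le:
  assumes "l \<in> \<Lambda>" "v \<in> carrier (E l)"
  shows "nrm (F l) (T l v) \<le> C * nrm (E l) v"
proof -
  have "nrm (F l) (T l v) \<le> op_norm (E l) (F l) (T l) * nrm (E l) v"
    by (rule nrm_le_op_norm[OF E.normed F.normed bounded]) (use assms in auto)
  also have "\<dots> \<le> C * nrm (E l) v"
    by (rule mult_right_mono[OF op_norm_le_C[OF assms(1)] nrm_nonneg[OF E.normed[OF assms(1)] assms(2)]])
  finally show ?thesis .
qed

lemma T_closed: "l \<in> \<Lambda> \<Longrightarrow> v \<in> carrier (E l) \<Longrightarrow> T l v \<in> carrier (F l)"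
  by (rule bounded_operatorD(1)[OF bounded])

lemma TS_closed:
  assumes "x \<in> carrier E.S"
  shows "TS x \<in> carrier F.S"
proof -
  have "lp_family p \<Lambda> (\<lambda>l. C * nrm (E l) (x l))"
    by (rule lp_family_cmult[OF E.S_lp_family[OF assms] C_nonneg E.p E.S_coord_nonneg[OF assms]])
  then have "lp_family p \<Lambda> (\<lambda>l. nrm (F l) (TS x l))"
    by (rule lp_family_mono[OF _ E.p])
      (simp_all add: direct_sum_op_def nrm_T_le nrm_nonneg[OF F.normed] T_closed E.S_coord[OF assms])
  then show ?thesis unfolding F.in_S_iff
    by (simp add: direct_sum_op_def T_closed E.S_coord[OF assms])
qed

lemma nrm_TS_le:
  assumes "x \<in> carrier E.S"
  shows "nrm F.S (TS x) \<le> C * nrm E.S x"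
proof -
  have nn: "0 \<le> C * nrm E.S x" using C_nonneg E.nrm_S_nonneg[OF assms] by simp
  have "lp_le p \<Lambda> (\<lambda>l. C * nrm (E l) (x l)) (C * nrm E.S x)"
    by (rule lp_le_cmult[OF E.lp_le_nrm_S[OF assms] C_nonneg E.nrm_S_nonneg[OF assms] E.p
          E.S_coord_nonneg[OF assms]])
  then have "lp_le p \<Lambda> (\<lambda>l. nrm (F l) (TS x l)) (C * nrm E.S x)"
    by (rule lp_le_mono[OF _ subset_refl order_refl nn E.p])
      (simp_all add: direct_sum_op_def nrm_T_le nrm_nonneg[OF F.normed] T_closed E.S_coord[OF assms])
  then show ?thesis using F.nrm_S_le_iff[OF TS_closed[OF assms] nn] by simp
qed

lemma bounded_operator_TS: "bounded_operator E.S F.S TS"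
proof -
  have "TS (x \<oplus>\<^bsub>E.S\<^esub> y) = TS x \<oplus>\<^bsub>F.S\<^esub> TS y" if "x \<in> carrier E.S" "y \<in> carrier E.S" for x y
    by (rule F.S_eqI) (simp_all add: direct_sum_op_def bounded_operatorD(2)[OF bounded] E.S_coord that)
  moreover have "TS (c \<odot>\<^bsub>E.S\<^esub> x) = c \<odot>\<^bsub>F.S\<^esub> TS x" if "x \<in> carrier E.S" for x c
    by (rule F.S_eqI) (simp_all add: direct_sum_op_def bounded_operatorD(3)[OF bounded] E.S_coord that)
  moreover have "\<exists>C. \<forall>x\<in>carrier E.S. nrm F.S (TS x) \<le> C * nrm E.S x" using nrm_TS_le by blast
  ultimately show ?thesis unfolding bounded_operator_def using TS_closed by simp
qed

lemma op_norm_TS_le: "op_norm E.S F.S TS \<le> C"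
proof (rule op_norm_le[OF E.normed_space_S])
  fix x assume "x \<in> unit_ball E.S"
  then have x: "x \<in> carrier E.S" "nrm E.S x \<le> 1" by (auto simp: unit_ball_def)
  show "nrm F.S (TS x) \<le> C" using nrm_TS_le[OF x(1)] mult_left_mono[OF x(2) C_nonneg] by simp
qed

lemma TS_inj: "l \<in> \<Lambda> \<Longrightarrow> TS (E.inj l v) = F.inj l (T l v)"
proof (rule F.S_eqI)
  fix m assume lm: "l \<in> \<Lambda>" "m \<in> \<Lambda>"
  have T0: "T m \<zero>\<^bsub>E m\<^esub> \<in> carrier (F m)"
    by (rule T_closed[OF lm(2) zero_closed[OF E.normed[OF lm(2)]]])
  have "T m \<zero>\<^bsub>E m\<^esub> = T m (0 \<odot>\<^bsub>E m\<^esub> \<zero>\<^bsub>E m\<^esub>)"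
    by (simp add: E.coord_smult_zero lm)
  also have "\<dots> = 0 \<odot>\<^bsub>F m\<^esub> T m \<zero>\<^bsub>E m\<^esub>"
    by (rule bounded_operatorD(3)[OF bounded[OF lm(2)] zero_closed[OF E.normed[OF lm(2)]]])
  also have "\<dots> = \<zero>\<^bsub>F m\<^esub>"
  proof -
    interpret Module.module scalar_space "F m" by (rule F.module_coord[OF lm(2)])
    show ?thesis using smult_l_null[OF T0] by simp
  qed
  finally show "TS (E.inj l v) m = F.inj l (T l v) m"
    using lm by (simp add: direct_sum_op_def E.inj_def F.inj_def)
qed (simp_all add: direct_sum_op_def F.inj_def)

lemma comp_adjoint:
  assumes "f \<in> carrier (dual F.S)" "l \<in> \<Lambda>"
  shows "E.comp l (adjoint E.S TS f) = adjoint (E l) (T l) (F.comp l f)"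
  by (rule extensionalityI[where A = "carrier (E l)"])
    (simp_all add: E.comp_def F.comp_def adjoint_def E.inj_closed TS_inj T_closed assms)

end

text \<open>Embeds the dual of one summand into the dual of the direct sum, along the projection
  onto that summand.\<close>

lemma (in normed_family) lift_closed:
  assumes g: "g \<in> carrier (dual (E l))" and l: "l \<in> \<Lambda>"
  shows "(\<lambda>y\<in>carrier S. g (y l)) \<in> carrier (dual S)"
    and "op_norm S scalar_space (\<lambda>y\<in>carrier S. g (y l)) \<le> op_norm (E l) scalar_space g"
proof -
  let ?n = "op_norm (E l) scalar_space g"
  have n: "0 \<le> ?n" by (rule dual_norm_nonneg[OF normed[OF l] g])
  have le: "norm (g (y l)) \<le> ?n * nrm S y" if y: "y \<in> carrier S" for y
  proof -
    have "norm (g (y l)) \<le> ?n * nrm (E l) (y l)"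
      by (rule norm_functional_le[OF normed[OF l] g S_coord[OF y l]])
    also have "\<dots> \<le> ?n * nrm S y" by (rule mult_left_mono[OF coord_le_nrm_S[OF y l] n])
    finally show ?thesis .
  qed
  then have "\<forall>y\<in>carrier S. norm ((\<lambda>y\<in>carrier S. g (y l)) y) \<le> ?n * nrm S y" by simp
  then have "\<exists>C. \<forall>y\<in>carrier S. norm ((\<lambda>y\<in>carrier S. g (y l)) y) \<le> C * nrm S y" ..
  moreover have "(\<lambda>l\<in>\<Lambda>. x l \<oplus>\<^bsub>E l\<^esub> y l) \<in> carrier S" if "x \<in> carrier S" "y \<in> carrier S" for x y
    using S_add_closed[OF that] .
  ultimately show "(\<lambda>y\<in>carrier S. g (y l)) \<in> carrier (dual S)" unfolding in_carrier_dual_iff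
    using S_smult_closed
    by (simp add: l S_coord functional_add[OF normed[OF l] g] functional_smult[OF normed[OF l] g])
  show "op_norm S scalar_space (\<lambda>y\<in>carrier S. g (y l)) \<le> ?n"
    by (rule dual_norm_leI[OF normed_space_S n]) (simp add: le)
qed

locale szlenk_family = ordinals cardinality + operator_family p \<Lambda> E F T C
  for cardinality :: "'u itself" and p :: real and \<Lambda> :: "'i set"
    and E :: "'i \<Rightarrow> ('k::{real_normed_field, euclidean_space}, 'a) nspace"
    and F :: "'i \<Rightarrow> ('k, 'b) nspace" and T :: "'i \<Rightarrow> 'a \<Rightarrow> 'b" and C :: real
begin

text \<open>Composition with the projection onto \<open>E l\<close> is weak-star continuous and maps
  the adjoint image of the dual ball for \<open>T l\<close> into that for the sum. It does not
  shrink distances, because testing on \<open>E.inj l x\<close> recovers the values at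
  \<open>x\<close>; so \<open>\<epsilon>\<close> is kept.\<close>

lemma Sz_eps_op_component_subset:
  assumes l: "l \<in> \<Lambda>"
  shows "(Sz_eps_op (E l) (F l) \<epsilon> (T l) :: 'u ordinal set) \<subseteq> Sz_eps_op E.S F.S \<epsilon> TS"
proof
  fix \<alpha> :: "'u ordinal"
  let ?K = "adjoint (E l) (T l) ` unit_ball (dual (F l))" and ?KS = "adjoint E.S TS ` unit_ball (dual F.S)"
  let ?\<phi> = "\<lambda>g. (\<lambda>y\<in>carrier E.S. g (y l))"
  have K: "?K \<subseteq> carrier (dual (E l))"
    by (rule adjoint_unit_ball_subset[OF E.normed[OF l] F.normed[OF l] bounded[OF l]])
  have "?\<phi> ` derived (weak_star (E l)) (ndist (dual (E l))) \<epsilon> ?K \<alpha>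
      \<subseteq> derived (weak_star E.S) (ndist (dual E.S)) \<epsilon> ?KS \<alpha>"
  proof (rule image_derived_subset)
    show "continuous_map (subtopology (weak_star (E l)) ?K) (weak_star E.S) ?\<phi>"
    proof (rule continuous_map_from_subtopology, rule continuous_map_into_weak_star[OF E.normed_space_S])
      show "?\<phi> g \<in> carrier (dual E.S)" if "g \<in> topspace (weak_star (E l))" for g
        using that E.lift_closed(1)[OF _ l] by (simp add: topspace_weak_star[OF E.normed[OF l]])
      show "continuous_map (weak_star (E l)) euclidean (\<lambda>g. ?\<phi> g x)" if "x \<in> carrier E.S" for x
        using continuous_map_weak_star_eval[OF E.normed[OF l] E.S_coord[OF that l]] that by simp
    qed
    show "?K \<subseteq> topspace (weak_star (E l))" using K by (simp add: topspace_weak_star[OF E.normed[OF l]])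
    show "?\<phi> ` ?K \<subseteq> ?KS"
    proof (intro image_subsetI)
      fix k assume "k \<in> ?K"
      then obtain f where f: "f \<in> carrier (dual (F l))" "op_norm (F l) scalar_space f \<le> 1"
        "k = adjoint (E l) (T l) f" by (auto simp: unit_ball_dual)
      let ?f = "\<lambda>y\<in>carrier F.S. f (y l)"
      have "?f \<in> unit_ball (dual F.S)"
        using F.lift_closed[OF f(1) l] f(2) by (simp add: unit_ball_dual)
      moreover have "?\<phi> k = adjoint E.S TS ?f"
        by (rule extensionalityI[where A = "carrier E.S"])
          (simp_all add: f(3) adjoint_def E.S_coord[OF _ l] TS_closed direct_sum_op_def[of \<Lambda> T] l
            TS_closed[unfolded direct_sum_op_def])
      ultimately show "?\<phi> k \<in> ?KS" by simp
    qed
    fix g h assume gh: "g \<in> ?K" "h \<in> ?K" "\<epsilon> < ndist (dual (E l)) g h"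
    then have gh': "g \<in> carrier (dual (E l))" "h \<in> carrier (dual (E l))" using K by auto
    then obtain x where x: "x \<in> unit_ball (E l)" "\<epsilon> < norm (g x - h x)"
      using gh(3) less_ndist_dual_iff[OF E.normed[OF l]] by auto
    then have xc: "x \<in> carrier (E l)" "nrm (E l) x \<le> 1" by (auto simp: unit_ball_def)
    have "E.inj l x \<in> unit_ball E.S"
      using E.inj_closed[OF l xc(1)] E.nrm_inj_le[OF l xc(1)] xc(2) by (simp add: unit_ball_def)
    moreover have "\<epsilon> < norm (?\<phi> g (E.inj l x) - ?\<phi> h (E.inj l x))"
      using x(2) E.inj_closed[OF l xc(1)] l by (simp add: E.inj_def)
    ultimately show "\<epsilon> < ndist (dual E.S) (?\<phi> g) (?\<phi> h)"
      using less_ndist_dual_iff[OF E.normed_space_S E.lift_closed(1)[OF gh'(1) l] E.lift_closed(1)[OF gh'(2) l]]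
      by blast
  qed
  moreover assume "\<alpha> \<in> Sz_eps_op (E l) (F l) \<epsilon> (T l)"
  ultimately show "\<alpha> \<in> Sz_eps_op E.S F.S \<epsilon> TS"
    by (auto simp: Sz_eps_op_def Sz_eps_eq_derived)
qed

lemma Sz_eps_op_eq_atMost:
  fixes N :: "('k::{real_normed_field, euclidean_space}, 'c) nspace"
  assumes "normed_space N" "normed_space Y" "bounded_operator N Y R"
    and "(Sz_eps_op N Y \<epsilon> R :: 'u ordinal set) \<noteq> UNIV"
  obtains \<gamma> where "(Sz_eps_op N Y \<epsilon> R :: 'u ordinal set) = {..\<gamma>}"
proof -
  let ?K = "adjoint N R ` unit_ball (dual Y)"
  obtain \<alpha> :: "'u ordinal" where \<alpha>: "derived (weak_star N) (ndist (dual N)) \<epsilon> ?K \<alpha> = {}"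
    using assms(4) by (auto simp: Sz_eps_op_def Sz_eps_eq_derived)
  have "?K \<noteq> {}" using zero_in_adjoint_unit_ball[OF assms(1-3)] by auto
  then obtain \<gamma> :: "'u ordinal" where "{\<beta>. derived (weak_star N) (ndist (dual N)) \<epsilon> ?K \<beta> \<noteq> {}} = {..\<gamma>}"
    by (rule derived_index_eq_atMost[OF compactin_adjoint_unit_ball[OF assms(1-3)]
          Hausdorff_space_weak_star[OF assms(1)] _ \<alpha>])
  then show ?thesis by (intro that) (simp add: Sz_eps_op_def Sz_eps_eq_derived)
qed

text \<open>The index of the sum for a fixed \<open>\<epsilon>\<close> is a successor, hence
  strictly below the limit \<open>omega_pow \<alpha>\<close>, and it bounds the indices of all
  summands simultaneously.\<close>

lemma Sz_op_le_imp_Sz_eps_op_less: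
  assumes "0 < \<alpha>" "(Sz_op E.S F.S TS :: 'u ordinal set) \<subseteq> {..<omega_pow \<alpha>}" "0 < \<epsilon>"
  shows "(\<Union>l\<in>\<Lambda>. Sz_eps_op (E l) (F l) \<epsilon> (T l)) \<subset> {..<omega_pow (\<alpha> :: 'u ordinal)}"
proof -
  have sub: "(Sz_eps_op E.S F.S \<epsilon> TS :: 'u ordinal set) \<subseteq> {..<omega_pow \<alpha>}"
    using assms(2,3) by (auto simp: Sz_op_def Sz_def Sz_eps_op_def)
  then have "omega_pow \<alpha> \<notin> (Sz_eps_op E.S F.S \<epsilon> TS :: 'u ordinal set)" by auto
  then have "(Sz_eps_op E.S F.S \<epsilon> TS :: 'u ordinal set) \<noteq> UNIV" by auto
  then obtain \<gamma> :: "'u ordinal" where \<gamma>: "Sz_eps_op E.S F.S \<epsilon> TS = {..\<gamma>}"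
    by (rule Sz_eps_op_eq_atMost[OF E.normed_space_S F.normed_space_S bounded_operator_TS])
  have "osucc \<gamma> < omega_pow \<alpha>"
    using sub unfolding \<gamma> by (intro limit_ordinal_osucc_less limit_ordinal_omega_pow assms(1)) auto
  moreover have "osucc \<gamma> \<notin> {..\<gamma>}" using less_osucc[of \<gamma>] by (simp add: not_le)
  moreover have "(\<Union>l\<in>\<Lambda>. Sz_eps_op (E l) (F l) \<epsilon> (T l)) \<subseteq> {..\<gamma>}"
    using Sz_eps_op_component_subset unfolding \<gamma>[symmetric] by (intro UN_least)
  ultimately show ?thesis using sub unfolding \<gamma> by auto
qed

end

section \<open>The upper bound for the Szlenk index of a direct sum\<close>

lemma ndist_dual_nonneg:
  assumes "normed_space N" "f \<in> carrier (dual N)" "g \<in> carrier (dual N)"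
  shows "0 \<le> ndist (dual N) f g"
  using norm_diff_le_ndist_dual[OF assms zero_in_unit_ball[OF assms(1)]] norm_ge_zero order_trans by blast

lemma (in normed_family) continuous_map_comp:
  assumes "l \<in> \<Lambda>"
  shows "continuous_map (weak_star S) (weak_star (E l)) (comp l)"
proof (rule continuous_map_into_weak_star[OF normed[OF assms]])
  show "comp l f \<in> carrier (dual (E l))" if "f \<in> topspace (weak_star S)" for f
    using that comp_closed[OF _ assms] by (simp add: topspace_weak_star[OF normed_space_S])
  show "continuous_map (weak_star S) euclidean (\<lambda>f. comp l f x)" if "x \<in> carrier (E l)" for x
    using continuous_map_weak_star_eval[OF normed_space_S inj_closed[OF assms that]] that
    by (simp add: comp_def)
qed

lemma scale_between:
  fixes a b :: real
  assumes "0 < a" "a < b"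
  obtains t where "0 < t" "t < 1" "a < t * b"
proof -
  obtain z where z: "a < z" "z < b" using dense[OF assms(2)] by auto
  show ?thesis by (rule that[of "z / b"]) (use assms z in simp_all)
qed

text \<open>On a coordinate where both \<open>n\<close> and \<open>n'\<close> are at most \<open>2 w\<close> and \<open>h\<close> is not small, \<open>h\<close> is controlled
  by the weight; on all other coordinates it is controlled by the slack \<open>s\<close> or is small.\<close>

lemma sum_le_weight_and_slack:
  fixes n n' w h :: "'i \<Rightarrow> real"
  assumes fin: "finite G" "finite H" and GH: "G \<subseteq> \<Lambda>" "H \<subseteq> \<Lambda>"
    and n: "\<And>J. finite J \<Longrightarrow> J \<subseteq> \<Lambda> \<Longrightarrow> (\<Sum>l\<in>J. n l) \<le> c"
    and n': "\<And>J. finite J \<Longrightarrow> J \<subseteq> \<Lambda> \<Longrightarrow> (\<Sum>l\<in>J. n' l) \<le> c"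
    and w: "\<And>l. l \<in> G \<Longrightarrow> 0 < w l \<and> w l < n l \<and> w l < n' l"
    and s: "c - (\<Sum>l\<in>G. w l) \<le> s"
    and h: "\<And>l. l \<in> \<Lambda> \<Longrightarrow> 0 \<le> h l \<and> h l \<le> D * (n l + n' l)" and D: "0 \<le> D" and \<kappa>: "0 \<le> \<kappa>"
  shows "(\<Sum>l\<in>H. h l) \<le> 10 * D * s + \<kappa> * c
    + 4 * D * (\<Sum>l\<in>{l \<in> G. n l \<le> 2 * w l \<and> n' l \<le> 2 * w l \<and> \<kappa> * w l < h l}. w l)"
proof -
  let ?B = "{l \<in> G. n l \<le> 2 * w l \<and> n' l \<le> 2 * w l \<and> \<kappa> * w l < h l}"
  have nG: "(\<Sum>l\<in>G. w l) \<le> (\<Sum>l\<in>G. n l)" "(\<Sum>l\<in>G. w l) \<le> (\<Sum>l\<in>G. n' l)"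
    using w by (simp_all add: sum_mono less_imp_le)
  have "(\<Sum>l\<in>H. h l) \<le> (\<Sum>l\<in>(H - G) \<union> G. h l)"
    using fin GH h by (intro sum_mono2) auto
  also have "\<dots> = (\<Sum>l\<in>H - G. h l) + (\<Sum>l\<in>G. h l)"
    using fin by (intro sum.union_disjoint) auto
  also have "(\<Sum>l\<in>H - G. h l) \<le> 2 * D * s"
  proof -
    \<comment> \<open>Each of the two families has total at most \<open>c\<close>, of which at least
      the sum of \<open>w\<close> lies on \<open>G\<close>; outside \<open>G\<close> at most
      \<open>s\<close> is left.\<close>
    have tail: "(\<Sum>l\<in>H - G. m l) \<le> s"
      if m: "\<And>J. finite J \<Longrightarrow> J \<subseteq> \<Lambda> \<Longrightarrow> (\<Sum>l\<in>J. m l) \<le> c" "(\<Sum>l\<in>G. w l) \<le> (\<Sum>l\<in>G. m l)" for m :: "'i \<Rightarrow> real"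
    proof -
      have "(\<Sum>l\<in>H - G. m l) + (\<Sum>l\<in>G. m l) = (\<Sum>l\<in>(H - G) \<union> G. m l)"
        using fin by (intro sum.union_disjoint[symmetric]) auto
      also have "\<dots> \<le> c" using fin GH by (intro m(1)) auto
      finally show ?thesis using m(2) s by linarith
    qed
    have "(\<Sum>l\<in>H - G. h l) \<le> (\<Sum>l\<in>H - G. D * (n l + n' l))"
      using GH h by (intro sum_mono) auto
    also have "\<dots> = D * ((\<Sum>l\<in>H - G. n l) + (\<Sum>l\<in>H - G. n' l))"
      by (simp only: sum_distrib_left sum.distrib distrib_left)
    also have "\<dots> \<le> D * (s + s)"
      by (intro mult_left_mono add_mono tail n n' nG D)
    finally show ?thesis by simp
  qed
  also have "(\<Sum>l\<in>G. h l) \<le> (\<Sum>l\<in>G. 4 * D * (if l \<in> ?B then w l else 0) + \<kappa> * w l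
      + 4 * D * (n l - w l) + 4 * D * (n' l - w l))"
  proof (rule sum_mono)
    fix l assume l: "l \<in> G"
    then have wl: "0 < w l" "w l < n l" "w l < n' l" using w by auto
    have hl: "h l \<le> D * (n l + n' l)" using h GH l by auto
    have pos: "0 \<le> 4 * D * (n l - w l)" "0 \<le> 4 * D * (n' l - w l)" "0 \<le> \<kappa> * w l"
      using wl D \<kappa> by auto
    consider "l \<in> ?B" | "n l \<le> 2 * w l" "n' l \<le> 2 * w l" "h l \<le> \<kappa> * w l" "l \<notin> ?B"
      | "\<not> (n l \<le> 2 * w l \<and> n' l \<le> 2 * w l)" "l \<notin> ?B" using l by force
    then show "h l \<le> 4 * D * (if l \<in> ?B then w l else 0) + \<kappa> * w l + 4 * D * (n l - w l) + 4 * D * (n' l - w l)"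
    proof cases
      case 1
      then have "D * (n l + n' l) \<le> D * (4 * w l)" using D by (intro mult_left_mono) auto
      then have "h l \<le> 4 * D * w l" using hl by linarith
      then show ?thesis using 1 pos by (simp only: if_True)
    next
      case 2
      then show ?thesis using pos by (simp only: if_False)
    next
      case 3
      then have "2 * w l < n l \<or> 2 * w l < n' l" by auto
      \<comment> \<open>If one of the two numbers exceeds \<open>2 * w l\<close>, its excess over
        \<open>w l\<close> is larger than \<open>w l\<close>, and the two excesses pay for the
        whole.\<close>
      then have "n l + n' l \<le> 4 * (n l - w l) + 4 * (n' l - w l)" using wl by (elim disjE) argo+
      then have "D * (n l + n' l) \<le> D * (4 * (n l - w l) + 4 * (n' l - w l))"
        using D by (rule mult_left_mono)
      also have "\<dots> = 4 * D * (n l - w l) + 4 * D * (n' l - w l)" by (simp add: algebra_simps)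
      finally have "h l \<le> 4 * D * (n l - w l) + 4 * D * (n' l - w l)" using hl by linarith
      then show ?thesis using 3(2) pos by (simp only: if_False)
    qed
  qed
  also have "\<dots> = 4 * D * (\<Sum>l\<in>?B. w l) + \<kappa> * (\<Sum>l\<in>G. w l)
      + 4 * D * ((\<Sum>l\<in>G. n l) - (\<Sum>l\<in>G. w l)) + 4 * D * ((\<Sum>l\<in>G. n' l) - (\<Sum>l\<in>G. w l))"
  proof -
    have "G \<inter> ?B = ?B" by auto
    then have "(\<Sum>l\<in>G. if l \<in> ?B then w l else 0) = (\<Sum>l\<in>?B. w l)"
      using sum.inter_restrict[OF fin(1), of w ?B] by simp
    then show ?thesis by (simp only: sum.distrib sum_distrib_left[symmetric] sum_subtractf)
  qed
  also have "\<dots> \<le> 4 * D * (\<Sum>l\<in>?B. w l) + \<kappa> * c + 4 * D * s + 4 * D * s"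
    using n[OF fin(1) GH(1)] n'[OF fin(1) GH(1)] nG s D \<kappa> by (intro add_mono mult_left_mono order_refl) auto
  \<comment> \<open>The coefficient 10 collects 2 from the coordinates outside \<open>G\<close> and
    4 from each of the two excesses on \<open>G\<close>.\<close>
  finally show ?thesis by (simp add: algebra_simps)
qed

context szlenk_family
begin

abbreviation q :: real where "q \<equiv> conj_exp p"

text \<open>The distance in the dual of the domain, pulled back along the adjoint: a pseudometric
  that vanishes on functionals with equal images.\<close>

definition dist_T :: "(('i \<Rightarrow> 'b) \<Rightarrow> 'k) \<Rightarrow> (('i \<Rightarrow> 'b) \<Rightarrow> 'k) \<Rightarrow> real" where
  "dist_T f g = ndist (dual E.S) (adjoint E.S TS f) (adjoint E.S TS g)"

definition dist_comp :: "'i \<Rightarrow> (('i \<Rightarrow> 'b) \<Rightarrow> 'k) \<Rightarrow> (('i \<Rightarrow> 'b) \<Rightarrow> 'k) \<Rightarrow> real" where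
  "dist_comp l f g = ndist (dual (E l)) (adjoint (E l) (T l) (F.comp l f)) (adjoint (E l) (T l) (F.comp l g))"

definition norm_comp :: "'i \<Rightarrow> (('i \<Rightarrow> 'b) \<Rightarrow> 'k) \<Rightarrow> real" where
  "norm_comp l f = op_norm (F l) scalar_space (F.comp l f)"

section \<open>Norms and distances of the coordinates of functionals\<close>

lemma q_ge_1: "1 \<le> q"
  by (rule conj_exp(1)[OF E.p])

lemma norm_comp_nonneg: "f \<in> carrier (dual F.S) \<Longrightarrow> l \<in> \<Lambda> \<Longrightarrow> 0 \<le> norm_comp l f"
  unfolding norm_comp_def by (rule dual_norm_nonneg[OF F.normed F.comp_closed])

lemma adjoint_comp_closed:
  "f \<in> carrier (dual F.S) \<Longrightarrow> l \<in> \<Lambda> \<Longrightarrow> adjoint (E l) (T l) (F.comp l f) \<in> carrier (dual (E l))"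
  by (rule adjoint_closed[OF E.normed F.normed bounded F.comp_closed])

lemma adjoint_TS_closed: "f \<in> carrier (dual F.S) \<Longrightarrow> adjoint E.S TS f \<in> carrier (dual E.S)"
  by (rule adjoint_closed[OF E.normed_space_S F.normed_space_S bounded_operator_TS])

lemma dist_comp_nonneg:
  "f \<in> carrier (dual F.S) \<Longrightarrow> g \<in> carrier (dual F.S) \<Longrightarrow> l \<in> \<Lambda> \<Longrightarrow> 0 \<le> dist_comp l f g"
  unfolding dist_comp_def by (intro ndist_dual_nonneg E.normed adjoint_comp_closed)

text \<open>Provides the constant \<open>D = (2 * C) powr q\<close> of the weight estimate: a sum of
  two norms is at most twice the larger one.\<close>

lemma dist_comp_powr_le:
  assumes f: "f \<in> carrier (dual F.S)" and g: "g \<in> carrier (dual F.S)" and l: "l \<in> \<Lambda>"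
  shows "dist_comp l f g powr q \<le> (2 * C) powr q * (norm_comp l f powr q + norm_comp l g powr q)"
proof -
  let ?a = "norm_comp l f" and ?b = "norm_comp l g"
  have ab: "0 \<le> ?a" "0 \<le> ?b" using f g l by (auto intro: norm_comp_nonneg)
  have q0: "0 \<le> q" using q_ge_1 by simp
  have "dist_comp l f g \<le> C * (?a + ?b)"
    unfolding dist_comp_def norm_comp_def
    by (rule ndist_adjoint_le[OF E.normed[OF l] F.normed[OF l] bounded[OF l] F.comp_closed[OF f l]
          F.comp_closed[OF g l] op_norm_le_C[OF l]])
  also have "\<dots> \<le> C * (2 * max ?a ?b)" using C_nonneg by (intro mult_left_mono) auto
  finally have "dist_comp l f g powr q \<le> (C * (2 * max ?a ?b)) powr q"
    by (rule powr_mono2[OF q0 dist_comp_nonneg[OF f g l]])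
  also have "\<dots> = (2 * C) powr q * max ?a ?b powr q"
    using C_nonneg ab by (simp add: powr_mult[symmetric] mult.assoc mult.left_commute)
  also have "\<dots> \<le> (2 * C) powr q * (?a powr q + ?b powr q)"
    by (intro mult_left_mono) (auto simp: max_def)
  finally show ?thesis .
qed

text \<open>The components of the difference of the two images have norms
  \<open>dist_comp l f g\<close>. Were all their finite ell_q-sums at most \<open>e powr q\<close>,
  then \<open>dual_norm_S_le\<close> would bound the distance by \<open>e\<close>.\<close>

lemma less_dist_T_imp:
  assumes f: "f \<in> carrier (dual F.S)" and g: "g \<in> carrier (dual F.S)" and e: "0 \<le> e" "e < dist_T f g"
  obtains H where "finite H" "H \<subseteq> \<Lambda>" "e powr q < (\<Sum>l\<in>H. dist_comp l f g powr q)"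
proof -
  let ?f = "adjoint E.S TS f" and ?g = "adjoint E.S TS g"
  let ?k = "\<lambda>x\<in>carrier E.S. ?f x - ?g x"
  have fg: "?f \<in> carrier (dual E.S)" "?g \<in> carrier (dual E.S)" by (rule adjoint_TS_closed[OF f], rule adjoint_TS_closed[OF g])
  have k: "?k \<in> carrier (dual E.S)" by (rule dual_diff_closed[OF E.normed_space_S fg])
  have comp_k: "op_norm (E l) scalar_space (E.comp l ?k) = dist_comp l f g" if l: "l \<in> \<Lambda>" for l
  proof -
    have "E.comp l ?k = (\<lambda>v\<in>carrier (E l). E.comp l ?f v - E.comp l ?g v)"
      by (auto simp: E.comp_def E.inj_closed[OF l] fun_eq_iff)
    then have "E.comp l ?k = (\<lambda>v\<in>carrier (E l). adjoint (E l) (T l) (F.comp l f) v - adjoint (E l) (T l) (F.comp l g) v)"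
      by (simp only: comp_adjoint[OF f l] comp_adjoint[OF g l])
    then show ?thesis unfolding dist_comp_def
      by (simp only: ndist_dual[OF E.normed[OF l] adjoint_comp_closed[OF f l] adjoint_comp_closed[OF g l]])
  qed
  have "\<not> op_norm E.S scalar_space ?k \<le> e"
    using e(2) unfolding dist_T_def by (simp only: ndist_dual[OF E.normed_space_S fg] not_le)
  then have "\<exists>H. finite H \<and> H \<subseteq> \<Lambda> \<and> \<not> (\<Sum>l\<in>H. op_norm (E l) scalar_space (E.comp l ?k) powr q) \<le> e powr q"
    using E.dual_norm_S_le[OF k e(1)] by blast
  then obtain H where H: "finite H" "H \<subseteq> \<Lambda>"
    "\<not> (\<Sum>l\<in>H. op_norm (E l) scalar_space (E.comp l ?k) powr q) \<le> e powr q" by (elim exE conjE)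
  moreover have "(\<Sum>l\<in>H. op_norm (E l) scalar_space (E.comp l ?k) powr q) = (\<Sum>l\<in>H. dist_comp l f g powr q)"
    by (rule sum.cong[OF refl]) (use H(2) comp_k in auto)
  ultimately show ?thesis using that[of H] by (simp only: not_le)
qed

lemma openin_norm_comp:
  assumes "l \<in> \<Lambda>" "0 \<le> s"
  shows "openin (weak_star F.S) {g \<in> carrier (dual F.S). s < norm_comp l g powr q}"
proof -
  have q1: "0 < q" using q_ge_1 by simp
  have "s < norm_comp l g powr q \<longleftrightarrow> s powr (1 / q) < norm_comp l g" if "g \<in> carrier (dual F.S)" for g
  proof
    assume "s < norm_comp l g powr q"
    then have "s powr (1 / q) < (norm_comp l g powr q) powr (1 / q)"
      using assms(2) q1 by (intro powr_less_mono2) auto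
    then show "s powr (1 / q) < norm_comp l g" using q1 norm_comp_nonneg[OF that assms(1)] by (simp add: powr_powr)
  next
    assume "s powr (1 / q) < norm_comp l g"
    then have "(s powr (1 / q)) powr q < norm_comp l g powr q" using q1 by (intro powr_less_mono2) auto
    then show "s < norm_comp l g powr q" using q1 assms(2) by (simp add: powr_powr)
  qed
  then have "{g \<in> carrier (dual F.S). s < norm_comp l g powr q}
    = {g \<in> topspace (weak_star F.S). F.comp l g \<in> {h \<in> carrier (dual (F l)). s powr (1 / q) < op_norm (F l) scalar_space h}}"
    using F.comp_closed[OF _ assms(1)] unfolding topspace_weak_star[OF F.normed_space_S] norm_comp_def by auto
  also have "openin (weak_star F.S) \<dots>"
    by (rule openin_continuous_map_preimage[OF F.continuous_map_comp[OF assms(1)]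
          openin_weak_star_dual_norm[OF F.normed[OF assms(1)]]])
  finally show ?thesis .
qed

text \<open>Division by a bound \<open>t\<close> of the coordinate norm moves the image of the
  coordinate into \<open>K l\<close>, so that the ranks of one fixed set serve coordinates of every
  size.\<close>

definition rescale :: "'i \<Rightarrow> real \<Rightarrow> (('i \<Rightarrow> 'b) \<Rightarrow> 'k) \<Rightarrow> 'a \<Rightarrow> 'k" where
  "rescale l t g = adjoint (E l) (T l) (\<lambda>v\<in>carrier (F l). of_real (1 / t) * F.comp l g v)"

abbreviation K :: "'i \<Rightarrow> ('a \<Rightarrow> 'k) set" where
  "K l \<equiv> adjoint (E l) (T l) ` unit_ball (dual (F l))"

section \<open>Rescaled coordinates\<close>

lemma rescale_apply:
  assumes "l \<in> \<Lambda>" "v \<in> carrier (E l)"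
  shows "rescale l t g v = of_real (1 / t) * adjoint (E l) (T l) (F.comp l g) v"
  using assms by (simp add: rescale_def adjoint_def T_closed)

lemma rescale_closed:
  assumes "g \<in> carrier (dual F.S)" "l \<in> \<Lambda>"
  shows "rescale l t g \<in> carrier (dual (E l))"
  unfolding rescale_def
  by (rule adjoint_closed[OF E.normed F.normed bounded dual_smult_closed[OF F.normed F.comp_closed]])
    (use assms in auto)

lemma rescale_in_K:
  assumes g: "g \<in> carrier (dual F.S)" and l: "l \<in> \<Lambda>" and t: "0 < t" "norm_comp l g \<le> t"
  shows "rescale l t g \<in> K l"
proof -
  let ?h = "\<lambda>v\<in>carrier (F l). of_real (1 / t) * F.comp l g v"
  have "op_norm (F l) scalar_space ?h \<le> 1"
  proof (rule dual_norm_leI[OF F.normed[OF l]])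
    fix v assume v: "v \<in> carrier (F l)"
    have "norm (F.comp l g v) \<le> norm_comp l g * nrm (F l) v"
      unfolding norm_comp_def by (rule norm_functional_le[OF F.normed[OF l] F.comp_closed[OF g l] v])
    also have "\<dots> \<le> t * nrm (F l) v" by (rule mult_right_mono[OF t(2) nrm_nonneg[OF F.normed[OF l] v]])
    finally have "norm (F.comp l g v) / t \<le> nrm (F l) v" using t(1) by (simp add: divide_le_eq mult.commute)
    then show "norm (?h v) \<le> 1 * nrm (F l) v" using v t(1) by (simp add: norm_mult norm_divide)
  qed simp
  then have "?h \<in> unit_ball (dual (F l))"
    using dual_smult_closed[OF F.normed[OF l] F.comp_closed[OF g l], of "of_real (1 / t)"]
    by (simp only: unit_ball_dual mem_Collect_eq)
  then show ?thesis unfolding rescale_def by (rule imageI)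
qed

lemma continuous_map_rescale:
  assumes l: "l \<in> \<Lambda>"
  shows "continuous_map (weak_star F.S) (weak_star (E l)) (rescale l t)"
proof (rule continuous_map_into_weak_star[OF E.normed[OF l]])
  show "rescale l t g \<in> carrier (dual (E l))" if "g \<in> topspace (weak_star F.S)" for g
    using that rescale_closed[OF _ l] by (simp add: topspace_weak_star[OF F.normed_space_S])
  fix x assume x: "x \<in> carrier (E l)"
  have "continuous_map (weak_star F.S) euclidean (\<lambda>g. g (F.inj l (T l x)))"
    by (rule continuous_map_weak_star_eval[OF F.normed_space_S F.inj_closed[OF l T_closed[OF l x]]])
  then have "continuous_map (weak_star F.S) euclidean ((\<lambda>z. of_real (1 / t) * z) \<circ> (\<lambda>g. g (F.inj l (T l x))))"
    by (rule continuous_map_compose)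
      (simp only: continuous_map_iff_continuous2 continuous_on_mult_const continuous_on_id)
  then show "continuous_map (weak_star F.S) euclidean (\<lambda>g. rescale l t g x)"
    using x l by (simp add: rescale_apply adjoint_def F.comp_def T_closed o_def)
qed

lemma less_ndist_rescale:
  assumes f: "f \<in> carrier (dual F.S)" and g: "g \<in> carrier (dual F.S)" and l: "l \<in> \<Lambda>"
    and t: "0 < t" "c * t < dist_comp l f g"
  shows "c < ndist (dual (E l)) (rescale l t f) (rescale l t g)"
proof -
  obtain x where x: "x \<in> unit_ball (E l)"
    "c * t < norm (adjoint (E l) (T l) (F.comp l f) x - adjoint (E l) (T l) (F.comp l g) x)"
    using t(2) less_ndist_dual_iff[OF E.normed[OF l] adjoint_comp_closed[OF f l] adjoint_comp_closed[OF g l]]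
    unfolding dist_comp_def by auto
  then have xc: "x \<in> carrier (E l)" by (simp add: unit_ball_def)
  have "norm (rescale l t f x - rescale l t g x)
    = norm (adjoint (E l) (T l) (F.comp l f) x - adjoint (E l) (T l) (F.comp l g) x) / t"
    unfolding rescale_apply[OF l xc] right_diff_distrib[symmetric] norm_mult using t(1) by (simp add: norm_divide)
  then have "c < norm (rescale l t f x - rescale l t g x)" using x(2) t(1) by (simp add: less_divide_eq)
  then show ?thesis
    using x(1) less_ndist_dual_iff[OF E.normed[OF l] rescale_closed[OF f l] rescale_closed[OF g l]] by blast
qed

text \<open>On the neighbourhood \<open>U\<close> of \<open>f\<close> the \<open>q\<close>-th powers
  of the norms stay above weights \<open>w\<close> on \<open>G\<close> with sum above
  \<open>(c * r) powr q\<close>, while membership in \<open>A\<close> limits their total to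
  \<open>c powr q\<close>. What the weights leave over is at most \<open>1 - r powr q\<close>, too
  little to explain a distance above \<open>e\<close>. So distant points differ on coordinates
  comparable to their weight, and there the ranks drop.\<close>

lemma derived_ball_local:
  fixes rk :: "'i \<Rightarrow> ('a \<Rightarrow> 'k) \<Rightarrow> 'u ordinal"
  assumes C: "0 < C" and A: "A \<subseteq> {f \<in> carrier (dual F.S). op_norm F.S scalar_space f \<le> c}"
    and c: "0 < c" "c \<le> 1" and r: "0 < r" "r < 1" and e: "0 < e" and c': "0 < c'"
    and small: "10 * (2 * C) powr q * (1 - r powr q) + 2 * c' powr q \<le> e powr q / 2"
    and rk_less: "\<And>l x. l \<in> \<Lambda> \<Longrightarrow> x \<in> K l \<Longrightarrow> rk l x < nat_mult (omega_pow \<beta>) m"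
    and rk: "\<And>l x. l \<in> \<Lambda> \<Longrightarrow> x \<in> K l \<Longrightarrow> \<exists>V. openin (weak_star (E l)) V \<and> x \<in> V \<and>
      (\<forall>y\<in>K l \<inter> V. rk l y \<le> rk l x \<and> (c' < ndist (dual (E l)) x y \<longrightarrow> rk l y < rk l x))"
    and j: "real m < real j * (e powr q / (8 * (2 * C) powr q))"
    and f: "f \<in> A" "c * r < op_norm F.S scalar_space f"
  shows "f \<notin> derived (weak_star F.S) dist_T (2 * e) A (nat_mult (omega_pow \<beta>) j)"
proof -
  let ?n = "\<lambda>l g. norm_comp l g powr q" and ?D = "(2 * C) powr q"
  have q: "0 < q" using q_ge_1 by simp
  have D: "0 < ?D" using C by simp
  have AF: "g \<in> carrier (dual F.S)" "op_norm F.S scalar_space g \<le> c" if "g \<in> A" for g using A that by auto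
  have n_sum: "(\<Sum>l\<in>J. ?n l g) \<le> c powr q" if "g \<in> A" "finite J" "J \<subseteq> \<Lambda>" for g J
  proof -
    have "(\<Sum>l\<in>J. ?n l g) \<le> op_norm F.S scalar_space g powr q"
      unfolding norm_comp_def by (rule F.sum_powr_dual_norm_comp_le[OF AF(1)[OF that(1)] that(2,3)])
    also have "\<dots> \<le> c powr q"
      using AF[OF that(1)] q by (intro powr_mono2) (auto intro: dual_norm_nonneg[OF F.normed_space_S])
    finally show ?thesis .
  qed
  let ?M = "(c * r) powr q"
  have M: "0 < ?M" using c r by simp
  have "\<exists>G. finite G \<and> G \<subseteq> \<Lambda> \<and> ?M < (\<Sum>l\<in>G. ?n l f)"
  proof (rule ccontr)
    assume "\<not> ?thesis"
    then have "op_norm F.S scalar_space f \<le> c * r"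
      using c r by (intro F.dual_norm_S_le[OF AF(1)[OF f(1)]]) (auto simp: norm_comp_def not_less)
    then show False using f(2) by simp
  qed
  then obtain G0 where G0: "finite G0" "G0 \<subseteq> \<Lambda>" "?M < (\<Sum>l\<in>G0. ?n l f)" by auto
  \<comment> \<open>Coordinates of norm 0 are dropped, so that all weights and scales are
    positive.\<close>
  define G where "G = {l \<in> G0. 0 < ?n l f}"
  have G: "finite G" "G \<subseteq> \<Lambda>" "\<And>l. l \<in> G \<Longrightarrow> 0 < ?n l f" using G0 by (auto simp: G_def)
  have sumG: "(\<Sum>l\<in>G. ?n l f) = (\<Sum>l\<in>G0. ?n l f)"
    unfolding G_def using G0(1) by (intro sum.mono_neutral_left) auto
  have "?M < (\<Sum>l\<in>G. ?n l f)" using G0(3) sumG by simp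
  \<comment> \<open>A factor slightly below 1 makes \<open>w l < ?n l f\<close> strict, so that
    \<open>f\<close> lies in the open set \<open>U\<close>, and keeps the sum of the weights above
    \<open>?M\<close>.\<close>
  then obtain \<tau> where \<tau>: "0 < \<tau>" "\<tau> < 1" and \<tau>': "?M < \<tau> * (\<Sum>l\<in>G. ?n l f)"
    by (rule scale_between[OF M])
  define w where "w l = \<tau> * ?n l f" for l
  have w: "0 < w l" if "l \<in> G" for l using \<tau> G(3)[OF that] by (simp add: w_def)
  have sum_w: "?M < (\<Sum>l\<in>G. w l)" using \<tau>' by (simp add: w_def sum_distrib_left)
  define U where "U = {g \<in> carrier (dual F.S). \<forall>l\<in>G. w l < ?n l g}"
  have U: "openin (weak_star F.S) U"
  proof (cases "G = {}")
    case True
    then have "U = topspace (weak_star F.S)" by (simp add: U_def topspace_weak_star[OF F.normed_space_S])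
    then show ?thesis by simp
  next
    case False
    then have "U = (\<Inter>l\<in>G. {g \<in> carrier (dual F.S). w l < ?n l g})" by (auto simp: U_def)
    moreover have "openin (weak_star F.S) {g \<in> carrier (dual F.S). w l < ?n l g}" if "l \<in> G" for l
      using openin_norm_comp[of l "w l"] w[OF that] G(2) that by auto
    ultimately show ?thesis using False G(1) by (simp add: openin_INT2)
  qed
  have "w l < ?n l f" if "l \<in> G" for l using \<tau> G(3)[OF that] by (simp add: w_def)
  then have fU: "f \<in> U" using AF(1)[OF f(1)] by (simp add: U_def)
  \<comment> \<open>One scale per coordinate, common to all functionals in \<open>A\<close> whose
    coordinate is at most \<open>2 * w l\<close> in \<open>q\<close>-th power; by
    \<open>good\<close> their rescaled coordinates lie in \<open>K l\<close>.\<close>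
  define t where "t l = (2 * w l) powr (1 / q)" for l
  have t: "0 < t l" "t l powr q = 2 * w l" if "l \<in> G" for l
    using w[OF that] q by (simp_all add: t_def powr_powr)
  have good: "norm_comp l g \<le> t l" if "g \<in> A" "l \<in> G" "?n l g \<le> 2 * w l" for g l
  proof -
    have "(?n l g) powr (1 / q) \<le> t l" unfolding t_def using that(3) q by (intro powr_mono2) auto
    moreover have "0 \<le> norm_comp l g" using norm_comp_nonneg[OF AF(1)[OF that(1)]] G(2) that(2) by auto
    ultimately show ?thesis using q by (simp add: powr_powr)
  qed
  \<comment> \<open>Coordinates above \<open>2 * w l\<close> get the lowest rank. Being above is an
    open condition, so crossing the threshold near a point can only lower the rank.\<close>
  define \<rho> where "\<rho> l g = (if ?n l g \<le> 2 * w l then rk l (rescale l (t l) g) else 0)" for l g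
  \<comment> \<open>Half of \<open>e powr q\<close> is absorbed by \<open>small\<close>; the other
    half must come from the term with factor \<open>4 * ?D\<close> in
    \<open>sum_le_weight_and_slack\<close>, hence the 8.\<close>
  let ?\<theta> = "e powr q / (8 * ?D)"
  have slack: "c powr q - (\<Sum>l\<in>G. w l) \<le> 1 - r powr q"
  proof -
    have "c powr q - (\<Sum>l\<in>G. w l) \<le> c powr q * (1 - r powr q)"
      using sum_w c r by (simp add: powr_mult algebra_simps)
    also have "\<dots> \<le> 1 * (1 - r powr q)"
      using c r q powr_mono2[of q c 1] powr_mono2[of q r 1] by (intro mult_right_mono) auto
    finally show ?thesis by simp
  qed
  have rt: "rank_tuple (weak_star F.S) dist_T e G w ?\<theta> (A \<inter> U) \<rho>"
    unfolding rank_tuple_def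
  proof
    fix g assume g: "g \<in> A \<inter> U"
    have gF: "g \<in> carrier (dual F.S)" using AF(1) g by auto
    have "\<forall>l\<in>G. \<exists>V. openin (weak_star F.S) V \<and> g \<in> V \<and> (\<forall>g'\<in>A \<inter> U \<inter> V. \<rho> l g' \<le> \<rho> l g \<and>
      (?n l g \<le> 2 * w l \<and> ?n l g' \<le> 2 * w l \<and> 2 * c' powr q * w l < dist_comp l g g' powr q \<longrightarrow> \<rho> l g' < \<rho> l g))"
    proof
      fix l assume l: "l \<in> G"
      then have l': "l \<in> \<Lambda>" using G(2) by auto
      show "\<exists>V. openin (weak_star F.S) V \<and> g \<in> V \<and> (\<forall>g'\<in>A \<inter> U \<inter> V. \<rho> l g' \<le> \<rho> l g \<and>
        (?n l g \<le> 2 * w l \<and> ?n l g' \<le> 2 * w l \<and> 2 * c' powr q * w l < dist_comp l g g' powr q \<longrightarrow> \<rho> l g' < \<rho> l g))"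
      proof (cases "?n l g \<le> 2 * w l")
        case False
        let ?V = "{g \<in> carrier (dual F.S). 2 * w l < ?n l g}"
        have "openin (weak_star F.S) ?V" using openin_norm_comp[OF l', of "2 * w l"] w[OF l] by simp
        moreover have "g \<in> ?V" using False gF by simp
        moreover have "\<rho> l g' = 0" if "g' \<in> ?V" for g' using that by (simp add: \<rho>_def)
        ultimately show ?thesis using False by (intro exI[of _ ?V]) simp
      next
        case True
        have "rescale l (t l) g \<in> K l"
          using g by (intro rescale_in_K gF l' t(1)[OF l] good l True) auto
        from rk[OF l' this] obtain W where W: "openin (weak_star (E l)) W" "rescale l (t l) g \<in> W"
          and Wrk: "\<forall>y\<in>K l \<inter> W. rk l y \<le> rk l (rescale l (t l) g) \<and>
            (c' < ndist (dual (E l)) (rescale l (t l) g) y \<longrightarrow> rk l y < rk l (rescale l (t l) g))" by (elim exE conjE)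
        let ?V = "{g \<in> topspace (weak_star F.S). rescale l (t l) g \<in> W}"
        have "openin (weak_star F.S) ?V" by (rule openin_continuous_map_preimage[OF continuous_map_rescale[OF l'] W(1)])
        moreover have "g \<in> ?V" using gF W(2) by (simp add: topspace_weak_star[OF F.normed_space_S])
        moreover have "\<rho> l g' \<le> \<rho> l g \<and>
          (?n l g \<le> 2 * w l \<and> ?n l g' \<le> 2 * w l \<and> 2 * c' powr q * w l < dist_comp l g g' powr q \<longrightarrow> \<rho> l g' < \<rho> l g)"
          if g': "g' \<in> A \<inter> U \<inter> ?V" for g'
        proof (cases "?n l g' \<le> 2 * w l")
          case True': True
          have g'F: "g' \<in> carrier (dual F.S)" using AF(1) g' by auto
          have "rescale l (t l) g' \<in> K l"
            using g' by (intro rescale_in_K g'F l' t(1)[OF l] good l True') auto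
          then have mem: "rescale l (t l) g' \<in> K l \<inter> W" using g' by simp
          \<comment> \<open>Since \<open>t l powr q = 2 * w l\<close>, the threshold
            \<open>2 * c' powr q * w l\<close> means distance \<open>c'\<close> after
            rescaling.\<close>
          have dist: "c' < ndist (dual (E l)) (rescale l (t l) g) (rescale l (t l) g')"
            if "2 * c' powr q * w l < dist_comp l g g' powr q"
          proof (rule less_ndist_rescale[OF gF g'F l' t(1)[OF l]])
            have "(c' * t l) powr q = 2 * c' powr q * w l"
              using c' t[OF l] by (simp add: powr_mult)
            then have "(c' * t l) powr q < dist_comp l g g' powr q" using that by simp
            then show "c' * t l < dist_comp l g g'"
              using q dist_comp_nonneg[OF gF g'F l'] powr_mono2[of q "dist_comp l g g'" "c' * t l"]
              by (meson less_imp_le not_le)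
          qed
          show ?thesis using bspec[OF Wrk mem] dist True True' by (simp add: \<rho>_def)
        next
          case False
          then show ?thesis by (simp add: \<rho>_def)
        qed
        ultimately show ?thesis by (intro exI[of _ ?V]) simp
      qed
    qed
    from bchoice[OF this] obtain V where V: "\<forall>l\<in>G. openin (weak_star F.S) (V l) \<and> g \<in> V l \<and>
      (\<forall>g'\<in>A \<inter> U \<inter> V l. \<rho> l g' \<le> \<rho> l g \<and>
      (?n l g \<le> 2 * w l \<and> ?n l g' \<le> 2 * w l \<and> 2 * c' powr q * w l < dist_comp l g g' powr q \<longrightarrow> \<rho> l g' < \<rho> l g))" ..
    \<comment> \<open>Intersecting with the whole space makes the empty base case of the induction
      on \<open>G\<close> open.\<close>
    let ?V = "topspace (weak_star F.S) \<inter> (\<Inter>l\<in>G. V l)"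
    have "openin (weak_star F.S) ?V" using G(1) V
    proof (induction G rule: finite_induct)
      case (insert l G)
      have "topspace (weak_star F.S) \<inter> (\<Inter>l\<in>insert l G. V l) = V l \<inter> (topspace (weak_star F.S) \<inter> (\<Inter>l\<in>G. V l))"
        by auto
      then show ?case using insert by (simp add: openin_Int)
    qed simp
    moreover have "g \<in> ?V" using gF V by (simp add: topspace_weak_star[OF F.normed_space_S])
    moreover have "(\<forall>l\<in>G. \<rho> l g' \<le> \<rho> l g) \<and>
      (e < dist_T g g' \<longrightarrow> ?\<theta> \<le> (\<Sum>l\<in>{l \<in> G. \<rho> l g' < \<rho> l g}. w l))" if g': "g' \<in> A \<inter> U \<inter> ?V" for g'
    proof (intro conjI impI)
      show "\<forall>l\<in>G. \<rho> l g' \<le> \<rho> l g" using V g' by simp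
      assume dist: "e < dist_T g g'"
      have g'F: "g' \<in> carrier (dual F.S)" using AF(1) g' by auto
      obtain H where H: "finite H" "H \<subseteq> \<Lambda>" "e powr q < (\<Sum>l\<in>H. dist_comp l g g' powr q)"
        by (rule less_dist_T_imp[OF gF g'F less_imp_le[OF e] dist])
      let ?B = "{l \<in> G. ?n l g \<le> 2 * w l \<and> ?n l g' \<le> 2 * w l \<and> 2 * c' powr q * w l < dist_comp l g g' powr q}"
      have "(\<Sum>l\<in>H. dist_comp l g g' powr q) \<le> 10 * ?D * (1 - r powr q) + 2 * c' powr q * c powr q
          + 4 * ?D * (\<Sum>l\<in>?B. w l)"
      proof (rule sum_le_weight_and_slack[OF G(1) H(1) G(2) H(2) _ _ _ slack])
        show "(\<Sum>l\<in>J. ?n l g) \<le> c powr q" if "finite J" "J \<subseteq> \<Lambda>" for J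
          using n_sum[OF _ that] g by simp
        show "(\<Sum>l\<in>J. ?n l g') \<le> c powr q" if "finite J" "J \<subseteq> \<Lambda>" for J
          using n_sum[OF _ that] g' by simp
        show "0 < w l \<and> w l < ?n l g \<and> w l < ?n l g'" if "l \<in> G" for l
          using w[OF that] g g' that by (simp add: U_def)
        show "0 \<le> dist_comp l g g' powr q \<and> dist_comp l g g' powr q \<le> ?D * (?n l g + ?n l g')" if "l \<in> \<Lambda>" for l
          using dist_comp_powr_le[OF gF g'F that] by simp
      qed (use D in auto)
      also have "2 * c' powr q * c powr q \<le> 2 * c' powr q * 1"
        using c q powr_mono2[of q c 1] by (intro mult_left_mono) auto
      finally have "e powr q < e powr q / 2 + 4 * ?D * (\<Sum>l\<in>?B. w l)" using H(3) small by simp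
      then have "e powr q \<le> 8 * ?D * (\<Sum>l\<in>?B. w l)" by simp
      then have "?\<theta> \<le> (\<Sum>l\<in>?B. w l)" using D by (simp add: divide_le_eq mult.commute)
      also have "\<dots> \<le> (\<Sum>l\<in>{l \<in> G. \<rho> l g' < \<rho> l g}. w l)"
        using G(1) V g' w by (intro sum_mono2) (auto intro: less_imp_le)
      finally show "?\<theta> \<le> (\<Sum>l\<in>{l \<in> G. \<rho> l g' < \<rho> l g}. w l)" .
    qed
    ultimately show "\<exists>V. openin (weak_star F.S) V \<and> g \<in> V \<and> (\<forall>g'\<in>A \<inter> U \<inter> V. (\<forall>l\<in>G. \<rho> l g' \<le> \<rho> l g) \<and>
      (e < dist_T g g' \<longrightarrow> ?\<theta> \<le> (\<Sum>l\<in>{l \<in> G. \<rho> l g' < \<rho> l g}. w l)))"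
      by (intro exI[of _ ?V]) simp
  qed
  have "derived (weak_star F.S) dist_T (2 * e) A (nat_mult (omega_pow \<beta>) j) \<inter> U = {}"
  proof (rule rank_tuple_derived_empty[OF G(1) _ U _ _ rt])
    show "0 \<le> w l" if "l \<in> G" for l using w[OF that] by simp
    show "dist_T y z \<le> dist_T x y + dist_T x z" if "x \<in> A" "y \<in> A" "z \<in> A" for x y z
      unfolding dist_T_def using that AF(1) by (intro ndist_dual_triangle E.normed_space_S adjoint_TS_closed)
    show "0 < ?\<theta>" using e D by simp
    show "\<rho> l g < nat_mult (omega_pow \<beta>) m" if "g \<in> A \<inter> U" "l \<in> G" for l g
    proof (cases "?n l g \<le> 2 * w l")
      case True
      have "rescale l (t l) g \<in> K l"
        using that AF(1) G(2) by (intro rescale_in_K t(1) good True) auto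
      then show ?thesis using rk_less[of l "rescale l (t l) g"] that G(2) True by (auto simp: \<rho>_def)
    next
      case False
      have "l \<in> \<Lambda>" using that G(2) by auto
      \<comment> \<open>\<open>K l\<close> contains the zero functional, whose rank lies below the
        bound; so the bound is positive and 0 an admissible rank.\<close>
      then have "rk l (\<lambda>x\<in>carrier (E l). 0) < nat_mult (omega_pow \<beta>) m"
        by (intro rk_less zero_in_adjoint_unit_ball E.normed F.normed bounded)
      then have "0 < nat_mult (omega_pow \<beta>) m" by (rule order_le_less_trans[OF zero_le_ordinal])
      then show ?thesis using False by (simp add: \<rho>_def)
    qed
    have "(\<Sum>l\<in>G. w l) \<le> (\<Sum>l\<in>G. ?n l f)" using fU by (intro sum_mono) (auto simp: U_def)
    also have "\<dots> \<le> c powr q" by (rule n_sum[OF f(1) G(1,2)])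
    also have "\<dots> \<le> 1" using c q powr_mono2[of q c 1] by simp
    finally have "real m * (\<Sum>l\<in>G. w l) \<le> real m * 1" by (intro mult_left_mono) auto
    then show "real m * (\<Sum>l\<in>G. w l) < real j * ?\<theta>" using j by simp
  qed
  then show ?thesis using fU by auto
qed

text \<open>The same \<open>\<Theta>\<close> and \<open>r\<close> serve every radius
  \<open>c\<close> up to 1 although \<open>e\<close> stays fixed: the slack
  \<open>c powr q * (1 - r powr q)\<close> is largest for \<open>c = 1\<close>. This is what allows
  the rounds to be repeated.\<close>

lemma derived_ball_step:
  assumes C: "0 < C" and \<alpha>: "0 < (\<alpha> :: 'u ordinal)" and e: "0 < e"
    and hyp: "\<And>\<epsilon>. 0 < \<epsilon> \<Longrightarrow> \<exists>\<gamma><omega_pow \<alpha>. \<forall>l\<in>\<Lambda>. derived (weak_star (E l)) (ndist (dual (E l))) \<epsilon> (K l) \<gamma> = {}"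
  obtains \<Theta> r where "\<Theta> < omega_pow \<alpha>" "0 < r" "r < 1"
    "\<And>c A. 0 < c \<Longrightarrow> c \<le> 1 \<Longrightarrow> A \<subseteq> {f \<in> carrier (dual F.S). op_norm F.S scalar_space f \<le> c} \<Longrightarrow>
      derived (weak_star F.S) dist_T (2 * e) A \<Theta> \<subseteq> {f \<in> carrier (dual F.S). op_norm F.S scalar_space f \<le> c * r}"
proof -
  let ?D = "(2 * C) powr q" and ?\<nu> = "e powr q"
  have q: "0 < q" using q_ge_1 by simp
  have D: "0 < ?D" and \<nu>: "0 < ?\<nu>" using C e by simp_all
  \<comment> \<open>\<open>\<eta>\<close> is \<open>1 - r powr q\<close>. The bound
    \<open>1 / 2\<close> keeps \<open>r\<close> positive, the other one gives the term
    \<open>10 * ?D * \<eta>\<close> at most a quarter of \<open>e powr q\<close>.\<close>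
  define \<eta> where "\<eta> = min (1 / 2) (?\<nu> / (40 * ?D))"
  have "0 < ?\<nu> / (40 * ?D)" using D \<nu> by simp
  then have \<eta>: "0 < \<eta>" "\<eta> < 1" "\<eta> \<le> ?\<nu> / (40 * ?D)" unfolding \<eta>_def by auto
  have D\<eta>: "10 * ?D * \<eta> \<le> ?\<nu> / 4" using mult_left_mono[OF \<eta>(3), of "10 * ?D"] D by simp
  define r where "r = (1 - \<eta>) powr (1 / q)"
  have rq: "r powr q = 1 - \<eta>" using \<eta> q by (simp add: r_def powr_powr)
  have r0: "0 < r" using \<eta> by (simp add: r_def)
  have r1: "r < 1"
  proof (rule ccontr)
    assume "\<not> r < 1"
    then have "1 powr q \<le> r powr q" using q by (intro powr_mono2) auto
    then show False using rq \<eta> by simp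
  qed
  \<comment> \<open>Chosen such that \<open>2 * c' powr q\<close> is the second quarter of
    \<open>e powr q\<close>.\<close>
  define c' where "c' = (?\<nu> / 8) powr (1 / q)"
  have c': "0 < c'" "c' powr q = ?\<nu> / 8" using \<nu> q by (simp_all add: c'_def powr_powr)
  have small: "10 * ?D * (1 - r powr q) + 2 * c' powr q \<le> ?\<nu> / 2" unfolding rq c'(2) using D\<eta> by simp
  obtain \<gamma> where \<gamma>: "\<gamma> < omega_pow \<alpha>"
    "\<And>l. l \<in> \<Lambda> \<Longrightarrow> derived (weak_star (E l)) (ndist (dual (E l))) c' (K l) \<gamma> = {}"
    using hyp[OF c'(1)] by auto
  obtain \<beta> m where m: "\<beta> < \<alpha>" "\<gamma> < nat_mult (omega_pow \<beta>) m" using less_omega_pow_imp[OF \<gamma>(1) \<alpha>] by auto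
  define P where "P l s \<longleftrightarrow> (\<forall>x\<in>K l. s x < \<gamma>) \<and> (\<forall>x\<in>K l. \<exists>V. openin (weak_star (E l)) V \<and> x \<in> V \<and>
      (\<forall>y\<in>K l \<inter> V. s y \<le> s x \<and> (c' < ndist (dual (E l)) x y \<longrightarrow> s y < s x)))"
    for l and s :: "('a \<Rightarrow> 'k) \<Rightarrow> 'u ordinal"
  have "\<exists>s. P l s" if l: "l \<in> \<Lambda>" for l
  proof -
    have "K l \<subseteq> topspace (weak_star (E l))"
      using adjoint_unit_ball_subset[OF E.normed[OF l] F.normed[OF l] bounded[OF l]]
      by (simp add: topspace_weak_star[OF E.normed[OF l]])
    then obtain s :: "('a \<Rightarrow> 'k) \<Rightarrow> 'u ordinal" where "\<And>x. x \<in> K l \<Longrightarrow> s x < \<gamma>"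
      "\<And>x. x \<in> K l \<Longrightarrow> \<exists>V. openin (weak_star (E l)) V \<and> x \<in> V \<and>
        (\<forall>y\<in>K l \<inter> V. s y \<le> s x \<and> (c' < ndist (dual (E l)) x y \<longrightarrow> s y < s x))"
      by (rule derived_empty_imp_rank[OF \<gamma>(2)[OF l]]) (rule that)
    then have "P l s" unfolding P_def by simp
    then show ?thesis by (intro exI[of _ s])
  qed
  then have "\<forall>l\<in>\<Lambda>. \<exists>s. P l s" by simp
  from bchoice[OF this] obtain rk where rk: "\<forall>l\<in>\<Lambda>. P l (rk l)" ..
  have "0 < ?\<nu> / (8 * ?D)" using D \<nu> by simp
  \<comment> \<open>\<open>j\<close> does not depend on the functional, the radius or the set
    \<open>A\<close>.\<close>
  then obtain j :: nat where j: "real m < real j * (?\<nu> / (8 * ?D))"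
    using ex_less_of_nat_mult by blast
  have step: "derived (weak_star F.S) dist_T (2 * e) A (nat_mult (omega_pow \<beta>) j)
      \<subseteq> {f \<in> carrier (dual F.S). op_norm F.S scalar_space f \<le> c * r}"
    if c: "0 < c" "c \<le> 1" and A: "A \<subseteq> {f \<in> carrier (dual F.S). op_norm F.S scalar_space f \<le> c}" for c A
  proof
    fix f assume f: "f \<in> derived (weak_star F.S) dist_T (2 * e) A (nat_mult (omega_pow \<beta>) j)"
    then have fA: "f \<in> A" by (rule subsetD[OF derived_subset])
    have "\<not> c * r < op_norm F.S scalar_space f"
    proof
      assume "c * r < op_norm F.S scalar_space f"
      then have "f \<notin> derived (weak_star F.S) dist_T (2 * e) A (nat_mult (omega_pow \<beta>) j)"
      proof (rule derived_ball_local[OF C A c r0 r1 e c'(1) small _ _ j fA, rotated 2])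
        fix l x assume lx: "l \<in> \<Lambda>" "x \<in> K l"
        then have Pl: "P l (rk l)" using rk by simp
        show "rk l x < nat_mult (omega_pow \<beta>) m"
          using Pl lx(2) m(2) unfolding P_def by (meson less_trans)
        show "\<exists>V. openin (weak_star (E l)) V \<and> x \<in> V \<and>
          (\<forall>y\<in>K l \<inter> V. rk l y \<le> rk l x \<and> (c' < ndist (dual (E l)) x y \<longrightarrow> rk l y < rk l x))"
          by (rule bspec[OF conjunct2[OF Pl[unfolded P_def]] lx(2)])
      qed
      then show False using f by simp
    qed
    then show "f \<in> {f \<in> carrier (dual F.S). op_norm F.S scalar_space f \<le> c * r}" using fA A by auto
  qed
  have "osucc \<beta> \<le> \<alpha>" using m(1) by simp
  then have "osucc \<beta> < \<alpha> \<or> osucc \<beta> = \<alpha>" by (simp only: order_le_less)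
  then have "omega_pow (osucc \<beta>) \<le> omega_pow \<alpha>"
    by (elim disjE) (simp_all add: less_imp_le omega_pow_strict_mono)
  then have "nat_mult (omega_pow \<beta>) j < omega_pow \<alpha>" by (rule order_less_le_trans[OF nat_mult_omega_pow_less])
  then show ?thesis using r0 r1 step by (rule that)
qed

text \<open>After \<open>n\<close> rounds the norm is at most \<open>r ^ n\<close>. Once
  \<open>C * r ^ n < e\<close>, the adjoint leaves distances of at most \<open>2 * e\<close>, and
  one further derivation gives the empty set.\<close>

lemma derived_ball_empty:
  assumes C: "0 < C" and \<alpha>: "0 < (\<alpha> :: 'u ordinal)" and e: "0 < e"
    and hyp: "\<And>\<epsilon>. 0 < \<epsilon> \<Longrightarrow> \<exists>\<gamma><omega_pow \<alpha>. \<forall>l\<in>\<Lambda>. derived (weak_star (E l)) (ndist (dual (E l))) \<epsilon> (K l) \<gamma> = {}"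
  obtains \<xi> where "\<xi> < omega_pow \<alpha>" "derived (weak_star F.S) dist_T (2 * e) (unit_ball (dual F.S)) \<xi> = {}"
proof -
  let ?B = "unit_ball (dual F.S)" and ?ball = "\<lambda>c. {f \<in> carrier (dual F.S). op_norm F.S scalar_space f \<le> c}"
  let ?der = "derived (weak_star F.S) dist_T (2 * e) :: _ \<Rightarrow> 'u ordinal \<Rightarrow> _"
  obtain \<Theta> r where \<Theta>: "\<Theta> < omega_pow \<alpha>" and r: "0 < r" "r < 1"
    and step: "\<And>c A. 0 < c \<Longrightarrow> c \<le> 1 \<Longrightarrow> A \<subseteq> ?ball c \<Longrightarrow> ?der A \<Theta> \<subseteq> ?ball (c * r)"
    by (rule derived_ball_step[OF C \<alpha> e]) (rule hyp, assumption, rule that)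
  have "\<exists>\<xi><omega_pow \<alpha>. ?der ?B \<xi> \<subseteq> ?ball (r ^ n)" for n
  proof (induction n)
    case 0
    have "?der ?B 0 \<subseteq> ?ball (r ^ 0)" by (simp add: unit_ball_dual)
    then show ?case using omega_pow_pos[of \<alpha>] by (intro exI[of _ 0]) simp
  next
    case (Suc n)
    then obtain \<xi> where \<xi>: "\<xi> < omega_pow \<alpha>" "?der ?B \<xi> \<subseteq> ?ball (r ^ n)" by auto
    have "?der (?der ?B \<xi>) \<Theta> \<subseteq> ?ball (r ^ n * r)"
      using r by (intro step \<xi>(2)) (auto simp: power_le_one)
    then have "?der ?B (oadd \<xi> \<Theta>) \<subseteq> ?ball (r ^ Suc n)" by (simp add: derived_oadd mult.commute)
    then show ?case using oadd_less_omega_pow[OF \<xi>(1) \<Theta>] by (intro exI[of _ "oadd \<xi> \<Theta>"]) simp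
  qed
  moreover obtain n where n: "r ^ n < e / C"
    using real_arch_pow_inv[of "e / C" r] r e C by auto
  ultimately obtain \<xi> where \<xi>: "\<xi> < omega_pow \<alpha>" "?der ?B \<xi> \<subseteq> ?ball (r ^ n)" by auto
  have rn: "C * r ^ n < e" using n C by (simp add: less_divide_eq mult.commute)
  have le: "dist_T f g \<le> 2 * e" if "f \<in> ?ball (r ^ n)" "g \<in> ?ball (r ^ n)" for f g
  proof -
    have fg: "f \<in> carrier (dual F.S)" "g \<in> carrier (dual F.S)" using that by auto
    have "dist_T f g \<le> C * (op_norm F.S scalar_space f + op_norm F.S scalar_space g)"
      unfolding dist_T_def
      by (rule ndist_adjoint_le[OF E.normed_space_S F.normed_space_S bounded_operator_TS fg op_norm_TS_le])
    also have "\<dots> \<le> C * (r ^ n + r ^ n)" using that C by (intro mult_left_mono add_mono) auto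
    also have "\<dots> \<le> 2 * e" using rn by (simp add: distrib_left)
    finally show ?thesis .
  qed
  have "sder (weak_star F.S) dist_T (2 * e) (?der ?B \<xi>) = {}"
  proof (rule ccontr)
    assume "sder (weak_star F.S) dist_T (2 * e) (?der ?B \<xi>) \<noteq> {}"
    then obtain f where f: "f \<in> sder (weak_star F.S) dist_T (2 * e) (?der ?B \<xi>)" by auto
    then have "f \<in> ?ball (r ^ n)" using \<xi>(2) sder_subset[of "weak_star F.S" dist_T "2 * e" "?der ?B \<xi>"] by auto
    then have "f \<in> topspace (weak_star F.S)" by (simp add: topspace_weak_star[OF F.normed_space_S])
    then have "\<exists>y\<in>?der ?B \<xi> \<inter> topspace (weak_star F.S). \<exists>z\<in>?der ?B \<xi> \<inter> topspace (weak_star F.S). 2 * e < dist_T y z"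
      using f unfolding sder_def by simp
    then obtain y z where "y \<in> ?der ?B \<xi>" "z \<in> ?der ?B \<xi>" "2 * e < dist_T y z" by auto
    moreover have "dist_T y z \<le> 2 * e" by (rule le) (use calculation \<xi>(2) in auto)
    ultimately show False by simp
  qed
  then have "?der ?B (osucc \<xi>) = {}" by simp
  moreover have "osucc \<xi> < omega_pow \<alpha>"
    by (rule limit_ordinal_osucc_less[OF limit_ordinal_omega_pow[OF \<alpha>] \<xi>(1)])
  ultimately show ?thesis using that by auto
qed

proposition Sz_op_direct_sum_le:
  assumes C: "0 < C" and \<alpha>: "0 < (\<alpha> :: 'u ordinal)"
    and hyp: "\<And>\<epsilon>. 0 < \<epsilon> \<Longrightarrow> (\<Union>l\<in>\<Lambda>. Sz_eps_op (E l) (F l) \<epsilon> (T l)) \<subset> {..<omega_pow \<alpha>}"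
  shows "Sz_op E.S F.S TS \<subseteq> {..<omega_pow \<alpha>}"
proof
  fix \<beta> :: "'u ordinal" assume "\<beta> \<in> Sz_op E.S F.S TS"
  then obtain \<epsilon> where \<epsilon>: "0 < \<epsilon>" "\<beta> \<in> Sz_eps E.S \<epsilon> (adjoint E.S TS ` unit_ball (dual F.S))"
    by (auto simp: Sz_op_def Sz_def)
  let ?B = "unit_ball (dual F.S)"
  \<comment> \<open>Factor 2 from the rank tuples and factor 2 from passing to the image under the
    adjoint.\<close>
  have e: "0 < \<epsilon> / 4" using \<epsilon> by simp
  \<comment> \<open>Properness of the inclusion yields a single \<open>\<gamma>\<close> outside the
    indices of all summands, which is the uniform bound on ranks.\<close>
  have hyp': "\<exists>\<gamma><omega_pow \<alpha>. \<forall>l\<in>\<Lambda>. derived (weak_star (E l)) (ndist (dual (E l))) \<epsilon>' (K l) \<gamma> = {}"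
    if \<epsilon>': "0 < \<epsilon>'" for \<epsilon>'
  proof -
    obtain \<gamma> where "\<gamma> \<in> {..<omega_pow \<alpha>}" "\<gamma> \<notin> (\<Union>l\<in>\<Lambda>. Sz_eps_op (E l) (F l) \<epsilon>' (T l))"
      using hyp[OF \<epsilon>'] by auto
    then show ?thesis by (intro exI[of _ \<gamma>]) (simp add: Sz_eps_op_def Sz_eps_eq_derived)
  qed
  obtain \<xi> where \<xi>: "\<xi> < omega_pow \<alpha>"
    "derived (weak_star F.S) dist_T (2 * (\<epsilon> / 4)) ?B \<xi> = {}"
    by (rule derived_ball_empty[OF C \<alpha> e]) (rule hyp', assumption, rule that)
  have sub: "adjoint E.S TS ` ?B \<subseteq> carrier (dual E.S)"
    by (rule adjoint_unit_ball_subset[OF E.normed_space_S F.normed_space_S bounded_operator_TS])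
  have "derived (weak_star E.S) (ndist (dual E.S)) (2 * (2 * (\<epsilon> / 4))) (adjoint E.S TS ` ?B) \<xi>
      \<subseteq> adjoint E.S TS ` derived (weak_star F.S)
        (\<lambda>f g. ndist (dual E.S) (adjoint E.S TS f) (adjoint E.S TS g)) (2 * (\<epsilon> / 4)) ?B \<xi>"
  proof (rule derived_image_subset)
    show "continuous_map (subtopology (weak_star F.S) ?B) (weak_star E.S) (adjoint E.S TS)"
      by (rule continuous_map_from_subtopology[OF
            continuous_map_adjoint[OF E.normed_space_S F.normed_space_S bounded_operator_TS]])
    show "compactin (weak_star F.S) ?B"
      by (rule compactin_unit_ball_dual[OF E.normed_space_S F.normed_space_S bounded_operator_TS])
    show "Hausdorff_space (weak_star F.S)" by (rule Hausdorff_space_weak_star[OF F.normed_space_S])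
    show "Hausdorff_space (weak_star E.S)" by (rule Hausdorff_space_weak_star[OF E.normed_space_S])
    fix x y z assume "x \<in> adjoint E.S TS ` ?B" "y \<in> adjoint E.S TS ` ?B" "z \<in> adjoint E.S TS ` ?B"
    then have "x \<in> carrier (dual E.S)" "y \<in> carrier (dual E.S)" "z \<in> carrier (dual E.S)" using sub by auto
    then show "ndist (dual E.S) y z \<le> ndist (dual E.S) x y + ndist (dual E.S) x z"
      by (rule ndist_dual_triangle[OF E.normed_space_S])
  qed
  then have empty: "derived (weak_star E.S) (ndist (dual E.S)) \<epsilon> (adjoint E.S TS ` ?B) \<xi> = {}"
    using \<xi>(2) unfolding dist_T_def[abs_def] by simp
  have "\<not> \<xi> \<le> \<beta>"
  proof
    assume "\<xi> \<le> \<beta>"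
    then have "derived (weak_star E.S) (ndist (dual E.S)) \<epsilon> (adjoint E.S TS ` ?B) \<beta> = {}"
      using derived_antimono[of \<xi> \<beta> "weak_star E.S" "ndist (dual E.S)" \<epsilon> "adjoint E.S TS ` ?B"] empty by simp
    then show False using \<epsilon>(2) by (simp add: Sz_eps_eq_derived)
  qed
  then show "\<beta> \<in> {..<omega_pow \<alpha>}" using \<xi>(1) by auto
qed

end

section \<open>The Szlenk index of an operator is a power of \<open>\<omega>\<close>\<close>

context ordinals
begin

lemma Sz_op_downward_closed:
  assumes "\<beta> \<in> (Sz_op N Y R :: 'u ordinal set)" "\<alpha> \<le> \<beta>"
  shows "\<alpha> \<in> Sz_op N Y R"
proof -
  let ?K = "adjoint N R ` unit_ball (dual Y)"
  obtain \<epsilon> where \<epsilon>: "0 < \<epsilon>" "derived (weak_star N) (ndist (dual N)) \<epsilon> ?K \<beta> \<noteq> {}"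
    using assms(1) by (auto simp: Sz_op_def Sz_def Sz_eps_eq_derived)
  then have "derived (weak_star N) (ndist (dual N)) \<epsilon> ?K \<alpha> \<noteq> {}"
    using derived_antimono[OF assms(2), of "weak_star N" "ndist (dual N)" \<epsilon> ?K] by auto
  then show ?thesis using \<epsilon>(1) by (auto simp: Sz_op_def Sz_def Sz_eps_eq_derived)
qed

text \<open>For a convex and symmetric \<open>K\<close> and \<open>x\<close> in a derived set of \<open>K\<close>, the map
  \<open>y \<mapsto> y/2 + (x - x)/4\<close> sends \<open>K\<close> into the derived set for \<open>\<epsilon>/4\<close>; so \<open>K/2\<close> can be derived further.\<close>

lemma Sz_op_oadd_closed:
  fixes N :: "('k::{real_normed_field, euclidean_space}, 'a) nspace"
  assumes N: "normed_space N" and Y: "normed_space Y" and R: "bounded_operator N Y R"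
    and \<alpha>: "\<alpha> \<in> (Sz_op N Y R :: 'u ordinal set)" and \<beta>: "\<beta> \<in> (Sz_op N Y R :: 'u ordinal set)"
  shows "oadd \<alpha> \<beta> \<in> Sz_op N Y R"
proof -
  let ?K = "adjoint N R ` unit_ball (dual Y)" and ?X = "weak_star N" and ?d = "ndist (dual N)"
  have K: "?K \<subseteq> carrier (dual N)" by (rule adjoint_unit_ball_subset[OF N Y R])
  have top: "?K \<subseteq> topspace ?X" using K by (simp add: topspace_weak_star[OF N])
  obtain \<epsilon>1 where \<epsilon>1: "0 < \<epsilon>1" "derived ?X ?d \<epsilon>1 ?K \<alpha> \<noteq> {}"
    using \<alpha> by (auto simp: Sz_op_def Sz_def Sz_eps_eq_derived)
  obtain \<epsilon>2 where \<epsilon>2: "0 < \<epsilon>2" "derived ?X ?d \<epsilon>2 ?K \<beta> \<noteq> {}"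
    using \<beta> by (auto simp: Sz_op_def Sz_def Sz_eps_eq_derived)
  define \<epsilon> where "\<epsilon> = min \<epsilon>1 \<epsilon>2"
  have \<epsilon>: "0 < \<epsilon>" "\<epsilon> \<le> \<epsilon>1" "\<epsilon> \<le> \<epsilon>2" using \<epsilon>1 \<epsilon>2 by (auto simp: \<epsilon>_def)
  obtain x where x: "x \<in> derived ?X ?d \<epsilon> ?K \<alpha>"
    using \<epsilon>1(2) derived_mono[OF subset_refl \<epsilon>(2), of ?X ?d ?K \<alpha>] by auto
  \<comment> \<open>\<open>?K\<close> is absolutely convex as regards real coefficients, being the
    linear image of a ball.\<close>
  have conv: "(\<lambda>v\<in>carrier N. of_real s * y v + of_real t * z v) \<in> ?K"
    if y: "y \<in> ?K" and z: "z \<in> ?K" and st: "\<bar>s\<bar> + \<bar>t\<bar> \<le> 1" for y z s t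
  proof -
    obtain f g where f: "f \<in> carrier (dual Y)" "op_norm Y scalar_space f \<le> 1" "y = adjoint N R f"
      and g: "g \<in> carrier (dual Y)" "op_norm Y scalar_space g \<le> 1" "z = adjoint N R g"
      using y z by (auto simp: unit_ball_dual)
    let ?h = "\<lambda>v\<in>carrier Y. of_real s * f v + of_real t * g v"
    have h: "?h \<in> carrier (dual Y)" by (rule dual_lincomb_closed[OF Y f(1) g(1)])
    have "op_norm Y scalar_space ?h \<le> 1"
    proof (rule dual_norm_leI[OF Y])
      fix v assume v: "v \<in> carrier Y"
      have fv: "norm (k v) \<le> nrm Y v" if "k \<in> carrier (dual Y)" "op_norm Y scalar_space k \<le> 1" for k
        using norm_functional_le[OF Y that(1) v] mult_right_mono[OF that(2) nrm_nonneg[OF Y v]] by simp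
      have "norm (?h v) \<le> \<bar>s\<bar> * norm (f v) + \<bar>t\<bar> * norm (g v)"
        using v norm_triangle_ineq[of "of_real s * f v" "of_real t * g v"] by (simp add: norm_mult)
      also have "\<dots> \<le> \<bar>s\<bar> * nrm Y v + \<bar>t\<bar> * nrm Y v"
        by (intro add_mono mult_left_mono fv f g) auto
      also have "\<dots> = (\<bar>s\<bar> + \<bar>t\<bar>) * nrm Y v" by (simp add: distrib_right)
      also have "\<dots> \<le> 1 * nrm Y v" by (rule mult_right_mono[OF st nrm_nonneg[OF Y v]])
      finally show "norm (?h v) \<le> 1 * nrm Y v" .
    qed simp
    then have "?h \<in> unit_ball (dual Y)" using h by (simp add: unit_ball_dual)
    moreover have "(\<lambda>v\<in>carrier N. of_real s * y v + of_real t * z v) = adjoint N R ?h"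
      by (rule extensionalityI[where A = "carrier N"])
        (simp_all add: f(3) g(3) adjoint_def bounded_operatorD(1)[OF R])
    ultimately show ?thesis by simp
  qed
  \<comment> \<open>An affine map with factor \<open>s\<close> multiplies distances by
    \<open>s\<close>, so stages for \<open>e\<close> are carried to stages for \<open>s * e\<close>
    in every \<open>B\<close> that contains the image.\<close>
  have move: "(\<lambda>v\<in>carrier N. of_real s * y v + of_real t * z v) \<in> derived ?X ?d (s * e) B \<gamma>"
    if y: "y \<in> derived ?X ?d e ?K \<gamma>" and z: "z \<in> ?K" and s: "0 < s"
      and B: "\<And>y. y \<in> ?K \<Longrightarrow> (\<lambda>v\<in>carrier N. of_real s * y v + of_real t * z v) \<in> B"
    for y z s t e B and \<gamma> :: "'u ordinal"
  proof -
    let ?\<phi> = "\<lambda>y. (\<lambda>v\<in>carrier N. of_real s * y v + of_real t * z v)"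
    have zN: "z \<in> carrier (dual N)" using z K by auto
    have closed: "?\<phi> y \<in> carrier (dual N)" if "y \<in> carrier (dual N)" for y
      by (rule dual_lincomb_closed[OF N that zN])
    have "?\<phi> ` derived ?X ?d e ?K \<gamma> \<subseteq> derived ?X ?d (s * e) B \<gamma>"
    proof (rule image_derived_subset[OF _ top])
      show "continuous_map (subtopology ?X ?K) ?X ?\<phi>"
      proof (rule continuous_map_from_subtopology, rule continuous_map_into_weak_star[OF N])
        show "?\<phi> y \<in> carrier (dual N)" if "y \<in> topspace ?X" for y
          using that closed by (simp add: topspace_weak_star[OF N])
        fix v assume v: "v \<in> carrier N"
        have "continuous_map ?X euclidean ((\<lambda>c. of_real s * c + of_real t * z v) \<circ> (\<lambda>y. y v))"
          by (rule continuous_map_compose[OF continuous_map_weak_star_eval[OF N v]])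
            (simp only: continuous_map_iff_continuous2, intro continuous_intros)
        then show "continuous_map ?X euclidean (\<lambda>y. ?\<phi> y v)" using v by (simp add: o_def)
      qed
      show "?\<phi> ` ?K \<subseteq> B" using B by auto
      fix y1 y2 assume y12: "y1 \<in> ?K" "y2 \<in> ?K" "e < ?d y1 y2"
      then have c12: "y1 \<in> carrier (dual N)" "y2 \<in> carrier (dual N)" using K by auto
      obtain v where v: "v \<in> unit_ball N" "e < norm (y1 v - y2 v)"
        using y12(3) less_ndist_dual_iff[OF N c12] by auto
      then have "v \<in> carrier N" by (simp add: unit_ball_def)
      then have "?\<phi> y1 v - ?\<phi> y2 v = of_real s * (y1 v - y2 v)" by (simp add: right_diff_distrib)
      then have "norm (?\<phi> y1 v - ?\<phi> y2 v) = s * norm (y1 v - y2 v)" using s by (simp add: norm_mult)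
      then have "s * e < norm (?\<phi> y1 v - ?\<phi> y2 v)" using v(2) s by simp
      then show "s * e < ?d (?\<phi> y1) (?\<phi> y2)"
        by (rule iffD2[OF less_ndist_dual_iff[OF N closed[OF c12(1)] closed[OF c12(2)]] bexI[OF _ v(1)]])
    qed
    then show ?thesis using y by (rule subsetD[OF _ imageI])
  qed
  have xK: "x \<in> ?K" using x by (rule subsetD[OF derived_subset])
  have half: "(\<lambda>v\<in>carrier N. of_real (1 / 2) * y v + of_real 0 * x v) \<in> derived ?X ?d (\<epsilon> / 4) ?K \<alpha>"
    if y: "y \<in> ?K" for y
  proof -
    \<comment> \<open>The map with factor \<open>1 / 4\<close> and translation \<open>3 / 4\<close>
      of \<open>?z\<close> preserves \<open>?K\<close> and must send \<open>x\<close> to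
      \<open>y / 2\<close>; solving for \<open>?z\<close> gives these coefficients, whose absolute
      values sum to 1.\<close>
    let ?z = "\<lambda>v\<in>carrier N. of_real (2 / 3) * y v + of_real (- 1 / 3) * x v"
    have z: "?z \<in> ?K" by (rule conv[OF y xK]) simp
    have "(\<lambda>v\<in>carrier N. of_real (1 / 4) * x v + of_real (3 / 4) * ?z v) \<in> derived ?X ?d (1 / 4 * \<epsilon>) ?K \<alpha>"
    proof (rule move[OF x z])
      show "(\<lambda>v\<in>carrier N. of_real (1 / 4) * y' v + of_real (3 / 4) * ?z v) \<in> ?K" if "y' \<in> ?K" for y'
        by (rule conv[OF that z]) simp
    qed simp
    moreover have "(\<lambda>v\<in>carrier N. of_real (1 / 4) * x v + of_real (3 / 4) * ?z v)
      = (\<lambda>v\<in>carrier N. of_real (1 / 2) * y v + of_real 0 * x v)"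
    proof (rule extensionalityI[where A = "carrier N"])
      fix v assume v: "v \<in> carrier N"
      have "of_real (1 / 4) * x v + of_real (3 / 4) * (of_real (2 / 3) * y v + of_real (- 1 / 3) * x v)
        = (of_real (1 / 4) + of_real (3 / 4) * of_real (- 1 / 3)) * x v + (of_real (3 / 4) * of_real (2 / 3)) * y v"
        by (simp only: algebra_simps)
      also have "\<dots> = of_real (1 / 4 + 3 / 4 * (- 1 / 3)) * x v + of_real (3 / 4 * (2 / 3)) * y v"
        by (simp only: of_real_add of_real_mult)
      finally show "(\<lambda>v\<in>carrier N. of_real (1 / 4) * x v + of_real (3 / 4) * ?z v) v
        = (\<lambda>v\<in>carrier N. of_real (1 / 2) * y v + of_real 0 * x v) v" using v by simp
    qed simp_all
    ultimately show ?thesis by simp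
  qed
  \<comment> \<open>Derived with \<open>\<epsilon> / 2\<close>, so that halving meets the parameter
    \<open>\<epsilon> / 4\<close> reached by the first \<open>\<alpha>\<close> stages.\<close>
  obtain u where u: "u \<in> derived ?X ?d (\<epsilon> / 2) ?K \<beta>"
    using \<epsilon>2(2) derived_mono[OF subset_refl, of "\<epsilon> / 2" \<epsilon>2 ?X ?d ?K \<beta>] \<epsilon> by auto
  have "(\<lambda>v\<in>carrier N. of_real (1 / 2) * u v + of_real 0 * x v)
      \<in> derived ?X ?d (1 / 2 * (\<epsilon> / 2)) (derived ?X ?d (\<epsilon> / 4) ?K \<alpha>) \<beta>"
    by (rule move[OF u xK _ half]) auto
  then have "derived ?X ?d (\<epsilon> / 4) ?K (oadd \<alpha> \<beta>) \<noteq> {}" by (auto simp: derived_oadd)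
  then show ?thesis using \<epsilon>(1) unfolding Sz_op_def Sz_def Sz_eps_eq_derived
    by (intro UN_I[of "\<epsilon> / 4"]) simp_all
qed

lemma Sz_op_eq_omega_pow:
  fixes N :: "('k::{real_normed_field, euclidean_space}, 'a) nspace"
  assumes "normed_space N" "normed_space Y" "bounded_operator N Y R"
    and "(Sz_op N Y R :: 'u ordinal set) \<noteq> UNIV"
  obtains \<beta> where "(Sz_op N Y R :: 'u ordinal set) = {..<omega_pow \<beta>}"
proof -
  let ?S = "Sz_op N Y R :: 'u ordinal set"
  define \<mu> where "\<mu> = (LEAST \<gamma>. \<gamma> \<notin> ?S)"
  obtain \<gamma> where "\<gamma> \<notin> ?S" using assms(4) by auto
  then have \<mu>: "\<mu> \<notin> ?S" unfolding \<mu>_def by (rule LeastI)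
  have S: "?S = {..<\<mu>}"
  proof (intro subset_antisym subsetI)
    fix \<beta> assume "\<beta> \<in> ?S"
    then show "\<beta> \<in> {..<\<mu>}" using \<mu> Sz_op_downward_closed[of \<beta> N Y R \<mu>] by (auto simp: not_le[symmetric])
  next
    fix \<beta> assume "\<beta> \<in> {..<\<mu>}"
    then have "\<beta> < (LEAST \<gamma>. \<gamma> \<notin> ?S)" by (simp add: \<mu>_def)
    from not_less_Least[OF this] show "\<beta> \<in> ?S" by simp
  qed
  have "0 \<in> ?S"
    using zero_in_adjoint_unit_ball[OF assms(1-3)] unfolding Sz_op_def Sz_def Sz_eps_eq_derived
    by (intro UN_I[of 1]) auto
  then have "0 < \<mu>" unfolding S by simp
  moreover have "oadd \<alpha> \<beta> < \<mu>" if "\<alpha> < \<mu>" "\<beta> < \<mu>" for \<alpha> \<beta>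
    using Sz_op_oadd_closed[OF assms(1-3), of \<alpha> \<beta>] that unfolding S by simp
  ultimately have "\<exists>\<beta>. \<mu> = omega_pow \<beta>" by (rule oadd_closed_imp_omega_pow)
  then obtain \<beta> where "\<mu> = omega_pow \<beta>" ..
  then show ?thesis using S that by simp
qed

end

section \<open>The Hahn-Banach theorem\<close>

text \<open>A minimal sublinear functional is linear, so Zorn's lemma for sublinear functionals suffices.\<close>

definition sublinear :: "('k::{real_normed_field, euclidean_space}, 'a) nspace \<Rightarrow> ('a \<Rightarrow> real) \<Rightarrow> bool" where
  "sublinear N s \<longleftrightarrow> (\<forall>x\<in>carrier N. \<forall>y\<in>carrier N. s (x \<oplus>\<^bsub>N\<^esub> y) \<le> s x + s y) \<and>
    (\<forall>t\<ge>0. \<forall>x\<in>carrier N. s (of_real t \<odot>\<^bsub>N\<^esub> x) = t * s x)"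

lemma le_cINF_add:
  fixes f g :: "'c \<Rightarrow> real"
  assumes "I \<noteq> {}" "\<And>i j. i \<in> I \<Longrightarrow> j \<in> I \<Longrightarrow> c \<le> f i + g j"
  shows "c \<le> (INF i\<in>I. f i) + (INF j\<in>I. g j)"
proof -
  have "c - (INF j\<in>I. g j) \<le> f i" if i: "i \<in> I" for i
  proof -
    have "c - f i \<le> (INF j\<in>I. g j)"
      by (rule cINF_greatest[OF assms(1)]) (use assms(2)[OF i] in \<open>simp add: algebra_simps\<close>)
    then show ?thesis by simp
  qed
  then have "c - (INF j\<in>I. g j) \<le> (INF i\<in>I. f i)" by (rule cINF_greatest[OF assms(1)])
  then show ?thesis by simp
qed

context
  fixes N :: "('k::{real_normed_field, euclidean_space}, 'a) nspace"
  assumes N: "normed_space N"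
begin

lemma
  shows ns_assoc: "x \<in> carrier N \<Longrightarrow> y \<in> carrier N \<Longrightarrow> z \<in> carrier N \<Longrightarrow>
      (x \<oplus>\<^bsub>N\<^esub> y) \<oplus>\<^bsub>N\<^esub> z = x \<oplus>\<^bsub>N\<^esub> (y \<oplus>\<^bsub>N\<^esub> z)"
    and ns_comm: "x \<in> carrier N \<Longrightarrow> y \<in> carrier N \<Longrightarrow> x \<oplus>\<^bsub>N\<^esub> y = y \<oplus>\<^bsub>N\<^esub> x"
    and ns_lcomm: "x \<in> carrier N \<Longrightarrow> y \<in> carrier N \<Longrightarrow> z \<in> carrier N \<Longrightarrow>
      x \<oplus>\<^bsub>N\<^esub> (y \<oplus>\<^bsub>N\<^esub> z) = y \<oplus>\<^bsub>N\<^esub> (x \<oplus>\<^bsub>N\<^esub> z)"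
    and ns_l_zero: "x \<in> carrier N \<Longrightarrow> \<zero>\<^bsub>N\<^esub> \<oplus>\<^bsub>N\<^esub> x = x"
    and ns_r_zero: "x \<in> carrier N \<Longrightarrow> x \<oplus>\<^bsub>N\<^esub> \<zero>\<^bsub>N\<^esub> = x"
    and ns_l_distr: "x \<in> carrier N \<Longrightarrow> (a + b) \<odot>\<^bsub>N\<^esub> x = a \<odot>\<^bsub>N\<^esub> x \<oplus>\<^bsub>N\<^esub> b \<odot>\<^bsub>N\<^esub> x"
    and ns_r_distr: "x \<in> carrier N \<Longrightarrow> y \<in> carrier N \<Longrightarrow>
      a \<odot>\<^bsub>N\<^esub> (x \<oplus>\<^bsub>N\<^esub> y) = a \<odot>\<^bsub>N\<^esub> x \<oplus>\<^bsub>N\<^esub> a \<odot>\<^bsub>N\<^esub> y"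
    and ns_smult_smult: "x \<in> carrier N \<Longrightarrow> a \<odot>\<^bsub>N\<^esub> (b \<odot>\<^bsub>N\<^esub> x) = (a * b) \<odot>\<^bsub>N\<^esub> x"
    and ns_smult_one: "x \<in> carrier N \<Longrightarrow> 1 \<odot>\<^bsub>N\<^esub> x = x"
    and ns_smult_l_zero: "x \<in> carrier N \<Longrightarrow> 0 \<odot>\<^bsub>N\<^esub> x = \<zero>\<^bsub>N\<^esub>"
proof -
  interpret Module.module scalar_space N by (rule normed_space_module[OF N])
  show "x \<in> carrier N \<Longrightarrow> y \<in> carrier N \<Longrightarrow> z \<in> carrier N \<Longrightarrow>
      (x \<oplus>\<^bsub>N\<^esub> y) \<oplus>\<^bsub>N\<^esub> z = x \<oplus>\<^bsub>N\<^esub> (y \<oplus>\<^bsub>N\<^esub> z)" by (rule M.a_assoc)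
  show "x \<in> carrier N \<Longrightarrow> y \<in> carrier N \<Longrightarrow> x \<oplus>\<^bsub>N\<^esub> y = y \<oplus>\<^bsub>N\<^esub> x" by (rule M.a_comm)
  show "x \<in> carrier N \<Longrightarrow> y \<in> carrier N \<Longrightarrow> z \<in> carrier N \<Longrightarrow>
      x \<oplus>\<^bsub>N\<^esub> (y \<oplus>\<^bsub>N\<^esub> z) = y \<oplus>\<^bsub>N\<^esub> (x \<oplus>\<^bsub>N\<^esub> z)" by (rule M.a_lcomm)
  show "x \<in> carrier N \<Longrightarrow> \<zero>\<^bsub>N\<^esub> \<oplus>\<^bsub>N\<^esub> x = x" by simp
  show "x \<in> carrier N \<Longrightarrow> x \<oplus>\<^bsub>N\<^esub> \<zero>\<^bsub>N\<^esub> = x" by simp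
  show "x \<in> carrier N \<Longrightarrow> (a + b) \<odot>\<^bsub>N\<^esub> x = a \<odot>\<^bsub>N\<^esub> x \<oplus>\<^bsub>N\<^esub> b \<odot>\<^bsub>N\<^esub> x"
    using smult_l_distr[of a b x] by simp
  show "x \<in> carrier N \<Longrightarrow> y \<in> carrier N \<Longrightarrow>
      a \<odot>\<^bsub>N\<^esub> (x \<oplus>\<^bsub>N\<^esub> y) = a \<odot>\<^bsub>N\<^esub> x \<oplus>\<^bsub>N\<^esub> a \<odot>\<^bsub>N\<^esub> y" using smult_r_distr[of a x y] by simp
  show "x \<in> carrier N \<Longrightarrow> a \<odot>\<^bsub>N\<^esub> (b \<odot>\<^bsub>N\<^esub> x) = (a * b) \<odot>\<^bsub>N\<^esub> x"
    using smult_assoc1[of a b x] by simp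
  show "x \<in> carrier N \<Longrightarrow> 1 \<odot>\<^bsub>N\<^esub> x = x" using smult_one by simp
  show "x \<in> carrier N \<Longrightarrow> 0 \<odot>\<^bsub>N\<^esub> x = \<zero>\<^bsub>N\<^esub>" using smult_l_null by simp
qed

lemma ns_neg: "x \<in> carrier N \<Longrightarrow> of_real (- 1) \<odot>\<^bsub>N\<^esub> x \<oplus>\<^bsub>N\<^esub> x = \<zero>\<^bsub>N\<^esub>"
  using ns_l_distr[of x "- 1" 1] ns_smult_one ns_smult_l_zero by simp

lemma
  assumes "sublinear N s"
  shows sublinear_add: "x \<in> carrier N \<Longrightarrow> y \<in> carrier N \<Longrightarrow> s (x \<oplus>\<^bsub>N\<^esub> y) \<le> s x + s y"
    and sublinear_smult: "0 \<le> t \<Longrightarrow> x \<in> carrier N \<Longrightarrow> s (of_real t \<odot>\<^bsub>N\<^esub> x) = t * s x"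
  using assms by (auto simp: sublinear_def)

section \<open>Sublinear functionals and their minimal elements\<close>

lemma sublinear_zero: "sublinear N s \<Longrightarrow> s \<zero>\<^bsub>N\<^esub> = 0"
  using sublinear_smult[of s 0 "\<zero>\<^bsub>N\<^esub>"] zero_closed[OF N] ns_smult_l_zero by simp

lemma sublinear_lower:
  assumes "sublinear N s" "x \<in> carrier N"
  shows "- s (of_real (- 1) \<odot>\<^bsub>N\<^esub> x) \<le> s x"
  using sublinear_add[OF assms(1) smult_closed[OF N assms(2)] assms(2), of "of_real (- 1)"]
    ns_neg[OF assms(2)] sublinear_zero[OF assms(1)] by simp

text \<open>An inequality suffices for positive homogeneity: used for \<open>1 / t\<close> as well,
  it becomes an equality.\<close>

lemma sublinearI:
  assumes add: "\<And>x y. x \<in> carrier N \<Longrightarrow> y \<in> carrier N \<Longrightarrow> s (x \<oplus>\<^bsub>N\<^esub> y) \<le> s x + s y"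
    and smult: "\<And>t x. 0 < t \<Longrightarrow> x \<in> carrier N \<Longrightarrow> s (of_real t \<odot>\<^bsub>N\<^esub> x) \<le> t * s x"
    and zero: "s \<zero>\<^bsub>N\<^esub> = 0"
  shows "sublinear N s"
proof -
  have "s (of_real t \<odot>\<^bsub>N\<^esub> x) = t * s x" if t: "0 \<le> t" and x: "x \<in> carrier N" for t x
  proof (cases "t = 0")
    case True
    then show ?thesis using zero ns_smult_l_zero[OF x] by simp
  next
    case False
    then have t: "0 < t" using t by simp
    have "of_real (1 / t) \<odot>\<^bsub>N\<^esub> (of_real t \<odot>\<^bsub>N\<^esub> x) = x"
      using t ns_smult_smult[OF x] ns_smult_one[OF x] by (simp add: of_real_mult[symmetric] del: of_real_mult)
    then have "s x \<le> 1 / t * s (of_real t \<odot>\<^bsub>N\<^esub> x)"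
      using smult[of "1 / t" "of_real t \<odot>\<^bsub>N\<^esub> x"] t smult_closed[OF N x] by simp
    then have "t * s x \<le> s (of_real t \<odot>\<^bsub>N\<^esub> x)" using t by (simp add: field_simps)
    then show ?thesis using smult[OF t x] by simp
  qed
  then show ?thesis using add by (simp add: sublinear_def)
qed

text \<open>Take the infimum of \<open>s (x + t y) - t s y\<close> over \<open>t \<ge> 0\<close>. If
  \<open>s\<close> is minimal it equals this infimum, and \<open>t = 1\<close> yields
  superadditivity; for the norm, the same choice prepares a functional that attains the norm at
  \<open>y\<close>.\<close>

lemma sublinear_shrink:
  assumes s: "sublinear N s" and y: "y \<in> carrier N"
  obtains s' where "sublinear N s'" "\<And>x. x \<in> carrier N \<Longrightarrow> s' x \<le> s x"
    "\<And>x. x \<in> carrier N \<Longrightarrow> s' x \<le> s (x \<oplus>\<^bsub>N\<^esub> y) - s y"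
proof -
  define h where "h x t = s (x \<oplus>\<^bsub>N\<^esub> of_real t \<odot>\<^bsub>N\<^esub> y) - t * s y" for x and t :: real
  define s' where "s' x = (INF t\<in>{0..}. h x t)" for x
  note yc = smult_closed[OF N y]
  \<comment> \<open>Subadditivity gives a lower bound independent of \<open>t\<close>, without which
    the infimum would be meaningless.\<close>
  have lower: "- s (of_real (- 1) \<odot>\<^bsub>N\<^esub> x) \<le> h x t" if x: "x \<in> carrier N" and t: "0 \<le> t" for x t
  proof -
    let ?m = "of_real (- 1) \<odot>\<^bsub>N\<^esub> x"
    have "?m \<oplus>\<^bsub>N\<^esub> (x \<oplus>\<^bsub>N\<^esub> of_real t \<odot>\<^bsub>N\<^esub> y) = of_real t \<odot>\<^bsub>N\<^esub> y"
      using ns_assoc[OF smult_closed[OF N x] x yc, of "of_real (- 1)"] ns_neg[OF x] ns_l_zero[OF yc] by simp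
    then have "t * s y \<le> s ?m + s (x \<oplus>\<^bsub>N\<^esub> of_real t \<odot>\<^bsub>N\<^esub> y)"
      using sublinear_add[OF s smult_closed[OF N x] add_closed[OF N x yc], of "of_real (- 1)" "of_real t"]
        sublinear_smult[OF s t y] by simp
    then show ?thesis by (simp add: h_def)
  qed
  have s'_le: "s' x \<le> h x t" if "x \<in> carrier N" "0 \<le> t" for x t
    unfolding s'_def
    by (rule cINF_lower) (use lower[OF that(1)] that in \<open>auto intro!: bdd_belowI2[of _ "- s (of_real (- 1) \<odot>\<^bsub>N\<^esub> x)"]\<close>)
  have ne: "{0 :: real..} \<noteq> {}" by auto
  show ?thesis
  proof (rule that[of s'])
    show "sublinear N s'"
    proof (rule sublinearI)
      fix x x' assume x: "x \<in> carrier N" and x': "x' \<in> carrier N"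
      show "s' (x \<oplus>\<^bsub>N\<^esub> x') \<le> s' x + s' x'"
        unfolding s'_def[of x] s'_def[of x']
      proof (rule le_cINF_add[OF ne])
        fix t u :: real assume tu: "t \<in> {0..}" "u \<in> {0..}"
        have eq: "(x \<oplus>\<^bsub>N\<^esub> x') \<oplus>\<^bsub>N\<^esub> of_real (t + u) \<odot>\<^bsub>N\<^esub> y
          = (x \<oplus>\<^bsub>N\<^esub> of_real t \<odot>\<^bsub>N\<^esub> y) \<oplus>\<^bsub>N\<^esub> (x' \<oplus>\<^bsub>N\<^esub> of_real u \<odot>\<^bsub>N\<^esub> y)"
          using x x' y yc by (simp add: ns_assoc ns_lcomm ns_l_distr add_closed[OF N] smult_closed[OF N])
        have "s' (x \<oplus>\<^bsub>N\<^esub> x') \<le> h (x \<oplus>\<^bsub>N\<^esub> x') (t + u)"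
          using tu x x' by (intro s'_le add_closed[OF N]) auto
        also have "\<dots> \<le> h x t + h x' u"
          unfolding h_def eq
          using sublinear_add[OF s add_closed[OF N x yc] add_closed[OF N x' yc], of "of_real t" "of_real u"]
          by (simp add: distrib_right)
        finally show "s' (x \<oplus>\<^bsub>N\<^esub> x') \<le> h x t + h x' u" .
      qed
    next
      fix t :: real and x assume t: "0 < t" and x: "x \<in> carrier N"
      have "s' (of_real t \<odot>\<^bsub>N\<^esub> x) / t \<le> h x u" if u: "u \<in> {0..}" for u
      proof -
        have eq: "of_real t \<odot>\<^bsub>N\<^esub> x \<oplus>\<^bsub>N\<^esub> of_real (t * u) \<odot>\<^bsub>N\<^esub> y
          = of_real t \<odot>\<^bsub>N\<^esub> (x \<oplus>\<^bsub>N\<^esub> of_real u \<odot>\<^bsub>N\<^esub> y)"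
          using x y by (simp add: ns_r_distr ns_smult_smult smult_closed[OF N])
        have "s' (of_real t \<odot>\<^bsub>N\<^esub> x) \<le> h (of_real t \<odot>\<^bsub>N\<^esub> x) (t * u)"
          using t u by (intro s'_le smult_closed[OF N x]) auto
        also have "\<dots> = t * h x u"
          unfolding h_def eq using sublinear_smult[OF s less_imp_le[OF t] add_closed[OF N x yc]]
          by (simp add: algebra_simps)
        finally show ?thesis using t by (simp add: divide_le_eq mult.commute)
      qed
      then have "s' (of_real t \<odot>\<^bsub>N\<^esub> x) / t \<le> s' x" unfolding s'_def[of x] by (rule cINF_greatest[OF ne])
      then show "s' (of_real t \<odot>\<^bsub>N\<^esub> x) \<le> t * s' x" using t by (simp add: divide_le_eq mult.commute)
    next
      have "h \<zero>\<^bsub>N\<^esub> t = 0" if "t \<in> {0..}" for t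
        using that sublinear_smult[OF s _ y, of t] ns_l_zero[OF yc] by (simp add: h_def)
      then have "s' \<zero>\<^bsub>N\<^esub> = (INF t\<in>{0 :: real..}. 0)" unfolding s'_def by (intro INF_cong) auto
      then show "s' \<zero>\<^bsub>N\<^esub> = 0" using ne by simp
    qed
    show "s' x \<le> s x" if x: "x \<in> carrier N" for x
      using s'_le[OF x, of 0] ns_smult_l_zero[OF y] ns_r_zero[OF x] by (simp add: h_def)
    show "s' x \<le> s (x \<oplus>\<^bsub>N\<^esub> y) - s y" if x: "x \<in> carrier N" for x
      using s'_le[OF x, of 1] ns_smult_one[OF y] by (simp add: h_def)
  qed
qed

lemma ex_minimal_sublinear:
  assumes p: "sublinear N p"
  obtains m where "sublinear N m" "\<And>x. x \<in> carrier N \<Longrightarrow> m x \<le> p x"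
    "\<forall>s. sublinear N s \<and> (\<forall>x\<in>carrier N. s x \<le> m x) \<longrightarrow> (\<forall>x\<in>carrier N. s x = m x)"
proof -
  \<comment> \<open>Fixing the value 0 off the carrier makes the pointwise order antisymmetric on
    \<open>A\<close>.\<close>
  define A where "A = {s. sublinear N s \<and> (\<forall>x\<in>carrier N. s x \<le> p x) \<and> (\<forall>x. x \<notin> carrier N \<longrightarrow> s x = 0)}"
  define P where "P s t \<longleftrightarrow> (\<forall>x. t x \<le> s x)" for s t :: "'a \<Rightarrow> real"
  have cut: "sublinear N (\<lambda>x. if x \<in> carrier N then s x else 0)" if "sublinear N s" for s
    using that by (simp add: sublinear_def add_closed[OF N] smult_closed[OF N])
  have "\<exists>m\<in>A. \<forall>a\<in>A. P m a \<longrightarrow> a = m"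
  proof (rule predicate_Zorn)
    show "partial_order_on A (relation_of P A)"
    proof (rule partial_order_on_relation_ofI)
      show "P a a" if "a \<in> A" for a by (simp add: P_def)
      show "P a c" if "a \<in> A" "b \<in> A" "c \<in> A" "P a b" "P b c" for a b c
        using that(4,5) unfolding P_def by (meson order_trans)
      show "a = b" if "a \<in> A" "b \<in> A" "P a b" "P b a" for a b
        using that(3,4) unfolding P_def by (intro ext antisym) auto
    qed
    fix C assume C: "C \<in> Chains (relation_of P A)"
    show "\<exists>u\<in>A. \<forall>a\<in>C. P a u"
    proof (cases "C = {}")
      case True
      have "(\<lambda>x. if x \<in> carrier N then p x else 0) \<in> A" using cut[OF p] by (simp add: A_def)
      then show ?thesis using True by blast
    next
      case False
      have CA: "C \<subseteq> A" using C unfolding Chains_def relation_of_def by auto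
      have chain: "P a b \<or> P b a" if "a \<in> C" "b \<in> C" for a b
        using C that unfolding Chains_def relation_of_def by auto
      \<comment> \<open>Pointwise infima of chains are again sublinear: of two members the smaller
        one serves both summands. They are finite, since every member at \<open>x\<close> is at
        least \<open>- p\<close> at the negative of \<open>x\<close>.\<close>
      define u where "u x = (INF s\<in>C. s x)" for x
      have low: "- p (of_real (- 1) \<odot>\<^bsub>N\<^esub> x) \<le> s x" if s: "s \<in> C" and x: "x \<in> carrier N" for s x
      proof -
        have "sublinear N s" "s (of_real (- 1) \<odot>\<^bsub>N\<^esub> x) \<le> p (of_real (- 1) \<odot>\<^bsub>N\<^esub> x)"
          using CA s smult_closed[OF N x] by (auto simp: A_def)
        then show ?thesis using sublinear_lower[of s x] x by simp
      qed
      have u_le: "u x \<le> s x" if s: "s \<in> C" for s x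
      proof (cases "x \<in> carrier N")
        case True
        then show ?thesis unfolding u_def using s low
          by (intro cINF_lower bdd_belowI2[of _ "- p (of_real (- 1) \<odot>\<^bsub>N\<^esub> x)"]) auto
      next
        case False
        then have "\<And>s. s \<in> C \<Longrightarrow> s x = 0" using CA by (auto simp: A_def)
        then have "u x = (INF s\<in>C. 0)" unfolding u_def by (intro INF_cong) auto
        then show ?thesis using \<open>C \<noteq> {}\<close> False CA s by (auto simp: A_def)
      qed
      have sub: "sublinear N s" if "s \<in> C" for s using CA that by (auto simp: A_def)
      have "sublinear N u"
      proof (rule sublinearI)
        fix x y assume x: "x \<in> carrier N" and y: "y \<in> carrier N"
        show "u (x \<oplus>\<^bsub>N\<^esub> y) \<le> u x + u y" unfolding u_def[of x] u_def[of y]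
        proof (rule le_cINF_add[OF False])
          fix s t assume s: "s \<in> C" and t: "t \<in> C"
          from chain[OF s t] show "u (x \<oplus>\<^bsub>N\<^esub> y) \<le> s x + t y"
          proof
            assume "P s t"
            then have "t x \<le> s x" by (simp add: P_def)
            then show ?thesis
              using u_le[OF t, of "x \<oplus>\<^bsub>N\<^esub> y"] sublinear_add[OF sub[OF t] x y] by linarith
          next
            assume "P t s"
            then have "s y \<le> t y" by (simp add: P_def)
            then show ?thesis
              using u_le[OF s, of "x \<oplus>\<^bsub>N\<^esub> y"] sublinear_add[OF sub[OF s] x y] by linarith
          qed
        qed
      next
        fix t :: real and x assume t: "0 < t" and x: "x \<in> carrier N"
        have "u (of_real t \<odot>\<^bsub>N\<^esub> x) / t \<le> s x" if s: "s \<in> C" for s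
          using u_le[OF s, of "of_real t \<odot>\<^bsub>N\<^esub> x"] sublinear_smult[OF sub[OF s] less_imp_le[OF t] x] t
          by (simp add: divide_le_eq mult.commute)
        then have "u (of_real t \<odot>\<^bsub>N\<^esub> x) / t \<le> u x" unfolding u_def[of x] by (rule cINF_greatest[OF False])
        then show "u (of_real t \<odot>\<^bsub>N\<^esub> x) \<le> t * u x" using t by (simp add: divide_le_eq mult.commute)
      next
        have "u \<zero>\<^bsub>N\<^esub> = (INF s\<in>C. 0)" unfolding u_def using sublinear_zero sub by (intro INF_cong) auto
        then show "u \<zero>\<^bsub>N\<^esub> = 0" using False by simp
      qed
      moreover obtain s0 where s0: "s0 \<in> C" using False by auto
      have "u x \<le> p x" if "x \<in> carrier N" for x
        using u_le[OF s0, of x] CA s0 that by (force simp: A_def)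
      moreover have "u x = 0" if x: "x \<notin> carrier N" for x
      proof -
        have "s x = 0" if "s \<in> C" for s using CA x that by (auto simp: A_def)
        then have "u x = (INF s\<in>C. 0)" unfolding u_def by (intro INF_cong) auto
        then show ?thesis using False by simp
      qed
      ultimately have "u \<in> A" by (simp add: A_def)
      then show ?thesis using u_le by (intro bexI[of _ u]) (auto simp: P_def)
    qed
  qed
  then obtain m where m: "m \<in> A" "\<And>a. a \<in> A \<Longrightarrow> P m a \<Longrightarrow> a = m" by auto
  show ?thesis
  proof (rule that[of m])
    show "sublinear N m" "\<And>x. x \<in> carrier N \<Longrightarrow> m x \<le> p x" using m(1) by (auto simp: A_def)
  next
    show "\<forall>s. sublinear N s \<and> (\<forall>x\<in>carrier N. s x \<le> m x) \<longrightarrow> (\<forall>x\<in>carrier N. s x = m x)"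
    proof (intro allI impI ballI)
      fix s x assume "sublinear N s \<and> (\<forall>x\<in>carrier N. s x \<le> m x)" and x: "x \<in> carrier N"
      then have s: "sublinear N s" "\<And>x. x \<in> carrier N \<Longrightarrow> s x \<le> m x" by auto
      let ?s = "\<lambda>x. if x \<in> carrier N then s x else 0"
      have "s x \<le> p x" if "x \<in> carrier N" for x
        using s(2)[OF that] m(1) that by (force simp: A_def)
      then have "?s \<in> A" using cut[OF s(1)] by (simp add: A_def)
      moreover have "P m ?s" using s(2) m(1) by (simp add: P_def A_def)
      ultimately have "?s = m" by (rule m(2))
      then show "s x = m x" using x by (auto dest: fun_cong[of _ _ x])
    qed
  qed
qed

text \<open>The norm is first shrunk at \<open>y\<close>, so that everything below it is at most
  \<open>- nrm N y\<close> at the negative of \<open>y\<close>; a minimal functional below is linear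
  and hence at least \<open>nrm N y\<close> at \<open>y\<close>.\<close>

lemma ex_real_functional:
  assumes y: "y \<in> carrier N"
  obtains u where "\<And>x z. x \<in> carrier N \<Longrightarrow> z \<in> carrier N \<Longrightarrow> u (x \<oplus>\<^bsub>N\<^esub> z) = u x + u z"
    "\<And>t x. x \<in> carrier N \<Longrightarrow> u (of_real t \<odot>\<^bsub>N\<^esub> x) = t * u x"
    "\<And>x. x \<in> carrier N \<Longrightarrow> u x \<le> nrm N x" "nrm N y \<le> u y"
proof -
  have nrm: "sublinear N (nrm N)"
    by (simp add: sublinear_def nrm_triangle[OF N] nrm_smult[OF N])
  obtain p where p: "sublinear N p" "\<And>x. x \<in> carrier N \<Longrightarrow> p x \<le> nrm N x"
    "\<And>x. x \<in> carrier N \<Longrightarrow> p x \<le> nrm N (x \<oplus>\<^bsub>N\<^esub> y) - nrm N y"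
    by (rule sublinear_shrink[OF nrm y]) (rule that)
  obtain m where m: "sublinear N m" "\<And>x. x \<in> carrier N \<Longrightarrow> m x \<le> p x"
    and min: "\<forall>s. sublinear N s \<and> (\<forall>x\<in>carrier N. s x \<le> m x) \<longrightarrow> (\<forall>x\<in>carrier N. s x = m x)"
    by (rule ex_minimal_sublinear[OF p(1)]) (rule that)
  have add: "m (x \<oplus>\<^bsub>N\<^esub> z) = m x + m z" if x: "x \<in> carrier N" and z: "z \<in> carrier N" for x z
  proof -
    obtain s where s: "sublinear N s" "\<And>x. x \<in> carrier N \<Longrightarrow> s x \<le> m x"
      "\<And>x. x \<in> carrier N \<Longrightarrow> s x \<le> m (x \<oplus>\<^bsub>N\<^esub> z) - m z"
      by (rule sublinear_shrink[OF m(1) z]) (rule that)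
    have "s x = m x" using min s(1,2) x by simp
    then show ?thesis using s(3)[OF x] sublinear_add[OF m(1) x z] by simp
  qed
  have neg: "m (of_real (- 1) \<odot>\<^bsub>N\<^esub> x) = - m x" if x: "x \<in> carrier N" for x
    using add[OF smult_closed[OF N x] x, of "of_real (- 1)"] ns_neg[OF x] sublinear_zero[OF m(1)] by simp
  show ?thesis
  proof (rule that[of m, OF add])
    show "m (of_real t \<odot>\<^bsub>N\<^esub> x) = t * m x" if x: "x \<in> carrier N" for t x
    proof (cases "0 \<le> t")
      case True
      then show ?thesis using sublinear_smult[OF m(1) _ x] by simp
    next
      case False
      have "of_real t \<odot>\<^bsub>N\<^esub> x = of_real (- 1) \<odot>\<^bsub>N\<^esub> (of_real (- t) \<odot>\<^bsub>N\<^esub> x)"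
        using ns_smult_smult[OF x] by simp
      then have "m (of_real t \<odot>\<^bsub>N\<^esub> x) = - m (of_real (- t) \<odot>\<^bsub>N\<^esub> x)"
        using neg[OF smult_closed[OF N x]] by simp
      then show ?thesis using sublinear_smult[OF m(1) _ x, of "- t"] False by simp
    qed
    show "m x \<le> nrm N x" if "x \<in> carrier N" for x using m(2)[OF that] p(2)[OF that] by simp
    have yc: "of_real (- 1) \<odot>\<^bsub>N\<^esub> y \<in> carrier N" by (rule smult_closed[OF N y])
    have "m (of_real (- 1) \<odot>\<^bsub>N\<^esub> y) \<le> nrm N (of_real (- 1) \<odot>\<^bsub>N\<^esub> y \<oplus>\<^bsub>N\<^esub> y) - nrm N y"
      using m(2)[OF yc] p(3)[OF yc] by (rule order_trans)
    then have "m (of_real (- 1) \<odot>\<^bsub>N\<^esub> y) \<le> - nrm N y" unfolding ns_neg[OF y] nrm_zero[OF N] by simp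
    then show "nrm N y \<le> m y" using neg[OF y] by simp
  qed
qed

end

text \<open>A real functional \<open>u\<close> is \<open>z \<mapsto> \<langle>f x * z, 1\<rangle>\<close> at \<open>z = 1\<close> for a unique scalar-linear \<open>f\<close>. The constant
  \<open>c\<close> (in fact 1) comes from not identifying the scalar field with the reals or complexes.\<close>

theorem Hahn_Banach:
  fixes N :: "('k::{real_normed_field, euclidean_space}, 'a) nspace"
  assumes N: "normed_space N"
  obtains c where "0 < c" "\<And>y. y \<in> carrier N \<Longrightarrow>
    \<exists>f\<in>carrier (dual N). op_norm N scalar_space f \<le> c \<and> nrm N y \<le> norm (f y)"
proof -
  \<comment> \<open>\<open>L c\<close> lists the coordinates of the real functional sending
    \<open>z\<close> to \<open>inner (c * z) 1\<close>. It is injective because a nonzero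
    \<open>c - d\<close> can be inverted, hence bijective by dimension: every real functional on the
    scalars has exactly one multiplier.\<close>
  define L where "L c = (\<Sum>b\<in>Basis. inner (c * b) 1 *\<^sub>R b)" for c :: 'k
  have L_inner: "inner (L c) b = inner (c * b) 1" if "b \<in> Basis" for c b
    unfolding L_def using that by simp
  have one: "inner (1 :: 'k) 1 = 1" by (simp add: dot_square_norm)
  have uniq: "c = d" if "\<And>z. inner (c * z) 1 = inner (d * z) 1" for c d :: 'k
  proof (rule ccontr)
    assume "c \<noteq> d"
    then have "inner ((c - d) * inverse (c - d)) 1 = (1 :: real)" using one by simp
    moreover have "inner ((c - d) * inverse (c - d)) 1 = (0 :: real)"
      using that[of "inverse (c - d)"] by (simp only: left_diff_distrib inner_diff_left)
    ultimately show False by simp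
  qed
  have linear_mult: "linear (\<lambda>z. inner (c * z) 1)" for c :: 'k
    by (rule linearI) (simp_all add: distrib_left inner_add_left)
  have "linear L"
    by (rule linearI) (simp_all add: L_def distrib_right inner_add_left scaleR_add_left sum.distrib scaleR_sum_right)
  moreover have "inj L"
  proof (rule injI)
    fix c d assume cd: "L c = L d"
    have "(\<lambda>z. inner (c * z) 1) = (\<lambda>z. inner (d * z) 1)"
      by (rule linear_eq_stdbasis[OF linear_mult linear_mult]) (use cd L_inner in metis)
    then show "c = d" by (intro uniq) (rule fun_cong)
  qed
  ultimately obtain M where M: "linear M" "\<And>x. L (M x) = x"
    using linear_injective_isomorphism by metis
  obtain B where B: "0 < B" "\<And>x. norm (M x) \<le> B * norm x" using linear_bounded_pos[OF M(1)] by auto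
  show ?thesis
  proof (rule that[of "B * DIM('k)"])
    show "0 < B * DIM('k)" using B by simp
    fix y assume y: "y \<in> carrier N"
    obtain u where u: "\<And>x z. x \<in> carrier N \<Longrightarrow> z \<in> carrier N \<Longrightarrow> u (x \<oplus>\<^bsub>N\<^esub> z) = u x + u z"
      "\<And>t x. x \<in> carrier N \<Longrightarrow> u (of_real t \<odot>\<^bsub>N\<^esub> x) = t * u x"
      "\<And>x. x \<in> carrier N \<Longrightarrow> u x \<le> nrm N x" "nrm N y \<le> u y"
      by (rule ex_real_functional[OF N y]) (rule that)
    have u_abs: "\<bar>u x\<bar> \<le> nrm N x" if x: "x \<in> carrier N" for x
      using u(3)[OF x] u(3)[OF smult_closed[OF N x, of "of_real (- 1)"]] u(2)[OF x, of "- 1"]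
        nrm_smult[OF N x, of "of_real (- 1)"] by simp
    \<comment> \<open>\<open>f x\<close> is the multiplier of the real functional sending the scalar
      \<open>z\<close> to the value of \<open>u\<close> at \<open>z\<close> times \<open>x\<close>;
      uniqueness of multipliers makes \<open>f\<close> linear over the scalars.\<close>
    define f where "f = (\<lambda>x\<in>carrier N. M (\<Sum>b\<in>Basis. u (b \<odot>\<^bsub>N\<^esub> x) *\<^sub>R b))"
    have f: "inner (f x * z) 1 = u (z \<odot>\<^bsub>N\<^esub> x)" if x: "x \<in> carrier N" for x z
    proof -
      have "linear (\<lambda>z. u (z \<odot>\<^bsub>N\<^esub> x))"
      proof (rule linearI)
        show "u ((a + b) \<odot>\<^bsub>N\<^esub> x) = u (a \<odot>\<^bsub>N\<^esub> x) + u (b \<odot>\<^bsub>N\<^esub> x)" for a b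
          using u(1)[OF smult_closed[OF N x] smult_closed[OF N x]] ns_l_distr[OF N x] by simp
        show "u ((t *\<^sub>R a) \<odot>\<^bsub>N\<^esub> x) = t *\<^sub>R u (a \<odot>\<^bsub>N\<^esub> x)" for t a
          using u(2)[OF smult_closed[OF N x], of t a] ns_smult_smult[OF N x, of "of_real t" a]
          by (simp add: scaleR_conv_of_real)
      qed
      then have "(\<lambda>z. inner (f x * z) 1) = (\<lambda>z. u (z \<odot>\<^bsub>N\<^esub> x))"
      proof (rule linear_eq_stdbasis[OF linear_mult])
        fix b :: 'k assume b: "b \<in> Basis"
        have "inner (f x * b) 1 = inner (L (f x)) b" by (rule L_inner[OF b, symmetric])
        also have "\<dots> = u (b \<odot>\<^bsub>N\<^esub> x)" using x b by (simp add: f_def M(2))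
        finally show "inner (f x * b) 1 = u (b \<odot>\<^bsub>N\<^esub> x)" .
      qed
      then show ?thesis by (rule fun_cong)
    qed
    have add: "f (x \<oplus>\<^bsub>N\<^esub> z) = f x + f z" if x: "x \<in> carrier N" and z: "z \<in> carrier N" for x z
    proof (rule uniq)
      fix w
      have "inner (f (x \<oplus>\<^bsub>N\<^esub> z) * w) 1 = u (w \<odot>\<^bsub>N\<^esub> x \<oplus>\<^bsub>N\<^esub> w \<odot>\<^bsub>N\<^esub> z)"
        unfolding f[OF add_closed[OF N x z]] ns_r_distr[OF N x z] ..
      also have "\<dots> = inner ((f x + f z) * w) 1"
        using u(1)[OF smult_closed[OF N x] smult_closed[OF N z]] f[OF x] f[OF z]
        by (simp add: distrib_right inner_add_left)
      finally show "inner (f (x \<oplus>\<^bsub>N\<^esub> z) * w) 1 = inner ((f x + f z) * w) 1" .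
    qed
    have smult: "f (a \<odot>\<^bsub>N\<^esub> x) = a * f x" if x: "x \<in> carrier N" for a x
    proof (rule uniq)
      fix w
      have "inner (f (a \<odot>\<^bsub>N\<^esub> x) * w) 1 = u ((w * a) \<odot>\<^bsub>N\<^esub> x)"
        unfolding f[OF smult_closed[OF N x]] ns_smult_smult[OF N x] ..
      also have "\<dots> = inner (f x * (w * a)) 1" by (rule f[OF x, symmetric])
      also have "f x * (w * a) = a * f x * w" by (simp only: ac_simps)
      finally show "inner (f (a \<odot>\<^bsub>N\<^esub> x) * w) 1 = inner (a * f x * w) 1" .
    qed
    have bound: "norm (f x) \<le> B * DIM('k) * nrm N x" if x: "x \<in> carrier N" for x
    proof -
      have "norm (\<Sum>b\<in>Basis. u (b \<odot>\<^bsub>N\<^esub> x) *\<^sub>R b) \<le> (\<Sum>b\<in>(Basis :: 'k set). nrm N x)"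
      proof (rule sum_norm_le)
        fix b :: 'k assume "b \<in> Basis"
        then show "norm (u (b \<odot>\<^bsub>N\<^esub> x) *\<^sub>R b) \<le> nrm N x"
          using u_abs[OF smult_closed[OF N x, of b]] nrm_smult[OF N x, of b] by simp
      qed
      also have "\<dots> = DIM('k) * nrm N x" by simp
      finally have "B * norm (\<Sum>b\<in>Basis. u (b \<odot>\<^bsub>N\<^esub> x) *\<^sub>R b) \<le> B * (DIM('k) * nrm N x)"
        using B(1) by (intro mult_left_mono) auto
      then show ?thesis using B(2)[of "\<Sum>b\<in>Basis. u (b \<odot>\<^bsub>N\<^esub> x) *\<^sub>R b"] x by (simp add: f_def mult.assoc)
    qed
    have "f \<in> extensional (carrier N)" by (simp add: f_def)
    moreover have "\<exists>C. \<forall>x\<in>carrier N. norm (f x) \<le> C * nrm N x" using bound by blast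
    ultimately have "f \<in> carrier (dual N)" unfolding in_carrier_dual_iff using add smult by simp
    moreover have "op_norm N scalar_space f \<le> B * DIM('k)"
      using B(1) bound by (intro dual_norm_leI[OF N]) auto
    moreover have "nrm N y \<le> norm (f y)"
    proof -
      have "nrm N y \<le> inner (f y * 1) 1" unfolding f[OF y] ns_smult_one[OF N y] by (rule u(4))
      also have "\<dots> \<le> norm (f y) * norm (1 :: 'k)" using norm_cauchy_schwarz[of "f y" 1] by simp
      finally show ?thesis by simp
    qed
    ultimately show "\<exists>f\<in>carrier (dual N). op_norm N scalar_space f \<le> B * DIM('k) \<and> nrm N y \<le> norm (f y)"
      by blast
  qed
qed

section \<open>Compactness\<close>

context
  fixes N :: "('k::{real_normed_field, euclidean_space}, 'a) nspace"
  assumes N: "normed_space N"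
begin

section \<open>The metric of a normed space\<close>

lemma ndist_eq:
  "x \<in> carrier N \<Longrightarrow> y \<in> carrier N \<Longrightarrow> ndist N x y = nrm N (x \<oplus>\<^bsub>N\<^esub> (-1) \<odot>\<^bsub>N\<^esub> y)"
  by (simp add: ndist_def minus_eq[OF N])

lemma ndist_triangle_ns:
  assumes "x \<in> carrier N" "y \<in> carrier N" "z \<in> carrier N"
  shows "ndist N x z \<le> ndist N x y + ndist N y z"
proof -
  note c = smult_closed[OF N]
  have "x \<oplus>\<^bsub>N\<^esub> (-1) \<odot>\<^bsub>N\<^esub> z = (x \<oplus>\<^bsub>N\<^esub> (-1) \<odot>\<^bsub>N\<^esub> y) \<oplus>\<^bsub>N\<^esub> (y \<oplus>\<^bsub>N\<^esub> (-1) \<odot>\<^bsub>N\<^esub> z)"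
  proof -
    have "(-1) \<odot>\<^bsub>N\<^esub> y \<oplus>\<^bsub>N\<^esub> (y \<oplus>\<^bsub>N\<^esub> (-1) \<odot>\<^bsub>N\<^esub> z) = (-1) \<odot>\<^bsub>N\<^esub> z"
      using ns_assoc[OF N c[OF assms(2)] assms(2) c[OF assms(3)], of "-1" "-1"] ns_neg[OF N assms(2)]
        ns_l_zero[OF N c[OF assms(3)]] by simp
    then show ?thesis
      using ns_assoc[OF N assms(1) c[OF assms(2)] add_closed[OF N assms(2) c[OF assms(3)]], of "-1" "-1"] by simp
  qed
  then show ?thesis
    using nrm_triangle[OF N add_closed[OF N assms(1) c[OF assms(2)]] add_closed[OF N assms(2) c[OF assms(3)]], of "-1" "-1"]
    by (simp add: ndist_eq assms)
qed

lemma ndist_commute_ns: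
  assumes "x \<in> carrier N" "y \<in> carrier N"
  shows "ndist N x y = ndist N y x"
proof -
  note c = smult_closed[OF N]
  have "(-1) \<odot>\<^bsub>N\<^esub> (x \<oplus>\<^bsub>N\<^esub> (-1) \<odot>\<^bsub>N\<^esub> y) = y \<oplus>\<^bsub>N\<^esub> (-1) \<odot>\<^bsub>N\<^esub> x"
    using assms by (simp add: ns_r_distr[OF N] c ns_smult_smult[OF N] ns_smult_one[OF N] ns_comm[OF N])
  then have "nrm N (y \<oplus>\<^bsub>N\<^esub> (-1) \<odot>\<^bsub>N\<^esub> x) = norm (- 1 :: 'k) * nrm N (x \<oplus>\<^bsub>N\<^esub> (-1) \<odot>\<^bsub>N\<^esub> y)"
    using nrm_smult[OF N add_closed[OF N assms(1) c[OF assms(2)]], of "-1" "-1"] by simp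
  then show ?thesis by (simp add: ndist_eq assms)
qed

lemma ndist_eq_0_iff:
  assumes "x \<in> carrier N" "y \<in> carrier N"
  shows "ndist N x y = 0 \<longleftrightarrow> x = y"
proof
  note c = smult_closed[OF N]
  assume "ndist N x y = 0"
  then have 0: "x \<oplus>\<^bsub>N\<^esub> (-1) \<odot>\<^bsub>N\<^esub> y = \<zero>\<^bsub>N\<^esub>"
    using nrm_eq_0_iff[OF N add_closed[OF N assms(1) c[OF assms(2)]], of "-1"] by (simp add: ndist_eq assms)
  have "x = x \<oplus>\<^bsub>N\<^esub> ((-1) \<odot>\<^bsub>N\<^esub> y \<oplus>\<^bsub>N\<^esub> y)"
    using ns_neg[OF N assms(2)] ns_r_zero[OF N assms(1)] by simp
  also have "\<dots> = (x \<oplus>\<^bsub>N\<^esub> (-1) \<odot>\<^bsub>N\<^esub> y) \<oplus>\<^bsub>N\<^esub> y"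
    by (rule ns_assoc[OF N assms(1) c[OF assms(2)] assms(2), symmetric])
  also have "\<dots> = y" unfolding 0 by (rule ns_l_zero[OF N assms(2)])
  finally show "x = y" .
next
  assume "x = y"
  then show "ndist N x y = 0"
    using ns_neg[OF N assms(2)] ns_comm[OF N smult_closed[OF N assms(2)] assms(2), of "-1"] nrm_zero[OF N]
    by (simp add: ndist_eq assms)
qed

lemma ndist_nonneg_ns: "0 \<le> ndist N x y"
  using nrm_nonneg[OF N add_closed[OF N _ smult_closed[OF N]]] by (simp add: ndist_def minus_eq[OF N])

lemma Metric_space_ns: "Metric_space (carrier N) (ndist N)"
proof
  show "ndist N x y = ndist N y x" for x y
  proof (cases "x \<in> carrier N \<and> y \<in> carrier N")
    case True
    then show ?thesis using ndist_commute_ns by simp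
  next
    case False
    then show ?thesis by (auto simp: ndist_def)
  qed
qed (simp_all add: ndist_nonneg_ns ndist_eq_0_iff ndist_triangle_ns)

end

text \<open>The values lie in a compact ball with a finite \<open>\<delta> / 2\<close>-net. Points
  with the same tuple of net points are \<open>\<delta>\<close>-close on all of \<open>F\<close>,
  and one representative for each of the finitely many tuples is enough.\<close>

lemma finite_net_of_finitely_many_functionals:
  fixes x :: "'c \<Rightarrow> 'a \<Rightarrow> 'k::euclidean_space"
  assumes "finite F" "\<And>i v. i \<in> F \<Longrightarrow> v \<in> B \<Longrightarrow> norm (x i v) \<le> b" "0 < \<delta>"
  obtains Z where "finite Z" "Z \<subseteq> B" "\<And>v. v \<in> B \<Longrightarrow> \<exists>z\<in>Z. \<forall>i\<in>F. norm (x i v - x i z) \<le> \<delta>"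
proof -
  have "compact (cball (0 :: 'k) b)" by simp
  moreover have "\<And>c. c \<in> cball (0 :: 'k) b \<Longrightarrow> open (ball c (\<delta> / 2))" by simp
  moreover have "cball (0 :: 'k) b \<subseteq> (\<Union>c\<in>cball 0 b. ball c (\<delta> / 2))" using assms(3) by auto
  ultimately obtain P where P: "P \<subseteq> cball (0 :: 'k) b" "finite P" "cball (0 :: 'k) b \<subseteq> (\<Union>c\<in>P. ball c (\<delta> / 2))"
    by (rule compactE_image)
  define code where "code v = (\<lambda>i\<in>F. SOME c. c \<in> P \<and> dist c (x i v) < \<delta> / 2)" for v
  have code: "code v i \<in> P \<and> dist (code v i) (x i v) < \<delta> / 2" if "v \<in> B" "i \<in> F" for v i
  proof -
    have "x i v \<in> cball 0 b" using assms(2)[OF that(2,1)] by simp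
    then have "x i v \<in> (\<Union>c\<in>P. ball c (\<delta> / 2))" by (rule subsetD[OF P(3)])
    then have "\<exists>c. c \<in> P \<and> dist c (x i v) < \<delta> / 2" by (simp only: UN_iff mem_ball Bex_def)
    from someI_ex[OF this] show ?thesis using that(2) by (simp add: code_def)
  qed
  have "code ` B \<subseteq> (\<Pi>\<^sub>E i\<in>F. P)"
  proof (intro image_subsetI PiE_I)
    show "code v i \<in> P" if "v \<in> B" "i \<in> F" for v i using code[OF that] by simp
    show "code v i = undefined" if "i \<notin> F" for v i using that by (simp add: code_def)
  qed
  then have fin: "finite (code ` B)" by (rule finite_subset) (simp add: finite_PiE assms(1) P(2))
  define rep where "rep g = (SOME v. v \<in> B \<and> code v = g)" for g
  have rep: "rep g \<in> B \<and> code (rep g) = g" if "g \<in> code ` B" for g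
  proof -
    have "\<exists>v. v \<in> B \<and> code v = g" using that by auto
    then show ?thesis unfolding rep_def by (rule someI_ex)
  qed
  show ?thesis
  proof (rule that[of "rep ` code ` B"])
    show "finite (rep ` code ` B)" using fin by simp
    show "rep ` code ` B \<subseteq> B" using rep by auto
    fix v assume v: "v \<in> B"
    let ?z = "rep (code v)"
    have z: "?z \<in> B" "code ?z = code v" using rep[of "code v"] v by auto
    have "norm (x i v - x i ?z) \<le> \<delta>" if i: "i \<in> F" for i
    proof -
      have "dist (x i v) (x i ?z) \<le> dist (code v i) (x i v) + dist (code v i) (x i ?z)"
        by (rule dist_triangle3)
      also have "\<dots> \<le> \<delta>" using code[OF v i] code[OF z(1) i] z(2) by simp
      finally show ?thesis by (simp add: dist_norm)
    qed
    then show "\<exists>z\<in>rep ` code ` B. \<forall>i\<in>F. norm (x i v - x i z) \<le> \<delta>" using v by (intro bexI[of _ ?z]) auto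
  qed
qed

context ordinals
begin

text \<open>Schauder's argument from the adjoint back to \<open>R\<close>. If the first derivation
  is empty for every \<open>\<epsilon>\<close>, weak-star compactness makes the adjoint image of the
  dual ball totally bounded. Finitely many functionals then control norm distances in the image of
  \<open>R\<close>, and completeness of \<open>Y\<close> turns total boundedness into relative
  compactness.\<close>

lemma Sz_op_trivial_imp_compact_operator:
  fixes N :: "('k::{real_normed_field, euclidean_space}, 'a) nspace"
  assumes N: "normed_space N" and Y: "banach_space Y" and R: "bounded_operator N Y R"
    and Sz: "(Sz_op N Y R :: 'u ordinal set) \<subseteq> {..<omega_pow 0}"
  shows "compact_operator N Y R"
proof -
  have Yn: "normed_space Y" and compl: "Metric_space.mcomplete (carrier Y) (ndist Y)"
    using Y by (auto simp: banach_space_def)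
  interpret MY: Metric_space "carrier Y" "ndist Y" by (rule Metric_space_ns[OF Yn])
  let ?K = "adjoint N R ` unit_ball (dual Y)" and ?X = "weak_star N" and ?d = "ndist (dual N)"
  have K: "?K \<subseteq> carrier (dual N)" by (rule adjoint_unit_ball_subset[OF N Yn R])
  have cK: "compactin ?X ?K" by (rule compactin_adjoint_unit_ball[OF N Yn R])
  have sder_empty: "sder ?X ?d \<epsilon> ?K = {}" if "0 < \<epsilon>" for \<epsilon>
  proof -
    have "osucc 0 \<notin> (Sz_op N Y R :: 'u ordinal set)" using Sz by auto
    then have "derived ?X ?d \<epsilon> ?K (osucc 0 :: 'u ordinal) = {}"
      using that by (auto simp: Sz_op_def Sz_def Sz_eps_eq_derived)
    then show ?thesis by simp
  qed
  have net: "\<exists>F. finite F \<and> F \<subseteq> ?K \<and> (\<forall>k\<in>?K. \<exists>x\<in>F. ?d k x \<le> \<epsilon>)" if \<epsilon>: "0 < \<epsilon>" for \<epsilon>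
  proof -
    have "\<forall>x\<in>?K. \<exists>V. openin ?X V \<and> x \<in> V \<and> (\<forall>y\<in>?K \<inter> V. \<forall>z\<in>?K \<inter> V. ?d y z \<le> \<epsilon>)"
    proof
      fix x assume x: "x \<in> ?K"
      have "x \<notin> sder ?X ?d \<epsilon> ?K" using sder_empty[OF \<epsilon>] by simp
      then have "\<not> (\<forall>V. openin ?X V \<and> x \<in> V \<longrightarrow> (\<exists>y\<in>?K \<inter> V. \<exists>z\<in>?K \<inter> V. \<epsilon> < ?d y z))"
        using x unfolding sder_def by blast
      then show "\<exists>V. openin ?X V \<and> x \<in> V \<and> (\<forall>y\<in>?K \<inter> V. \<forall>z\<in>?K \<inter> V. ?d y z \<le> \<epsilon>)"
        by (meson not_less)
    qed
    from bchoice[OF this] obtain V where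
      V: "\<forall>x\<in>?K. openin ?X (V x) \<and> x \<in> V x \<and> (\<forall>y\<in>?K \<inter> V x. \<forall>z\<in>?K \<inter> V x. ?d y z \<le> \<epsilon>)" ..
    have "(\<forall>U\<in>V ` ?K. openin ?X U) \<and> ?K \<subseteq> \<Union>(V ` ?K)" using V by auto
    then have "\<exists>\<F>. finite \<F> \<and> \<F> \<subseteq> V ` ?K \<and> ?K \<subseteq> \<Union>\<F>"
      using conjunct2[OF cK[unfolded compactin_def], rule_format, of "V ` ?K"] by simp
    then obtain \<F> where \<F>: "finite \<F>" "\<F> \<subseteq> V ` ?K" "?K \<subseteq> \<Union>\<F>" by (elim exE conjE)
    obtain F where F: "F \<subseteq> ?K" "finite F" "\<F> = V ` F"
      using finite_subset_image[OF \<F>(1,2)] by (elim exE conjE)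
    have "\<exists>x\<in>F. ?d k x \<le> \<epsilon>" if k: "k \<in> ?K" for k
    proof -
      obtain x where x: "x \<in> F" "k \<in> V x" using k \<F>(3) F(3) by auto
      then have "x \<in> ?K" using F(1) by auto
      then show ?thesis using V k x by (intro bexI[of _ x]) auto
    qed
    then show ?thesis using F by (intro exI[of _ F]) auto
  qed
  obtain c where c: "0 < c" and HB: "\<And>y. y \<in> carrier Y \<Longrightarrow>
      \<exists>f\<in>carrier (dual Y). op_norm Y scalar_space f \<le> c \<and> nrm Y y \<le> norm (f y)"
    by (rule Hahn_Banach[OF Yn]) (rule that)
  let ?B = "unit_ball N"
  have RB: "R ` ?B \<subseteq> carrier Y" using bounded_operatorD(1)[OF R] by (auto simp: unit_ball_def)
  have "MY.mtotally_bounded (R ` ?B)"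
    unfolding MY.mtotally_bounded_def
  proof (intro allI impI)
    fix e :: real assume e: "0 < e"
    \<comment> \<open>Three errors of size \<open>\<delta>\<close>, magnified by \<open>c\<close>,
      must stay strictly below \<open>e\<close>.\<close>
    define \<delta> where "\<delta> = e / (4 * c)"
    have \<delta>: "0 < \<delta>" using e c by (simp add: \<delta>_def)
    obtain F where F: "finite F" "F \<subseteq> ?K" "\<forall>k\<in>?K. \<exists>x\<in>F. ?d k x \<le> \<delta>"
      using net[OF \<delta>] by (elim exE conjE)
    have FN: "x \<in> carrier (dual N)" if "x \<in> F" for x using F(2) K that by auto
    have bnd: "norm (x v) \<le> (\<Sum>x\<in>F. op_norm N scalar_space x)" if "x \<in> F" "v \<in> ?B" for x v
    proof -
      have "norm (x v) \<le> op_norm N scalar_space x"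
        using dual_norm_le_iff[OF N FN[OF that(1)], of "op_norm N scalar_space x"] that(2) by simp
      also have "\<dots> \<le> (\<Sum>x\<in>F. op_norm N scalar_space x)"
        using F(1) that(1) dual_norm_nonneg[OF N FN] by (intro member_le_sum) auto
      finally show ?thesis .
    qed
    obtain Z where Z: "finite Z" "Z \<subseteq> ?B" and
      near: "\<And>v. v \<in> ?B \<Longrightarrow> \<exists>z\<in>Z. \<forall>x\<in>F. norm (x v - x z) \<le> \<delta>"
      by (rule finite_net_of_finitely_many_functionals[of F ?B "\<lambda>x v. x v"
            "\<Sum>x\<in>F. op_norm N scalar_space x" \<delta>]) (rule F(1), rule bnd, assumption+, rule \<delta>, rule that)
    have "\<exists>z\<in>Z. ndist Y (R z) (R v) < e" if v: "v \<in> ?B" for v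
    proof -
      obtain z where z: "z \<in> Z" "\<And>x. x \<in> F \<Longrightarrow> norm (x v - x z) \<le> \<delta>" using near[OF v] by auto
      have vz: "v \<in> carrier N" "z \<in> carrier N" "z \<in> ?B" using v z(1) Z(2) by (auto simp: unit_ball_def)
      have Rvz: "R v \<in> carrier Y" "R z \<in> carrier Y" using bounded_operatorD(1)[OF R] vz by auto
      let ?w = "R z \<oplus>\<^bsub>Y\<^esub> (-1) \<odot>\<^bsub>Y\<^esub> R v"
      have w: "?w \<in> carrier Y" using Rvz by (intro add_closed[OF Yn] smult_closed[OF Yn])
      obtain f where f: "f \<in> carrier (dual Y)" "op_norm Y scalar_space f \<le> c" "nrm Y ?w \<le> norm (f ?w)"
        using HB[OF w] by auto
      \<comment> \<open>The functional that detects the norm of \<open>?w\<close> has norm up to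
        \<open>c\<close>; division by \<open>c\<close> brings it into the dual ball, whose image has
        a net.\<close>
      let ?g = "\<lambda>y\<in>carrier Y. of_real (1 / c) * f y"
      have g: "?g \<in> carrier (dual Y)" by (rule dual_smult_closed[OF Yn f(1)])
      have "op_norm Y scalar_space ?g \<le> 1"
      proof (rule dual_norm_leI[OF Yn])
        fix y assume y: "y \<in> carrier Y"
        have "norm (f y) \<le> c * nrm Y y"
          using norm_functional_le[OF Yn f(1) y] mult_right_mono[OF f(2) nrm_nonneg[OF Yn y]] by simp
        then show "norm (?g y) \<le> 1 * nrm Y y"
          using y c by (simp add: norm_mult norm_divide divide_le_eq mult.commute)
      qed simp
      then have "?g \<in> unit_ball (dual Y)" using g by (simp add: unit_ball_dual)
      then have kK: "adjoint N R ?g \<in> ?K" by (rule imageI)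
      then obtain x where x: "x \<in> F" "?d (adjoint N R ?g) x \<le> \<delta>" using F(3) by auto
      let ?k = "adjoint N R ?g"
      have kN: "?k \<in> carrier (dual N)" using kK K by auto
      have kx: "norm (?k u - x u) \<le> \<delta>" if "u \<in> ?B" for u
        using norm_diff_le_ndist_dual[OF N kN FN[OF x(1)] that] x(2) by linarith
      have k_apply: "?k u = of_real (1 / c) * f (R u)" if "u \<in> carrier N" for u
        using that bounded_operatorD(1)[OF R] by (simp add: adjoint_def)
      have fw: "f ?w = f (R z) - f (R v)"
        using functional_add[OF Yn f(1) Rvz(2) smult_closed[OF Yn Rvz(1)], of "-1"]
          functional_smult[OF Yn f(1) Rvz(1), of "-1"] by simp
      have "?k z - ?k v = of_real (1 / c) * f ?w"
        unfolding k_apply[OF vz(1)] k_apply[OF vz(2)] fw by (simp only: right_diff_distrib)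
      then have "norm (?k z - ?k v) = norm (f ?w) / c" using c by (simp only: norm_mult norm_of_real) simp
      moreover have "norm (?k z - ?k v) \<le> 3 * \<delta>"
      proof -
        have "?k z - ?k v = (?k z - x z) - ((?k v - x v) + (x v - x z))" by simp
        then have "norm (?k z - ?k v) \<le> norm (?k z - x z) + norm ((?k v - x v) + (x v - x z))"
          by (simp only: norm_triangle_ineq4)
        also have "\<dots> \<le> norm (?k z - x z) + (norm (?k v - x v) + norm (x v - x z))"
          by (intro add_left_mono norm_triangle_ineq)
        also have "\<dots> \<le> \<delta> + (\<delta> + \<delta>)" by (intro add_mono kx v vz z(2) x(1))
        finally show ?thesis by simp
      qed
      ultimately have "norm (f ?w) \<le> 3 * \<delta> * c" using c by (simp add: divide_le_eq)
      also have "3 * \<delta> * c < e" using e c by (simp add: \<delta>_def)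
      finally have "nrm Y ?w < e" using f(3) by linarith
      then show ?thesis using z(1) Rvz by (intro bexI[of _ z]) (simp_all add: ndist_eq[OF Yn])
    qed
    then have "R ` ?B \<subseteq> (\<Union>x\<in>R ` Z. MY.mball x e)"
      using Z(2) RB by (fastforce simp: MY.in_mball)
    then show "\<exists>G. finite G \<and> G \<subseteq> R ` ?B \<and> R ` ?B \<subseteq> (\<Union>x\<in>G. MY.mball x e)"
      using Z by (intro exI[of _ "R ` Z"]) auto
  qed
  then have "compactin MY.mtopology (MY.mtopology closure_of (R ` ?B))"
    using MY.mtotally_bounded_eq_compact_closure_of[OF compl, of "R ` ?B"] RB by simp
  then show ?thesis unfolding compact_operator_def relatively_compact_def by simp
qed

end

section \<open>Completeness of direct sums\<close>

lemma (in normed_family) S_diff: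
  assumes "x \<in> carrier S" "y \<in> carrier S"
  shows "(\<lambda>l\<in>\<Lambda>. x l \<oplus>\<^bsub>E l\<^esub> (-1) \<odot>\<^bsub>E l\<^esub> y l) \<in> carrier S"
    and "ndist S x y = nrm S (\<lambda>l\<in>\<Lambda>. x l \<oplus>\<^bsub>E l\<^esub> (-1) \<odot>\<^bsub>E l\<^esub> y l)"
proof -
  have eq: "x \<oplus>\<^bsub>S\<^esub> (-1) \<odot>\<^bsub>S\<^esub> y = (\<lambda>l\<in>\<Lambda>. x l \<oplus>\<^bsub>E l\<^esub> (-1) \<odot>\<^bsub>E l\<^esub> y l)"
    by (rule S_eqI) simp_all
  show "(\<lambda>l\<in>\<Lambda>. x l \<oplus>\<^bsub>E l\<^esub> (-1) \<odot>\<^bsub>E l\<^esub> y l) \<in> carrier S"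
    using add_closed[OF normed_space_S assms(1) smult_closed[OF normed_space_S assms(2)], of "-1"]
    unfolding eq .
  show "ndist S x y = nrm S (\<lambda>l\<in>\<Lambda>. x l \<oplus>\<^bsub>E l\<^esub> (-1) \<odot>\<^bsub>E l\<^esub> y l)"
    using ndist_eq[OF normed_space_S assms] unfolding eq .
qed

lemma (in normed_family) ndist_S_le_iff:
  assumes "x \<in> carrier S" "y \<in> carrier S" "0 \<le> M"
  shows "ndist S x y \<le> M \<longleftrightarrow> lp_le p \<Lambda> (\<lambda>l. ndist (E l) (x l) (y l)) M"
proof -
  have "lp_le p \<Lambda> (\<lambda>l. nrm (E l) ((\<lambda>l\<in>\<Lambda>. x l \<oplus>\<^bsub>E l\<^esub> (-1) \<odot>\<^bsub>E l\<^esub> y l) l)) M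
    \<longleftrightarrow> lp_le p \<Lambda> (\<lambda>l. ndist (E l) (x l) (y l)) M"
  proof -
    have coord: "nrm (E l) ((\<lambda>l\<in>\<Lambda>. x l \<oplus>\<^bsub>E l\<^esub> (-1) \<odot>\<^bsub>E l\<^esub> y l) l) = ndist (E l) (x l) (y l)"
      if "l \<in> \<Lambda>" for l
      using that by (simp add: ndist_eq[OF normed] S_coord assms)
    then have "(\<Sum>l\<in>G. nrm (E l) ((\<lambda>l\<in>\<Lambda>. x l \<oplus>\<^bsub>E l\<^esub> (-1) \<odot>\<^bsub>E l\<^esub> y l) l) powr p)
      = (\<Sum>l\<in>G. ndist (E l) (x l) (y l) powr p)" if "G \<subseteq> \<Lambda>" for G
      using that by (intro sum.cong) auto
    then show ?thesis unfolding lp_le_def using coord by simp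
  qed
  then show ?thesis unfolding S_diff(2)[OF assms(1,2)] nrm_S_le_iff[OF S_diff(1)[OF assms(1,2)] assms(3)] .
qed

text \<open>Coordinatewise limits exist; the uniform Cauchy estimate survives them because norm
  bounds in the sum are bounds on single coordinates or finite sums. Completeness of the range sum
  is what the compactness criterion asks for.\<close>

lemma (in normed_family) banach_space_S:
  assumes banach: "\<And>l. l \<in> \<Lambda> \<Longrightarrow> banach_space (E l)"
  shows "banach_space S"
proof -
  interpret M: Metric_space "carrier S" "ndist S" by (rule Metric_space_ns[OF normed_space_S])
  have "M.mcomplete"
    unfolding M.mcomplete_def
  proof (intro allI impI)
    fix \<sigma> assume "M.MCauchy \<sigma>"
    then have range: "range \<sigma> \<subseteq> carrier S"
      and cauchy': "\<forall>e>0. \<exists>n0. \<forall>n m. n0 \<le> n \<longrightarrow> n0 \<le> m \<longrightarrow> ndist S (\<sigma> n) (\<sigma> m) < e"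
      unfolding M.MCauchy_def by simp_all
    have \<sigma>: "\<sigma> n \<in> carrier S" for n using range by auto
    have cauchy: "\<exists>n0. \<forall>n\<ge>n0. \<forall>m\<ge>n0. ndist S (\<sigma> n) (\<sigma> m) < e" if "0 < e" for e
      using cauchy'[rule_format, OF that] by blast
    have coord: "\<sigma> n l \<in> carrier (E l)" if "l \<in> \<Lambda>" for n l by (rule S_coord[OF \<sigma> that])
    have coord_le: "ndist (E l) (\<sigma> n l) (\<sigma> m l) \<le> ndist S (\<sigma> n) (\<sigma> m)" if "l \<in> \<Lambda>" for l n m
      using coord_le_nrm_S[OF S_diff(1)[OF \<sigma>[of n] \<sigma>[of m]] that] that
      unfolding S_diff(2)[OF \<sigma>[of n] \<sigma>[of m]] by (simp add: ndist_eq[OF normed[OF that] coord[OF that] coord[OF that]])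
    have "\<forall>l\<in>\<Lambda>. \<exists>y. y \<in> carrier (E l) \<and> (\<lambda>m. ndist (E l) (\<sigma> m l) y) \<longlonglongrightarrow> 0"
    proof
      fix l assume l: "l \<in> \<Lambda>"
      interpret El: Metric_space "carrier (E l)" "ndist (E l)" by (rule Metric_space_ns[OF normed[OF l]])
      have "El.MCauchy (\<lambda>n. \<sigma> n l)"
        unfolding El.MCauchy_def
      proof (intro conjI allI impI)
        show "range (\<lambda>n. \<sigma> n l) \<subseteq> carrier (E l)" using coord[OF l] by auto
        fix e :: real assume e: "0 < e"
        obtain n0 where "\<forall>n\<ge>n0. \<forall>m\<ge>n0. ndist S (\<sigma> n) (\<sigma> m) < e" using cauchy[OF e] by (elim exE)
        then show "\<exists>n0. \<forall>n m. n0 \<le> n \<longrightarrow> n0 \<le> m \<longrightarrow> ndist (E l) (\<sigma> n l) (\<sigma> m l) < e"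
          using coord_le[OF l] by (meson order_le_less_trans)
      qed
      moreover have "El.mcomplete" using banach[OF l] by (simp add: banach_space_def)
      ultimately obtain y where y: "limitin El.mtopology (\<lambda>n. \<sigma> n l) y sequentially"
        unfolding El.mcomplete_def by blast
      then have yc: "y \<in> carrier (E l)"
        and lim': "\<forall>e>0. \<exists>n0. \<forall>n\<ge>n0. \<sigma> n l \<in> carrier (E l) \<and> ndist (E l) (\<sigma> n l) y < e"
        unfolding El.limit_metric_sequentially by simp_all
      have lim: "\<exists>n0. \<forall>n\<ge>n0. ndist (E l) (\<sigma> n l) y < e" if "0 < e" for e
        using lim'[rule_format, OF that] by blast
      have "(\<lambda>m. ndist (E l) (\<sigma> m l) y) \<longlonglongrightarrow> 0"
        by (rule LIMSEQ_I) (use lim ndist_nonneg_ns[OF normed[OF l]] in simp)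
      then show "\<exists>y. y \<in> carrier (E l) \<and> (\<lambda>m. ndist (E l) (\<sigma> m l) y) \<longlonglongrightarrow> 0" using yc by blast
    qed
    from bchoice[OF this] obtain z where
      z: "\<And>l. l \<in> \<Lambda> \<Longrightarrow> z l \<in> carrier (E l)" "\<And>l. l \<in> \<Lambda> \<Longrightarrow> (\<lambda>m. ndist (E l) (\<sigma> m l) (z l)) \<longlonglongrightarrow> 0" by auto
    define y where "y = (\<lambda>l\<in>\<Lambda>. z l)"
    have yc: "y l \<in> carrier (E l)" if "l \<in> \<Lambda>" for l using z(1) that by (simp add: y_def)
    have lim: "(\<lambda>m. ndist (E l) (\<sigma> n l) (\<sigma> m l)) \<longlonglongrightarrow> ndist (E l) (\<sigma> n l) (y l)" if l: "l \<in> \<Lambda>" for n l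
    proof (rule LIM_zero_cancel, rule Lim_null_comparison)
      show "(\<lambda>m. ndist (E l) (\<sigma> m l) (y l)) \<longlonglongrightarrow> 0" using z(2)[OF l] l by (simp add: y_def)
      show "\<forall>\<^sub>F m in sequentially. norm (ndist (E l) (\<sigma> n l) (\<sigma> m l) - ndist (E l) (\<sigma> n l) (y l))
          \<le> ndist (E l) (\<sigma> m l) (y l)"
      proof (intro always_eventually allI)
        fix m
        note c = coord[OF l, of n] coord[OF l, of m] yc[OF l]
        show "norm (ndist (E l) (\<sigma> n l) (\<sigma> m l) - ndist (E l) (\<sigma> n l) (y l)) \<le> ndist (E l) (\<sigma> m l) (y l)"
          using ndist_triangle_ns[OF normed[OF l] c(1) c(2) c(3)] ndist_triangle_ns[OF normed[OF l] c(1) c(3) c(2)]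
            ndist_commute_ns[OF normed[OF l] c(2) c(3)] by auto
      qed
    qed
    \<comment> \<open>The index \<open>m\<close> tends to infinity in each finite partial sum while
      \<open>n\<close> stays fixed.\<close>
    have close: "lp_le p \<Lambda> (\<lambda>l. ndist (E l) (\<sigma> n l) (y l)) e"
      if e: "0 < e" and n0: "\<forall>n\<ge>n0. \<forall>m\<ge>n0. ndist S (\<sigma> n) (\<sigma> m) < e" and n: "n0 \<le> n" for e n0 n
    proof -
      have le: "lp_le p \<Lambda> (\<lambda>l. ndist (E l) (\<sigma> n l) (\<sigma> m l)) e" if "n0 \<le> m" for m
        using n0 n that ndist_S_le_iff[OF \<sigma>[of n] \<sigma>[of m], of e] e by (simp add: less_imp_le)
      show ?thesis
      proof (cases "p = 0")
        case True
        have "ndist (E l) (\<sigma> n l) (y l) \<le> e" if l: "l \<in> \<Lambda>" for l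
          by (rule LIMSEQ_le_const2[OF lim[OF l]]) (use le True l in \<open>auto simp: lp_le_def\<close>)
        then show ?thesis using True by (simp add: lp_le_def)
      next
        case False
        then have p1: "1 < p" using p by simp
        have "(\<Sum>l\<in>G. ndist (E l) (\<sigma> n l) (y l) powr p) \<le> e powr p" if G: "finite G" "G \<subseteq> \<Lambda>" for G
        proof (rule LIMSEQ_le_const2)
          show "(\<lambda>m. \<Sum>l\<in>G. ndist (E l) (\<sigma> n l) (\<sigma> m l) powr p) \<longlonglongrightarrow> (\<Sum>l\<in>G. ndist (E l) (\<sigma> n l) (y l) powr p)"
          proof (rule tendsto_sum)
            fix l assume "l \<in> G"
            then have l: "l \<in> \<Lambda>" using G by auto
            show "(\<lambda>m. ndist (E l) (\<sigma> n l) (\<sigma> m l) powr p) \<longlonglongrightarrow> ndist (E l) (\<sigma> n l) (y l) powr p"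
              by (rule tendsto_powr'[OF lim[OF l] tendsto_const])
                (use p1 ndist_nonneg_ns[OF normed[OF l]] in auto)
          qed
          show "\<exists>n0. \<forall>m\<ge>n0. (\<Sum>l\<in>G. ndist (E l) (\<sigma> n l) (\<sigma> m l) powr p) \<le> e powr p"
            using le G False by (auto simp: lp_le_def)
        qed
        then show ?thesis using False by (simp add: lp_le_def)
      qed
    qed
    have nrm_y: "nrm (E l) (y l) \<le> nrm (E l) (\<sigma> n l) + ndist (E l) (\<sigma> n l) (y l)" if l: "l \<in> \<Lambda>" for l n
    proof -
      note nl = normed[OF l]
      have nz: "nrm (E l) v = ndist (E l) v \<zero>\<^bsub>E l\<^esub>" if v: "v \<in> carrier (E l)" for v
        using v zero_closed[OF nl] coord_smult_zero[OF l, of "-1"] coord_r_zero[OF l v] by (simp add: ndist_eq[OF nl])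
      show ?thesis
        unfolding nz[OF yc[OF l]] nz[OF coord[OF l]]
        using ndist_triangle_ns[OF nl yc[OF l] coord[OF l, of n] zero_closed[OF nl]]
          ndist_commute_ns[OF nl yc[OF l] coord[OF l, of n]] by simp
    qed
    have nn_y: "0 \<le> nrm (E l) (y l)" if "l \<in> \<Lambda>" for l by (rule nrm_nonneg[OF normed[OF that] yc[OF that]])
    have "lp_family p \<Lambda> (\<lambda>l. nrm (E l) (y l))"
    proof (cases "p = 0")
      case True
      have "finite {l \<in> \<Lambda>. nrm (E l) (y l) \<ge> e}" if e: "0 < e" for e :: real
      proof -
        have e2: "0 < e / 2" using e by simp
        obtain n0 where n0: "\<forall>n\<ge>n0. \<forall>m\<ge>n0. ndist S (\<sigma> n) (\<sigma> m) < e / 2" using cauchy[OF e2] by auto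
        have "lp_le p \<Lambda> (\<lambda>l. ndist (E l) (\<sigma> n0 l) (y l)) (e / 2)" by (rule close[OF e2 n0 order_refl])
        then have d: "ndist (E l) (\<sigma> n0 l) (y l) \<le> e / 2" if "l \<in> \<Lambda>" for l
          using True that unfolding lp_le_def by simp
        \<comment> \<open>The approximant is within \<open>e / 2\<close> in every coordinate, so
          large coordinates of the limit are large for it as well; this places the limit in the
          c_0-sum.\<close>
        have "{l \<in> \<Lambda>. nrm (E l) (y l) \<ge> e} \<subseteq> {l \<in> \<Lambda>. nrm (E l) (\<sigma> n0 l) \<ge> e / 2}"
        proof safe
          fix l assume l: "l \<in> \<Lambda>" "e \<le> nrm (E l) (y l)"
          show "e / 2 \<le> nrm (E l) (\<sigma> n0 l)" using nrm_y[OF l(1), of n0] d[OF l(1)] l(2) by argo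
        qed
        moreover have "finite {l \<in> \<Lambda>. nrm (E l) (\<sigma> n0 l) \<ge> e / 2}"
          using S_lp_family[OF \<sigma>[of n0]] True e2 unfolding lp_family_def by metis
        ultimately show ?thesis by (rule finite_subset)
      qed
      then show ?thesis using True by (simp add: lp_family_def)
    next
      case False
      then have p1: "1 < p" using p by simp
      obtain n0 where n0: "\<forall>n\<ge>n0. \<forall>m\<ge>n0. ndist S (\<sigma> n) (\<sigma> m) < 1" using cauchy[of 1] by auto
      have "lp_le p \<Lambda> (\<lambda>l. ndist (E l) (\<sigma> n0 l) (y l)) 1" by (rule close[OF zero_less_one n0 order_refl])
      then have fam: "lp_family p \<Lambda> (\<lambda>l. ndist (E l) (\<sigma> n0 l) (y l))" using p1 by (rule lp_le_imp_lp_family)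
      have "lp_family p \<Lambda> (\<lambda>l. nrm (E l) (\<sigma> n0 l) + ndist (E l) (\<sigma> n0 l) (y l))"
        by (rule lp_family_add[OF S_lp_family[OF \<sigma>] fam p S_coord_nonneg[OF \<sigma>] ndist_nonneg_ns[OF normed]])
      then show ?thesis by (rule lp_family_mono[OF _ p nn_y nrm_y])
    qed
    then have yS: "y \<in> carrier S" unfolding in_S_iff using yc by (simp add: y_def)
    have "limitin M.mtopology \<sigma> y sequentially"
      unfolding M.limit_metric_sequentially
    proof (intro conjI allI impI)
      show "y \<in> carrier S" by (rule yS)
      fix e :: real assume e: "0 < e"
      then have e2: "0 < e / 2" by simp
      obtain n0 where n0: "\<forall>n\<ge>n0. \<forall>m\<ge>n0. ndist S (\<sigma> n) (\<sigma> m) < e / 2" using cauchy[OF e2] by auto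
      have "ndist S (\<sigma> n) y < e" if n: "n0 \<le> n" for n
      proof -
        have "ndist S (\<sigma> n) y \<le> e / 2"
          using close[OF e2 n0 n] ndist_S_le_iff[OF \<sigma>[of n] yS less_imp_le[OF e2]] by simp
        then show ?thesis using e by linarith
      qed
      then show "\<exists>n0. \<forall>n\<ge>n0. \<sigma> n \<in> carrier S \<and> ndist S (\<sigma> n) y < e" using \<sigma> by blast
    qed
    then show "\<exists>y. limitin M.mtopology \<sigma> y sequentially" by (intro exI[of _ y])
  qed
  then show ?thesis using normed_space_S by (simp add: banach_space_def)
qed

context szlenk_family
begin

section \<open>The equivalence and the formula for the index, for a family with a positive common
  bound\<close>

lemma Sz_op_direct_sum_le_iff:
  assumes "0 < C" "0 < (\<alpha> :: 'u ordinal)"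
  shows "Sz_op E.S F.S TS \<le> {..<omega_pow \<alpha>} \<longleftrightarrow>
    (\<forall>\<epsilon>>0. (SUP l\<in>\<Lambda>. Sz_eps_op (E l) (F l) \<epsilon> (T l)) < {..<omega_pow \<alpha>})"
proof (intro iffI allI impI)
  fix \<epsilon> :: real
  assume "Sz_op E.S F.S TS \<le> {..<omega_pow \<alpha>}" "0 < \<epsilon>"
  then show "(SUP l\<in>\<Lambda>. Sz_eps_op (E l) (F l) \<epsilon> (T l)) < {..<omega_pow \<alpha>}"
    by (rule Sz_op_le_imp_Sz_eps_op_less[OF assms(2)])
next
  assume "\<forall>\<epsilon>>0. (SUP l\<in>\<Lambda>. Sz_eps_op (E l) (F l) \<epsilon> (T l)) < {..<omega_pow \<alpha>}"
  then show "Sz_op E.S F.S TS \<le> {..<omega_pow \<alpha>}" by (intro Sz_op_direct_sum_le assms) simp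
qed

lemma Sz_op_direct_sum_eq:
  assumes C: "0 < C" and banach: "\<And>l. l \<in> \<Lambda> \<Longrightarrow> banach_space (F l)"
    and noncompact: "\<not> compact_operator E.S F.S TS"
  shows "(Sz_op E.S F.S TS :: 'u ordinal set) =
    (INF \<beta>\<in>{\<beta> :: 'u ordinal. \<forall>\<epsilon>>0. (SUP l\<in>\<Lambda>. Sz_eps_op (E l) (F l) \<epsilon> (T l)) < {..<omega_pow \<beta>}}. {..<omega_pow \<beta>})"
    (is "?S = (INF \<beta>\<in>?I. {..<omega_pow \<beta>})")
proof (rule antisym)
  \<comment> \<open>The exponent 0 is never admissible: \<open>omega_pow 0\<close> is
    \<open>{0}\<close> as an initial segment, and every index contains 0 because the zero functional
    belongs to the set that is derived.\<close>
  have pos: "0 < \<beta>" if \<beta>: "\<beta> \<in> ?I" for \<beta>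
  proof (rule ccontr)
    assume "\<not> 0 < \<beta>"
    then have [simp]: "\<beta> = 0" by (simp add: zero_less_ordinal_iff)
    obtain l where l: "l \<in> \<Lambda>" using E.nonempty by auto
    have "0 \<in> (Sz_eps_op (E l) (F l) 1 (T l) :: 'u ordinal set)"
      using zero_in_adjoint_unit_ball[OF E.normed[OF l] F.normed[OF l] bounded[OF l]]
      by (auto simp: Sz_eps_op_def Sz_eps_eq_derived)
    then have "0 \<in> (SUP l\<in>\<Lambda>. Sz_eps_op (E l) (F l) 1 (T l) :: 'u ordinal set)" using l by auto
    moreover have "{..<omega_pow \<beta>} = {0 :: 'u ordinal}" by auto
    moreover have "(SUP l\<in>\<Lambda>. Sz_eps_op (E l) (F l) 1 (T l)) < {..<omega_pow \<beta>}" using \<beta> by simp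
    ultimately show False by auto
  qed
  show "?S \<le> (INF \<beta>\<in>?I. {..<omega_pow \<beta>})"
  proof (rule INF_greatest)
    fix \<beta> assume "\<beta> \<in> ?I"
    then show "?S \<le> {..<omega_pow \<beta>}" using Sz_op_direct_sum_le_iff[OF C pos] by simp
  qed
  show "(INF \<beta>\<in>?I. {..<omega_pow \<beta>}) \<le> ?S"
  proof (cases "?S = UNIV")
    case False
    then obtain \<beta> :: "'u ordinal" where \<beta>: "?S = {..<omega_pow \<beta>}"
      by (rule Sz_op_eq_omega_pow[OF E.normed_space_S F.normed_space_S bounded_operator_TS])
    have "0 < \<beta>"
    proof (rule ccontr)
      assume "\<not> 0 < \<beta>"
      then have "?S \<subseteq> {..<omega_pow 0}" using \<beta> by (simp add: zero_less_ordinal_iff)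
      then show False
        using Sz_op_trivial_imp_compact_operator[OF E.normed_space_S F.banach_space_S[OF banach] bounded_operator_TS]
          noncompact by simp
    qed
    \<comment> \<open>The index is itself \<open>omega_pow \<beta>\<close>, so the equivalence for
      this \<open>\<beta>\<close> puts it among the competitors of the infimum.\<close>
    then have "\<beta> \<in> ?I" using Sz_op_direct_sum_le_iff[OF C, of \<beta>] \<beta> by simp
    then show ?thesis unfolding \<beta> by (rule INF_lower)
  qed simp
qed

end

text \<open>In the type of ordinals, the first summand is the type of functionals on the direct sum,
  so that \<open>UNIV\<close> faithfully stands for an infinite index; the free summand
  \<open>'o\<close> admits ordinals of any size.\<close>

theorem theorem2p10:
  fixes \<Lambda> :: "'i set"
    and E :: "'i \<Rightarrow> ('k::{real_normed_field, euclidean_space}, 'a) nspace"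
    and F :: "'i \<Rightarrow> ('k, 'b) nspace"
    and T :: "'i \<Rightarrow> 'a \<Rightarrow> 'b"
    and \<alpha> :: "((('i \<Rightarrow> 'a) \<Rightarrow> 'k) + 'o) ordinal"
    and p :: real
  assumes "\<Lambda> \<noteq> {}"
    and "\<And>l. l \<in> \<Lambda> \<Longrightarrow> banach_space (E l)"
    and "\<And>l. l \<in> \<Lambda> \<Longrightarrow> banach_space (F l)"
    and "\<And>l. l \<in> \<Lambda> \<Longrightarrow> asplund_operator TYPE(real + 'm) (E l) (F l) (T l)"
    and "bdd_above ((\<lambda>l. op_norm (E l) (F l) (T l)) ` \<Lambda>)"
    and "\<alpha> > 0"
    and "p = 0 \<or> 1 < p"
  shows "(Sz_op (direct_sum p \<Lambda> E) (direct_sum p \<Lambda> F) (direct_sum_op \<Lambda> T) \<le> {..<omega_pow \<alpha>}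
            \<longleftrightarrow> (\<forall>\<epsilon>>0. (SUP l\<in>\<Lambda>. Sz_eps_op (E l) (F l) \<epsilon> (T l)) < {..<omega_pow \<alpha>}))
       \<and> (\<not> compact_operator (direct_sum p \<Lambda> E) (direct_sum p \<Lambda> F) (direct_sum_op \<Lambda> T)
            \<longrightarrow> Sz_op (direct_sum p \<Lambda> E) (direct_sum p \<Lambda> F) (direct_sum_op \<Lambda> T)
              = (INF \<beta>\<in>{\<beta> :: ((('i \<Rightarrow> 'a) \<Rightarrow> 'k) + 'o) ordinal.
                    \<forall>\<epsilon>>0. (SUP l\<in>\<Lambda>. Sz_eps_op (E l) (F l) \<epsilon> (T l)) < {..<omega_pow \<beta>}}.
                  {..<omega_pow \<beta>}))"
proof -
  \<comment> \<open>The scalars contain a copy of the reals, and constant functions carry their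
    infinitude over to the type that measures the ordinals.\<close>
  have "infinite (UNIV :: 'k set)"
  proof
    assume "finite (UNIV :: 'k set)"
    then have "finite (range (of_real :: real \<Rightarrow> 'k))" by (rule finite_subset[rotated]) simp
    then show False using finite_imageD[of "of_real :: real \<Rightarrow> 'k" UNIV] infinite_UNIV_char_0[where 'a = real]
      by (auto simp: inj_on_def)
  qed
  moreover have "range (\<lambda>f :: ('i \<Rightarrow> 'a) \<Rightarrow> 'k. f undefined) = UNIV"
    by (rule surjI[of _ "\<lambda>c _. c"]) simp
  ultimately have "infinite (UNIV :: (('i \<Rightarrow> 'a) \<Rightarrow> 'k) set)" using finite_imageI by metis
  then have inf: "infinite (UNIV :: ((('i \<Rightarrow> 'a) \<Rightarrow> 'k) + 'o) set)"
    by (simp add: finite_Plus_UNIV_iff)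
  obtain B where B: "\<And>l. l \<in> \<Lambda> \<Longrightarrow> op_norm (E l) (F l) (T l) \<le> B"
    using assms(5) by (auto simp: bdd_above_def)
  \<comment> \<open>The maximum with 1 makes the common bound positive, as required by the divisions
    by \<open>C\<close> and \<open>(2 * C) powr q\<close>.\<close>
  interpret szlenk_family "TYPE((('i \<Rightarrow> 'a) \<Rightarrow> 'k) + 'o)" p \<Lambda> E F T "max 1 B"
  proof unfold_locales
    show "normed_space (E l)" "normed_space (F l)" if "l \<in> \<Lambda>" for l
      using assms(2,3)[OF that] by (auto simp: banach_space_def)
    show "bounded_operator (E l) (F l) (T l)" if "l \<in> \<Lambda>" for l
      using assms(4)[OF that] by (simp add: asplund_operator_def)
    show "op_norm (E l) (F l) (T l) \<le> max 1 B" if "l \<in> \<Lambda>" for l using B[OF that] by simp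
  qed (use assms inf in auto)
  show ?thesis
    using Sz_op_direct_sum_le_iff[of \<alpha>] Sz_op_direct_sum_eq[OF _ assms(3)] assms(6) by simp
qed

end
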